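(* 1. (Complexity of approximate counting) Let $c>0$ and assume there is an algorithm for SAT with running time $\tilde{O}(2^{cn})$. For any $\delta>0$, there is an algorithm which outputs with high probability in time $\tilde{O}(2^{(c+\delta)n})$ an approximation $\tilde{s}$ for the number of solutions $s$ of an input CNF such that $$(1-2^{-\alpha n})\,s\leq \tilde{s}\leq (1+2^{-\alpha n})\,s$$ with $\alpha=\Omega\!\left(\frac{\delta^2}{\log(1/\delta)}\right)$. 2. (Algorithm analysis) Let $F$ be the input CNF over $n$ variables and let $s$ be the number of solutions of $F$. (a) Let $k$ be such that $4\log(16 n) \leq k+1\leq n$ and let $\kappa$ be such that $k+1=\kappa\,\log(512\kappa)\cdot 4\log(16 n)$. The probability that the algorithm ACOUNT (with access to a SAT-oracle), run on $F$ and $k$, outputs in time $O\big(n\cdot\log(n)\cdot (n^2 + 2^k\cdot k\cdot n + \mathrm{size}(F))\big)$ an approximation $\tilde{s}$ such that $$\frac{1}{4}\,2^{-n / \kappa }\,s\leq \tilde{s}\leq 4\,s$$ is at least $1/4$. (b) For constant $k\geq 5$, the probability that the algorithm ACOUNT-CONSTANT, run on $F$ and $k$, outputs an approximation $\tilde{s}$ such that $$\frac{1}{4}\,2^{-n + \frac{\log(n)}{k}\,n^{1-4/k} }\,s\leq \tilde{s}\leq 4\,s$$ is at least $1/4$.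
   Context: $\log$ is the logarithm to base $2$. A CNF is a Boolean formula in conjunctive normal form; $n$ denotes its number of variables; its solutions are its satisfying assignments in $\{0,1\}^n$; a $k$-CNF has at most $k$ literals per clause. SAT is the problem of deciding whether a CNF is satisfiable. $\tilde{O}(\cdot)$ suppresses factors polynomial in the input size. Algorithms may be randomized, and probabilities are over their internal randomness. For $0\le p\le 1$, $\mu_p$ is the distribution on subsets $S\subseteq[n]=\{1,\dots,n\}$ in which each element of $[n]$ is included independently with probability $p$. Random function $\mathsf{h}:\{0,1\}^n\to\{0,1\}^l$ with bias $p$: choose $S_1,\dots,S_l\sim\mu_p$ independently, and let $\mathsf{h}=(\mathsf{h}_1,\dots,\mathsf{h}_l)$ with $\mathsf{h}_i(x)=\bigoplus_{j\in S_i}x_j$ (empty sum equal to $0$). Random function $\mathsf{h}^c:\{0,1\}^n\to\{0,1\}^l$ with parameter $k$: the same, except that $S_1,\dots,S_l$ are chosen independently and uniformly from the $k$-element subsets of $[n]$. Algorithm ACOUNT (with access to a SAT-oracle). Input: a CNF $F$ over $n$ variables and a parameter $k$. 1. Set $p:=\frac{k+1}{2n}$. 2. For $l=1,\dots,n+1$ (the loop body is lines 3-9): 3. Repeat $8\lceil\log(n)\rceil$ times (the loop body is lines 4-7): 4. Construct $\mathsf{h}:\{0,1\}^n\to\{0,1\}^l$ with bias $p$. Select $b\in\{0,1\}^l$ uniformly at random. 5. If $|S_i|>k$ for some $i\in[l]$ then stop. 6. Let $G$ be the $k$-CNF encoding, over the same $n$ variables, of $\mathsf{h}(x)=b$. 7.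 Record if $F\wedge G$ is satisfiable. 8. If unsatisfiability was recorded more than $4\lceil\log(n)\rceil$ times 9. then output $2^{l-1}$ and stop. 10. (After the loop over $l$.) Output $0$. Algorithm ACOUNT-CONSTANT is the same as ACOUNT with the only difference that it constructs $\mathsf{h}^c$ (with parameter $k$) in place of $\mathsf{h}$.
   Formalization: In 2(a) and 2(b), F is assumed satisfiable (s>0; for s=0 the output is 1); in line 5 of ACOUNT, "stop" ends only the current repetition, with nothing recorded; in 2(b), "for constant k≥5" means for every n≥n_0(k), as the bound fails e.g. for k=n=64. *)

theory Defs
  imports
    "HOL-Probability.Probability"
    "HOL-Library.Landau_Symbols"
begin

section \<open>CNF formulas\<close>

text \<open>The variables of a formula over \<open>n\<close> variables are \<open>0, \<dots>, n - 1\<close>; not all of them need to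
  occur. The literal \<open>(i, True)\<close> is the variable \<open>i\<close>, the literal \<open>(i, False)\<close> its negation.
  An element of \<open>{0,1}\<^sup>n\<close> is a list of \<open>n\<close> truth values.\<close>

type_synonym literal = "nat \<times> bool"
type_synonym cnf = "literal list list"

definition cnf_over :: "nat \<Rightarrow> cnf \<Rightarrow> bool" where
  "cnf_over n F \<longleftrightarrow> (\<forall>C\<in>set F. \<forall>(i, b)\<in>set C. i < n)"

definition satisfies :: "bool list \<Rightarrow> cnf \<Rightarrow> bool" where
  "satisfies x F \<longleftrightarrow> (\<forall>C\<in>set F. \<exists>(i, b)\<in>set C. x ! i = b)"

definition solutions :: "nat \<Rightarrow> cnf \<Rightarrow> bool list set" where
  "solutions n F = {x. length x = n \<and> satisfies x F}"

definition satisfiable :: "nat \<Rightarrow> cnf \<Rightarrow> bool" where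
  "satisfiable n F \<longleftrightarrow> solutions n F \<noteq> {}"

text \<open>The input size. The number of variables is part of the input.\<close>

definition cnf_size :: "nat \<Rightarrow> cnf \<Rightarrow> nat" where
  "cnf_size n F = n + (\<Sum>C\<leftarrow>F. 1 + length C)"


section \<open>Randomized algorithms with an oracle and their running time\<close>

text \<open>
  Algorithms are programs of a pointer machine. There are finitely many registers per program. A
  register holds a natural number or a pair of values; pairs are immutable and shared, so that
  building, copying and taking apart a pair are single steps. The only arithmetic is increment,
  decrement and comparison. After \<open>t\<close> steps a register therefore exceeds the numbers in the input
  and in the program by at most \<open>t\<close>, so unit costs do not hide computations on long numbers; long
  numbers are to be represented by lists of bits.
\<close>

datatype val = Num nat | Pair val val

primrec val_size :: "val \<Rightarrow> nat" where
  "val_size (Num m) = 1"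
| "val_size (Pair v w) = 1 + val_size v + val_size w"

fun succ_val :: "val \<Rightarrow> val" where
  "succ_val (Num m) = Num (Suc m)"
| "succ_val (Pair v w) = Num 0"

fun pred_val :: "val \<Rightarrow> val" where
  "pred_val (Num m) = Num (m - 1)"
| "pred_val (Pair v w) = Num 0"

fun fst_val :: "val \<Rightarrow> val" where
  "fst_val (Num m) = Num 0"
| "fst_val (Pair v w) = v"

fun snd_val :: "val \<Rightarrow> val" where
  "snd_val (Num m) = Num 0"
| "snd_val (Pair v w) = w"

fun random_val :: "val \<Rightarrow> val pmf" where
  "random_val (Num m) = (if m = 0 then return_pmf (Num 0) else map_pmf Num (pmf_of_set {..<m}))"
| "random_val (Pair v w) = return_pmf (Num 0)"

type_synonym store = "nat \<Rightarrow> val"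

datatype test = IsPair nat | IsEq nat nat | IsLess nat nat

fun eq_val :: "val \<Rightarrow> val \<Rightarrow> bool" where
  "eq_val (Num a) (Num b) = (a = b)"
| "eq_val _ _ = False"

fun less_val :: "val \<Rightarrow> val \<Rightarrow> bool" where
  "less_val (Num a) (Num b) = (a < b)"
| "less_val _ _ = False"

fun is_pair :: "val \<Rightarrow> bool" where
  "is_pair (Num a) = False"
| "is_pair (Pair v w) = True"

primrec holds :: "test \<Rightarrow> store \<Rightarrow> bool" where
  "holds (IsPair x) s = is_pair (s x)"
| "holds (IsEq x y) s = eq_val (s x) (s y)"
| "holds (IsLess x y) s = less_val (s x) (s y)"

datatype com =
    Skip
  | Const nat nat
  | Copy nat nat
  | Inc nat nat
  | Dec nat nat
  | MkPair nat nat nat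
  | GetFst nat nat
  | GetSnd nat nat
  | Random nat nat
  | Ask nat nat
  | Seq com com
  | Cond test com com
  | While test com
  | Call nat com nat

text \<open>The second component of a state is the number of steps so far. Divergence is missing
  probability mass.\<close>

type_synonym state = "store \<times> nat"

partial_function (spmf) while_spmf ::
    "test \<Rightarrow> (state \<Rightarrow> state spmf) \<Rightarrow> state \<Rightarrow> state spmf" where
  "while_spmf b body st =
     (if holds b (fst st)
      then bind_spmf (body (fst st, snd st + 1)) (while_spmf b body)
      else return_spmf (fst st, snd st + 1))"

definition init_store :: "val \<Rightarrow> store" where
  "init_store v = (\<lambda>x. Num 0)(0 := v)"

text \<open>An oracle query is charged with the size of the (unshared) query. \<open>Call x c y\<close> runs \<open>c\<close> on
  fresh registers with input \<open>y\<close> and puts the result into \<open>x\<close>; as programs are finite terms, this is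
  a local scope and not a recursive call.\<close>

primrec exec :: "(val \<Rightarrow> val) \<Rightarrow> com \<Rightarrow> state \<Rightarrow> state spmf" where
  "exec orc Skip st = return_spmf (fst st, snd st + 1)"
| "exec orc (Const x m) st = return_spmf ((fst st)(x := Num m), snd st + 1)"
| "exec orc (Copy x y) st = return_spmf ((fst st)(x := fst st y), snd st + 1)"
| "exec orc (Inc x y) st = return_spmf ((fst st)(x := succ_val (fst st y)), snd st + 1)"
| "exec orc (Dec x y) st = return_spmf ((fst st)(x := pred_val (fst st y)), snd st + 1)"
| "exec orc (MkPair x y z) st = return_spmf ((fst st)(x := Pair (fst st y) (fst st z)), snd st + 1)"
| "exec orc (GetFst x y) st = return_spmf ((fst st)(x := fst_val (fst st y)), snd st + 1)"
| "exec orc (GetSnd x y) st = return_spmf ((fst st)(x := snd_val (fst st y)), snd st + 1)"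
| "exec orc (Random x y) st =
     spmf_of_pmf (map_pmf (\<lambda>v. ((fst st)(x := v), snd st + 1)) (random_val (fst st y)))"
| "exec orc (Ask x y) st =
     return_spmf ((fst st)(x := orc (fst st y)), snd st + 1 + val_size (fst st y))"
| "exec orc (Seq c d) st = bind_spmf (exec orc c st) (exec orc d)"
| "exec orc (Cond b c d) st =
     (if holds b (fst st) then exec orc c (fst st, snd st + 1)
      else exec orc d (fst st, snd st + 1))"
| "exec orc (While b c) st = while_spmf b (exec orc c) st"
| "exec orc (Call x c y) st =
     map_spmf (\<lambda>st'. ((fst st)(x := fst st' 0), snd st'))
       (exec orc c (init_store (fst st y), snd st + 1))"

text \<open>Joint distribution of output and running time. Input and output are in register \<open>0\<close>.\<close>

definition run :: "(val \<Rightarrow> val) \<Rightarrow> com \<Rightarrow> val \<Rightarrow> (val \<times> nat) spmf" where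
  "run orc P v = map_spmf (\<lambda>st. (fst st 0, snd st)) (exec orc P (init_store v, 0))"

text \<open>The constant oracle, for algorithms without oracle.\<close>

definition no_oracle :: "val \<Rightarrow> val" where
  "no_oracle v = Num 0"


subsection \<open>Encodings\<close>

primrec enc_list :: "val list \<Rightarrow> val" where
  "enc_list [] = Num 0"
| "enc_list (v # vs) = Pair v (enc_list vs)"

definition enc_bool :: "bool \<Rightarrow> val" where
  "enc_bool b = Num (if b then 1 else 0)"

definition enc_literal :: "literal \<Rightarrow> val" where
  "enc_literal l = Pair (Num (fst l)) (enc_bool (snd l))"

definition enc_cnf :: "nat \<Rightarrow> cnf \<Rightarrow> val" where
  "enc_cnf n F = Pair (Num n) (enc_list (map (\<lambda>C. enc_list (map enc_literal C)) F))"

text \<open>Numerical outputs are in binary, least significant bit first, and a rational number is given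
  by numerator and denominator. Every value denotes some number.\<close>

primrec bin_val :: "val \<Rightarrow> nat" where
  "bin_val (Num m) = 0"
| "bin_val (Pair v w) = (if v = Num 0 then 0 else 1) + 2 * bin_val w"

definition rat_val :: "val \<Rightarrow> real" where
  "rat_val v = real (bin_val (fst_val v)) / real (bin_val (snd_val v))"

definition sat_oracle :: "val \<Rightarrow> val" where
  "sat_oracle v = enc_bool (\<exists>n F. cnf_over n F \<and> v = enc_cnf n F \<and> satisfiable n F)"


subsection \<open>Exponential time\<close>

text \<open>With \<open>n\<close> the number of variables and \<open>m\<close> the input size, the bounds \<open>\<tilde>O(2\<^sup>a\<^sup>n)\<close> are those of the
  following form for some constants \<open>K\<close> and \<open>d\<close>.\<close>

definition exp_time :: "real \<Rightarrow> nat \<Rightarrow> real \<Rightarrow> nat \<Rightarrow> nat \<Rightarrow> real" where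
  "exp_time K d a n m = K * (1 + real m) ^ d * 2 powr (a * real n)"

text \<open>A randomized algorithm for SAT: it always halts in time, and errs with probability at
  most \<open>1/3\<close> on every input. This includes deterministic algorithms.\<close>

definition sat_algorithm :: "com \<Rightarrow> real \<Rightarrow> bool" where
  "sat_algorithm A c \<longleftrightarrow> (\<exists>K d. \<forall>n F. cnf_over n F \<longrightarrow>
     (let R = run no_oracle A (enc_cnf n F) in
        lossless_spmf R \<and>
        (\<forall>(v, t)\<in>set_spmf R. real t \<le> exp_time K d c n (cnf_size n F)) \<and>
        measure (measure_spmf R) {(v, t). v = enc_bool (satisfiable n F)} \<ge> 2 / 3))"

text \<open>High probability means probability at least \<open>1 - 2\<^sup>-\<^sup>n\<close>.\<close>

definition counting_algorithm :: "com \<Rightarrow> real \<Rightarrow> real \<Rightarrow> bool" where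
  "counting_algorithm B a \<alpha> \<longleftrightarrow> (\<exists>K d. \<forall>n F. cnf_over n F \<longrightarrow>
     measure (measure_spmf (run no_oracle B (enc_cnf n F)))
       {(v, t). real t \<le> exp_time K d a n (cnf_size n F) \<and>
          (1 - 2 powr (- \<alpha> * real n)) * real (card (solutions n F)) \<le> rat_val v \<and>
          rat_val v \<le> (1 + 2 powr (- \<alpha> * real n)) * real (card (solutions n F))}
       \<ge> 1 - 1 / 2 ^ n)"


section \<open>Random parities and the algorithm ACOUNT\<close>

definition random_subset :: "nat \<Rightarrow> real \<Rightarrow> nat set pmf" where
  "random_subset n p = map_pmf (\<lambda>f. {j. f j}) (Pi_pmf {..<n} False (\<lambda>_. bernoulli_pmf p))"

definition random_k_subset :: "nat \<Rightarrow> nat \<Rightarrow> nat set pmf" where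
  "random_k_subset n k = pmf_of_set {S. S \<subseteq> {..<n} \<and> card S = k}"

text \<open>The function \<open>h\<close> is given by the list of the sets \<open>S\<^sub>1, \<dots>, S\<^sub>l\<close>.\<close>

definition parity :: "nat set \<Rightarrow> bool list \<Rightarrow> bool" where
  "parity S x \<longleftrightarrow> odd (\<Sum>j\<in>S. of_bool (x ! j) :: nat)"

definition hash :: "nat set list \<Rightarrow> bool list \<Rightarrow> bool list" where
  "hash Ss x = map (\<lambda>S. parity S x) Ss"

text \<open>The CNF encoding of one parity constraint excludes each assignment to the variables in \<open>S\<close>
  that has the wrong parity by a clause with \<open>|S|\<close> literals.\<close>

definition parity_cnf :: "nat set \<Rightarrow> bool \<Rightarrow> cnf" where
  "parity_cnf S b =
     (let vs = sorted_list_of_set S in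
        map (\<lambda>as. zip vs (map Not as))
          (filter (\<lambda>as. odd (count_list as True) \<noteq> b) (List.n_lists (length vs) [False, True])))"

definition hash_cnf :: "nat set list \<Rightarrow> bool list \<Rightarrow> cnf" where
  "hash_cnf Ss bs = concat (map2 parity_cnf Ss bs)"

lemma satisfies_append: "satisfies x (F @ G) \<longleftrightarrow> satisfies x F \<and> satisfies x G"
  by (auto simp: satisfies_def)

lemma satisfies_parity_cnf:
  assumes "finite S"
  shows "satisfies x (parity_cnf S b) \<longleftrightarrow> parity S x = b"
proof -
  define vs where "vs = sorted_list_of_set S"
  define ys where "ys = map ((!) x) vs"
  have clause: "(\<exists>(i, c)\<in>set (zip vs (map Not as)). x ! i = c) \<longleftrightarrow> as \<noteq> ys"
    if "length as = length vs" for as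
    using that unfolding ys_def
    by (induction as vs rule: list_induct2) auto
  have count: "count_list (map ((!) x) us) True = (\<Sum>j\<leftarrow>us. of_bool (x ! j))" for us
    by (induction us) auto
  have "(\<Sum>j\<leftarrow>vs. of_bool (x ! j)) = (\<Sum>j\<in>S. of_bool (x ! j) :: nat)"
    using assms by (simp add: vs_def sum_list_distinct_conv_sum_set)
  hence odd: "odd (count_list ys True) = parity S x"
    using count[of vs] by (simp add: ys_def parity_def)
  have "satisfies x (parity_cnf S b) \<longleftrightarrow>
      (\<forall>as. length as = length vs \<longrightarrow> odd (count_list as True) \<noteq> b \<longrightarrow> as \<noteq> ys)"
    using clause unfolding satisfies_def parity_cnf_def Let_def vs_def[symmetric]
    by (auto simp: set_n_lists)
  also have "\<dots> \<longleftrightarrow> parity S x = b"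
  proof -
    have "length ys = length vs" by (simp add: ys_def)
    thus ?thesis using odd by metis
  qed
  finally show ?thesis .
qed

lemma satisfies_hash_cnf:
  assumes "\<forall>S\<in>set Ss. finite S" and "length Ss = length bs"
  shows "satisfies x (hash_cnf Ss bs) \<longleftrightarrow> hash Ss x = bs"
  using assms(2,1)
proof (induction Ss bs rule: list_induct2)
  case Nil
  then show ?case by (simp add: satisfies_def hash_cnf_def hash_def)
next
  case (Cons S Ss b bs)
  then show ?case
    by (simp add: hash_cnf_def hash_def satisfies_append satisfies_parity_cnf)
qed

text \<open>One repetition at level \<open>l\<close>, where \<open>D\<close> is the distribution of each of the sets
  \<open>S\<^sub>1, \<dots>, S\<^sub>l\<close>; the result is whether unsatisfiability is recorded. If some \<open>|S\<^sub>i|\<close> exceeds \<open>k\<close>, then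
  it is the repetition that stops, without recording anything. Stopping the whole run without
  output would make the success probability negligible for small \<open>k\<close>: for \<open>n = 1000\<close>, \<open>k = 55\<close>
  and a tautology, a run would draw about \<open>4 \<cdot> 10\<^sup>7\<close> sets before it reaches an output, and each of
  them is too large with probability more than \<open>10\<^sup>-\<^sup>6\<close>.\<close>

definition acount_round :: "nat set pmf \<Rightarrow> nat \<Rightarrow> nat \<Rightarrow> cnf \<Rightarrow> nat \<Rightarrow> bool pmf" where
  "acount_round D n k F l =
     do {
       Ss \<leftarrow> replicate_pmf l D;
       bs \<leftarrow> pmf_of_set {bs. length bs = l};
       return_pmf
         (if \<exists>S\<in>set Ss. card S > k then False else \<not> satisfiable n (F @ hash_cnf Ss bs))
     }"

primrec acount_loop :: "nat set pmf \<Rightarrow> nat \<Rightarrow> nat \<Rightarrow> cnf \<Rightarrow> nat list \<Rightarrow> nat pmf" where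
  "acount_loop D n k F [] = return_pmf 0"
| "acount_loop D n k F (l # ls) =
     do {
       rs \<leftarrow> replicate_pmf (8 * nat \<lceil>log 2 n\<rceil>) (acount_round D n k F l);
       if count_list rs True > 4 * nat \<lceil>log 2 n\<rceil> then return_pmf (2 ^ (l - 1))
       else acount_loop D n k F ls
     }"

definition acount :: "nat \<Rightarrow> nat \<Rightarrow> cnf \<Rightarrow> nat pmf" where
  "acount n k F = acount_loop (random_subset n ((k + 1) / (2 * n))) n k F [1..<n + 2]"

definition acount_constant :: "nat \<Rightarrow> nat \<Rightarrow> cnf \<Rightarrow> nat pmf" where
  "acount_constant n k F = acount_loop (random_k_subset n k) n k F [1..<n + 2]"

definition acount_input :: "nat \<Rightarrow> nat \<Rightarrow> cnf \<Rightarrow> val" where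
  "acount_input n k F = Pair (Num k) (enc_cnf n F)"

text \<open>A program with a SAT-oracle that implements ACOUNT. The assumption on \<open>k\<close> says that the bias
  is at most \<open>1\<close>.\<close>

definition implements_acount :: "com \<Rightarrow> bool" where
  "implements_acount Q \<longleftrightarrow> (\<forall>n k F. cnf_over n F \<and> 1 \<le> n \<and> k + 1 \<le> 2 * n \<longrightarrow>
     map_spmf (\<lambda>(v, t). bin_val v) (run sat_oracle Q (acount_input n k F)) =
     spmf_of_pmf (acount n k F))"

end

theory Submission imports Defs begin

text \<open>Let \<open>N\<close> be the number of the \<open>s\<close> solutions that satisfy \<open>l\<close> random parity constraints. Its mean is
  \<open>s / 2\<^sup>l\<close>, and its second moment is governed by the probabilities that a random parity does not separate
  two solutions. For sparse parities these are close to \<open>1/2\<close> unless the two solutions are near each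
  other (or nearly antipodal, if the sets have constant size), and Hamming balls contain few points.
  So \<open>N > 0\<close> with high probability if \<open>s / 2\<^sup>l\<close> is large, whereas \<open>N = 0\<close> with probability at least
  \<open>1/2\<close>, up to oversized sets, if \<open>s / 2\<^sup>l \<le> 1/2\<close>. This yields the two statements about ACOUNT.

  For the first part, \<open>\<delta>\<close> is at least \<open>18 / q\<close> and the parities have constant size. The second moment
  then exceeds the squared mean by a factor \<open>2\<^sup>n\<^sup>/\<^sup>q\<close> only. The mean of about \<open>2\<^sup>7\<^sup>n\<^sup>/\<^sup>q\<close> copies of \<open>N\<close>, each of them
  cut off at about \<open>2\<^sup>2\<^sup>n\<^sup>/\<^sup>q\<close>, determines \<open>s\<close> up to a factor \<open>1 \<plusminus> 2\<^sup>-\<^sup>n\<^sup>/\<^sup>q\<close> at the first level where it is at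
  most \<open>4\<close>. The cut off \<open>N\<close> is found by extending partial assignments, with a majority vote over
  independent runs of the SAT algorithm for every query.\<close>

subsection \<open>Expectations of bounded functions\<close>

text \<open>The two parts meet opposite difficulties. ACOUNT has a prescribed bias, so there the
  work lies in constants: at a level with 2^l >= 2 s a round records unsatisfiability with
  probability that may be barely below 1/2, no tail bound helps, and the majority vote is compared
  with a fair coin to first order. In the first part the exponents are free. With e about n / q the
  dispersion is at most 2^(e + 1); cutting off at 2^(2 e + 6) then costs about 2^-e at the levels
  that matter, and averaging values of that size to precision 2^-(e + 1) takes of order 2^(7 e)
  trials, because the exponent in the tail bound is of order 2^(7 e - 2 e - 4 e) = 2^e and must beat
  n. The sums are of order 2^(9 e); converting them to binary by repeated increments squares this,
  hence the 18. The accuracy exponent 1 / q is linear in \<delta>, which is more than the required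
  order. Since later oracle queries depend on earlier answers, errors of the SAT algorithm are
  handled by the total variation distance to a run with a perfect oracle.\<close>

abbreviation E :: "'a pmf \<Rightarrow> ('a \<Rightarrow> real) \<Rightarrow> real" where
  "E \<equiv> measure_pmf.expectation"

lemma integrable_bounded_pmf:
  fixes f :: "'a \<Rightarrow> real"
  assumes "\<And>x. x \<in> set_pmf p \<Longrightarrow> \<bar>f x\<bar> \<le> B"
  shows "integrable (measure_pmf p) f"
  by (rule measure_pmf.integrable_const_bound[of _ B]) (use assms in \<open>auto simp: AE_measure_pmf_iff\<close>)

lemma nn_integral_bounded_pmf:
  fixes f :: "'a \<Rightarrow> real"
  assumes "\<And>x. 0 \<le> f x" "\<And>x. f x \<le> B"
  shows "(\<integral>\<^sup>+x. ennreal (f x) \<partial>measure_pmf p) = ennreal (E p f)"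
  by (rule nn_integral_eq_integral, rule integrable_bounded_pmf[of _ _ B]) (use assms in \<open>auto simp: abs_of_nonneg\<close>)

lemma E_nonneg: "(\<And>x. 0 \<le> f x) \<Longrightarrow> 0 \<le> E p f"
  by simp

lemma E_le:
  assumes "\<And>x. 0 \<le> f x" "\<And>x. f x \<le> B"
  shows "E p f \<le> B"
proof -
  have "integrable (measure_pmf p) f"
    by (rule integrable_bounded_pmf[of _ _ B]) (use assms in \<open>simp add: abs_of_nonneg\<close>)
  hence "E p f \<le> E p (\<lambda>_. B)" by (rule integral_mono) (use assms in auto)
  thus ?thesis by simp
qed

text \<open>The nonnegative integral commutes with \<open>bind_pmf\<close> without integrability
  conditions; the bounds on \<open>f\<close> transfer the equation to real expectations. They are
  demanded on the whole type, which later forces some integrands to be truncated.\<close>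

lemma E_bind:
  fixes f :: "'b \<Rightarrow> real"
  assumes f: "\<And>x. 0 \<le> f x" "\<And>x. f x \<le> B"
  shows "E (bind_pmf p q) f = E p (\<lambda>x. E (q x) f)"
proof -
  have "ennreal (E (bind_pmf p q) f) = (\<integral>\<^sup>+x. \<integral>\<^sup>+y. ennreal (f y) \<partial>q x \<partial>p)"
    using nn_integral_bounded_pmf[of f B "bind_pmf p q"] f by simp
  also have "\<dots> = (\<integral>\<^sup>+x. ennreal (E (q x) f) \<partial>p)"
    by (simp add: nn_integral_bounded_pmf[of f B] f)
  also have "\<dots> = ennreal (E p (\<lambda>x. E (q x) f))"
    by (rule nn_integral_bounded_pmf[of _ B]) (use E_le[of f B] f in auto)
  finally show ?thesis using f by (simp add: E_nonneg)
qed

lemma prob_E: "measure_pmf.prob p {x. P x} = E p (\<lambda>x. of_bool (P x))"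
proof -
  have "(\<lambda>x. of_bool (P x)) = (indicat_real {x. P x})"
    by (auto simp: indicator_def)
  thus ?thesis by simp
qed

lemma E_mono:
  fixes f g :: "'a \<Rightarrow> real"
  assumes "\<And>x. x \<in> set_pmf p \<Longrightarrow> f x \<le> g x" "\<And>x. \<bar>f x\<bar> \<le> B" "\<And>x. \<bar>g x\<bar> \<le> B"
  shows "E p f \<le> E p g"
  by (rule integral_mono_AE) (use assms in \<open>auto simp: AE_measure_pmf_iff intro!: integrable_bounded_pmf\<close>)

lemma E_sum_bounded:
  fixes f :: "'i \<Rightarrow> 'a \<Rightarrow> real"
  assumes "\<And>i x. i \<in> I \<Longrightarrow> \<bar>f i x\<bar> \<le> B"
  shows "E p (\<lambda>x. \<Sum>i\<in>I. f i x) = (\<Sum>i\<in>I. E p (f i))"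
  by (rule Bochner_Integration.integral_sum) (use assms in \<open>auto intro!: integrable_bounded_pmf\<close>)

abbreviation coin :: "bool pmf" where
  "coin \<equiv> pmf_of_set UNIV"

lemma E_coin: "E coin f = (f True + f False) / 2"
  by (subst integral_pmf_of_set) (auto simp: UNIV_bool)

text \<open>Splits the uniform vector \<open>b\<close> into independent coins, so that each coin can
  be paired with its set in \<open>hash_pmf\<close>.\<close>

lemma replicate_pmf_coin: "pmf_of_set {bs :: bool list. length bs = l} = replicate_pmf l coin"
proof (rule pmf_eqI)
  fix bs :: "bool list"
  have fin: "finite {bs :: bool list. length bs = l}" "card {bs :: bool list. length bs = l} = 2 ^ l" for l
    using finite_lists_length_eq[of "UNIV :: bool set" l] card_lists_length_eq[of "UNIV :: bool set" l] by auto
  have ne: "{bs :: bool list. length bs = l} \<noteq> {}" by (auto intro: exI[of _ "replicate l True"])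
  have "pmf (replicate_pmf l coin) bs = of_bool (length bs = l) / 2 ^ l"
  proof (induction l arbitrary: bs)
    case (Suc l)
    show ?case
    proof (cases bs)
      case (Cons b bs')
      have "replicate_pmf (Suc l) coin = map_pmf (\<lambda>(b, bs). b # bs) (pair_pmf coin (replicate_pmf l coin))"
        by (simp add: pair_pmf_def map_bind_pmf bind_return_pmf map_pmf_def bind_assoc_pmf)
      hence "pmf (replicate_pmf (Suc l) coin) bs = pmf (pair_pmf coin (replicate_pmf l coin)) (b, bs')"
        using pmf_map_inj'[of "\<lambda>(b, bs). b # bs" "pair_pmf coin (replicate_pmf l coin)" "(b, bs')"]
        by (simp add: Cons inj_def)
      thus ?thesis by (simp add: pmf_pair Suc.IH Cons)
    qed (simp add: pmf_eq_0_set_pmf set_replicate_pmf del: replicate_pmf.simps)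
  qed (auto simp: indicator_def)
  thus "pmf (pmf_of_set {bs. length bs = l}) bs = pmf (replicate_pmf l coin) bs"
    using ne fin by (simp add: indicator_def)
qed

lemma measure_replicate_all:
  "measure_pmf.prob (replicate_pmf l p) {xs. \<forall>y\<in>set xs. Q y} = measure_pmf.prob p {y. Q y} ^ l"
proof (induction l)
  case (Suc l)
  have "measure_pmf.prob (replicate_pmf (Suc l) p) {xs. \<forall>y\<in>set xs. Q y} =
      E p (\<lambda>x. E (replicate_pmf l p) (\<lambda>xs. of_bool (\<forall>y\<in>set (x # xs). Q y)))"
    unfolding prob_E replicate_pmf.simps by (subst E_bind[of _ 1], simp, simp)+ simp
  also have "\<dots> = E p (\<lambda>x. of_bool (Q x) * E (replicate_pmf l p) (\<lambda>xs. of_bool (\<forall>y\<in>set xs. Q y)))"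
    by (intro Bochner_Integration.integral_cong refl) auto
  also have "\<dots> = measure_pmf.prob p {y. Q y} ^ Suc l"
    unfolding prob_E[symmetric] Suc.IH by (simp add: prob_E)
  finally show ?case .
qed simp

subsection \<open>Second moments of hash functions\<close>

text \<open>A constraint is a random set together with its random right-hand side, and the
  constraints are independent and identically distributed. The type of the sets stays abstract:
  ACOUNT uses sets, the algorithm of the first part lists of indices.\<close>

definition hash_pmf :: "'a pmf \<Rightarrow> nat \<Rightarrow> ('a \<times> bool) list pmf" where
  "hash_pmf D l = replicate_pmf l (pair_pmf D coin)"

text \<open>Independent draws commute, so the order of ACOUNT (all sets, then all bits) can be
  exchanged for one pair after the other.\<close>

lemma bind_hash_pmf:
  "bind_pmf (replicate_pmf l D) (\<lambda>as. bind_pmf (pmf_of_set {bs. length bs = l}) (\<lambda>bs. return_pmf (f as bs))) =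
     map_pmf (\<lambda>ps. f (map fst ps) (map snd ps)) (hash_pmf D l)"
  unfolding replicate_pmf_coin
proof (induction l arbitrary: f)
  case (Suc l)
  have "bind_pmf (replicate_pmf (Suc l) D) (\<lambda>as. bind_pmf (replicate_pmf (Suc l) coin) (\<lambda>bs. return_pmf (f as bs))) =
      bind_pmf D (\<lambda>a. bind_pmf (replicate_pmf l D) (\<lambda>as. bind_pmf coin (\<lambda>b.
        bind_pmf (replicate_pmf l coin) (\<lambda>bs. return_pmf (f (a # as) (b # bs))))))"
    by (simp add: bind_assoc_pmf bind_return_pmf)
  also have "\<dots> = bind_pmf D (\<lambda>a. bind_pmf coin (\<lambda>b. bind_pmf (replicate_pmf l D) (\<lambda>as.
        bind_pmf (replicate_pmf l coin) (\<lambda>bs. return_pmf (f (a # as) (b # bs))))))"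
    by (subst bind_commute_pmf[of "replicate_pmf l D" coin]) (rule refl)
  also have "\<dots> = bind_pmf D (\<lambda>a. bind_pmf coin (\<lambda>b.
      map_pmf (\<lambda>ps. f (a # map fst ps) (b # map snd ps)) (hash_pmf D l)))"
    by (simp only: Suc.IH)
  also have "\<dots> = map_pmf (\<lambda>ps. f (map fst ps) (map snd ps)) (hash_pmf D (Suc l))"
    by (simp add: hash_pmf_def map_pmf_def pair_pmf_def bind_assoc_pmf bind_return_pmf)
  finally show ?case .
qed (simp add: hash_pmf_def bind_return_pmf)

definition agree :: "('a \<Rightarrow> 'x \<Rightarrow> bool) \<Rightarrow> ('a \<times> bool) list \<Rightarrow> 'x \<Rightarrow> bool" where
  "agree g ps x \<longleftrightarrow> (\<forall>p\<in>set ps. g (fst p) x = snd p)"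

definition hits :: "('a \<Rightarrow> 'x \<Rightarrow> bool) \<Rightarrow> 'x set \<Rightarrow> ('a \<times> bool) list \<Rightarrow> nat" where
  "hits g S ps = card {x\<in>S. agree g ps x}"

definition collide :: "'a pmf \<Rightarrow> ('a \<Rightarrow> 'x \<Rightarrow> bool) \<Rightarrow> 'x \<Rightarrow> 'x \<Rightarrow> real" where
  "collide D g x y = measure_pmf.prob D {a. g a x = g a y}"

text \<open>For nonempty \<open>S\<close> this is E(N^2) / (E N)^2, where N is the number of hits
  (\<open>E_hits\<close>, \<open>E_hits_square\<close>): two points satisfy a common constraint with
  probability \<open>collide / 2\<close>, as against 1/4 under pairwise independence.\<close>

definition dispersion :: "'a pmf \<Rightarrow> ('a \<Rightarrow> 'x \<Rightarrow> bool) \<Rightarrow> 'x set \<Rightarrow> nat \<Rightarrow> real" where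
  "dispersion D g S l = (\<Sum>x\<in>S. \<Sum>y\<in>S. (2 * collide D g x y) ^ l) / (real (card S))\<^sup>2"

lemma E_pair_coin:
  assumes "\<And>x. 0 \<le> f x" "\<And>x. f x \<le> B"
  shows "E (pair_pmf D coin) f = E D (\<lambda>a. (f (a, True) + f (a, False)) / 2)"
  unfolding pair_pmf_def by (subst E_bind[of _ B], fact, fact)+ (simp add: E_coin)

text \<open>The right-hand side is a fair coin independent of the set, so each constraint holds with
  probability 1/2, whatever \<open>g\<close> is.\<close>

lemma prob_agree: "E (hash_pmf D l) (\<lambda>ps. of_bool (agree g ps x)) = (1 / 2) ^ l"
proof -
  have "measure_pmf.prob (pair_pmf D coin) {p. g (fst p) x = snd p} = 1 / 2"
  proof -
    have eq: "(\<lambda>a. (of_bool (g (fst (a, True)) x = snd (a, True)) + of_bool (g (fst (a, False)) x = snd (a, False))) / 2) =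
        (\<lambda>_. 1 / 2 :: real)"
      by (rule ext) auto
    show ?thesis unfolding prob_E by (subst E_pair_coin[of _ 1], simp, simp, subst eq, simp)
  qed
  thus ?thesis unfolding hash_pmf_def agree_def prob_E[symmetric] measure_replicate_all by (simp only:)
qed

text \<open>Two points satisfy the same constraint iff it does not separate them and the coin shows
  their common value.\<close>

lemma prob_agree2:
  "E (hash_pmf D l) (\<lambda>ps. of_bool (agree g ps x \<and> agree g ps y)) = (collide D g x y / 2) ^ l"
proof -
  have "measure_pmf.prob (pair_pmf D coin) {p. g (fst p) x = snd p \<and> g (fst p) y = snd p} = collide D g x y / 2"
  proof -
    have "measure_pmf.prob (pair_pmf D coin) {p. g (fst p) x = snd p \<and> g (fst p) y = snd p} =
        E D (\<lambda>a. of_bool (g a x = g a y) / 2)"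
      unfolding prob_E by (subst E_pair_coin[of _ 1]) (auto simp: of_bool_def intro!: Bochner_Integration.integral_cong)
    thus ?thesis by (simp add: collide_def prob_E)
  qed
  moreover have "agree g ps x \<and> agree g ps y \<longleftrightarrow> (\<forall>p\<in>set ps. g (fst p) x = snd p \<and> g (fst p) y = snd p)" for ps
    by (auto simp: agree_def)
  ultimately show ?thesis unfolding hash_pmf_def prob_E[symmetric] by (simp only: measure_replicate_all)
qed

lemma real_hits:
  assumes "finite S"
  shows "real (hits g S ps) = (\<Sum>x\<in>S. of_bool (agree g ps x))"
proof -
  have "{x\<in>S. agree g ps x} = S \<inter> {x. agree g ps x}" by auto
  thus ?thesis using assms by (simp add: hits_def)
qed

lemma hits_le: "finite S \<Longrightarrow> hits g S ps \<le> card S"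
  unfolding hits_def by (rule card_mono) auto

lemma E_hits: "finite S \<Longrightarrow> E (hash_pmf D l) (\<lambda>ps. real (hits g S ps)) = real (card S) / 2 ^ l"
  unfolding real_hits by (subst E_sum_bounded[of _ _ 1]) (auto simp: prob_agree power_one_over)

lemma E_hits_square:
  assumes "finite S"
  shows "E (hash_pmf D l) (\<lambda>ps. (real (hits g S ps))\<^sup>2) = (real (card S) / 2 ^ l)\<^sup>2 * dispersion D g S l"
proof -
  have eq: "(real (hits g S ps))\<^sup>2 = (\<Sum>x\<in>S. \<Sum>y\<in>S. of_bool (agree g ps x \<and> agree g ps y))" for ps
    unfolding real_hits[OF assms] power2_eq_square sum_product by (simp add: of_bool_conj)
  have "\<bar>\<Sum>y\<in>S. of_bool (agree g ps x \<and> agree g ps y) :: real\<bar> \<le> real (card S)" for ps x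
  proof -
    have "(\<Sum>y\<in>S. of_bool (agree g ps x \<and> agree g ps y) :: real) \<le> (\<Sum>y\<in>S. 1)"
      by (rule sum_mono) auto
    thus ?thesis by (simp add: sum_nonneg)
  qed
  hence "E (hash_pmf D l) (\<lambda>ps. (real (hits g S ps))\<^sup>2) = (\<Sum>x\<in>S. \<Sum>y\<in>S. (collide D g x y / 2) ^ l)"
    unfolding eq by (subst E_sum_bounded[of _ _ "real (card S)"], simp, subst E_sum_bounded[of _ _ 1], simp)
      (simp add: prob_agree2)
  also have "\<dots> = (\<Sum>x\<in>S. \<Sum>y\<in>S. (2 * collide D g x y) ^ l / (2 ^ l)\<^sup>2)"
  proof (intro sum.cong refl)
    fix x y
    have "collide D g x y / 2 = (2 * collide D g x y) / 4" by simp
    moreover have "(2 ^ l)\<^sup>2 = (4 :: real) ^ l" by (simp add: power2_eq_square flip: power_mult_distrib)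
    ultimately show "(collide D g x y / 2) ^ l = (2 * collide D g x y) ^ l / (2 ^ l)\<^sup>2"
      by (simp only: power_divide)
  qed
  also have "\<dots> = (\<Sum>x\<in>S. \<Sum>y\<in>S. (2 * collide D g x y) ^ l) / (2 ^ l)\<^sup>2"
    by (simp add: sum_divide_distrib)
  also have "\<dots> = (real (card S) / 2 ^ l)\<^sup>2 * dispersion D g S l"
  proof (cases "card S = 0")
    \<comment> \<open>Here \<open>S\<close> is empty, and the dispersion is 0 / 0 = 0.\<close>
    case True
    thus ?thesis using assms by (simp add: dispersion_def)
  qed (simp add: dispersion_def power_divide)
  finally show ?thesis .
qed

text \<open>Chebyshev's inequality: (N / \<mu> - 1)^2 equals 1 where N = 0, and its mean is the
  dispersion minus 1.\<close>

lemma prob_no_hit: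
  assumes "finite S" "S \<noteq> {}"
  shows "measure_pmf.prob (hash_pmf D l) {ps. hits g S ps = 0} \<le> dispersion D g S l - 1"
proof -
  define \<mu> where "\<mu> = real (card S) / 2 ^ l"
  have \<mu>: "\<mu> > 0" using assms by (simp add: \<mu>_def card_gt_0_iff)
  let ?N = "\<lambda>ps. real (hits g S ps)"
  have b: "\<bar>?N ps\<bar> \<le> real (card S)" "\<bar>(?N ps)\<^sup>2\<bar> \<le> (real (card S))\<^sup>2" for ps
    using hits_le[OF assms(1), of g ps] by (auto intro: power_mono)
  have int: "integrable (measure_pmf (hash_pmf D l)) ?N" "integrable (measure_pmf (hash_pmf D l)) (\<lambda>ps. (?N ps)\<^sup>2)"
    using b by (blast intro: integrable_bounded_pmf)+
  have "measure_pmf.prob (hash_pmf D l) {ps. hits g S ps = 0} \<le>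
      E (hash_pmf D l) (\<lambda>ps. (?N ps)\<^sup>2 / \<mu>\<^sup>2 - 2 * ?N ps / \<mu> + 1)"
    unfolding prob_E
  proof (rule integral_mono_AE)
    show "integrable (measure_pmf (hash_pmf D l)) (\<lambda>ps. of_bool (hits g S ps = 0) :: real)"
      by (rule integrable_bounded_pmf[of _ _ 1]) auto
    show "integrable (measure_pmf (hash_pmf D l)) (\<lambda>ps. (?N ps)\<^sup>2 / \<mu>\<^sup>2 - 2 * ?N ps / \<mu> + 1)"
      using int by simp
    have "of_bool (hits g S ps = 0) \<le> (?N ps)\<^sup>2 / \<mu>\<^sup>2 - 2 * ?N ps / \<mu> + 1" for ps
    proof -
      have "(?N ps)\<^sup>2 / \<mu>\<^sup>2 - 2 * ?N ps / \<mu> + 1 = (?N ps / \<mu> - 1)\<^sup>2"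
        by (simp add: power2_diff power_divide)
      thus ?thesis by auto
    qed
    thus "AE ps in hash_pmf D l. of_bool (hits g S ps = 0) \<le> (?N ps)\<^sup>2 / \<mu>\<^sup>2 - 2 * ?N ps / \<mu> + 1" by simp
  qed
  also have "\<dots> = E (hash_pmf D l) (\<lambda>ps. (?N ps)\<^sup>2) / \<mu>\<^sup>2 - 2 * E (hash_pmf D l) ?N / \<mu> + 1"
    using int by simp
  also have "\<dots> = dispersion D g S l - 1"
    unfolding E_hits[OF assms(1)] E_hits_square[OF assms(1)] \<mu>_def[symmetric] using \<mu> by simp
  finally show ?thesis .
qed

text \<open>In each row of the double sum the far pairs contribute at most (1 + \<tau>)^l each. A
  near pair can contribute up to 2^l, but there are at most \<open>V\<close> of them.\<close>

lemma dispersion_le: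
  assumes "finite S" "S \<noteq> {}"
    and far: "\<And>x y. x \<in> S \<Longrightarrow> y \<in> S \<Longrightarrow> \<not> near x y \<Longrightarrow> 2 * collide D g x y \<le> 1 + \<tau>"
    and near: "\<And>x. x \<in> S \<Longrightarrow> real (card {y\<in>S. near x y}) \<le> V"
    and "0 \<le> \<tau>"
  shows "dispersion D g S l \<le> (1 + \<tau>) ^ l + V * 2 ^ l / real (card S)"
proof -
  have s: "real (card S) > 0" using assms by (simp add: card_gt_0_iff)
  have pt: "(2 * collide D g x y) ^ l \<le> (1 + \<tau>) ^ l + of_bool (near x y) * 2 ^ l" if "x \<in> S" "y \<in> S" for x y
  proof (cases "near x y")
    case True
    have "(2 * collide D g x y) ^ l \<le> 2 ^ l"
      by (rule power_mono) (auto simp: collide_def)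
    thus ?thesis using True \<open>0 \<le> \<tau>\<close> by (simp add: add.commute add_increasing)
  next
    case False
    have "(2 * collide D g x y) ^ l \<le> (1 + \<tau>) ^ l"
      by (rule power_mono[OF far[OF that False]]) (simp add: collide_def)
    thus ?thesis using False by simp
  qed
  have row: "(\<Sum>y\<in>S. (2 * collide D g x y) ^ l) \<le> real (card S) * (1 + \<tau>) ^ l + V * 2 ^ l" if "x \<in> S" for x
  proof -
    have "(\<Sum>y\<in>S. (2 * collide D g x y) ^ l) \<le> (\<Sum>y\<in>S. (1 + \<tau>) ^ l + of_bool (near x y) * 2 ^ l)"
      by (rule sum_mono) (use pt that in auto)
    also have "\<dots> = real (card S) * (1 + \<tau>) ^ l + real (card {y\<in>S. near x y}) * 2 ^ l"
    proof -
      have "S \<inter> {y. near x y} = {y\<in>S. near x y}" by auto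
      thus ?thesis using assms(1) by (simp add: sum.distrib flip: sum_distrib_right)
    qed
    also have "\<dots> \<le> real (card S) * (1 + \<tau>) ^ l + V * 2 ^ l"
      using near[OF that] by simp
    finally show ?thesis .
  qed
  have "(\<Sum>x\<in>S. \<Sum>y\<in>S. (2 * collide D g x y) ^ l) \<le> (\<Sum>x\<in>S. real (card S) * (1 + \<tau>) ^ l + V * 2 ^ l)"
    by (rule sum_mono) (rule row)
  also have "\<dots> = real (card S) * (real (card S) * (1 + \<tau>) ^ l + V * 2 ^ l)" by simp
  finally have "dispersion D g S l \<le> real (card S) * (real (card S) * (1 + \<tau>) ^ l + V * 2 ^ l) / (real (card S))\<^sup>2"
    unfolding dispersion_def by (rule divide_right_mono) simp
  also have "\<dots> = (1 + \<tau>) ^ l + V * 2 ^ l / real (card S)"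
    using s by (simp add: power2_eq_square field_simps)
  finally show ?thesis .
qed

subsection \<open>Hamming distance\<close>

definition hdist :: "bool list \<Rightarrow> bool list \<Rightarrow> nat" where
  "hdist x y = card {i. i < length x \<and> x ! i \<noteq> y ! i}"

lemma hdist_Cons: "hdist (a # x) (b # y) = of_bool (a \<noteq> b) + hdist x y"
proof -
  have eq: "{i. i < length (a # x) \<and> (a # x) ! i \<noteq> (b # y) ! i} =
      (if a \<noteq> b then {0} else {}) \<union> Suc ` {i. i < length x \<and> x ! i \<noteq> y ! i}"
  proof (rule set_eqI)
    show "j \<in> {i. i < length (a # x) \<and> (a # x) ! i \<noteq> (b # y) ! i} \<longleftrightarrow>
      j \<in> (if a \<noteq> b then {0} else {}) \<union> Suc ` {i. i < length x \<and> x ! i \<noteq> y ! i}" for j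
      by (cases j) (auto simp: image_iff)
  qed
  show ?thesis unfolding hdist_def[of "a # x"] eq
    by (subst card_Un_disjoint) (auto simp: hdist_def card_image)
qed

lemma hdist_le: "hdist x y \<le> length x"
  unfolding hdist_def by (rule order_trans[OF card_mono[of "{..<length x}"]]) auto

text \<open>The generating function of the distance from \<open>x\<close> factors over the
  coordinates, each of which agrees (factor \<open>b\<close>) or differs (factor \<open>a\<close>).
  All estimates of Hamming balls below are exponential moments obtained from it.\<close>

lemma sum_hdist:
  fixes a b :: real
  shows "(\<Sum>y | length y = length x. a ^ hdist x y * b ^ (length x - hdist x y)) = (a + b) ^ length x"
proof (induction x)
  case (Cons c x)
  let ?A = "{y :: bool list. length y = length x}"
  have fin: "finite ?A" using finite_lists_length_eq[of "UNIV :: bool set" "length x"] by simp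
  have split: "{y. length y = length (c # x)} = (\<lambda>y. c # y) ` ?A \<union> (\<lambda>y. (\<not> c) # y) ` ?A"
  proof -
    have "y \<in> (\<lambda>y. c # y) ` ?A \<union> (\<lambda>y. (\<not> c) # y) ` ?A" if "length y = length (c # x)" for y :: "bool list"
      using that by (cases y) auto
    thus ?thesis by auto
  qed
  have "(\<Sum>y | length y = length (c # x). a ^ hdist (c # x) y * b ^ (length (c # x) - hdist (c # x) y)) =
     (\<Sum>y\<in>?A. a ^ hdist x y * b ^ (Suc (length x) - hdist x y)) +
     (\<Sum>y\<in>?A. a ^ Suc (hdist x y) * b ^ (length x - hdist x y))"
    unfolding split using fin
    by (subst sum.union_disjoint) (auto simp: sum.reindex inj_on_def hdist_Cons)
  also have "\<dots> = (\<Sum>y\<in>?A. (a + b) * (a ^ hdist x y * b ^ (length x - hdist x y)))"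
    unfolding sum.distrib[symmetric]
    by (intro sum.cong refl) (simp add: Suc_diff_le hdist_le algebra_simps)
  also have "\<dots> = (a + b) * (a + b) ^ length x"
    unfolding sum_distrib_left[symmetric] Cons.IH ..
  finally show ?case by simp
qed (simp add: hdist_def)

subsection \<open>Programs over a single value\<close>

datatype cmp = CPair | CEq | CLess

text \<open>A program below keeps its whole state as one value in register 0 and replaces it by an
  expression in that value. Specifications then relate values and not stores.\<close>

datatype expr =
    EV
  | EN nat
  | EFst expr
  | ESnd expr
  | EP expr expr
  | EInc expr
  | EDec expr
  | EIf cmp expr expr expr expr

fun cmp_holds :: "cmp \<Rightarrow> val \<Rightarrow> val \<Rightarrow> bool" where
  "cmp_holds CPair v w = is_pair v"
| "cmp_holds CEq v w = eq_val v w"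
| "cmp_holds CLess v w = less_val v w"

fun cmp_test :: "cmp \<Rightarrow> nat \<Rightarrow> nat \<Rightarrow> test" where
  "cmp_test CPair x y = IsPair x"
| "cmp_test CEq x y = IsEq x y"
| "cmp_test CLess x y = IsLess x y"

lemma holds_cmp_test [simp]: "holds (cmp_test b x y) s = cmp_holds b (s x) (s y)"
  by (cases b) auto

primrec ev :: "expr \<Rightarrow> val \<Rightarrow> val" where
  "ev EV v = v"
| "ev (EN m) v = Num m"
| "ev (EFst e) v = fst_val (ev e v)"
| "ev (ESnd e) v = snd_val (ev e v)"
| "ev (EP a b) v = Pair (ev a v) (ev b v)"
| "ev (EInc e) v = succ_val (ev e v)"
| "ev (EDec e) v = pred_val (ev e v)"
| "ev (EIf b x y c d) v = (if cmp_holds b (ev x v) (ev y v) then ev c v else ev d v)"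

text \<open>Both branches of a conditional are charged, which makes the bound independent of the
  value.\<close>

primrec ecost :: "expr \<Rightarrow> nat" where
  "ecost EV = 1"
| "ecost (EN m) = 1"
| "ecost (EFst e) = ecost e + 1"
| "ecost (ESnd e) = ecost e + 1"
| "ecost (EP a b) = ecost a + ecost b + 1"
| "ecost (EInc e) = ecost e + 1"
| "ecost (EDec e) = ecost e + 1"
| "ecost (EIf b x y c d) = ecost x + ecost y + ecost c + ecost d + 1"

lemma exec_Seq: "exec orc (Seq c d) = (\<lambda>st. bind_spmf (exec orc c st) (exec orc d))"
  by (rule ext) simp

lemma exec_While: "exec orc (While b c) = while_spmf b (exec orc c)"
  by (rule ext) simp

text \<open>The registers from \<open>r\<close> on are an evaluation stack; those below
  \<open>r\<close> survive, in particular the state in register 0 if \<open>r\<close> is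
  positive.\<close>

primrec compile :: "expr \<Rightarrow> nat \<Rightarrow> com" where
  "compile EV r = Copy r 0"
| "compile (EN m) r = Const r m"
| "compile (EFst e) r = Seq (compile e r) (GetFst r r)"
| "compile (ESnd e) r = Seq (compile e r) (GetSnd r r)"
| "compile (EP a b) r = Seq (compile a r) (Seq (compile b (Suc r)) (MkPair r r (Suc r)))"
| "compile (EInc e) r = Seq (compile e r) (Inc r r)"
| "compile (EDec e) r = Seq (compile e r) (Dec r r)"
| "compile (EIf b x y c d) r =
     Seq (compile x r) (Seq (compile y (Suc r)) (Cond (cmp_test b r (Suc r)) (compile c r) (compile d r)))"

lemma exec_compile:
  assumes "0 < r"
  shows "\<exists>s' t'. exec orc (compile e r) (s, t) = return_spmf (s', t') \<and>
           s' r = ev e (s 0) \<and> (\<forall>i<r. s' i = s i) \<and> t' \<le> t + ecost e"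
  using assms
proof (induction e arbitrary: r s t)
  case (EP a b)
  obtain s1 t1 where 1: "exec orc (compile a r) (s, t) = return_spmf (s1, t1)"
    "s1 r = ev a (s 0)" "\<forall>i<r. s1 i = s i" "t1 \<le> t + ecost a"
    using EP.IH(1)[OF EP.prems] by blast
  obtain s2 t2 where 2: "exec orc (compile b (Suc r)) (s1, t1) = return_spmf (s2, t2)"
    "s2 (Suc r) = ev b (s1 0)" "\<forall>i<Suc r. s2 i = s1 i" "t2 \<le> t1 + ecost b"
    using EP.IH(2)[of "Suc r"] by blast
  show ?case using 1 2 EP.prems by auto
next
  case (EIf b x y c d)
  obtain s1 t1 where 1: "exec orc (compile x r) (s, t) = return_spmf (s1, t1)"
    "s1 r = ev x (s 0)" "\<forall>i<r. s1 i = s i" "t1 \<le> t + ecost x"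
    using EIf.IH(1)[OF EIf.prems] by blast
  obtain s2 t2 where 2: "exec orc (compile y (Suc r)) (s1, t1) = return_spmf (s2, t2)"
    "s2 (Suc r) = ev y (s1 0)" "\<forall>i<Suc r. s2 i = s1 i" "t2 \<le> t1 + ecost y"
    using EIf.IH(2)[of "Suc r"] by blast
  obtain s3 t3 where 3: "exec orc (compile c r) (s2, t2 + 1) = return_spmf (s3, t3)"
    "s3 r = ev c (s2 0)" "\<forall>i<r. s3 i = s2 i" "t3 \<le> t2 + 1 + ecost c"
    using EIf.IH(3)[OF EIf.prems] by blast
  obtain s4 t4 where 4: "exec orc (compile d r) (s2, t2 + 1) = return_spmf (s4, t4)"
    "s4 r = ev d (s2 0)" "\<forall>i<r. s4 i = s2 i" "t4 \<le> t2 + 1 + ecost d"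
    using EIf.IH(4)[OF EIf.prems] by blast
  show ?case
  proof (cases "cmp_holds b (s2 r) (s2 (Suc r))")
    case True
    then show ?thesis using 1 2 3 EIf.prems by auto
  next
    case False
    then show ?thesis using 1 2 4 EIf.prems by auto
  qed
next
  case (EFst e)
  obtain s1 t1 where 1: "exec orc (compile e r) (s, t) = return_spmf (s1, t1)"
    "s1 r = ev e (s 0)" "\<forall>i<r. s1 i = s i" "t1 \<le> t + ecost e"
    using EFst.IH[OF EFst.prems] by blast
  then show ?case by auto
next
  case (ESnd e)
  obtain s1 t1 where 1: "exec orc (compile e r) (s, t) = return_spmf (s1, t1)"
    "s1 r = ev e (s 0)" "\<forall>i<r. s1 i = s i" "t1 \<le> t + ecost e"
    using ESnd.IH[OF ESnd.prems] by blast
  then show ?case by auto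
next
  case (EInc e)
  obtain s1 t1 where 1: "exec orc (compile e r) (s, t) = return_spmf (s1, t1)"
    "s1 r = ev e (s 0)" "\<forall>i<r. s1 i = s i" "t1 \<le> t + ecost e"
    using EInc.IH[OF EInc.prems] by blast
  then show ?case by auto
next
  case (EDec e)
  obtain s1 t1 where 1: "exec orc (compile e r) (s, t) = return_spmf (s1, t1)"
    "s1 r = ev e (s 0)" "\<forall>i<r. s1 i = s i" "t1 \<le> t + ecost e"
    using EDec.IH[OF EDec.prems] by blast
  then show ?case by auto
qed auto

text \<open>Coupling with a lossless distribution expresses three things at once: almost sure
  termination, the law of the output, and a time bound on every run. The quantifier over
  \<open>s\<close> allows the other registers to contain remnants of earlier computations, which is
  what makes sequential composition possible.\<close>

definition computes :: "(val \<Rightarrow> val) \<Rightarrow> com \<Rightarrow> val \<Rightarrow> val pmf \<Rightarrow> nat \<Rightarrow> bool" where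
  "computes orc c v p T \<longleftrightarrow> (\<forall>s t. s 0 = v \<longrightarrow>
     rel_spmf (\<lambda>st w. fst st 0 = w \<and> snd st \<le> t + T) (exec orc c (s, t)) (spmf_of_pmf p))"

lemma computesD:
  "computes orc c v p T \<Longrightarrow> s 0 = v \<Longrightarrow>
     rel_spmf (\<lambda>st w. fst st 0 = w \<and> snd st \<le> t + T) (exec orc c (s, t)) (spmf_of_pmf p)"
  by (simp add: computes_def)

lemma computes_mono: "computes orc c v p T \<Longrightarrow> T \<le> T' \<Longrightarrow> computes orc c v p T'"
  unfolding computes_def by (fastforce elim!: rel_spmf_mono)

lemma computes_cong: "computes orc c v p T \<Longrightarrow> p = p' \<Longrightarrow> T \<le> T' \<Longrightarrow> computes orc c v p' T'"
  using computes_mono by blast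

lemma spmf_of_pmf_bind': "spmf_of_pmf (bind_pmf p q) = bind_spmf (spmf_of_pmf p) (\<lambda>w. spmf_of_pmf (q w))"
  by (simp add: spmf_of_pmf_bind bind_spmf_of_pmf)

lemma rel_spmf_bind_spmf_of_pmf:
  assumes "rel_spmf R A (spmf_of_pmf p)"
    and "\<And>x w. w \<in> set_pmf p \<Longrightarrow> R x w \<Longrightarrow> rel_spmf S (f x) (spmf_of_pmf (q w))"
  shows "rel_spmf S (bind_spmf A f) (spmf_of_pmf (bind_pmf p q))"
proof -
  have "rel_spmf (\<lambda>x w. R x w \<and> w \<in> set_pmf p) A (spmf_of_pmf p)"
    by (rule rel_spmf_mono_strong[OF assms(1)]) auto
  thus ?thesis unfolding spmf_of_pmf_bind'
    by (rule rel_spmf_bindI) (use assms(2) in auto)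
qed

text \<open>Intermediate values are encodings \<open>\<phi> a\<close> of mathematical objects.
  Ranging over \<open>a\<close> in the support, the second premise can use facts about the sampled
  object that its encoding alone does not display.\<close>

lemma computes_Seq_map:
  assumes "computes orc c v (map_pmf \<phi> p) T1" "\<And>a. a \<in> set_pmf p \<Longrightarrow> computes orc d (\<phi> a) (q a) T2"
  shows "computes orc (Seq c d) v (bind_pmf p q) (T1 + T2)"
  unfolding computes_def
proof (intro allI impI)
  fix s :: store and t :: nat assume s: "s 0 = v"
  show "rel_spmf (\<lambda>st w. fst st 0 = w \<and> snd st \<le> t + (T1 + T2)) (exec orc (Seq c d) (s, t)) (spmf_of_pmf (bind_pmf p q))"
    unfolding exec.simps
  proof (rule rel_spmf_bind_spmf_of_pmf)
    show "rel_spmf (\<lambda>st a. fst st 0 = \<phi> a \<and> snd st \<le> t + T1) (exec orc c (s, t)) (spmf_of_pmf p)"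
      using computesD[where s = s and t = t, OF assms(1)] s by (simp add: spmf_rel_map flip: map_spmf_of_pmf)
    fix x :: state and a assume a: "a \<in> set_pmf p" and x: "fst x 0 = \<phi> a \<and> snd x \<le> t + T1"
    have "rel_spmf (\<lambda>st w'. fst st 0 = w' \<and> snd st \<le> snd x + T2) (exec orc d (fst x, snd x)) (spmf_of_pmf (q a))"
      using computesD[where s = "fst x" and t = "snd x", OF assms(2)[OF a]] x by simp
    thus "rel_spmf (\<lambda>st w. fst st 0 = w \<and> snd st \<le> t + (T1 + T2)) (exec orc d x) (spmf_of_pmf (q a))"
      using x by (auto elim!: rel_spmf_mono)
  qed
qed


lemma computes_Seq_det:
  assumes "computes orc c v (return_pmf w) T1" "computes orc d w q T2"
  shows "computes orc (Seq c d) v q (T1 + T2)"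
proof -
  have "computes orc (Seq c d) v (bind_pmf (return_pmf w) (\<lambda>_. q)) (T1 + T2)"
    by (rule computes_Seq_map[where \<phi> = "\<lambda>x. x"]) (use assms in auto)
  thus ?thesis by (simp add: bind_return_pmf)
qed

definition asn :: "expr \<Rightarrow> com" where
  "asn e = Seq (compile e 1) (Copy 0 1)"

lemma computes_asn: "computes orc (asn e) v (return_pmf (ev e v)) (ecost e + 1)"
  unfolding computes_def
proof (intro allI impI)
  fix s :: store and t :: nat assume s: "s 0 = v"
  obtain s1 t1 where "exec orc (compile e 1) (s, t) = return_spmf (s1, t1)"
    "s1 1 = ev e (s 0)" "t1 \<le> t + ecost e"
    using exec_compile[of 1 orc e s t] by auto
  thus "rel_spmf (\<lambda>st w. fst st 0 = w \<and> snd st \<le> t + (ecost e + 1)) (exec orc (asn e) (s, t))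
     (spmf_of_pmf (return_pmf (ev e v)))" using s
    by (simp add: asn_def)
qed

text \<open>The sample is paired with the old state, so that nothing is lost; an assignment then
  rearranges the result. The same convention holds for \<open>ask\<close> and
  \<open>call\<close>.\<close>

definition rnd :: "expr \<Rightarrow> com" where
  "rnd e = Seq (compile e 1) (Seq (Random 1 1) (MkPair 0 1 0))"

lemma computes_rnd: "computes orc (rnd e) v (map_pmf (\<lambda>w. Pair w v) (random_val (ev e v))) (ecost e + 2)"
  unfolding computes_def
proof (intro allI impI)
  fix s :: store and t :: nat assume s: "s 0 = v"
  obtain s1 t1 where "exec orc (compile e 1) (s, t) = return_spmf (s1, t1)"
    "s1 1 = ev e (s 0)" "s1 0 = s 0" "t1 \<le> t + ecost e"
    using exec_compile[of 1 orc e s t] by auto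
  hence "exec orc (rnd e) (s, t) = spmf_of_pmf (map_pmf (\<lambda>w. ((s1(1 := w))(0 := Pair w v), t1 + 2)) (random_val (ev e v)))"
    using s by (simp add: rnd_def exec_Seq map_pmf_def spmf_of_pmf_bind' bind_spmf_of_pmf spmf_of_pmf_bind del: spmf_of_pmf_bind exec.simps(11))
      (simp add: bind_spmf_def bind_assoc_pmf bind_return_pmf)
  thus "rel_spmf (\<lambda>st w. fst st 0 = w \<and> snd st \<le> t + (ecost e + 2)) (exec orc (rnd e) (s, t))
     (spmf_of_pmf (map_pmf (\<lambda>w. Pair w v) (random_val (ev e v))))"
    using \<open>t1 \<le> t + ecost e\<close> by (simp add: pmf.rel_map rel_pmf_reflI)
qed

definition ask :: "expr \<Rightarrow> com" where
  "ask e = Seq (compile e 1) (Seq (Ask 1 1) (MkPair 0 1 0))"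

lemma computes_ask:
  "computes orc (ask e) v (return_pmf (Pair (orc (ev e v)) v)) (ecost e + 2 + val_size (ev e v))"
  unfolding computes_def
proof (intro allI impI)
  fix s :: store and t :: nat assume s: "s 0 = v"
  obtain s1 t1 where "exec orc (compile e 1) (s, t) = return_spmf (s1, t1)"
    "s1 1 = ev e (s 0)" "s1 0 = s 0" "t1 \<le> t + ecost e"
    using exec_compile[of 1 orc e s t] by auto
  thus "rel_spmf (\<lambda>st w. fst st 0 = w \<and> snd st \<le> t + (ecost e + 2 + val_size (ev e v))) (exec orc (ask e) (s, t))
     (spmf_of_pmf (return_pmf (Pair (orc (ev e v)) v)))" using s
    by (auto simp: ask_def)
qed

definition call :: "com \<Rightarrow> expr \<Rightarrow> com" where
  "call c e = Seq (compile e 1) (Seq (Call 1 c 1) (MkPair 0 1 0))"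

text \<open>The SAT algorithm is a given program, known only through its runs from the initial
  store, and may misbehave if other registers are dirty. \<open>Call\<close> starts it on exactly
  that store, so this weaker judgement suffices for calls.\<close>

definition computes_init :: "(val \<Rightarrow> val) \<Rightarrow> com \<Rightarrow> val \<Rightarrow> val pmf \<Rightarrow> nat \<Rightarrow> bool" where
  "computes_init orc c v p T \<longleftrightarrow> (\<forall>t.
     rel_spmf (\<lambda>st w. fst st 0 = w \<and> snd st \<le> t + T) (exec orc c (init_store v, t)) (spmf_of_pmf p))"

lemma computes_init: "computes orc c v p T \<Longrightarrow> computes_init orc c v p T"
  by (simp add: computes_def computes_init_def init_store_def)

lemma computes_call_init:
  assumes "computes_init orc c (ev e v) p T"
  shows "computes orc (call c e) v (map_pmf (\<lambda>w. Pair w v) p) (ecost e + 2 + T)"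
  unfolding computes_def
proof (intro allI impI)
  fix s :: store and t :: nat assume s: "s 0 = v"
  obtain s1 t1 where 1: "exec orc (compile e 1) (s, t) = return_spmf (s1, t1)"
    "s1 1 = ev e (s 0)" "s1 0 = s 0" "t1 \<le> t + ecost e"
    using exec_compile[of 1 orc e s t] by auto
  have "rel_spmf (\<lambda>st w. fst st 0 = w \<and> snd st \<le> t1 + 1 + T)
      (exec orc c (init_store (ev e v), t1 + 1)) (spmf_of_pmf p)"
    using assms unfolding computes_init_def by blast
  thus "rel_spmf (\<lambda>st w. fst st 0 = w \<and> snd st \<le> t + (ecost e + 2 + T)) (exec orc (call c e) (s, t))
     (spmf_of_pmf (map_pmf (\<lambda>w. Pair w v) p))" using s 1
    by (auto simp: call_def bind_map_spmf o_def map_spmf_conv_bind_spmf[symmetric] spmf_rel_map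
         simp flip: map_spmf_of_pmf elim!: rel_spmf_mono)
qed

lemmas computes_call = computes_call_init[OF computes_init]

definition ite :: "cmp \<Rightarrow> expr \<Rightarrow> expr \<Rightarrow> com \<Rightarrow> com \<Rightarrow> com" where
  "ite b x y c d = Seq (compile x 1) (Seq (compile y 2) (Cond (cmp_test b 1 2) c d))"

text \<open>\<open>While\<close> tests registers, so the two compared expressions are evaluated
  before the loop and again at the end of each iteration.\<close>

definition whl :: "cmp \<Rightarrow> expr \<Rightarrow> expr \<Rightarrow> com \<Rightarrow> com" where
  "whl b x y c = Seq (compile x 1) (Seq (compile y 2)
     (While (cmp_test b 1 2) (Seq c (Seq (compile x 1) (compile y 2)))))"

lemma exec_compile2:
  "\<exists>s' t'. exec orc (Seq (compile x 1) (compile y 2)) (s, t) = return_spmf (s', t') \<and>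
     s' 1 = ev x (s 0) \<and> s' 2 = ev y (s 0) \<and> s' 0 = s 0 \<and> t' \<le> t + ecost x + ecost y"
proof -
  obtain s1 t1 where 1: "exec orc (compile x 1) (s, t) = return_spmf (s1, t1)"
    "s1 1 = ev x (s 0)" "s1 0 = s 0" "t1 \<le> t + ecost x"
    using exec_compile[of 1 orc x s t] by auto
  obtain s2 t2 where 2: "exec orc (compile y 2) (s1, t1) = return_spmf (s2, t2)"
    "s2 2 = ev y (s1 0)" "s2 0 = s1 0" "s2 1 = s1 1" "t2 \<le> t1 + ecost y"
    using exec_compile[of 2 orc y s1 t1] by auto
  show ?thesis using 1 2 by auto
qed

lemma computes_ite:
  assumes "cmp_holds b (ev x v) (ev y v) \<Longrightarrow> computes orc c v p T"
    and "\<not> cmp_holds b (ev x v) (ev y v) \<Longrightarrow> computes orc d v p T"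
  shows "computes orc (ite b x y c d) v p (ecost x + ecost y + 1 + T)"
  unfolding computes_def
proof (intro allI impI)
  fix s :: store and t :: nat assume s: "s 0 = v"
  obtain s1 t1 where 1: "exec orc (Seq (compile x 1) (compile y 2)) (s, t) = return_spmf (s1, t1)"
    "s1 1 = ev x v" "s1 2 = ev y v" "s1 0 = v" "t1 \<le> t + ecost x + ecost y"
    using exec_compile2[of orc x y s t] s by auto
  have eq: "exec orc (ite b x y c d) (s, t) =
      bind_spmf (exec orc (Seq (compile x 1) (compile y 2)) (s, t)) (exec orc (Cond (cmp_test b 1 2) c d))"
    by (simp add: ite_def exec_Seq del: exec.simps)
  have "rel_spmf (\<lambda>st w. fst st 0 = w \<and> snd st \<le> t1 + 1 + T)
      (exec orc (if cmp_holds b (ev x v) (ev y v) then c else d) (s1, t1 + 1)) (spmf_of_pmf p)"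
    using computesD[where s = s1 and t = "t1 + 1", OF assms(1)] computesD[where s = s1 and t = "t1 + 1", OF assms(2)] 1(4) by auto
  thus "rel_spmf (\<lambda>st w. fst st 0 = w \<and> snd st \<le> t + (ecost x + ecost y + 1 + T)) (exec orc (ite b x y c d) (s, t))
     (spmf_of_pmf p)" unfolding eq 1(1) using 1
    by (auto elim!: rel_spmf_mono split: if_splits)
qed

lemma computes_whl_stop:
  assumes "\<not> cmp_holds b (ev x v) (ev y v)"
  shows "computes orc (whl b x y c) v (return_pmf v) (ecost x + ecost y + 1)"
  unfolding computes_def
proof (intro allI impI)
  fix s :: store and t :: nat assume s: "s 0 = v"
  obtain s1 t1 where 1: "exec orc (Seq (compile x 1) (compile y 2)) (s, t) = return_spmf (s1, t1)"
    "s1 1 = ev x v" "s1 2 = ev y v" "s1 0 = v" "t1 \<le> t + ecost x + ecost y"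
    using exec_compile2[of orc x y s t] s by auto
  let ?W = "While (cmp_test b 1 2) (Seq c (Seq (compile x 1) (compile y 2)))"
  have eq: "exec orc (whl b x y c) (s, t) =
      bind_spmf (exec orc (Seq (compile x 1) (compile y 2)) (s, t)) (exec orc ?W)"
    by (simp add: whl_def exec_Seq del: exec.simps)
  have W: "exec orc ?W (s1, t1) = return_spmf (s1, t1 + 1)"
    using assms 1 by (simp add: while_spmf.simps)
  show "rel_spmf (\<lambda>st w. fst st 0 = w \<and> snd st \<le> t + (ecost x + ecost y + 1)) (exec orc (whl b x y c) (s, t))
     (spmf_of_pmf (return_pmf v))" unfolding eq 1(1) return_bind_spmf W using 1 by simp
qed

lemma computes_whl_step_map:
  assumes h: "cmp_holds b (ev x v) (ev y v)"
    and c: "computes orc c v (map_pmf \<phi> p) T1"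
    and rest: "\<And>a. a \<in> set_pmf p \<Longrightarrow> computes orc (whl b x y c) (\<phi> a) (q a) T2"
  shows "computes orc (whl b x y c) v (bind_pmf p q) (ecost x + ecost y + 1 + T1 + T2)"
  unfolding computes_def
proof (intro allI impI)
  fix s :: store and t :: nat assume s: "s 0 = v"
  obtain s1 t1 where 1: "exec orc (Seq (compile x 1) (compile y 2)) (s, t) = return_spmf (s1, t1)"
    "s1 1 = ev x v" "s1 2 = ev y v" "s1 0 = v" "t1 \<le> t + ecost x + ecost y"
    using exec_compile2[of orc x y s t] s by auto
  let ?W = "While (cmp_test b 1 2) (Seq c (Seq (compile x 1) (compile y 2)))"
  have eq: "exec orc (whl b x y c) = (\<lambda>st.
      bind_spmf (exec orc (Seq (compile x 1) (compile y 2)) st) (exec orc ?W))"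
    by (rule ext) (simp add: whl_def exec_Seq del: exec.simps)
  \<comment> \<open>The evaluation at the end of the body doubles as the head of a fresh
    \<open>whl\<close>.\<close>
  have W: "exec orc ?W (s1, t1) = exec orc (Seq c (whl b x y c)) (s1, t1 + 1)"
  proof -
    have "exec orc ?W (s1, t1) =
        bind_spmf (exec orc (Seq c (Seq (compile x 1) (compile y 2))) (s1, t1 + 1)) (exec orc ?W)"
      using h 1 by (simp only: exec.simps(13) while_spmf.simps[of _ _ "(s1, t1)"] holds_cmp_test fst_conv snd_conv if_True)
         (simp add: exec_While)
    thus ?thesis unfolding eq exec_Seq[of orc c] by simp
  qed
  have "computes orc (Seq c (whl b x y c)) v (bind_pmf p q) (T1 + T2)"
    by (rule computes_Seq_map[OF c rest])
  hence "rel_spmf (\<lambda>st w. fst st 0 = w \<and> snd st \<le> t1 + 1 + (T1 + T2))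
      (exec orc ?W (s1, t1)) (spmf_of_pmf (bind_pmf p q))"
    unfolding W computes_def using 1 by blast
  thus "rel_spmf (\<lambda>st w. fst st 0 = w \<and> snd st \<le> t + (ecost x + ecost y + 1 + T1 + T2))
     (exec orc (whl b x y c) (s, t)) (spmf_of_pmf (bind_pmf p q))"
    unfolding eq 1(1) using 1(5) by (auto elim!: rel_spmf_mono simp del: exec.simps)
qed


lemma computes_whl_step_det:
  assumes "cmp_holds b (ev x v) (ev y v)"
    and "computes orc c v (return_pmf w) T1"
    and "computes orc (whl b x y c) w q T2"
  shows "computes orc (whl b x y c) v q (ecost x + ecost y + 1 + T1 + T2)"
proof -
  have "computes orc (whl b x y c) v (bind_pmf (return_pmf w) (\<lambda>_. q)) (ecost x + ecost y + 1 + T1 + T2)"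
    by (rule computes_whl_step_map[where \<phi> = "\<lambda>x. x", OF assms(1)]) (use assms in auto)
  thus ?thesis by (simp add: bind_return_pmf)
qed

lemma computes_run:
  assumes "computes orc c v p T"
  shows "map_spmf fst (run orc c v) = spmf_of_pmf p"
    and "\<forall>(w, t)\<in>set_spmf (run orc c v). t \<le> T"
    and "lossless_spmf (run orc c v)"
proof -
  have r: "rel_spmf (\<lambda>(w', t) w. w' = w \<and> t \<le> T) (run orc c v) (spmf_of_pmf p)"
    using computesD[OF assms, of "init_store v" 0] unfolding run_def
    by (simp add: init_store_def spmf_rel_map)
  have "rel_spmf (=) (map_spmf fst (run orc c v)) (spmf_of_pmf p)"
    by (simp add: spmf_rel_map) (rule rel_spmf_mono[OF r], auto)
  thus eq: "map_spmf fst (run orc c v) = spmf_of_pmf p" by (simp add: spmf_rel_eq)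
  have "lossless_spmf (map_spmf fst (run orc c v))" unfolding eq by simp
  thus "lossless_spmf (run orc c v)" by simp
  show "\<forall>(w, t)\<in>set_spmf (run orc c v). t \<le> T"
    using r by (auto elim!: rel_spmfE)
qed

section \<open>Independence of the behaviour from the initial step counter\<close>

lemma shift_Suc:
  fixes g :: "state \<Rightarrow> state spmf"
  assumes f: "\<And>s t. g (s, t) = map_spmf (\<lambda>(s', t'). (s', t' + t)) (g (s, 0))"
   shows "g (s', Suc (t' + t)) =
            map_spmf (\<lambda>(s'', t''). (s'', t'' + t)) (g (s', Suc t'))"
proof -
        have "g (s', t' + Suc t) =
            map_spmf (\<lambda>(s'', t''). (s'', t'' + (t' + Suc t))) (g (s', 0))"
          by (rule f)
        also have "\<dots> = map_spmf (\<lambda>(s'', t''). (s'', t'' + t))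
            (map_spmf (\<lambda>(s'', t''). (s'', t'' + (t' + 1))) (g (s', 0)))"
          by (simp add: spmf.map_comp o_def case_prod_unfold add.assoc)
        also have "map_spmf (\<lambda>(s'', t''). (s'', t'' + (t' + 1))) (g (s', 0)) = g (s', t' + 1)"
          by (rule f[symmetric])
        finally show ?thesis by simp
qed

lemma shift_bind:
  fixes g h :: "state \<Rightarrow> state spmf"
  assumes f: "\<And>s t. g (s, t) = map_spmf (\<lambda>(s', t'). (s', t' + t)) (g (s, 0))"
  assumes h: "\<And>s t. h (s, t) = map_spmf (\<lambda>(s', t'). (s', t' + t)) (h (s, 0))"
  shows "bind_spmf (h (s, t + 1)) g =
          map_spmf (\<lambda>(s', t'). (s', t' + t)) (bind_spmf (h (s, 1)) g)"
  apply (subst h)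
  apply (subst (2) h)
  apply (simp only: bind_map_spmf map_spmf_bind_spmf o_def)
  apply (rule bind_spmf_cong[OF refl])
  apply (simp add: case_prod_unfold)
  subgoal using shift_Suc[of g, OF f]  by (simp add: case_prod_unfold)
 done

text \<open>Programs never read the step counter. This is needed because \<open>run\<close> starts
  it at 0, whereas a called program starts at the current count. Loops are treated by fixpoint
  induction, as termination is not assumed.\<close>

lemma exec_shift:
  "exec orc c (s, t) = map_spmf (\<lambda>(s', t'). (s', t' + t)) (exec orc c (s, 0))"
proof (induction c arbitrary: s t)
  case (Random x y)
  show ?case by (simp add: pmf.map_comp o_def)
next
  case (Seq c d)
  have "exec orc (Seq c d) (s, t) = bind_spmf (exec orc c (s, 0)) (\<lambda>(s', t'). exec orc d (s', t' + t))"
    by (simp add: Seq.IH(1)[of s t] bind_map_spmf o_def case_prod_unfold)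
  also have "\<dots> = bind_spmf (exec orc c (s, 0)) (\<lambda>(s', t'). map_spmf (\<lambda>(s'', t''). (s'', t'' + t)) (exec orc d (s', t')))"
  proof (intro bind_spmf_cong refl, clarsimp)
    fix s' and t' :: nat
    have "exec orc d (s', t' + t) = map_spmf (\<lambda>(s'', t''). (s'', t'' + (t' + t))) (exec orc d (s', 0))"
      by (rule Seq.IH(2))
    also have "\<dots> = map_spmf (\<lambda>(s'', t''). (s'', t'' + t))
        (map_spmf (\<lambda>(s'', t''). (s'', t'' + t')) (exec orc d (s', 0)))"
      by (simp add: spmf.map_comp o_def case_prod_unfold add.assoc)
    also have "map_spmf (\<lambda>(s'', t''). (s'', t'' + t')) (exec orc d (s', 0)) = exec orc d (s', t')"
      by (rule Seq.IH(2)[symmetric])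
    finally show "exec orc d (s', t' + t) = map_spmf (\<lambda>(s'', t''). (s'', t'' + t)) (exec orc d (s', t'))" .
  qed
  finally show ?case by (simp add: map_spmf_bind_spmf o_def case_prod_unfold)
next
  case (Cond b c d)
  have *: "exec orc c' (s, t + 1) = map_spmf (\<lambda>(s', t'). (s', t' + t)) (exec orc c' (s, 1))"
    if "\<And>s t. exec orc c' (s, t) = map_spmf (\<lambda>(s', t'). (s', t' + t)) (exec orc c' (s, 0))" for c'
    by (subst that, subst (2) that) (simp add: spmf.map_comp o_def case_prod_unfold)
  show ?case using *[OF Cond.IH(1)] *[OF Cond.IH(2)] by simp
next
  case (Call x c y)
  have "exec orc c (init_store (s y), t + 1) =
      map_spmf (\<lambda>(s', t'). (s', t' + t)) (exec orc c (init_store (s y), 1))"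
    by (subst Call.IH, subst (2) Call.IH) (simp add: spmf.map_comp o_def case_prod_unfold)
  thus ?case by (simp add: spmf.map_comp o_def case_prod_unfold)
next
  case (While b c)
  have step: "exec orc c (s, t) = map_spmf (\<lambda>(s', t'). (s', t' + t)) (exec orc c (s, 0))" for s t
    by (rule While.IH)
  have *: "\<forall>s t. while_spmf b (exec orc c) (s, t) =
      map_spmf (\<lambda>(s', t'). (s', t' + t)) (while_spmf b (exec orc c) (s, 0))"
  proof (rule while_spmf.fixp_induct[where P = "\<lambda>w. \<forall>s t. w b (exec orc c) (s, t) =
      map_spmf (\<lambda>(s', t'). (s', t' + t)) (w b (exec orc c) (s, 0))"], goal_cases)
    case 1
    show ?case by (simp add: cont_intro)
  next
    case 2
    show ?case by simp
  next
    case (3 f)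
    have f: "f b (exec orc c) (s, t) = map_spmf (\<lambda>(s', t'). (s', t' + t)) (f b (exec orc c) (s, 0))" for s t
      by (rule 3[rule_format])
    show ?case
    proof (intro allI)
      fix s :: store and t :: nat
      have m: "map_spmf h (return_spmf x) = return_spmf (h x)" for h :: "state \<Rightarrow> state" and x by simp
      note ** = shift_bind[of "f b (exec orc c)" "exec orc c" s t, OF f step]
      show "(if holds b (fst (s, t)) then bind_spmf (exec orc c (fst (s, t), snd (s, t) + 1)) (f b (exec orc c))
           else return_spmf (fst (s, t), snd (s, t) + 1)) =
        map_spmf (\<lambda>(s', t'). (s', t' + t))
          (if holds b (fst (s, 0)) then bind_spmf (exec orc c (fst (s, 0), snd (s, 0) + 1)) (f b (exec orc c))
           else return_spmf (fst (s, 0), snd (s, 0) + 1))"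
        by (cases "holds b s") (simp_all only: fst_conv snd_conv if_True if_False ** add_0 m
          prod.case add.commute[of 1 t])
    qed
  qed
  show ?case unfolding exec.simps by (rule *[rule_format])
qed auto

text \<open>The entry point for the given SAT algorithm: what \<open>sat_algorithm\<close> says
  about its runs becomes a judgement usable in \<open>computes_call_init\<close>.\<close>

lemma computes_init_run:
  assumes "map_spmf fst (run orc c v) = spmf_of_pmf p"
    and "\<forall>(w, t)\<in>set_spmf (run orc c v). t \<le> T"
  shows "computes_init orc c v p T"
  unfolding computes_init_def
proof
  fix t
  let ?E = "exec orc c (init_store v, 0)"
  have eq: "map_spmf fst (run orc c v) = map_spmf (\<lambda>st. fst st 0) ?E"
    by (simp add: run_def spmf.map_comp o_def)
  have "rel_spmf (\<lambda>st w. fst st 0 = w) ?E (map_spmf (\<lambda>st. fst st 0) ?E)"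
    unfolding spmf_rel_map by (rule rel_spmf_reflI) simp
  hence "rel_spmf (\<lambda>st w. fst st 0 = w) ?E (spmf_of_pmf p)"
    unfolding eq[symmetric] assms(1) .
  hence *: "rel_spmf (\<lambda>st w. fst st 0 = w \<and> snd st \<le> T) ?E (spmf_of_pmf p)"
  proof (rule rel_spmf_mono_strong)
    fix st w assume "fst st 0 = w" "st \<in> set_spmf ?E"
    hence "(w, snd st) \<in> set_spmf (run orc c v)" by (force simp: run_def)
    with assms(2) \<open>fst st 0 = w\<close> show "fst st 0 = w \<and> snd st \<le> T" by blast
  qed
  show "rel_spmf (\<lambda>st w. fst st 0 = w \<and> snd st \<le> t + T) (exec orc c (init_store v, t)) (spmf_of_pmf p)"
    by (subst exec_shift, simp only: spmf_rel_map, rule rel_spmf_mono[OF *]) clarsimp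
qed

subsection \<open>Loops\<close>

primrec mfold :: "('x \<Rightarrow> 'a \<Rightarrow> 'a pmf) \<Rightarrow> 'x list \<Rightarrow> 'a \<Rightarrow> 'a pmf" where
  "mfold g [] a = return_pmf a"
| "mfold g (x # xs) a = bind_pmf (g x a) (mfold g xs)"

lemma mfold_return: "mfold (\<lambda>x a. return_pmf (g x a)) xs a = return_pmf (fold g xs a)"
  by (induction xs arbitrary: a) (auto simp: bind_return_pmf)

lemma mfold_invariant:
  assumes "a' \<in> set_pmf (mfold g xs a)" "I xs a"
    and "\<And>z zs a a'. I (z # zs) a \<Longrightarrow> a' \<in> set_pmf (g z a) \<Longrightarrow> I zs a'"
  shows "I [] a'"
  using assms(1,2) by (induction xs arbitrary: a) (auto dest: assms(3))

text \<open>The list \<open>zs\<close> of remaining iterations is a ghost variable: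
  \<open>\<phi>\<close> may store it, its length, or something determined by it, as long as the loop
  test recognises emptiness. The additional iteration in the time bound pays for the final
  test.\<close>

lemma computes_for:
  assumes stop: "\<And>a. I [] a \<Longrightarrow> \<not> cmp_holds b (ev x (\<phi> [] a)) (ev y (\<phi> [] a))"
    and go: "\<And>z zs a. I (z # zs) a \<Longrightarrow> cmp_holds b (ev x (\<phi> (z # zs) a)) (ev y (\<phi> (z # zs) a))"
    and body: "\<And>z zs a. I (z # zs) a \<Longrightarrow> computes orc c (\<phi> (z # zs) a) (map_pmf (\<phi> zs) (g z a)) T"
    and inv: "\<And>z zs a a'. I (z # zs) a \<Longrightarrow> a' \<in> set_pmf (g z a) \<Longrightarrow> I zs a'"
    and I: "I zs a"
  shows "computes orc (whl b x y c) (\<phi> zs a) (map_pmf (\<phi> []) (mfold g zs a))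
           ((length zs + 1) * (ecost x + ecost y + 1 + T))"
  using I
proof (induction zs arbitrary: a)
  case Nil
  show ?case using computes_whl_stop[OF stop[OF Nil], of orc c]
    by (auto elim!: computes_mono)
next
  case (Cons z zs)
  show ?case
    by (rule computes_cong, rule computes_whl_step_map[OF go[OF Cons.prems] body[OF Cons.prems]])
      (auto intro: Cons.IH inv[OF Cons.prems] simp: map_bind_pmf)
qed

lemma computes_for_le:
  assumes "\<And>a. I [] a \<Longrightarrow> \<not> cmp_holds b (ev x (\<phi> [] a)) (ev y (\<phi> [] a))"
    and "\<And>z zs a. I (z # zs) a \<Longrightarrow> cmp_holds b (ev x (\<phi> (z # zs) a)) (ev y (\<phi> (z # zs) a))"
    and "\<And>z zs a. I (z # zs) a \<Longrightarrow> computes orc c (\<phi> (z # zs) a) (map_pmf (\<phi> zs) (g z a)) T"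
    and "\<And>z zs a a'. I (z # zs) a \<Longrightarrow> a' \<in> set_pmf (g z a) \<Longrightarrow> I zs a'"
    and "I zs a"
    and "ecost x + ecost y + 1 + T \<le> K"
  shows "computes orc (whl b x y c) (\<phi> zs a) (map_pmf (\<phi> []) (mfold g zs a)) ((length zs + 1) * K)"
  by (rule computes_mono, rule computes_for[where I = I, OF assms(1-5)], assumption+, rule mult_le_mono2, fact assms(6))

lemma computes_for_det:
  assumes stop: "\<And>a. I [] a \<Longrightarrow> \<not> cmp_holds b (ev x (\<phi> [] a)) (ev y (\<phi> [] a))"
    and go: "\<And>z zs a. I (z # zs) a \<Longrightarrow> cmp_holds b (ev x (\<phi> (z # zs) a)) (ev y (\<phi> (z # zs) a))"
    and body: "\<And>z zs a. I (z # zs) a \<Longrightarrow> computes orc c (\<phi> (z # zs) a) (return_pmf (\<phi> zs (g z a))) T"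
    and inv: "\<And>z zs a. I (z # zs) a \<Longrightarrow> I zs (g z a)"
    and I: "I zs a"
    and K: "ecost x + ecost y + 1 + T \<le> K"
  shows "computes orc (whl b x y c) (\<phi> zs a) (return_pmf (\<phi> [] (fold g zs a))) ((length zs + 1) * K)"
proof -
  have "computes orc (whl b x y c) (\<phi> zs a) (map_pmf (\<phi> []) (mfold (\<lambda>z a. return_pmf (g z a)) zs a))
           ((length zs + 1) * K)"
    by (rule computes_for_le[where I = I]) (use assms in auto)
  thus ?thesis by (simp add: mfold_return)
qed

lemma computes_for_asn:
  assumes "\<And>a. \<not> cmp_holds b (ev x (\<phi> [] a)) (ev y (\<phi> [] a))"
    and "\<And>z zs a. cmp_holds b (ev x (\<phi> (z # zs) a)) (ev y (\<phi> (z # zs) a))"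
    and "\<And>z zs a. ev e (\<phi> (z # zs) a) = \<phi> zs (g z a)"
    and K: "ecost x + ecost y + ecost e + 2 \<le> K"
  shows "computes orc (whl b x y (asn e)) (\<phi> zs a) (return_pmf (\<phi> [] (fold g zs a)))
           ((length zs + 1) * K)"
proof (rule computes_for_det[where I = "\<lambda>_ _. True"])
  show "computes orc (asn e) (\<phi> (z # zs) a) (return_pmf (\<phi> zs (g z a))) (ecost e + 1)" for z zs a
    unfolding assms(3)[symmetric] by (rule computes_asn)
qed (use assms in auto)

subsection \<open>Encoded formulas\<close>

definition enc_clause :: "literal list \<Rightarrow> val" where
  "enc_clause C = enc_list (map enc_literal C)"

definition enc_clauses :: "cnf \<Rightarrow> val" where
  "enc_clauses F = enc_list (map enc_clause F)"

lemma enc_cnf_eq: "enc_cnf n F = Pair (Num n) (enc_clauses F)"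
  by (simp add: enc_cnf_def enc_clauses_def enc_clause_def[abs_def])

lemma enc_clause_simps [simp]:
  "enc_clause [] = Num 0" "enc_clause (l # C) = Pair (enc_literal l) (enc_clause C)"
  by (simp_all add: enc_clause_def)

lemma enc_clauses_simps [simp]:
  "enc_clauses [] = Num 0" "enc_clauses (C # F) = Pair (enc_clause C) (enc_clauses F)"
  by (simp_all add: enc_clauses_def)

lemma enc_bool_simps [simp]: "enc_bool True = Num 1" "enc_bool False = Num 0"
  by (simp_all add: enc_bool_def)

lemma enc_literal_simp [simp]: "enc_literal (i, b) = Pair (Num i) (enc_bool b)"
  by (simp add: enc_literal_def)

lemma enc_bool_eq_iff [simp]: "enc_bool a = enc_bool b \<longleftrightarrow> a = b"
  by (simp add: enc_bool_def)

lemma enc_literal_eq_iff [simp]: "enc_literal l = enc_literal m \<longleftrightarrow> l = m"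
  by (cases l; cases m) simp

lemma enc_clause_eq_iff [simp]: "enc_clause C = enc_clause D \<longleftrightarrow> C = D"
proof (induction C arbitrary: D)
  case Nil
  show ?case by (cases D) auto
next
  case (Cons l C)
  thus ?case by (cases D) simp_all
qed

lemma enc_clauses_eq_iff [simp]: "enc_clauses F = enc_clauses G \<longleftrightarrow> F = G"
proof (induction F arbitrary: G)
  case Nil
  show ?case by (cases G) auto
next
  case (Cons C F)
  thus ?case by (cases G) simp_all
qed

lemma eq_val_enc_bool [simp]: "eq_val (enc_bool b) (Num 0) \<longleftrightarrow> \<not> b"
  by (simp add: enc_bool_def)

text \<open>The oracle speaks of some formula with the given encoding; injectivity of the encoding
  makes it the intended one.\<close>

lemma sat_oracle_enc_cnf: "cnf_over n F \<Longrightarrow> sat_oracle (enc_cnf n F) = enc_bool (satisfiable n F)"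
  by (auto simp: sat_oracle_def enc_cnf_eq)

lemma val_size_enc_clause: "val_size (enc_clause C) = 1 + 4 * length C"
  by (induction C) (auto simp: enc_bool_def split: if_splits)

lemma val_size_enc_cnf: "val_size (enc_cnf n F) \<le> 3 + 4 * cnf_size n F"
proof -
  have "val_size (enc_clauses F) \<le> 1 + 4 * (\<Sum>C\<leftarrow>F. 1 + length C)"
    by (induction F) (auto simp: val_size_enc_clause)
  thus ?thesis by (simp add: enc_cnf_eq cnf_size_def)
qed

lemma cnf_over_simps [simp]:
  "cnf_over n []" "cnf_over n (C # F) \<longleftrightarrow> (\<forall>l\<in>set C. fst l < n) \<and> cnf_over n F"
  "cnf_over n (F @ G) \<longleftrightarrow> cnf_over n F \<and> cnf_over n G"
  by (auto simp: cnf_over_def)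

subsection \<open>Encoding parity constraints\<close>

text \<open>Counts with multiplicity, so that repeated indices cancel in pairs. Lists with
  repetitions do occur in the first part, where indices are drawn with replacement.\<close>

definition lparity :: "nat list \<Rightarrow> bool list \<Rightarrow> bool" where
  "lparity js x \<longleftrightarrow> odd (\<Sum>j\<leftarrow>js. of_bool (x ! j) :: nat)"

lemma lparity_simps [simp]:
  "\<not> lparity [] x" "lparity (j # js) x \<longleftrightarrow> (lparity js x \<noteq> x ! j)"
  by (auto simp: lparity_def)

lemma lparity_eq_parity: "distinct js \<Longrightarrow> lparity js x = parity (set js) x"
  by (simp add: lparity_def parity_def sum_list_distinct_conv_sum_set)

text \<open>A partial clause excludes an assignment to the variables that are already treated. It carries
  the sum of that assignment and the required parity.\<close>

definition extend_clauses :: "nat \<Rightarrow> (bool \<times> literal list) list \<Rightarrow> (bool \<times> literal list) list" where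
  "extend_clauses v L =
     fold (\<lambda>(f, C) L'. (f, (v, True) # C) # (\<not> f, (v, False) # C) # L') L []"

text \<open>The flag starts as \<open>b\<close> and flips with every variable that the excluded
  assignment sets to 1. In the end it is set exactly when that assignment has the wrong parity, and
  only then the clause is kept.\<close>

definition parity_clauses :: "nat list \<Rightarrow> bool \<Rightarrow> cnf \<Rightarrow> cnf" where
  "parity_clauses vs b F =
     fold (\<lambda>(f, C) G. if f then C # G else G) (fold extend_clauses vs [(b, [])]) F"

definition clause_holds :: "bool list \<Rightarrow> literal list \<Rightarrow> bool" where
  "clause_holds x C \<longleftrightarrow> (\<exists>(i, b)\<in>set C. x ! i = b)"

lemma clause_holds_Cons [simp]: "clause_holds x ((i, b) # C) \<longleftrightarrow> x ! i = b \<or> clause_holds x C"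
  "\<not> clause_holds x []"
  by (auto simp: clause_holds_def)

lemma satisfies_Cons: "satisfies x (C # F) \<longleftrightarrow> clause_holds x C \<and> satisfies x F"
  by (auto simp: satisfies_def clause_holds_def)

lemma extend_clauses_eq:
  "extend_clauses v L = concat (map (\<lambda>z. [(fst z, (v, True) # snd z), (\<not> fst z, (v, False) # snd z)]) (rev L))"
proof -
  have "fold (\<lambda>(f, C) L'. (f, (v, True) # C) # (\<not> f, (v, False) # C) # L') L M =
      concat (map (\<lambda>z. [(fst z, (v, True) # snd z), (\<not> fst z, (v, False) # snd z)]) (rev L)) @ M" for M
    by (induction L arbitrary: M) (simp_all add: split_beta)
  thus ?thesis by (simp add: extend_clauses_def)
qed

lemma length_extend_clauses: "length (extend_clauses v L) = 2 * length L"
  by (induction L) (simp_all add: extend_clauses_eq)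

lemma length_fold_extend_clauses: "length (fold extend_clauses vs L) = 2 ^ length vs * length L"
  by (induction vs arbitrary: L) (auto simp: length_extend_clauses)

text \<open>Of the two extensions of a clause by \<open>v\<close>, one is satisfied through its new
  literal; the other reduces to the old clause, with the flag changed according to
  \<open>x ! v\<close>. The arbitrary start list \<open>L\<close> is what the induction
  needs.\<close>

lemma fold_extend_clauses_holds:
  "(\<forall>(f, C)\<in>set (fold extend_clauses vs L). f \<longrightarrow> clause_holds x C) \<longleftrightarrow>
   (\<forall>(f, C)\<in>set L. f \<noteq> lparity vs x \<longrightarrow> clause_holds x C)"
proof (induction vs arbitrary: L)
  case Nil
  show ?case by (simp add: split_beta)
next
  case (Cons v vs)
  have *: "(\<forall>y\<in>set (extend_clauses v L). Q y) \<longleftrightarrow>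
      (\<forall>z\<in>set L. Q (fst z, (v, True) # snd z) \<and> Q (\<not> fst z, (v, False) # snd z))" for Q
    by (simp add: extend_clauses_eq)
  have "((fst z \<noteq> lparity vs x \<longrightarrow> clause_holds x ((v, True) # snd z)) \<and>
         ((\<not> fst z) \<noteq> lparity vs x \<longrightarrow> clause_holds x ((v, False) # snd z))) \<longleftrightarrow>
        (fst z \<noteq> lparity (v # vs) x \<longrightarrow> clause_holds x (snd z))" for z
    by (cases "x ! v"; cases "fst z"; cases "lparity vs x") simp_all
  thus ?case using Cons.IH[of "extend_clauses v L"] unfolding * by (simp add: split_beta del: lparity_simps clause_holds_Cons)
qed

lemma fold_extend_clauses_vars:
  assumes "(f, C) \<in> set (fold extend_clauses vs L)" "\<forall>(f, C)\<in>set L. length C \<le> m \<and> fst ` set C \<subseteq> V"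
  shows "length C \<le> length vs + m \<and> fst ` set C \<subseteq> set vs \<union> V"
  using assms
proof (induction vs arbitrary: L m V)
  case Nil
  thus ?case by force
next
  case (Cons v vs)
  have "\<forall>z\<in>set L. length (snd z) \<le> m \<and> fst ` set (snd z) \<subseteq> V"
    using Cons.prems(2) by (simp add: split_beta)
  hence "\<forall>z\<in>set (extend_clauses v L). length (snd z) \<le> Suc m \<and> fst ` set (snd z) \<subseteq> insert v V"
    by (auto simp: extend_clauses_eq)
  hence "length C \<le> length vs + Suc m \<and> fst ` set C \<subseteq> set vs \<union> insert v V"
    using Cons.IH[of "extend_clauses v L" "Suc m" "insert v V"] Cons.prems(1) by (simp add: split_beta)
  thus ?case by auto
qed

lemma fold_filter_clauses:
  "fold (\<lambda>(f, C) G. if f then C # G else G) L F = rev (map snd (filter fst L)) @ F"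
  by (induction L arbitrary: F) auto

lemma satisfies_parity_clauses:
  "satisfies x (parity_clauses vs b F) \<longleftrightarrow> lparity vs x = b \<and> satisfies x F"
proof -
  have "(\<forall>(f, C)\<in>set L. f \<longrightarrow> clause_holds x C) \<longleftrightarrow> satisfies x (rev (map snd (filter fst L)))" for L
    by (force simp: satisfies_def clause_holds_def)
  from this[of "fold extend_clauses vs [(b, [])]"] show ?thesis
    unfolding fold_extend_clauses_holds
    by (auto simp: parity_clauses_def fold_filter_clauses satisfies_append)
qed

lemma cnf_over_parity_clauses:
  assumes "set vs \<subseteq> {..<n}" "cnf_over n F"
  shows "cnf_over n (parity_clauses vs b F)"
proof -
  let ?L = "fold extend_clauses vs [(b, [])]"
  have vars: "fst ` set C \<subseteq> {..<n}" if "(f, C) \<in> set ?L" for f C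
    using fold_extend_clauses_vars[OF that, of 0 "{}"] assms(1) by auto
  have eq: "parity_clauses vs b F = rev (map snd (filter fst ?L)) @ F"
    by (simp add: parity_clauses_def fold_filter_clauses)
  have over: "\<forall>(i, c)\<in>set C. i < n" if "fst ` set C \<subseteq> {..<n}" for C :: "literal list"
  proof (clarify)
    fix i c assume "(i, c) \<in> set C"
    hence "fst (i, c) \<in> fst ` set C" by (rule imageI)
    hence "fst (i, c) \<in> {..<n}" by (rule subsetD[OF that])
    thus "i < n" by simp
  qed
  show ?thesis unfolding eq cnf_over_def set_append
  proof (rule ballI, elim UnE)
    fix C assume "C \<in> set (rev (map snd (filter fst ?L)))"
    hence "C \<in> snd ` set ?L" unfolding set_rev set_map set_filter by blast
    then obtain p where p: "C = snd p" "p \<in> set ?L" by (rule imageE)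
    have "(fst p, C) \<in> set ?L" unfolding p(1) prod.collapse by (rule p(2))
    thus "\<forall>(i, c)\<in>set C. i < n" by (intro over vars)
  next
    fix C assume "C \<in> set F"
    thus "\<forall>(i, c)\<in>set C. i < n" using assms(2) unfolding cnf_over_def by (elim bspec[rotated])
  qed
qed

lemma cnf_size_parity_clauses:
  "cnf_size n (parity_clauses vs b F) \<le> cnf_size n F + 2 ^ length vs * (1 + length vs)"
proof -
  define L where "L = fold extend_clauses vs [(b, [])]"
  have len: "length C \<le> length vs" if "(f, C) \<in> set L" for f C
    using fold_extend_clauses_vars[of f C vs "[(b, [])]" 0 "{}"] that by (auto simp: L_def)
  have "(\<Sum>C\<leftarrow>map snd (filter fst M). 1 + length C) \<le> length M * (1 + length vs)" if "set M \<subseteq> set L" for M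
    using that
  proof (induction M)
    case (Cons y M)
    obtain f C where y: "y = (f, C)" by force
    have "length C \<le> length vs" using Cons.prems len by (auto simp: y)
    thus ?case using Cons by (simp add: y)
  qed simp
  from this[of L] have "(\<Sum>C\<leftarrow>map snd (filter fst L). 1 + length C) \<le> length L * (1 + length vs)" by simp
  moreover have "length L = 2 ^ length vs" by (simp add: L_def length_fold_extend_clauses)
  moreover have "(\<Sum>C\<leftarrow>rev (map snd (filter fst L)). 1 + length C) = (\<Sum>C\<leftarrow>map snd (filter fst L). 1 + length C)"
    by (simp only: rev_map[symmetric] sum_list_rev)
  moreover have "cnf_size n (parity_clauses vs b F) = cnf_size n F + (\<Sum>C\<leftarrow>rev (map snd (filter fst L)). 1 + length C)"
    by (simp only: parity_clauses_def fold_filter_clauses L_def[symmetric] cnf_size_def map_append sum_list.append)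
  ultimately show ?thesis by simp
qed

text \<open>States are nested pairs: \<open>e0\<close>, \<open>e1\<close>, ... select the entries of
  the tuple, and \<open>r1\<close>, \<open>r2\<close>, ... are what remains after dropping that many
  entries.\<close>

abbreviation "r1 \<equiv> ESnd EV"
abbreviation "r2 \<equiv> ESnd r1"
abbreviation "r3 \<equiv> ESnd r2"
abbreviation "r4 \<equiv> ESnd r3"
abbreviation "r5 \<equiv> ESnd r4"
abbreviation "r6 \<equiv> ESnd r5"
abbreviation "e0 \<equiv> EFst EV"
abbreviation "e1 \<equiv> EFst r1"
abbreviation "e2 \<equiv> EFst r2"
abbreviation "e3 \<equiv> EFst r3"
abbreviation "e4 \<equiv> EFst r4"
abbreviation "e5 \<equiv> EFst r5"
abbreviation "e6 \<equiv> EFst r6"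
abbreviation "ifz e a b \<equiv> EIf CEq e (EN 0) a b"

definition enc_partial :: "(bool \<times> literal list) list \<Rightarrow> val" where
  "enc_partial L = enc_list (map (\<lambda>(f, C). Pair (enc_bool f) (enc_clause C)) L)"

lemma enc_partial_simps [simp]:
  "enc_partial [] = Num 0"
  "enc_partial (z # L) = Pair (Pair (enc_bool (fst z)) (enc_clause (snd z))) (enc_partial L)"
  by (simp_all add: enc_partial_def split_beta)

definition prog_extend :: com where
  "prog_extend = whl CPair e0 EV (asn
     (EP (ESnd e0) (EP
        (EP (EP (EFst (EFst e0)) (EP (EP e2 (EN 1)) (ESnd (EFst e0))))
        (EP (EP (ifz (EFst (EFst e0)) (EN 1) (EN 0)) (EP (EP e2 (EN 0)) (ESnd (EFst e0)))) e1)) r2)))"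

lemma computes_extend:
  "computes orc prog_extend (Pair (enc_partial L) (Pair (Num 0) (Pair (Num v) w)))
     (return_pmf (Pair (Num 0) (Pair (enc_partial (extend_clauses v L)) (Pair (Num v) w)))) ((length L + 1) * 100)"
proof -
  have "computes orc prog_extend (Pair (enc_partial L) (Pair (enc_partial []) (Pair (Num v) w)))
     (return_pmf (Pair (enc_partial []) (Pair (enc_partial (extend_clauses v L)) (Pair (Num v) w)))) ((length L + 1) * 100)"
    unfolding prog_extend_def extend_clauses_def
  proof (rule computes_for_asn[where zs = L and a = "[]" and
       \<phi> = "\<lambda>L L'. Pair (enc_partial L) (Pair (enc_partial L') (Pair (Num v) w))"
       and g = "\<lambda>(f, C) L'. (f, (v, True) # C) # (\<not> f, (v, False) # C) # L'"], goal_cases)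
    case (3 z zs a)
    show ?case by (cases z) simp
  qed simp_all
  thus ?thesis by simp
qed

definition prog_parity :: com where
  "prog_parity =
     Seq (asn (EP e0 (EP (EP (EP e1 (EN 0)) (EN 0)) r2)))
    (Seq (whl CPair e0 EV
       (Seq (asn (EP e1 (EP (EN 0) (EP (EFst e0) (EP (ESnd e0) r2)))))
       (Seq prog_extend
            (asn (EP e3 (EP e1 r4))))))
    (Seq (asn r1)
    (Seq (whl CPair e0 EV
       (asn (EP (ESnd e0) (ifz (EFst (EFst e0)) r1 (EP (ESnd (EFst e0)) r1)))))
    (asn r1))))"

lemma computes_parity:
  "computes orc prog_parity (Pair (enc_list (map Num vs)) (Pair (enc_bool b) (enc_clauses F)))
     (return_pmf (enc_clauses (parity_clauses vs b F))) (1000 * ((length vs + 1) * 2 ^ length vs))"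
proof -
  let ?L = "fold extend_clauses vs [(b, [])]"
  have K1: "1 \<le> (2 :: nat) ^ length vs" by simp
  have 1: "computes orc (whl CPair e0 EV
       (Seq (asn (EP e1 (EP (EN 0) (EP (EFst e0) (EP (ESnd e0) r2)))))
       (Seq prog_extend
            (asn (EP e3 (EP e1 r4)))))) (Pair (enc_list (map Num vs)) (Pair (enc_partial [(b, [])]) (enc_clauses F)))
     (return_pmf (Pair (enc_list (map Num [])) (Pair (enc_partial ?L) (enc_clauses F))))
     ((length vs + 1) * (300 * 2 ^ length vs))"
  \<comment> \<open>The number of partial clauses doubles with each variable; the invariant keeps it
    below 2^(length vs), which bounds the inner loop uniformly.\<close>
  proof (rule computes_for_det[where I = "\<lambda>us L. length L * 2 ^ length us = 2 ^ length vs" and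
      \<phi> = "\<lambda>us L. Pair (enc_list (map Num us)) (Pair (enc_partial L) (enc_clauses F))"])
    fix z :: nat and zs :: "nat list" and L :: "(bool \<times> literal list) list" assume "length L * 2 ^ length (z # zs) = (2 :: nat) ^ length vs"
    hence "2 * length L * 2 ^ length zs \<le> 2 ^ length vs" by simp
    moreover have "length L * 1 \<le> length L * 2 ^ length zs" by (rule mult_le_mono2) simp
    ultimately have "2 * length L \<le> 2 ^ length vs" by linarith
    have "(1::nat) \<le> 2 ^ length vs" by simp
    from this \<open>2 * length L \<le> 2 ^ length vs\<close> have len: "100 * (length L + 1) \<le> 50 + 100 * (2 :: nat) ^ length vs"
    proof -
      have "100 * (l + 1) \<le> 50 + 100 * K" if "1 \<le> K" "2 * l \<le> K" for l K :: nat
        using that by simp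
      from this[OF \<open>1 \<le> 2 ^ length vs\<close> \<open>2 * length L \<le> 2 ^ length vs\<close>] show ?thesis .
    qed
    show "computes orc (Seq (asn (EP e1 (EP (EN 0) (EP (EFst e0) (EP (ESnd e0) r2)))))
       (Seq prog_extend
            (asn (EP e3 (EP e1 r4))))) (Pair (enc_list (map Num (z # zs))) (Pair (enc_partial L) (enc_clauses F)))
       (return_pmf (Pair (enc_list (map Num zs)) (Pair (enc_partial (extend_clauses z L)) (enc_clauses F))))
       (100 + 100 * 2 ^ length vs)"
      by (rule computes_mono, rule computes_Seq_det[OF computes_asn], simp,
          rule computes_Seq_det[OF computes_extend], rule computes_cong[OF computes_asn])
        (use len in auto)
  qed (simp_all add: length_extend_clauses, use K1 in linarith)
  have 2: "computes orc (whl CPair e0 EV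
       (asn (EP (ESnd e0) (ifz (EFst (EFst e0)) r1 (EP (ESnd (EFst e0)) r1)))))
     (Pair (enc_partial ?L) (enc_clauses F)) (return_pmf (Pair (enc_partial []) (enc_clauses (parity_clauses vs b F))))
     ((length ?L + 1) * 50)"
    unfolding parity_clauses_def
  proof (rule computes_for_asn[where zs = ?L and a = F and
       \<phi> = "\<lambda>L G. Pair (enc_partial L) (enc_clauses G)"
       and g = "\<lambda>(f, C) G. if f then C # G else G"], goal_cases)
    case (3 z zs a)
    show ?case by (cases z) simp
  qed simp_all
  define N where "N = length vs"
  define K where "K = (2 :: nat) ^ length vs"
  have K: "1 \<le> K" "N * 1 \<le> N * K" by (simp_all add: K_def)
  have len: "length ?L = K" by (simp add: length_fold_extend_clauses K_def)
  have "computes orc prog_parity (Pair (enc_list (map Num vs)) (Pair (enc_bool b) (enc_clauses F)))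
     (return_pmf (enc_clauses (parity_clauses vs b F)))
     (50 + ((N + 1) * (300 * K) + (50 + ((K + 1) * 50 + 50))))"
    unfolding prog_parity_def
    apply (rule computes_mono)
     apply (rule computes_Seq_det[OF computes_asn])
     apply (simp only: ev.simps fst_val.simps snd_val.simps)
     apply (rule computes_Seq_det[OF 1[unfolded K_def[symmetric], unfolded N_def[symmetric] enc_partial_simps fst_conv snd_conv enc_clause_simps]])
     apply (rule computes_Seq_det[OF computes_asn])
     apply (simp only: ev.simps fst_val.simps snd_val.simps)
     apply (rule computes_Seq_det[OF 2[unfolded len]])
     apply (rule computes_cong[OF computes_asn])
      apply simp
     apply (rule order_refl)
    apply simp
    done
  thus ?thesis
  proof (rule computes_mono)
    show "50 + ((N + 1) * (300 * K) + (50 + ((K + 1) * 50 + 50))) \<le> 1000 * ((length vs + 1) * 2 ^ length vs)"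
      using K unfolding K_def[symmetric] unfolding N_def[symmetric] by (simp add: algebra_simps)
  qed
qed

subsection \<open>Majority votes\<close>

lemma pmf_bool_False: "pmf p False = 1 - pmf p True"
  using sum_pmf_eq_1[OF finite subset_UNIV, of p] unfolding UNIV_bool by simp

lemma bernoulli_pmf_True: "bernoulli_pmf (pmf p True) = p"
proof (rule pmf_eqI)
  show "pmf (bernoulli_pmf (pmf p True)) b = pmf p b" for b
    by (cases b) (simp_all add: pmf_le_1 pmf_bool_False)
qed

lemma count_list_True: "count_list rs True = length (filter id rs)"
  by (induction rs) auto

lemma prob_count_list:
  "measure_pmf.prob (replicate_pmf m p) {rs. t < count_list rs True} =
     (\<Sum>j\<in>{t<..m}. real (m choose j) * pmf p True ^ j * (1 - pmf p True) ^ (m - j))"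
proof -
  have r: "pmf p True \<in> {0..1}" by (simp add: pmf_le_1)
  have "map_pmf (\<lambda>rs. count_list rs True) (replicate_pmf m p) = binomial_pmf m (pmf p True)"
    unfolding binomial_pmf_altdef[OF r] bernoulli_pmf_True by (simp add: count_list_True[abs_def] o_def)
  hence "measure_pmf.prob (replicate_pmf m p) {rs. t < count_list rs True} =
      measure_pmf.prob (binomial_pmf m (pmf p True)) {t<..}"
    by (simp flip: \<open>map_pmf _ _ = _\<close> add: vimage_def greaterThan_def)
  also have "\<dots> = measure_pmf.prob (binomial_pmf m (pmf p True)) {t<..m}"
  proof (rule measure_prob_cong_0)
    fix j assume "j \<in> {t<..} - {t<..m}"
    hence "m < j" by auto
    thus "pmf (binomial_pmf m (pmf p True)) j = 0" using r by (simp add: pmf_binomial binomial_eq_0)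
  qed auto
  also have "\<dots> = (\<Sum>j\<in>{t<..m}. real (m choose j) * pmf p True ^ j * (1 - pmf p True) ^ (m - j))"
    using r by (subst measure_measure_pmf_finite) (simp_all add: pmf_binomial)
  finally show ?thesis .
qed

text \<open>Exponential Markov inequality with weight 16^(j - 4 L): the moment is (1 + 15 p)^(8 L)
  <= 2^(8 L), against 16^(4 L) = 2^(16 L) in the denominator.\<close>

lemma majority_le:
  assumes "pmf p True \<le> 1 / 16"
  shows "measure_pmf.prob (replicate_pmf (8 * L) p) {rs. 4 * L < count_list rs True} \<le> 1 / 2 ^ (8 * L)"
proof -
  let ?q = "pmf p True"
  have q: "0 \<le> ?q" "?q \<le> 1" by (simp_all add: pmf_le_1)
  have "(\<Sum>j\<in>{4 * L<..8 * L}. real (8 * L choose j) * ?q ^ j * (1 - ?q) ^ (8 * L - j)) \<le>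
      (\<Sum>j\<in>{4 * L<..8 * L}. real (8 * L choose j) * (16 * ?q) ^ j * (1 - ?q) ^ (8 * L - j) / 16 ^ (4 * L))"
  proof (rule sum_mono)
    fix j assume j: "j \<in> {4 * L<..8 * L}"
    have "(16 :: real) ^ (4 * L) \<le> 16 ^ j" using j by (intro power_increasing) auto
    hence "1 \<le> (16 :: real) ^ j / 16 ^ (4 * L)" by simp
    moreover have "0 \<le> real (8 * L choose j) * ?q ^ j * (1 - ?q) ^ (8 * L - j)" using q by simp
    ultimately have "real (8 * L choose j) * ?q ^ j * (1 - ?q) ^ (8 * L - j) * 1 \<le>
        real (8 * L choose j) * ?q ^ j * (1 - ?q) ^ (8 * L - j) * (16 ^ j / 16 ^ (4 * L))"
      by (rule mult_left_mono)
    thus "real (8 * L choose j) * ?q ^ j * (1 - ?q) ^ (8 * L - j) \<le>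
        real (8 * L choose j) * (16 * ?q) ^ j * (1 - ?q) ^ (8 * L - j) / 16 ^ (4 * L)"
      by (simp add: power_mult_distrib mult_ac)
  qed
  also have "\<dots> \<le> (\<Sum>j\<le>8 * L. real (8 * L choose j) * (16 * ?q) ^ j * (1 - ?q) ^ (8 * L - j) / 16 ^ (4 * L))"
    by (rule sum_mono2) (use q in auto)
  also have "\<dots> = (16 * ?q + (1 - ?q)) ^ (8 * L) / 16 ^ (4 * L)"
    by (simp only: binomial_ring sum_divide_distrib)
  also have "\<dots> \<le> 2 ^ (8 * L) / 16 ^ (4 * L)"
    by (intro divide_right_mono power_mono) (use assms q in auto)
  also have "\<dots> = 1 / 2 ^ (8 * L)"
  proof -
    have "(16 :: real) ^ (4 * L) = 2 ^ (8 * L) * 2 ^ (8 * L)"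
      by (simp add: power_mult flip: power_mult_distrib)
    thus ?thesis by simp
  qed
  finally show ?thesis unfolding prob_count_list .
qed

text \<open>The Wallis-type bound 1 / sqrt (3 a + 1) on the central probability, squared.
  Consecutive values have quotient (2 a + 1) / (2 a + 2), and (2 a + 1)^2 (3 a + 4) <= (2 a + 2)^2
  (3 a + 1), so this form carries itself through the induction.\<close>

lemma central_binomial_le: "(real (2 * a choose a) / 4 ^ a)\<^sup>2 * (3 * real a + 1) \<le> 1"
proof (induction a)
  case (Suc a)
  have eq: "real (2 * Suc a choose Suc a) * (real a + 1) = real (2 * a choose a) * (2 * (2 * real a + 1))"
  proof -
    have 1: "Suc a * (Suc (2 * a) choose Suc a) = Suc (2 * a) * (2 * a choose a)"
      by (rule Suc_times_binomial)
    have "Suc (2 * a) choose a = Suc (2 * a) choose Suc a"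
      by (subst binomial_symmetric) auto
    hence "2 * Suc a choose Suc a = 2 * (Suc (2 * a) choose Suc a)" by simp
    hence "(2 * Suc a choose Suc a) * Suc a = 2 * (Suc (2 * a) * (2 * a choose a))"
      using 1 by (simp only: mult.assoc mult.commute)
    hence "real ((2 * Suc a choose Suc a) * Suc a) = real (2 * (Suc (2 * a) * (2 * a choose a)))" by (rule arg_cong)
    thus ?thesis by (simp add: algebra_simps)
  qed
  define c where "c = real (2 * a choose a) / 4 ^ a"
  have c': "real (2 * Suc a choose Suc a) / 4 ^ Suc a = c * ((2 * real a + 1) / (2 * (real a + 1)))"
  proof -
    define C where "C = real (2 * a choose a)"
    define C' where "C' = real (2 * Suc a choose Suc a)"
    have "C' / 4 ^ Suc a = (C' * (real a + 1)) / (4 ^ Suc a * (real a + 1))" by simp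
    also have "\<dots> = C / 4 ^ a * ((2 * real a + 1) / (2 * (real a + 1)))"
    proof -
      have "C * (2 * z) / (4 * X * y) = C / X * (z / (2 * y))" for X y z :: real
        by (cases "X = 0"; cases "y = 0") (simp_all add: field_simps)
      thus ?thesis unfolding eq[folded C_def C'_def] by (simp only: power_Suc)
    qed
    finally show ?thesis unfolding c_def C_def[symmetric] C'_def[symmetric] .
  qed
  have x: "((2 * real a + 1) / (2 * (real a + 1)))\<^sup>2 * (3 * real (Suc a) + 1) \<le> 3 * real a + 1"
  proof -
    have "(2 * real a + 1)\<^sup>2 * (3 * real a + 4) \<le> (3 * real a + 1) * (2 * (real a + 1))\<^sup>2"
      by (simp add: power2_eq_square algebra_simps)
    thus ?thesis by (simp add: power_divide field_simps)
  qed
  have "(real (2 * Suc a choose Suc a) / 4 ^ Suc a)\<^sup>2 * (3 * real (Suc a) + 1) =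
      c\<^sup>2 * (((2 * real a + 1) / (2 * (real a + 1)))\<^sup>2 * (3 * real (Suc a) + 1))"
    unfolding c' power_mult_distrib by (simp only: mult.assoc)
  also have "\<dots> \<le> c\<^sup>2 * (3 * real a + 1)"
    by (rule mult_left_mono[OF x]) simp
  also have "\<dots> \<le> 1" using Suc.IH by (simp add: c_def)
  finally show ?case .
qed simp

lemma sum_upper_half:
  fixes f :: "nat \<Rightarrow> real"
  shows "(\<Sum>j\<le>2 * a. f j) = f a + (\<Sum>j\<in>{a<..2 * a}. f j) + (\<Sum>j\<in>{a<..2 * a}. f (2 * a - j))"
proof -
  have "{..2 * a} = insert a ({a<..2 * a} \<union> {..<a})" by auto
  hence "(\<Sum>j\<le>2 * a. f j) = f a + ((\<Sum>j\<in>{a<..2 * a}. f j) + (\<Sum>j<a. f j))"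
    by (simp only:) (subst sum.insert, simp, simp, subst sum.union_disjoint, auto)
  moreover have "(\<Sum>j<a. f j) = (\<Sum>j\<in>{a<..2 * a}. f (2 * a - j))"
    by (rule sum.reindex_bij_witness[of _ "\<lambda>j. 2 * a - j" "\<lambda>j. 2 * a - j"]) auto
  ultimately show ?thesis by simp
qed

lemma sum_binomial_upper: "(\<Sum>j\<in>{a<..2 * a}. real (2 * a choose j)) = (4 ^ a - real (2 * a choose a)) / 2"
proof -
  have "(\<Sum>j\<le>2 * a. real (2 * a choose j)) = 2 ^ (2 * a)"
    by (simp flip: of_nat_sum add: choose_row_sum)
  moreover have "(\<Sum>j\<in>{a<..2 * a}. real (2 * a choose (2 * a - j))) = (\<Sum>j\<in>{a<..2 * a}. real (2 * a choose j))"
    by (intro sum.cong refl) (subst binomial_symmetric, auto)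
  ultimately show ?thesis using sum_upper_half[of "\<lambda>j. real (2 * a choose j)" a] by (simp add: power_mult)
qed

text \<open>De Moivre's formula for the mean absolute deviation of the fair binomial law. The sum
  telescopes, each term being 2 a (C(2 a - 1, j - 1) - C(2 a - 1, j)).\<close>

lemma sum_binomial_deviation:
  "(\<Sum>j\<in>{a<..2 * a}. real (2 * a choose j) * (2 * real j - 2 * real a)) = real a * real (2 * a choose a)"
proof (cases a)
  case (Suc b)
  have trm: "real (2 * a choose j) * (2 * real j - 2 * real a) =
      2 * real a * real (2 * a - 1 choose (j - 1)) - 2 * real a * real (2 * a - 1 choose j)" if "0 < j" for j
  proof -
    have 1: "j * (2 * a choose j) = 2 * a * (2 * a - 1 choose (j - 1))"
      by (rule times_binomial_minus1_eq[OF that])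
    have "2 * a choose j = (2 * a - 1 choose (j - 1)) + (2 * a - 1 choose j)"
      using Suc that by (subst choose_reduce_nat) auto
    hence 2: "real (2 * a choose j) = real (2 * a - 1 choose (j - 1)) + real (2 * a - 1 choose j)" by simp
    from 1 have "real (j * (2 * a choose j)) = real (2 * a * (2 * a - 1 choose (j - 1)))" by (rule arg_cong)
    thus ?thesis using 2 by (simp add: algebra_simps)
  qed
  have "(\<Sum>j\<in>{a<..2 * a}. real (2 * a choose j) * (2 * real j - 2 * real a)) =
      (\<Sum>j\<in>{a<..2 * a}. 2 * real a * real (2 * a - 1 choose (j - 1)) - 2 * real a * real (2 * a - 1 choose j))"
    by (intro sum.cong refl trm) auto
  also have seteq: "{a<..2 * a} = {Suc a..2 * a}" by auto
  also have "(\<Sum>j\<in>{Suc a..2 * a}. 2 * real a * real (2 * a - 1 choose (j - 1)) - 2 * real a * real (2 * a - 1 choose j)) =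
     2 * real a * real (2 * a - 1 choose a) - 2 * real a * real (2 * a - 1 choose (2 * a))"
    using sum_telescope''[of a "2 * a" "\<lambda>j. - (2 * real a * real (2 * a - 1 choose j))"] by simp
  also have "\<dots> = real a * real (2 * (2 * a - 1 choose a))"
  proof -
    have "2 * a - 1 choose (2 * a) = 0" using Suc by (intro binomial_eq_0) auto
    thus ?thesis by simp
  qed
  also have "2 * (2 * a - 1 choose a) = 2 * a choose a"
  proof -
    have "2 * a choose a = (2 * a - 1 choose (a - 1)) + (2 * a - 1 choose a)"
      using Suc by (subst choose_reduce_nat) auto
    moreover have "2 * a - 1 choose (a - 1) = 2 * a - 1 choose a"
      using Suc by (subst binomial_symmetric) auto
    ultimately show ?thesis by simp
  qed
  finally show ?thesis unfolding seteq .
qed simp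

lemma half_le_of_symmetric:
  fixes S fa T T' b :: real
  assumes "S = fa + T + T'" "T' \<le> T" "fa \<le> b" "S = 1"
  shows "(1 - b) / 2 \<le> T"
  using assms by argo

text \<open>The success probability may lie slightly below 1/2, so the vote is compared with a fair
  coin. The fair coin loses half the probability \<open>b\<close> of a tie; the bias costs, to first
  order, \<epsilon> times the deviation sum a b of \<open>sum_binomial_deviation\<close>, and a
  second-order term.\<close>

lemma majority_ge:
  fixes a :: nat and p :: "bool pmf"
  defines "b \<equiv> real (2 * a choose a) / 4 ^ a"
  assumes p: "(1 - \<epsilon>) / 2 \<le> pmf p True" and \<epsilon>: "0 \<le> \<epsilon>" "\<epsilon> \<le> 1"
  shows "(1 - b) / 2 - real a * \<epsilon>\<^sup>2 / 2 - \<epsilon> * real a * b \<le>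
     measure_pmf.prob (replicate_pmf (2 * a) p) {rs. a < count_list rs True}"
proof -
  let ?r = "pmf p True"
  have r: "0 \<le> ?r" "?r \<le> 1" by (simp_all add: pmf_le_1)
  let ?f = "\<lambda>j. real (2 * a choose j) * ?r ^ j * (1 - ?r) ^ (2 * a - j)"
  let ?T = "\<Sum>j\<in>{a<..2 * a}. ?f j"
  have b0: "0 \<le> b" by (simp add: b_def)
  have up: "(\<Sum>j\<in>{a<..2 * a}. real (2 * a choose j) / 4 ^ a) = (1 - b) / 2"
    unfolding sum_divide_distrib[symmetric] sum_binomial_upper by (simp add: b_def field_simps)
  have "(1 - b) / 2 - real a * \<epsilon>\<^sup>2 / 2 - \<epsilon> * real a * b \<le> ?T"
  proof (cases "1 / 2 \<le> ?r")
    case True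
    \<comment> \<open>If the coin favours success, each upper term dominates its mirror image, so
      only the tie is lost.\<close>
    have "(\<Sum>j\<in>{a<..2 * a}. ?f (2 * a - j)) \<le> ?T"
    proof (rule sum_mono)
      fix j assume j: "j \<in> {a<..2 * a}"
      have "?r ^ (2 * a - j) * (1 - ?r) ^ j = (?r * (1 - ?r)) ^ (2 * a - j) * (1 - ?r) ^ (2 * j - 2 * a)"
        using j by (simp add: power_mult_distrib mult.assoc flip: power_add)
      also have "\<dots> \<le> (?r * (1 - ?r)) ^ (2 * a - j) * ?r ^ (2 * j - 2 * a)"
        using True r by (intro mult_left_mono power_mono) auto
      also have "\<dots> = ?r ^ j * (1 - ?r) ^ (2 * a - j)"
        using j by (simp add: power_mult_distrib mult.assoc mult.left_commute flip: power_add)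
      finally have *: "?r ^ (2 * a - j) * (1 - ?r) ^ j \<le> ?r ^ j * (1 - ?r) ^ (2 * a - j)" .
      have "2 * a choose (2 * a - j) = 2 * a choose j" "2 * a - (2 * a - j) = j"
        using j by (simp_all flip: binomial_symmetric)
      thus "?f (2 * a - j) \<le> ?f j" using * by (simp add: mult.assoc mult_left_mono)
    qed
    moreover have "?f a \<le> b"
    proof -
      have "?r * (1 - ?r) \<le> 1 / 4"
        using zero_le_square[of "?r - 1 / 2"] by (simp add: algebra_simps)
      hence "(?r * (1 - ?r)) ^ a \<le> (1 / 4) ^ a" using r by (intro power_mono) auto
      hence "real (2 * a choose a) * (?r * (1 - ?r)) ^ a \<le> real (2 * a choose a) * (1 / 4) ^ a"
        by (rule mult_left_mono) simp
      thus ?thesis by (simp add: b_def power_mult_distrib power_one_over mult.assoc)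
    qed
    moreover have "(\<Sum>j\<le>2 * a. ?f j) = 1"
      using binomial_ring[of ?r "1 - ?r" "2 * a"] by simp
    ultimately have "(1 - b) / 2 \<le> ?T"
      by (intro half_le_of_symmetric[OF sum_upper_half[of ?f a]])
    moreover have "0 \<le> real a * \<epsilon>\<^sup>2 / 2" "0 \<le> \<epsilon> * real a * b" using \<epsilon> b0 by simp_all
    ultimately show ?thesis by linarith
  next
    case False
    define e where "e = 1 - 2 * ?r"
    have e: "0 \<le> e" "e \<le> \<epsilon>" "e \<le> 1" and re: "?r = (1 - e) / 2" "1 - ?r = (1 + e) / 2"
      using False p r by (simp_all add: e_def field_simps)
    have e2: "e\<^sup>2 \<le> \<epsilon>\<^sup>2" "e\<^sup>2 \<le> 1" using e by (auto intro: power_mono simp: power_le_one)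
    \<comment> \<open>With u = 2 a - j and w = 2 j - 2 a the term is (r (1 - r))^u r^w up to the
      binomial coefficient. Bernoulli's inequality applies to both powers, and the product of the
      two losses has the favourable sign.\<close>
    have pt: "real (2 * a choose j) / 4 ^ a * (1 - real a * e\<^sup>2 - e * (2 * real j - 2 * real a)) \<le> ?f j"
      if j: "j \<in> {a<..2 * a}" for j
    proof -
      define u where "u = 2 * a - j"
      define w where "w = 2 * j - 2 * a"
      have j': "j = u + w" "2 * a - j = u" "2 * a = u + (u + w)" "u \<le> a" using j by (auto simp: u_def w_def)
      have w: "real w = 2 * real j - 2 * real a" using j by (simp add: w_def of_nat_diff)
      have A: "1 - real u * e\<^sup>2 \<le> (1 - e\<^sup>2) ^ u"
        using Bernoulli_inequality[of "- e\<^sup>2" u] e2 by simp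
      have B: "1 - real w * e \<le> (1 - e) ^ w"
        using Bernoulli_inequality[of "- e" w] e by simp
      have AB: "(1 - e\<^sup>2) ^ u \<le> 1" "(1 - e) ^ w \<le> 1" "0 \<le> (1 - e\<^sup>2) ^ u" "0 \<le> (1 - e) ^ w"
        using e e2 by (auto intro: power_le_one)
      have "(1 - (1 - e\<^sup>2) ^ u) * (1 - (1 - e) ^ w) \<ge> 0" using AB by simp
      hence "1 - real u * e\<^sup>2 - real w * e \<le> (1 - e\<^sup>2) ^ u * (1 - e) ^ w"
        using A B by (simp add: algebra_simps)
      moreover have "real u * e\<^sup>2 \<le> real a * e\<^sup>2" using j' by (intro mult_right_mono) auto
      ultimately have "1 - real a * e\<^sup>2 - e * real w \<le> (1 - e\<^sup>2) ^ u * (1 - e) ^ w" by (simp add: mult.commute)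
      moreover have "?r ^ j * (1 - ?r) ^ (2 * a - j) = (1 - e\<^sup>2) ^ u * (1 - e) ^ w / 4 ^ a"
      proof -
        have "?r ^ j * (1 - ?r) ^ (2 * a - j) = ?r ^ (u + w) * (1 - ?r) ^ u"
          using j'(1,2) by simp
        also have "\<dots> = ((1 - e) / 2) ^ (u + w) * ((1 + e) / 2) ^ u"
          by (simp only: re(2)) (simp only: re(1))
        also have "\<dots> = ((1 - e) * (1 + e)) ^ u * (1 - e) ^ w / 2 ^ (u + (u + w))"
          by (simp add: power_add power_divide power_mult_distrib mult_ac)
        also have "(1 - e) * (1 + e) = 1 - e\<^sup>2" by (simp add: power2_eq_square algebra_simps)
        also have "(2 :: real) ^ (u + (u + w)) = 4 ^ a" unfolding j'(3)[symmetric] by (simp add: power_mult)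
        finally show ?thesis .
      qed
      ultimately have "(1 - real a * e\<^sup>2 - e * real w) / 4 ^ a \<le> ?r ^ j * (1 - ?r) ^ (2 * a - j)"
        by (simp add: divide_right_mono)
      from mult_left_mono[OF this, of "real (2 * a choose j)"] show ?thesis
        by (simp add: w mult.assoc)
    qed
    have "(\<Sum>j\<in>{a<..2 * a}. real (2 * a choose j) / 4 ^ a * (1 - real a * e\<^sup>2 - e * (2 * real j - 2 * real a))) =
        (1 - real a * e\<^sup>2) * (\<Sum>j\<in>{a<..2 * a}. real (2 * a choose j) / 4 ^ a) -
        e / 4 ^ a * (\<Sum>j\<in>{a<..2 * a}. real (2 * a choose j) * (2 * real j - 2 * real a))"
    proof -
      have "c / X * (1 - A - e * D) = (1 - A) * (c / X) - e / X * (c * D)" for c X A D :: real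
        by (cases "X = 0") (simp_all add: field_simps)
      thus ?thesis unfolding sum_distrib_left sum_subtractf[symmetric] by (intro sum.cong refl)
    qed
    also have "\<dots> = (1 - real a * e\<^sup>2) * ((1 - b) / 2) - e * real a * b"
      unfolding up sum_binomial_deviation by (simp add: b_def)
    finally have eq: "(\<Sum>j\<in>{a<..2 * a}. real (2 * a choose j) / 4 ^ a * (1 - real a * e\<^sup>2 - e * (2 * real j - 2 * real a))) =
        (1 - real a * e\<^sup>2) * ((1 - b) / 2) - e * real a * b" .
    have "(1 - real a * e\<^sup>2) * ((1 - b) / 2) - e * real a * b \<le> ?T"
      unfolding eq[symmetric] by (rule sum_mono) (rule pt)
    hence f1: "(1 - b) / 2 - real a * e\<^sup>2 * ((1 - b) / 2) - e * real a * b \<le> ?T"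
      by (simp only: left_diff_distrib mult_1)
    have f2: "real a * e\<^sup>2 * ((1 - b) / 2) \<le> real a * \<epsilon>\<^sup>2 / 2"
    proof -
      have "real a * e\<^sup>2 * ((1 - b) / 2) \<le> real a * e\<^sup>2 * (1 / 2)"
        using b0 by (intro mult_left_mono) auto
      also have "\<dots> \<le> real a * \<epsilon>\<^sup>2 * (1 / 2)"
        using e2 by (intro mult_right_mono mult_left_mono) auto
      finally show ?thesis by simp
    qed
    have f3: "e * real a * b \<le> \<epsilon> * real a * b" using e b0 by (intro mult_right_mono) auto
    have "X - Y - Z \<le> T \<Longrightarrow> Y \<le> Y' \<Longrightarrow> Z \<le> Z' \<Longrightarrow> X - Y' - Z' \<le> T" for X Y Z Y' Z' T :: real
      by simp
    from this[OF f1 f2 f3] show ?thesis .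
  qed
  thus ?thesis unfolding prob_count_list .
qed

subsection \<open>The main loop\<close>

text \<open>Union bound along the loop: stopping before level \<open>l\<close> is harmless if the
  output is good, and otherwise costs at most \<open>\<eta>\<close>. Level \<open>l\<close> itself
  stops with probability at least \<open>\<beta>\<close>, once it is reached.\<close>

lemma acount_loop_ge:
  fixes n k F D \<eta> \<beta>
  defines "L \<equiv> nat \<lceil>log 2 (real n)\<rceil>"
  defines "maj \<equiv> \<lambda>l. measure_pmf.prob (replicate_pmf (8 * L) (acount_round D n k F l)) {rs. 4 * L < count_list rs True}"
  assumes G: "2 ^ (l - 1) \<in> G" "\<beta> \<le> maj l" and ls: "\<And>j. j \<in> set ls \<Longrightarrow> 2 ^ (j - 1) \<in> G \<or> maj j \<le> \<eta>" and \<eta>: "0 \<le> \<eta>"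
  shows "\<beta> - real (length ls) * \<eta> \<le> measure_pmf.prob (acount_loop D n k F (ls @ l # ls')) G"
proof -
  have step: "measure_pmf.prob (acount_loop D n k F (j # js)) G =
      maj j * of_bool (2 ^ (j - 1) \<in> G) + (1 - maj j) * measure_pmf.prob (acount_loop D n k F js) G" for j js
  proof -
    let ?P = "replicate_pmf (8 * L) (acount_round D n k F j)"
    let ?c = "measure_pmf.prob (acount_loop D n k F js) G"
    have "measure_pmf.prob (acount_loop D n k F (j # js)) G = E (acount_loop D n k F (j # js)) (\<lambda>x. of_bool (x \<in> G))"
      by (simp only: prob_E[symmetric] Collect_mem_eq)
    also have "\<dots> = E ?P (\<lambda>rs. of_bool (4 * L < count_list rs True) * of_bool (2 ^ (j - 1) \<in> G) +
        (1 - of_bool (4 * L < count_list rs True)) * ?c)"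
      unfolding acount_loop.simps L_def[symmetric]
      by (subst E_bind[of _ 1], simp, simp, intro Bochner_Integration.integral_cong refl)
        (auto simp: prob_E[symmetric])
    also have "\<dots> = maj j * of_bool (2 ^ (j - 1) \<in> G) + (1 - maj j) * ?c"
    proof -
      have "integrable (measure_pmf ?P) (\<lambda>rs. of_bool (4 * L < count_list rs True) :: real)"
        by (rule integrable_bounded_pmf[of _ _ 1]) auto
      thus ?thesis by (simp add: maj_def prob_E)
    qed
    finally show ?thesis .
  qed
  have maj01: "0 \<le> maj j" "maj j \<le> 1" for j by (simp_all add: maj_def)
  show ?thesis using ls
  proof (induction ls)
    case Nil
    have "0 \<le> (1 - maj l) * measure_pmf.prob (acount_loop D n k F ls') G" using maj01 by simp
    thus ?case using G step[of l ls'] by (simp del: acount_loop.simps)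
  next
    case (Cons j ls)
    let ?c = "measure_pmf.prob (acount_loop D n k F (ls @ l # ls')) G"
    have IH: "\<beta> - real (length ls) * \<eta> \<le> ?c" using Cons by simp
    have c: "0 \<le> ?c" "?c \<le> 1" by simp_all
    consider "2 ^ (j - 1) \<in> G" | "2 ^ (j - 1) \<notin> G" "maj j \<le> \<eta>" using Cons.prems[of j] by auto
    thus ?case
    proof cases
      case 1
      have "maj j * ?c \<le> maj j * 1" using c maj01 by (intro mult_left_mono) auto
      hence "?c \<le> maj j + (1 - maj j) * ?c" by (simp add: algebra_simps)
      hence "?c \<le> measure_pmf.prob (acount_loop D n k F ((j # ls) @ l # ls')) G" using 1 step[of j "ls @ l # ls'"] by (simp del: acount_loop.simps)
      thus ?thesis using IH \<eta> by (simp add: algebra_simps)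
    next
      case 2
      have "maj j * ?c \<le> \<eta> * 1" using 2 c maj01 \<eta> by (intro mult_mono) auto
      hence "?c - \<eta> \<le> (1 - maj j) * ?c" by (simp add: algebra_simps)
      thus ?thesis using IH 2 step[of j "ls @ l # ls'"] by (simp del: acount_loop.simps add: algebra_simps)
    qed
  qed
qed

subsection \<open>Sampling\<close>

lemma computes_asn_eq: "ev e v = w \<Longrightarrow> computes orc (asn e) v (return_pmf w) (ecost e + 1)"
  using computes_asn by blast

lemma EInc_funpow [simp]:
  "ev ((EInc ^^ m) e) v = (succ_val ^^ m) (ev e v)" "(succ_val ^^ m) (Num a) = Num (m + a)"
  "ecost ((EInc ^^ m) e) = m + ecost e"
  by (induction m) auto

lemma computes_then_asn:
  assumes "computes orc c v (map_pmf \<phi> p) T" "\<And>a. a \<in> set_pmf p \<Longrightarrow> ev e (\<phi> a) = \<psi> a"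
  shows "computes orc (Seq c (asn e)) v (map_pmf \<psi> p) (T + (ecost e + 1))"
proof -
  have "computes orc (Seq c (asn e)) v (bind_pmf p (\<lambda>a. return_pmf (\<psi> a))) (T + (ecost e + 1))"
  proof (rule computes_Seq_map[OF assms(1)])
    show "computes orc (asn e) (\<phi> a) (return_pmf (\<psi> a)) (ecost e + 1)" if "a \<in> set_pmf p" for a
      using computes_asn[of orc e "\<phi> a"] assms(2)[OF that] by simp
  qed
  thus ?thesis by (simp add: map_pmf_def)
qed

lemma computes_rnd_num:
  assumes "ev e v = Num m" "m > 0"
  shows "computes orc (rnd e) v (map_pmf (\<lambda>r. Pair (Num r) v) (pmf_of_set {..<m})) (ecost e + 2)"
  using computes_rnd[of orc e v] assms by (simp add: pmf.map_comp o_def)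

lemma computes_rnd_coin:
  "computes orc (rnd (EN 2)) v (map_pmf (\<lambda>b. Pair (enc_bool b) v) (pmf_of_set UNIV)) 3"
proof -
  have "map_pmf (\<lambda>b. if b then 1 else 0 :: nat) (pmf_of_set UNIV) = pmf_of_set ((\<lambda>b. if b then 1 else 0) ` UNIV)"
    by (rule map_pmf_of_set_inj) (auto simp: inj_on_def)
  also have "(\<lambda>b. if b then 1 else 0 :: nat) ` UNIV = {..<2}" by (auto simp: UNIV_bool)
  finally have "pmf_of_set {..<2} = map_pmf (\<lambda>b. if b then 1 else 0 :: nat) (pmf_of_set UNIV)" by simp
  note eq = this
  show ?thesis
    by (rule computes_cong[OF computes_rnd_num[of "EN 2" v 2]]) (simp_all add: eq pmf.map_comp o_def enc_bool_def)
qed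

lemma computes_call_map:
  assumes "computes orc c (ev e v) (map_pmf h p) T"
  shows "computes orc (call c e) v (map_pmf (\<lambda>a. Pair (h a) v) p) (ecost e + 2 + T)"
  using computes_call[OF assms] by (simp add: pmf.map_comp o_def)

lemma computes_call_det:
  assumes "computes orc c (ev e v) (return_pmf w) T"
  shows "computes orc (call c e) v (return_pmf (Pair w v)) (ecost e + 2 + T)"
  using computes_call[OF assms] by simp

lemma mfold_replicate:
  "mfold (\<lambda>_ a. map_pmf (\<lambda>y. h y a) P) zs a = map_pmf (\<lambda>ys. fold h ys a) (replicate_pmf (length zs) P)"
proof (induction zs arbitrary: a)
  case (Cons z zs)
  show ?case by (simp add: Cons.IH map_bind_pmf bind_map_pmf) (simp add: map_pmf_def)
qed simp

lemma replicate_pmf_map: "replicate_pmf l (map_pmf f p) = map_pmf (map f) (replicate_pmf l p)"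
  by (induction l) (simp_all add: map_bind_pmf bind_map_pmf)

definition subset_step :: "real \<Rightarrow> nat \<Rightarrow> nat list \<Rightarrow> nat list pmf" where
  "subset_step p z vs = map_pmf (\<lambda>b. if b then z # vs else vs) (bernoulli_pmf p)"

text \<open>The indices descend because the program counts down. The first coin then concerns the
  largest index, as an induction on \<open>n\<close> requires.\<close>

definition subset_list :: "nat \<Rightarrow> real \<Rightarrow> nat list pmf" where
  "subset_list n p = mfold (subset_step p) (rev [0..<n]) []"

lemma mfold_subset_step_append:
  "mfold (subset_step p) zs vs = map_pmf (\<lambda>us. us @ vs) (mfold (subset_step p) zs [])"
proof (induction zs arbitrary: vs)
  case (Cons z zs)
  have *: "mfold (subset_step p) zs (if b then z # vs else vs) =
      map_pmf (\<lambda>us. us @ vs) (mfold (subset_step p) zs (if b then [z] else []))" for b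
    by (subst (1 2) Cons.IH) (simp add: pmf.map_comp o_def)
  show ?case
    by (simp add: subset_step_def[of p z] bind_map_pmf map_bind_pmf *)
qed simp

lemma set_subset_list:
  assumes "vs \<in> set_pmf (subset_list n p)"
  shows "distinct vs \<and> set vs \<subseteq> {..<n}"
proof -
  define I where "I = (\<lambda>zs vs. distinct vs \<and> set vs \<inter> set zs = {} \<and> set vs \<subseteq> {..<n} \<and> distinct zs \<and> set zs \<subseteq> {..<n})"
  have "I [] vs"
    by (rule mfold_invariant[OF assms[unfolded subset_list_def]])
      (auto simp: I_def subset_step_def split: if_splits)
  thus ?thesis by (simp add: I_def)
qed

lemma map_set_subset_list: "map_pmf set (subset_list n p) = random_subset n p"
proof (induction n)
  case 0
  show ?case by (simp add: subset_list_def random_subset_def)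
next
  case (Suc n)
  have "map_pmf set (subset_list (Suc n) p) =
      bind_pmf (bernoulli_pmf p) (\<lambda>b. map_pmf (\<lambda>us. if b then insert n (set us) else set us) (subset_list n p))"
  proof -
    have "map_pmf set (mfold (subset_step p) (rev [0..<n]) (if b then [n] else [])) =
        map_pmf (\<lambda>us. if b then insert n (set us) else set us) (mfold (subset_step p) (rev [0..<n]) [])" for b
      by (cases b; subst mfold_subset_step_append) (simp_all add: pmf.map_comp o_def)
    thus ?thesis by (simp add: subset_list_def subset_step_def[of p n] bind_map_pmf map_bind_pmf)
  qed
  also have "\<dots> = bind_pmf (bernoulli_pmf p) (\<lambda>b. map_pmf (\<lambda>S. if b then insert n S else S) (random_subset n p))"
    unfolding Suc.IH[symmetric] by (simp add: pmf.map_comp o_def)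
  also have "\<dots> = random_subset (Suc n) p"
  proof -
    have "map_pmf (\<lambda>f. {j. (f(n := b)) j}) (Pi_pmf {..<n} False (\<lambda>_. bernoulli_pmf p)) =
        map_pmf (\<lambda>S. if b then insert n S else S) (random_subset n p)" for b
      unfolding random_subset_def pmf.map_comp
    proof (rule map_pmf_cong[OF refl])
      fix f assume "f \<in> set_pmf (Pi_pmf {..<n} False (\<lambda>_. bernoulli_pmf p))"
      hence "f n = False" by (auto simp: set_Pi_pmf PiE_dflt_def)
      thus "{j. (f(n := b)) j} = ((\<lambda>S. if b then insert n S else S) \<circ> (\<lambda>f. {j. f j})) f" by auto
    qed
    moreover have "random_subset (Suc n) p =
        bind_pmf (bernoulli_pmf p) (\<lambda>b. map_pmf (\<lambda>f. {j. (f(n := b)) j}) (Pi_pmf {..<n} False (\<lambda>_. bernoulli_pmf p)))"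
      unfolding random_subset_def lessThan_Suc
      by (subst Pi_pmf_insert) (simp_all add: pair_pmf_def map_bind_pmf map_pmf_def bind_assoc_pmf bind_return_pmf)
    ultimately show ?thesis by simp
  qed
  finally show ?case .
qed

text \<open>The bias of ACOUNT is the fraction (k + 1) / (2 n), so comparing a uniform number below
  2 n with k + 1 is an exact biased coin.\<close>

lemma bernoulli_from_uniform:
  assumes "a \<le> m" "m > 0"
  shows "map_pmf (\<lambda>r. r < a) (pmf_of_set {..<m :: nat}) = bernoulli_pmf (real a / real m)"
proof (rule pmf_eqI)
  fix b
  have p: "real a / real m \<in> {0..1}" using assms by (simp add: field_simps)
  have T: "pmf (map_pmf (\<lambda>r. r < a) (pmf_of_set {..<m})) True = real a / real m"
  proof -
    have "{..<m} \<inter> {..<a} = {..<a}" using assms by auto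
    thus ?thesis using assms by (subst pmf_map, subst measure_pmf_of_set) (auto simp: vimage_def lessThan_def)
  qed
  have F: "pmf q False = 1 - pmf q True" for q :: "bool pmf"
    using sum_pmf_eq_1[OF finite subset_UNIV, of q] unfolding UNIV_bool by simp
  show "pmf (map_pmf (\<lambda>r. r < a) (pmf_of_set {..<m})) b = pmf (bernoulli_pmf (real a / real m)) b"
    using T p by (cases b) (simp_all add: F)
qed

text \<open>The cardinality is counted along, so that the later test against \<open>k\<close> is a
  single comparison.\<close>

definition prog_subset :: com where
  "prog_subset =
     Seq (asn (EP e0 (EP (EN 0) (EP (EN 0) r1))))
    (Seq (whl CLess (EN 0) e0
       (Seq (rnd (ESnd r3))
            (asn (EIf CLess e0 (EFst (ESnd r3))
               (EP (EDec e1) (EP (EInc e2) (EP (EP (EDec e1) e3) r4)))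
               (EP (EDec e1) r2)))))
    (asn (EP e1 e2)))"

lemma computes_subset:
  assumes "a \<le> m" "m > 0"
  shows "computes orc prog_subset (Pair (Num n) (Pair (Num a) (Num m)))
     (map_pmf (\<lambda>vs. Pair (Num (length vs)) (enc_list (map Num vs))) (subset_list n (real a / real m)))
     (200 * (n + 1))"
proof -
  define \<phi> where "\<phi> = (\<lambda>zs vs. Pair (Num (length (zs :: nat list))) (Pair (Num (length vs))
      (Pair (enc_list (map Num vs)) (Pair (Num a) (Num m)))))"
  define W where "W = whl CLess (EN 0) e0
       (Seq (rnd (ESnd r3))
            (asn (EIf CLess e0 (EFst (ESnd r3))
               (EP (EDec e1) (EP (EInc e2) (EP (EP (EDec e1) e3) r4)))
               (EP (EDec e1) r2))))"
  have 1: "computes orc W (\<phi> (rev [0..<n]) []) (map_pmf (\<phi> []) (subset_list n (real a / real m)))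
      ((length (rev [0..<n]) + 1) * 100)"
    unfolding subset_list_def W_def
  proof (rule computes_for_le[where I = "\<lambda>zs _. zs = rev [0..<length zs]" and T = 90], goal_cases)
    case (3 z zs vs)
    have z: "z = length zs" "zs = rev [0..<length zs]" using 3 by simp_all
    have "map_pmf (\<phi> zs) (subset_step (real a / real m) z vs) =
        map_pmf (\<lambda>r. \<phi> zs (if r < a then z # vs else vs)) (pmf_of_set {..<m})"
      unfolding subset_step_def bernoulli_from_uniform[OF assms, symmetric] by (simp add: pmf.map_comp o_def)
    moreover have "computes orc (Seq (rnd (ESnd r3))
            (asn (EIf CLess e0 (EFst (ESnd r3))
               (EP (EDec e1) (EP (EInc e2) (EP (EP (EDec e1) e3) r4)))
               (EP (EDec e1) r2)))) (\<phi> (z # zs) vs)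
        (map_pmf (\<lambda>r. \<phi> zs (if r < a then z # vs else vs)) (pmf_of_set {..<m})) 90"
      by (rule computes_mono, rule computes_then_asn, rule computes_rnd_num[of _ _ m])
        (use assms z(1) in \<open>simp_all add: \<phi>_def\<close>)
    ultimately show ?case by simp
  qed (simp_all add: \<phi>_def)
  have "computes orc prog_subset (Pair (Num n) (Pair (Num a) (Num m)))
     (map_pmf (\<lambda>vs. Pair (Num (length vs)) (enc_list (map Num vs))) (subset_list n (real a / real m)))
     (50 + ((n + 1) * 100 + 20))"
    unfolding prog_subset_def W_def[symmetric]
  proof (rule computes_mono, rule computes_Seq_det[OF computes_asn], rule computes_then_asn)
    show "computes orc W (ev (EP e0 (EP (EN 0) (EP (EN 0) r1))) (Pair (Num n) (Pair (Num a) (Num m))))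
        (map_pmf (\<phi> []) (subset_list n (real a / real m))) ((n + 1) * 100)"
      using 1 by (simp add: \<phi>_def)
  qed (simp_all add: \<phi>_def)
  thus ?thesis by (rule computes_mono) simp
qed

subsection \<open>One round\<close>

text \<open>An oversized set clears the flag for good. Its constraint is not encoded, since the
  clauses would be too many, but the remaining sets are still drawn: the loop keeps a fixed length
  and the law stays a product.\<close>

definition add_parity :: "nat \<Rightarrow> nat list \<times> bool \<Rightarrow> bool \<times> cnf \<Rightarrow> bool \<times> cnf" where
  "add_parity k = (\<lambda>(vs, b) (ok, F). if k < length vs then (False, F) else (ok, parity_clauses vs b F))"

lemma fold_add_parity:
  "fst (fold (add_parity k) ps (ok, F)) \<longleftrightarrow> ok \<and> (\<forall>p\<in>set ps. length (fst p) \<le> k)"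
  "fst (fold (add_parity k) ps (ok, F)) \<Longrightarrow>
     satisfies x (snd (fold (add_parity k) ps (ok, F))) \<longleftrightarrow> satisfies x F \<and> (\<forall>p\<in>set ps. lparity (fst p) x = snd p)"
proof (induction ps arbitrary: ok F)
  case (Cons p ps)
  {
    case 1
    show ?case using Cons.IH(1) by (cases p) (auto simp: add_parity_def)
  next
    case 2
    show ?case using Cons.IH 2 by (cases p) (auto simp: add_parity_def satisfies_parity_clauses split: if_splits)
  }
qed auto

definition prog_hash :: com where
  "prog_hash = whl CLess (EN 0) e0
     (Seq (call prog_subset r4)
     (Seq (rnd (EN 2))
     (ite CLess (EFst (ESnd (ESnd r3))) (EFst e1)
       (asn (EP (EDec e2) (EP (EN 0) r4)))
       (Seq (call prog_parity (EP (ESnd e1) (EP e0 e4)))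
            (asn (EP (EDec e3) (EP e4 (EP e0 r6))))))))"

definition hash_list :: "nat \<Rightarrow> nat \<Rightarrow> real \<Rightarrow> nat \<Rightarrow> cnf \<Rightarrow> (bool \<times> cnf) pmf" where
  "hash_list n k p l F = map_pmf (\<lambda>ps. fold (add_parity k) ps (True, F))
     (replicate_pmf l (pair_pmf (subset_list n p) (pmf_of_set UNIV)))"

lemma computes_hash:
  fixes a m n k l F
  assumes am: "a \<le> m" "m > 0" and F: "cnf_over n F"
  defines "env \<equiv> Pair (Num n) (Pair (Num a) (Num m))"
  defines "B \<equiv> 2 ^ k * (k + 1)"
  defines "p \<equiv> real a / real m"
  shows "computes orc prog_hash (Pair (Num l) (Pair (enc_bool True) (Pair (enc_clauses F) (Pair (Num k) env))))
     (map_pmf (\<lambda>z. Pair (Num 0) (Pair (enc_bool (fst z)) (Pair (enc_clauses (snd z)) (Pair (Num k) env)))) (hash_list n k p l F))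
     ((l + 1) * (500 * (n + 1) + 1000 * B))"
    and "(ok, G) \<in> set_pmf (hash_list n k p l F) \<Longrightarrow> cnf_over n G \<and> cnf_size n G \<le> cnf_size n F + l * B"
proof -
  define h where "h = add_parity k"
  define P where "P = pair_pmf (subset_list n p) (pmf_of_set (UNIV :: bool set))"
  \<comment> \<open>A budget: every remaining iteration may still add \<open>B\<close> to the
    size.\<close>
  define I where "I = (\<lambda>zs (okG :: bool \<times> cnf). cnf_over n (snd okG) \<and>
      cnf_size n (snd okG) + length (zs :: unit list) * B \<le> cnf_size n F + l * B)"
  define \<phi> where "\<phi> = (\<lambda>(zs :: unit list) (okG :: bool \<times> cnf). Pair (Num (length zs))
      (Pair (enc_bool (fst okG)) (Pair (enc_clauses (snd okG)) (Pair (Num k) env))))"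
  have hash: "hash_list n k p l F = mfold (\<lambda>_ okG. map_pmf (\<lambda>y. h y okG) P) (replicate l ()) (True, F)"
    unfolding mfold_replicate hash_list_def h_def P_def by simp
  have step: "I zs okG'" if "I (z # zs) okG" "okG' \<in> set_pmf (map_pmf (\<lambda>y. h y okG) P)" for z zs okG okG'
  proof -
    from that(2) obtain vs b where vs: "vs \<in> set_pmf (subset_list n p)" and eq: "okG' = h (vs, b) okG"
      by (auto simp: P_def)
    have len: "set vs \<subseteq> {..<n}" using set_subset_list[OF vs] by auto
    show ?thesis
    proof (cases "k < length vs")
      case True
      thus ?thesis using that(1) by (auto simp: I_def eq h_def add_parity_def split_beta)
    next
      case False
      obtain ok G where okG: "okG = (ok, G)" by force
      have "2 ^ length vs * (1 + length vs) \<le> B"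
        using False unfolding B_def by (intro mult_le_mono) (auto intro: power_increasing)
      hence "cnf_size n (parity_clauses vs b G) \<le> cnf_size n G + B"
        using cnf_size_parity_clauses[of n vs b G] by linarith
      thus ?thesis using that(1) False cnf_over_parity_clauses[OF len]
        by (auto simp: I_def eq okG h_def add_parity_def)
    qed
  qed
  have body: "computes orc
     (Seq (call prog_subset r4)
     (Seq (rnd (EN 2))
     (ite CLess (EFst (ESnd (ESnd r3))) (EFst e1)
       (asn (EP (EDec e2) (EP (EN 0) r4)))
       (Seq (call prog_parity (EP (ESnd e1) (EP e0 e4)))
            (asn (EP (EDec e3) (EP e4 (EP e0 r6))))))))
     (\<phi> (z # zs) okG) (map_pmf (\<phi> zs) (map_pmf (\<lambda>y. h y okG) P)) (400 * (n + 1) + 1000 * B)" for z zs okG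
  proof -
    obtain ok G where okG: "okG = (ok, G)" by force
    let ?v = "\<phi> (z # zs) okG"
    let ?c = "ite CLess (EFst (ESnd (ESnd r3))) (EFst e1)
       (asn (EP (EDec e2) (EP (EN 0) r4)))
       (Seq (call prog_parity (EP (ESnd e1) (EP e0 e4)))
            (asn (EP (EDec e3) (EP e4 (EP e0 r6)))))"
    have "computes orc prog_subset (ev r4 ?v)
        (map_pmf (\<lambda>vs. Pair (Num (length vs)) (enc_list (map Num vs))) (subset_list n p)) (200 * (n + 1))"
      using computes_subset[OF am, of orc n] by (simp add: \<phi>_def env_def p_def)
    from computes_call_map[OF this]
    have 1: "computes orc (call prog_subset r4) ?v
        (map_pmf (\<lambda>vs. Pair (Pair (Num (length vs)) (enc_list (map Num vs))) ?v) (subset_list n p)) (20 + 200 * (n + 1))"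
      by (rule computes_mono) simp
    have 3: "computes orc ?c (Pair (enc_bool b) (Pair (Pair (Num (length vs)) (enc_list (map Num vs))) ?v))
       (return_pmf (\<phi> zs (h (vs, b) okG))) (130 + 1000 * B)" for vs b
    proof (rule computes_mono, rule computes_ite[where T = "100 + 1000 * B"], goal_cases)
      case 1
      hence "k < length vs" by (simp add: \<phi>_def)
      thus ?case
        by (intro computes_cong[OF computes_asn]) (simp_all add: \<phi>_def okG h_def add_parity_def)
    next
      case 2
      hence k: "\<not> k < length vs" by (simp add: \<phi>_def)
      have "2 ^ length vs * (length vs + 1) \<le> B"
        using k unfolding B_def by (intro mult_le_mono) (auto intro: power_increasing)
      hence len: "1000 * ((length vs + 1) * 2 ^ length vs) \<le> 1000 * B" by (simp only: mult.commute mult_le_mono)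
      have call: "computes orc (call prog_parity (EP (ESnd e1) (EP e0 e4)))
          (Pair (enc_bool b) (Pair (Pair (Num (length vs)) (enc_list (map Num vs))) ?v))
          (return_pmf (Pair (enc_clauses (parity_clauses vs b G))
             (Pair (enc_bool b) (Pair (Pair (Num (length vs)) (enc_list (map Num vs))) ?v))))
          (30 + 1000 * B)"
        by (rule computes_mono[OF computes_call_det[OF computes_mono[OF _ len]]])
          (use computes_parity[of orc vs b G] in \<open>simp_all add: \<phi>_def okG\<close>)
      show ?case
        by (rule computes_mono, rule computes_Seq_det[OF call], rule computes_asn_eq)
          (use k in \<open>simp_all add: \<phi>_def okG h_def add_parity_def\<close>)
    qed simp
    show ?thesis
    proof (rule computes_cong)
      show "computes orc (Seq (call prog_subset r4) (Seq (rnd (EN 2)) ?c)) ?v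
         (bind_pmf (subset_list n p) (\<lambda>vs. bind_pmf (pmf_of_set UNIV) (\<lambda>b. return_pmf (\<phi> zs (h (vs, b) okG)))))
         ((20 + 200 * (n + 1)) + (3 + (130 + 1000 * B)))"
        by (rule computes_Seq_map[OF 1], rule computes_Seq_map[OF computes_rnd_coin], rule 3)
      show "bind_pmf (subset_list n p) (\<lambda>vs. bind_pmf (pmf_of_set UNIV) (\<lambda>b. return_pmf (\<phi> zs (h (vs, b) okG)))) =
         map_pmf (\<phi> zs) (map_pmf (\<lambda>y. h y okG) P)"
        by (simp add: P_def pair_pmf_def map_pmf_def bind_assoc_pmf bind_return_pmf)
    qed simp
  qed
  have "computes orc prog_hash (\<phi> (replicate l ()) (True, F))
     (map_pmf (\<phi> []) (hash_list n k p l F)) ((length (replicate l ()) + 1) * (500 * (n + 1) + 1000 * B))"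
    unfolding hash prog_hash_def
    by (rule computes_for_le[where I = I, OF _ _ body step]) (simp_all add: \<phi>_def I_def F)
  thus "computes orc prog_hash (Pair (Num l) (Pair (enc_bool True) (Pair (enc_clauses F) (Pair (Num k) env))))
     (map_pmf (\<lambda>z. Pair (Num 0) (Pair (enc_bool (fst z)) (Pair (enc_clauses (snd z)) (Pair (Num k) env)))) (hash_list n k p l F))
     ((l + 1) * (500 * (n + 1) + 1000 * B))"
    by (simp add: \<phi>_def)
  show "cnf_over n G \<and> cnf_size n G \<le> cnf_size n F + l * B" if "(ok, G) \<in> set_pmf (hash_list n k p l F)"
  proof -
    have "I [] (ok, G)"
      by (rule mfold_invariant[where I = I, OF that[unfolded hash]], simp add: I_def F, rule step)
    thus ?thesis by (simp add: I_def)
  qed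
qed

text \<open>\<open>parity_clauses\<close> and \<open>parity_cnf\<close> produce different clauses
  with the same solutions, and a round looks at nothing but satisfiability. Distinctness of the
  sampled lists identifies list length with cardinality and \<open>lparity\<close> with
  \<open>parity\<close>.\<close>

lemma hash_list_eq_round:
  "map_pmf (\<lambda>(ok, G). ok \<and> \<not> satisfiable n G) (hash_list n k p l F) = acount_round (random_subset n p) n k F l"
proof -
  have "acount_round (random_subset n p) n k F l =
      map_pmf (\<lambda>ps. if \<exists>S\<in>set (map fst ps). card S > k then False
                  else \<not> satisfiable n (F @ hash_cnf (map fst ps) (map snd ps)))
        (hash_pmf (random_subset n p) l)"
    unfolding acount_round_def by (rule bind_hash_pmf)
  also have "hash_pmf (random_subset n p) l =
      map_pmf (map (\<lambda>(vs, b). (set vs, b))) (replicate_pmf l (pair_pmf (subset_list n p) coin))"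
    unfolding hash_pmf_def map_set_subset_list[symmetric] pair_map_pmf1 replicate_pmf_map
    by (simp add: apfst_def map_prod_def split_beta)
  also have "map_pmf (\<lambda>ps. if \<exists>S\<in>set (map fst ps). card S > k then False
                  else \<not> satisfiable n (F @ hash_cnf (map fst ps) (map snd ps))) \<dots> =
      map_pmf (\<lambda>ps. fst (fold (add_parity k) ps (True, F)) \<and> \<not> satisfiable n (snd (fold (add_parity k) ps (True, F))))
        (replicate_pmf l (pair_pmf (subset_list n p) coin))"
    unfolding pmf.map_comp
  proof (rule map_pmf_cong[OF refl])
    fix ps assume "ps \<in> set_pmf (replicate_pmf l (pair_pmf (subset_list n p) coin))"
    hence d: "distinct (fst q)" if "q \<in> set ps" for q
      using that set_subset_list[of "fst q" n p] by (auto simp: set_replicate_pmf)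
    let ?ps = "map (\<lambda>(vs, b). (set vs, b)) ps"
    have len: "(\<exists>S\<in>set (map fst ?ps). card S > k) \<longleftrightarrow> \<not> fst (fold (add_parity k) ps (True, F))"
      unfolding fold_add_parity(1) using d by (force simp: distinct_card not_le)
    have sat: "satisfiable n (F @ hash_cnf (map fst ?ps) (map snd ?ps)) \<longleftrightarrow>
        satisfiable n (snd (fold (add_parity k) ps (True, F)))" if "fst (fold (add_parity k) ps (True, F))"
    proof -
      have "satisfies x (F @ hash_cnf (map fst ?ps) (map snd ?ps)) \<longleftrightarrow>
          satisfies x (snd (fold (add_parity k) ps (True, F)))" for x
      proof -
        have "satisfies x (hash_cnf (map fst ?ps) (map snd ?ps)) \<longleftrightarrow> hash (map fst ?ps) x = map snd ?ps"
          by (rule satisfies_hash_cnf) auto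
        also have "\<dots> \<longleftrightarrow> (\<forall>q\<in>set ps. lparity (fst q) x = snd q)"
          using d by (auto simp: hash_def lparity_eq_parity split_beta)
        finally show ?thesis using fold_add_parity(2)[OF that] by (simp add: satisfies_append)
      qed
      thus ?thesis by (simp add: satisfiable_def solutions_def)
    qed
    show "((\<lambda>ps. if \<exists>S\<in>set (map fst ps). card S > k then False
                  else \<not> satisfiable n (F @ hash_cnf (map fst ps) (map snd ps))) \<circ> map (\<lambda>(vs, b). (set vs, b))) ps =
      (fst (fold (add_parity k) ps (True, F)) \<and> \<not> satisfiable n (snd (fold (add_parity k) ps (True, F))))"
      unfolding o_def len using sat by auto
  qed
  finally show ?thesis by (simp add: hash_list_def pmf.map_comp o_def split_beta)
qed

definition prog_round :: com where
  "prog_round = Seq (asn (EP e0 (EP (EN 1) r1))) (Seq prog_hash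
     (ite CEq e1 (EN 0) (asn (EN 0)) (Seq (ask (EP e4 e2)) (asn (ifz e0 (EN 1) (EN 0))))))"

lemma computes_round:
  fixes a m n k l F
  assumes am: "a \<le> m" "m > 0" and F: "cnf_over n F"
  defines "B \<equiv> 2 ^ k * (k + 1)"
  defines "p \<equiv> real a / real m"
  shows "computes sat_oracle prog_round (Pair (Num l) (Pair (enc_clauses F) (Pair (Num k) (Pair (Num n) (Pair (Num a) (Num m))))))
     (map_pmf enc_bool (acount_round (random_subset n p) n k F l))
     ((l + 1) * (500 * (n + 1) + 1000 * B) + (4 * (cnf_size n F + l * B) + 100))"
proof -
  note H = computes_hash[where k = k and l = l, OF am F, folded B_def p_def]
  have 2: "computes sat_oracle (ite CEq e1 (EN 0) (asn (EN 0)) (Seq (ask (EP e4 e2)) (asn (ifz e0 (EN 1) (EN 0)))))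
      (Pair (Num 0) (Pair (enc_bool (fst z)) (Pair (enc_clauses (snd z)) (Pair (Num k) (Pair (Num n) (Pair (Num a) (Num m)))))))
      (return_pmf (enc_bool (fst z \<and> \<not> satisfiable n (snd z)))) (4 * (cnf_size n F + l * B) + 80)"
    if "z \<in> set_pmf (hash_list n k p l F)" for z
  proof -
    obtain ok G where z: "z = (ok, G)" by force
    have G: "cnf_over n G" "cnf_size n G \<le> cnf_size n F + l * B"
      using H(2)[of ok G] that by (simp_all add: z)
    have size: "val_size (Pair (Num n) (enc_clauses G)) \<le> 3 + 4 * (cnf_size n F + l * B)"
    proof -
      have "3 + 4 * cnf_size n G \<le> 3 + 4 * (cnf_size n F + l * B)" using G(2) by simp
      with val_size_enc_cnf[of n G] show ?thesis unfolding enc_cnf_eq by (rule order_trans)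
    qed
    show ?thesis
    proof (rule computes_mono, rule computes_ite[where T = "4 * (cnf_size n F + l * B) + 60"], goal_cases)
      case 1
      thus ?case by (intro computes_cong[OF computes_asn]) (simp_all add: z)
    next
      case 2
      hence ok: "ok" by (simp add: z)
      show ?case
        by (rule computes_mono, rule computes_Seq_det[OF computes_ask], rule computes_asn_eq)
          (use size ok sat_oracle_enc_cnf[OF G(1)] in \<open>simp_all add: z enc_cnf_eq\<close>)
    qed simp
  qed
  have 1: "computes sat_oracle prog_hash
     (ev (EP e0 (EP (EN 1) r1)) (Pair (Num l) (Pair (enc_clauses F) (Pair (Num k) (Pair (Num n) (Pair (Num a) (Num m)))))))
     (map_pmf (\<lambda>z. Pair (Num 0) (Pair (enc_bool (fst z)) (Pair (enc_clauses (snd z)) (Pair (Num k) (Pair (Num n) (Pair (Num a) (Num m)))))))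
       (hash_list n k p l F)) ((l + 1) * (500 * (n + 1) + 1000 * B))"
    using H(1)[of sat_oracle] by simp
  show ?thesis unfolding hash_list_eq_round[symmetric] prog_round_def
    apply (rule computes_cong)
      apply (rule computes_Seq_det[OF computes_asn])
      apply (rule computes_Seq_map[OF 1])
      apply (rule 2, assumption)
     apply (simp add: map_pmf_def bind_assoc_pmf bind_return_pmf case_prod_unfold)
    apply simp
    done
qed

subsection \<open>The algorithm ACOUNT\<close>

definition prog_double :: com where
  "prog_double = Seq (asn (EP EV (EN 0)))
     (Seq (whl CLess (EN 0) e0 (asn (EP (EDec e0) (EInc (EInc r1))))) (asn r1))"

lemma computes_double: "computes orc prog_double (Num n) (return_pmf (Num (2 * n))) ((n + 1) * 40)"
proof -
  have fold: "fold (\<lambda>_ a. a + 2) zs a = a + 2 * length zs" for zs :: "unit list" and a :: nat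
    by (induction zs arbitrary: a) auto
  have "computes orc (whl CLess (EN 0) e0 (asn (EP (EDec e0) (EInc (EInc r1)))))
      (Pair (Num (length (replicate n ()))) (Num 0))
      (return_pmf (Pair (Num (length ([] :: unit list))) (Num (fold (\<lambda>_ a. a + 2) (replicate n ()) 0))))
      ((length (replicate n ()) + 1) * 20)"
    by (rule computes_for_asn[where \<phi> = "\<lambda>zs a. Pair (Num (length zs)) (Num a)"]) simp_all
  hence *: "computes orc (whl CLess (EN 0) e0 (asn (EP (EDec e0) (EInc (EInc r1)))))
      (Pair (Num n) (Num 0)) (return_pmf (Pair (Num 0) (Num (2 * n)))) ((n + 1) * 20)"
    unfolding fold by simp
  show ?thesis unfolding prog_double_def
    by (rule computes_mono, rule computes_Seq_det[OF computes_asn], simp, rule computes_Seq_det[OF *],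
        rule computes_asn_eq) simp_all
qed

text \<open>Lets the machine find the number of rounds without logarithms: it counts how often 1 can
  be doubled before reaching \<open>n\<close>.\<close>

lemma log_ceiling_iff:
  assumes "1 \<le> n"
  shows "i < nat \<lceil>log 2 (real n)\<rceil> \<longleftrightarrow> 2 ^ i < n"
proof -
  have "i < nat \<lceil>log 2 (real n)\<rceil> \<longleftrightarrow> real i < log 2 (real n)"
    by (simp add: zless_nat_eq_int_zless less_ceiling_iff)
  also have "\<dots> \<longleftrightarrow> 2 powr real i < real n"
    using assms by (simp add: less_log_iff)
  also have "\<dots> \<longleftrightarrow> 2 ^ i < n"
    by (simp add: powr_realpow flip: of_nat_less_iff)
  finally show ?thesis .
qed

definition prog_log :: com where
  "prog_log = Seq (asn (EP (EN 1) (EP (EN 0) (EP (EN 0) EV))))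
     (Seq (whl CLess e0 r3 (Seq (call prog_double e0)
        (asn (EP e0 (EP ((EInc ^^ 4) e2) (EP ((EInc ^^ 8) e3) r4))))))
     (asn (EP e1 e2)))"

lemma computes_log:
  assumes "1 \<le> n"
  defines "L \<equiv> nat \<lceil>log 2 (real n)\<rceil>"
  shows "computes orc prog_log (Num n) (return_pmf (Pair (Num (4 * L)) (Num (8 * L)))) ((L + 1) * (100 * (n + 1)))"
proof -
  define \<phi> where "\<phi> = (\<lambda>zs (i :: nat). Pair (Num (2 ^ i)) (Pair (Num (4 * i)) (Pair (Num (8 * i)) (Num (n + 0 * length (zs :: unit list))))))"
  have fold: "fold (\<lambda>_ a. Suc a) zs a = a + length zs" for zs :: "unit list" and a :: nat
    by (induction zs arbitrary: a) auto
  have L: "2 ^ i < n \<longleftrightarrow> i < L" for i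
    using log_ceiling_iff[OF assms(1)] by (simp add: L_def)
  have body: "computes orc (Seq (call prog_double e0)
        (asn (EP e0 (EP ((EInc ^^ 4) e2) (EP ((EInc ^^ 8) e3) r4))))) (\<phi> (z # zs) i)
      (return_pmf (\<phi> zs (Suc i))) (50 * (n + 1) + 40)" if "2 ^ i < n" for z zs i
  proof -
    have "computes orc prog_double (ev e0 (\<phi> (z # zs) i)) (return_pmf (Num (2 * 2 ^ i))) ((2 ^ i + 1) * 40)"
      using computes_double[of orc "2 ^ i"] by (simp add: \<phi>_def)
    note C = computes_call_det[OF this]
    show ?thesis
      by (rule computes_mono, rule computes_Seq_det[OF C], rule computes_asn_eq)
        (use that in \<open>simp_all add: \<phi>_def\<close>)
  qed
  have body': "computes orc (Seq (call prog_double e0)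
        (asn (EP e0 (EP ((EInc ^^ 4) e2) (EP ((EInc ^^ 8) e3) r4))))) (\<phi> (z # zs) i)
      (return_pmf (\<phi> zs (Suc i))) (50 * (n + 1) + 40)" if "i + length (z # zs) = L" for z zs i
    by (rule body) (use that L in simp)
  have "computes orc (whl CLess e0 r3 (Seq (call prog_double e0)
        (asn (EP e0 (EP ((EInc ^^ 4) e2) (EP ((EInc ^^ 8) e3) r4)))))) (\<phi> (replicate L ()) 0)
      (return_pmf (\<phi> [] (fold (\<lambda>_ a. Suc a) (replicate L ()) 0))) ((length (replicate L ()) + 1) * (90 * (n + 1)))"
    by (rule computes_for_det[where I = "\<lambda>zs i. i + length zs = L" and \<phi> = \<phi> and g = "\<lambda>_ i. Suc i", OF _ _ body'])
      (use assms(1) in \<open>simp_all add: \<phi>_def L\<close>)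
  hence *: "computes orc (whl CLess e0 r3 (Seq (call prog_double e0)
        (asn (EP e0 (EP ((EInc ^^ 4) e2) (EP ((EInc ^^ 8) e3) r4))))))
      (ev (EP (EN 1) (EP (EN 0) (EP (EN 0) EV))) (Num n))
      (return_pmf (\<phi> [] L)) ((L + 1) * (90 * (n + 1)))"
    unfolding fold by (simp add: \<phi>_def)
  have "computes orc prog_log (Num n) (return_pmf (Pair (Num (4 * L)) (Num (8 * L)))) (10 + ((L + 1) * (90 * (n + 1)) + 10))"
    unfolding prog_log_def
    apply (rule computes_mono)
     apply (rule computes_Seq_det[OF computes_asn])
     apply (rule computes_Seq_det)
      apply (rule computes_cong[OF *])
       apply (rule refl)
      apply (rule order_refl)
     apply (rule computes_asn_eq)
     apply (simp add: \<phi>_def)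
    apply simp
    done
  thus ?thesis by (rule computes_mono) (use assms(1) in \<open>simp add: algebra_simps\<close>)
qed

definition prog_level :: com where
  "prog_level = Seq (whl CLess (EN 0) e0
     (Seq (call prog_round r2) (asn (EP (EDec e1) (EP (ifz e0 e2 (EInc e2)) r3))))) (asn e1)"

lemma computes_level:
  assumes "\<And>v. v = Pair (Num l) w \<Longrightarrow> computes orc prog_round v (map_pmf enc_bool R) T"
  shows "computes orc prog_level (Pair (Num m) (Pair (Num 0) (Pair (Num l) w)))
     (map_pmf (\<lambda>rs. Num (count_list rs True)) (replicate_pmf m R)) ((m + 1) * (100 + T) + 10)"
proof -
  define \<phi> where "\<phi> = (\<lambda>(zs :: unit list) c. Pair (Num (length zs)) (Pair (Num c) (Pair (Num l) w)))"
  let ?h = "\<lambda>b c. if b then Suc c else c"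
  have fold: "fold ?h rs c = count_list rs True + c" for rs c
    by (induction rs arbitrary: c) auto
  have body: "computes orc (Seq (call prog_round r2) (asn (EP (EDec e1) (EP (ifz e0 e2 (EInc e2)) r3))))
      (\<phi> (z # zs) c) (map_pmf (\<phi> zs) (map_pmf (\<lambda>b. ?h b c) R)) (70 + T)" for z zs c
    unfolding pmf.map_comp
    by (rule computes_mono, rule computes_then_asn, rule computes_call_map, rule assms)
      (auto simp: \<phi>_def enc_bool_def)
  have "computes orc (whl CLess (EN 0) e0
     (Seq (call prog_round r2) (asn (EP (EDec e1) (EP (ifz e0 e2 (EInc e2)) r3)))))
     (\<phi> (replicate m ()) 0) (map_pmf (\<phi> []) (mfold (\<lambda>_ c. map_pmf (\<lambda>b. ?h b c) R) (replicate m ()) 0))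
     ((length (replicate m ()) + 1) * (100 + T))"
    by (rule computes_for_le[where I = "\<lambda>_ _. True", OF _ _ body]) (simp_all add: \<phi>_def)
  hence "computes orc (whl CLess (EN 0) e0
     (Seq (call prog_round r2) (asn (EP (EDec e1) (EP (ifz e0 e2 (EInc e2)) r3)))))
     (Pair (Num m) (Pair (Num 0) (Pair (Num l) w)))
     (map_pmf (\<lambda>rs. \<phi> [] (count_list rs True)) (replicate_pmf m R)) ((m + 1) * (100 + T))"
    unfolding mfold_replicate fold by (simp add: \<phi>_def pmf.map_comp o_def)
  from computes_then_asn[OF this, of e1 "\<lambda>rs. Num (count_list rs True)"] show ?thesis
    unfolding prog_level_def by (rule computes_mono) (simp_all add: \<phi>_def)
qed

text \<open>The least significant bit comes first, so doubling is prepending a zero, one step per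
  level.\<close>

primrec pow_val :: "nat \<Rightarrow> val" where
  "pow_val 0 = Pair (Num 1) (Num 0)"
| "pow_val (Suc i) = Pair (Num 0) (pow_val i)"

lemma bin_val_pow_val [simp]: "bin_val (pow_val i) = 2 ^ i"
  by (induction i) auto

text \<open>Needed because the machine returns values; \<open>bin_val\<close> maps this law to that
  of \<open>acount_loop\<close>.\<close>

primrec acount_vals :: "nat set pmf \<Rightarrow> nat \<Rightarrow> nat \<Rightarrow> cnf \<Rightarrow> nat list \<Rightarrow> val pmf" where
  "acount_vals D n k F [] = return_pmf (Num 0)"
| "acount_vals D n k F (l # ls) =
     bind_pmf (replicate_pmf (8 * nat \<lceil>log 2 n\<rceil>) (acount_round D n k F l)) (\<lambda>rs.
       if count_list rs True > 4 * nat \<lceil>log 2 n\<rceil> then return_pmf (pow_val (l - 1))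
       else acount_vals D n k F ls)"

lemma map_acount_vals: "map_pmf bin_val (acount_vals D n k F ls) = acount_loop D n k F ls"
  by (induction ls) (auto simp: map_bind_pmf intro!: bind_pmf_cong)

text \<open>The state of the main loop consists of the number of remaining levels, the current level
  \<open>l\<close>, the number \<open>2\<^sup>l\<^sup>-\<^sup>1\<close>, the two numbers of rounds, and the input of a round.\<close>

definition prog_levels :: com where
  "prog_levels = whl CLess (EN 0) e0
     (Seq (call prog_level (EP e4 (EP (EN 0) (EP e1 r5))))
          (asn (EIf CLess e4 e0 (EP (EN 0) e3)
             (EIf CLess (EN 1) e1 (EP (EDec e1) (EP (EInc e2) (EP (EP (EN 0) e3) r4))) (EP (EN 0) (EN 0))))))"

lemma computes_levels:
  fixes D n k F w
  defines "L \<equiv> nat \<lceil>log 2 (real n)\<rceil>"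
  defines "\<psi> \<equiv> \<lambda>m l. Pair (Num m) (Pair (Num l) (Pair (pow_val (l - 1)) (Pair (Num (4 * L)) (Pair (Num (8 * L)) w))))"
  assumes R: "\<And>l. l \<le> N \<Longrightarrow> computes orc prog_round (Pair (Num l) w) (map_pmf enc_bool (acount_round D n k F l)) T"
    and l: "1 \<le> l" "l + m \<le> N + 1" "m > 0"
  shows "computes orc prog_levels (\<psi> m l) (map_pmf (\<lambda>v. Pair (Num 0) v) (acount_vals D n k F [l..<l + m]))
     (m * (300 + ((8 * L + 1) * (100 + T))) + 10)"
  using l
proof (induction m arbitrary: l)
  case (Suc m)
  define P where "P = replicate_pmf (8 * L) (acount_round D n k F l)"
  define K where "K = (8 * L + 1) * (100 + T)"
  \<comment> \<open>A first component 0 ends the loop, with the output behind it. After the last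
    level the output is \<open>Num 0\<close>, which denotes 0.\<close>
  let ?next = "\<lambda>rs. if 4 * L < count_list rs True then Pair (Num 0) (pow_val (l - 1))
      else if 0 < m then \<psi> m (Suc l) else Pair (Num 0) (Num 0)"
  have pow: "pow_val l = Pair (Num 0) (pow_val (l - 1))" using Suc.prems(1) by (cases l) auto
  have "computes orc prog_level (ev (EP e4 (EP (EN 0) (EP e1 r5))) (\<psi> (Suc m) l))
      (map_pmf (\<lambda>rs. Num (count_list rs True)) P) (K + 10)"
    using computes_level[of l w orc "acount_round D n k F l" T "8 * L"] R[of l] Suc.prems
    by (simp add: P_def K_def \<psi>_def)
  note call = computes_call_map[OF this]
  have body: "computes orc (Seq (call prog_level (EP e4 (EP (EN 0) (EP e1 r5))))
          (asn (EIf CLess e4 e0 (EP (EN 0) e3)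
             (EIf CLess (EN 1) e1 (EP (EDec e1) (EP (EInc e2) (EP (EP (EN 0) e3) r4))) (EP (EN 0) (EN 0))))))
      (\<psi> (Suc m) l) (map_pmf ?next P) (200 + K)"
    by (rule computes_mono, rule computes_then_asn, rule call)
      (use Suc.prems(1) in \<open>auto simp: \<psi>_def pow\<close>)
  define q where "q = (\<lambda>rs. if 4 * L < count_list rs True then return_pmf (Pair (Num 0) (pow_val (l - 1)))
      else map_pmf (\<lambda>v. Pair (Num 0) v) (acount_vals D n k F [Suc l..<Suc l + m]))"
  have rest: "computes orc prog_levels (?next rs) (q rs) (m * (300 + K) + 10)" for rs
  proof -
    have stop: "computes orc prog_levels (Pair (Num 0) v) (return_pmf (Pair (Num 0) v)) (m * (300 + K) + 10)" for v
      unfolding prog_levels_def by (rule computes_mono[OF computes_whl_stop]) simp_all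
    consider "4 * L < count_list rs True" | "\<not> 4 * L < count_list rs True" "m = 0" | "\<not> 4 * L < count_list rs True" "0 < m"
      by auto
    thus ?thesis
    proof cases
      case 3
      thus ?thesis using Suc.IH[of "Suc l"] Suc.prems by (simp add: q_def K_def)
    qed (use stop in \<open>simp_all add: q_def\<close>)
  qed
  have "computes orc prog_levels (\<psi> (Suc m) l) (bind_pmf P q)
      (ecost (EN 0) + ecost e0 + 1 + (200 + K) + (m * (300 + K) + 10))"
    unfolding prog_levels_def
    by (rule computes_whl_step_map[OF _ body rest[unfolded prog_levels_def]]) (simp add: \<psi>_def)
  moreover have "bind_pmf P q = map_pmf (\<lambda>v. Pair (Num 0) v) (acount_vals D n k F [l..<l + Suc m])"
    by (simp add: upt_rec[of l] P_def q_def L_def map_bind_pmf if_distrib[of "map_pmf _"] cong: if_cong)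
  ultimately show ?case by (auto elim!: computes_mono simp: K_def)
qed simp

definition prog_acount :: com where
  "prog_acount =
     Seq (call prog_double e1)
    (Seq (call prog_log e2)
    (Seq (asn (EP (EInc e3) (EP (EN 1) (EP (EP (EN 1) (EN 0)) (EP (EFst e0) (EP (ESnd e0)
           (EP r4 (EP e2 (EP e3 (EP (EInc e2) e1))))))))))
    (Seq prog_levels (asn r1))))"

lemma computes_acount:
  fixes n k :: nat and F :: cnf
  assumes "cnf_over n F" "1 \<le> n" "k + 1 \<le> 2 * n"
  defines "L \<equiv> nat \<lceil>log 2 (real n)\<rceil>"
  defines "B \<equiv> 2 ^ k * (k + 1)"
  defines "T \<equiv> (n + 2) * (500 * (n + 1) + 1000 * B) + (4 * (cnf_size n F + (n + 1) * B) + 100)"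
  shows "computes sat_oracle prog_acount (acount_input n k F)
     (acount_vals (random_subset n ((real k + 1) / (2 * real n))) n k F [1..<n + 2])
     ((n + 1) * (300 + (8 * L + 1) * (100 + T)) + (L + 2) * (200 * (n + 1)))"
proof -
  let ?w = "Pair (enc_clauses F) (Pair (Num k) (Pair (Num n) (Pair (Num (k + 1)) (Num (2 * n)))))"
  let ?D = "random_subset n ((real k + 1) / (2 * real n))"
  have D: "?D = random_subset n (real (k + 1) / real (2 * n))" by (simp add: add.commute)
  define X where "X = (n + 1) * (300 + (8 * L + 1) * (100 + T))"
  have R: "computes sat_oracle prog_round (Pair (Num l) ?w) (map_pmf enc_bool (acount_round ?D n k F l)) T"
    if "l \<le> n + 1" for l
  proof (rule computes_mono)
    show "computes sat_oracle prog_round (Pair (Num l) ?w) (map_pmf enc_bool (acount_round ?D n k F l))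
       ((l + 1) * (500 * (n + 1) + 1000 * B) + (4 * (cnf_size n F + l * B) + 100))"
      unfolding D by (rule computes_round[of "k + 1" "2 * n" n F l k, folded B_def]) (use assms(1-3) in simp_all)
    show "(l + 1) * (500 * (n + 1) + 1000 * B) + (4 * (cnf_size n F + l * B) + 100) \<le> T"
    proof -
      have 1: "(l + 1) * (500 * (n + 1) + 1000 * B) \<le> (n + 2) * (500 * (n + 1) + 1000 * B)"
        by (rule mult_le_mono1) (use that in simp)
      have 2: "l * B \<le> (n + 1) * B"
        by (rule mult_le_mono1) (use that in simp)
      show ?thesis unfolding T_def by (rule add_le_mono[OF 1]) (use 2 in simp)
    qed
  qed
  have levels: "computes sat_oracle prog_levels
     (Pair (Num (n + 1)) (Pair (Num 1) (Pair (pow_val (1 - 1)) (Pair (Num (4 * L)) (Pair (Num (8 * L)) ?w)))))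
     (map_pmf (\<lambda>v. Pair (Num 0) v) (acount_vals ?D n k F [1..<1 + (n + 1)])) (X + 10)"
    using computes_levels[where N = "n + 1" and l = 1 and m = "n + 1", OF R] unfolding X_def L_def by simp
  define A where "A = map_pmf (\<lambda>v. Pair (Num 0) v) (acount_vals ?D n k F [1..<1 + (n + 1)])"
  let ?v = "acount_input n k F"
  have v: "?v = Pair (Num k) (Pair (Num n) (enc_clauses F))" by (simp add: acount_input_def enc_cnf_eq)
  have "computes sat_oracle prog_double (ev e1 ?v) (return_pmf (Num (2 * n))) ((n + 1) * 40)"
    using computes_double[of sat_oracle n] by (simp add: v)
  note c1 = computes_call_det[OF this]
  have "computes sat_oracle prog_log (ev e2 (Pair (Num (2 * n)) ?v)) (return_pmf (Pair (Num (4 * L)) (Num (8 * L))))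
      ((L + 1) * (100 * (n + 1)))"
    using computes_log[OF assms(2), of sat_oracle] by (simp add: v L_def)
  note c2 = computes_call_det[OF this]
  let ?e = "EP (EInc e3) (EP (EN 1) (EP (EP (EN 1) (EN 0)) (EP (EFst e0) (EP (ESnd e0)
           (EP r4 (EP e2 (EP e3 (EP (EInc e2) e1))))))))"
  have "computes sat_oracle prog_levels (ev ?e (Pair (Pair (Num (4 * L)) (Num (8 * L))) (Pair (Num (2 * n)) ?v))) A (X + 10)"
    using levels[folded A_def] by (simp add: v)
  note c3 = this[unfolded A_def]
  have "computes sat_oracle prog_acount ?v (map_pmf (\<lambda>v. v) (acount_vals ?D n k F [1..<1 + (n + 1)]))
     (10 + (n + 1) * 40 + (10 + (L + 1) * (100 * (n + 1)) + (60 + (X + 10 + 10))))"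
    unfolding prog_acount_def
    apply (rule computes_mono)
     apply (rule computes_Seq_det[OF c1])
     apply (rule computes_Seq_det[OF c2])
     apply (rule computes_Seq_det[OF computes_asn])
     apply (rule computes_then_asn[OF c3])
     apply simp
    apply simp
    done
  thus ?thesis
  proof (rule computes_cong)
    show "map_pmf (\<lambda>v. v) (acount_vals ?D n k F [1..<1 + (n + 1)]) = acount_vals ?D n k F [1..<n + 2]"
    proof -
      have "1 + (n + 1) = n + 2" by simp
      thus ?thesis by (simp only: map_pmf_ident)
    qed
    show "10 + (n + 1) * 40 + (10 + (L + 1) * (100 * (n + 1)) + (60 + (X + 10 + 10))) \<le>
        (n + 1) * (300 + (8 * L + 1) * (100 + T)) + (L + 2) * (200 * (n + 1))"
    proof -
      have "10 + N * 40 + (10 + (M + 1) * (100 * N) + (60 + (Y + 10 + 10))) \<le> Y + (M + 2) * (200 * N)"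
        if "1 \<le> N" for N M Y :: nat
        using that by (simp add: add_mult_distrib)
      from this[of "n + 1" L X] show ?thesis by (simp only: X_def le_add2)
    qed
  qed
qed

lemma implements_acount_prog: "implements_acount prog_acount"
  unfolding implements_acount_def
proof (intro allI impI)
  fix n k :: nat and F :: cnf
  assume "cnf_over n F \<and> 1 \<le> n \<and> k + 1 \<le> 2 * n"
  hence "map_spmf fst (run sat_oracle prog_acount (acount_input n k F)) =
      spmf_of_pmf (acount_vals (random_subset n ((real k + 1) / (2 * real n))) n k F [1..<n + 2])"
    using computes_run(1)[OF computes_acount] by blast
  hence "map_spmf bin_val (map_spmf fst (run sat_oracle prog_acount (acount_input n k F))) =
      spmf_of_pmf (map_pmf bin_val (acount_vals (random_subset n ((real k + 1) / (2 * real n))) n k F [1..<n + 2]))"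
    by (simp only: map_spmf_of_pmf)
  thus "map_spmf (\<lambda>(v, t). bin_val v) (run sat_oracle prog_acount (acount_input n k F)) = spmf_of_pmf (acount n k F)"
    by (simp only: map_acount_vals acount_def spmf.map_comp o_def case_prod_unfold)
qed

subsection \<open>Rounds\<close>

lemma finite_lists_bool: "finite {bs :: bool list. length bs = l}" "card {bs :: bool list. length bs = l} = 2 ^ l"
  using finite_lists_length_eq[of "UNIV :: bool set" l] card_lists_length_eq[of "UNIV :: bool set" l] by auto

lemma finite_solutions: "finite (solutions n F)" "card (solutions n F) \<le> 2 ^ n"
proof -
  have sub: "solutions n F \<subseteq> {bs. length bs = n}" by (auto simp: solutions_def)
  show "finite (solutions n F)" by (rule finite_subset[OF sub]) (rule finite_lists_bool)
  show "card (solutions n F) \<le> 2 ^ n" using card_mono[OF finite_lists_bool(1) sub] by (simp add: finite_lists_bool(2))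
qed

lemma pmf_True_E: "pmf p True = E p (\<lambda>b. of_bool b)"
proof -
  have eq: "{b. b} = {True}" by auto
  show ?thesis using prob_E[of p "\<lambda>b. b", unfolded eq measure_pmf_single] by simp
qed

lemma satisfiable_append_hash:
  assumes "\<And>S. S \<in> set Ss \<Longrightarrow> finite S" "length Ss = length bs"
  shows "satisfiable n (F @ hash_cnf Ss bs) \<longleftrightarrow> bs \<in> hash Ss ` solutions n F"
  using satisfies_hash_cnf[of Ss bs] assms
  by (auto simp: satisfiable_def solutions_def satisfies_append image_iff)

text \<open>Recording unsatisfiability implies that no solution satisfies all constraints, which
  Chebyshev's inequality bounds; oversized sets only prevent recordings.\<close>

lemma acount_round_le:
  assumes fin: "\<And>S. S \<in> set_pmf D \<Longrightarrow> finite S" and s: "solutions n F \<noteq> {}"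
  shows "pmf (acount_round D n k F l) True \<le> dispersion D parity (solutions n F) l - 1"
proof -
  let ?f = "\<lambda>ps. if \<exists>S\<in>set (map fst ps). card S > k then False
      else \<not> satisfiable n (F @ hash_cnf (map fst ps) (map snd ps))"
  have "pmf (acount_round D n k F l) True = measure_pmf.prob (hash_pmf D l) {ps. ?f ps}"
    unfolding acount_round_def bind_hash_pmf pmf_map by (rule arg_cong[where f = "measure_pmf.prob _"]) auto
  also have "\<dots> \<le> measure_pmf.prob (hash_pmf D l) {ps. hits parity (solutions n F) ps = 0}"
  proof (rule measure_pmf.finite_measure_mono_AE)
    show "AE ps in hash_pmf D l. ps \<in> {ps. ?f ps} \<longrightarrow> ps \<in> {ps. hits parity (solutions n F) ps = 0}"
      unfolding AE_measure_pmf_iff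
    proof (intro ballI impI)
      fix ps assume ps: "ps \<in> set_pmf (hash_pmf D l)" and "ps \<in> {ps. ?f ps}"
      hence f: "\<not> satisfiable n (F @ hash_cnf (map fst ps) (map snd ps))" by (simp split: if_splits)
      have "finite S" if "S \<in> set (map fst ps)" for S
        using that ps fin by (force simp: hash_pmf_def set_replicate_pmf)
      hence "map snd ps \<notin> hash (map fst ps) ` solutions n F"
        using f by (subst satisfiable_append_hash[symmetric]) auto
      hence "{x \<in> solutions n F. agree parity ps x} = {}"
        by (auto simp: agree_def hash_def image_iff)
      thus "ps \<in> {ps. hits parity (solutions n F) ps = 0}" by (simp only: hits_def card.empty mem_Collect_eq)
    qed
  qed simp
  also have "\<dots> \<le> dispersion D parity (solutions n F) l - 1"
    by (rule prob_no_hit[OF finite_solutions(1) s])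
  finally show ?thesis .
qed

text \<open>For fixed sets the hash function takes at most s <= 2^(l - 1) values on the solutions,
  so a uniform \<open>b\<close> misses all of them with probability at least 1/2. The choice of
  \<open>b\<close> is independent of the event that all sets are small, which has probability at
  least 1 - l \<pi>.\<close>

lemma acount_round_ge:
  assumes fin: "\<And>S. S \<in> set_pmf D \<Longrightarrow> finite S"
    and big: "measure_pmf.prob D {S. card S > k} \<le> \<pi>" "\<pi> \<le> 1"
    and s: "2 * card (solutions n F) \<le> 2 ^ l"
  shows "(1 - real l * \<pi>) / 2 \<le> pmf (acount_round D n k F l) True"
proof -
  let ?U = "pmf_of_set {bs :: bool list. length bs = l}"
  have ne: "{bs :: bool list. length bs = l} \<noteq> {}" by (auto intro: exI[of _ "replicate l True"])
  have unsat: "1 / 2 \<le> E ?U (\<lambda>bs. of_bool (\<not> satisfiable n (F @ hash_cnf Ss bs)))"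
    if Ss: "Ss \<in> set_pmf (replicate_pmf l D)" for Ss
  proof -
    let ?I = "{bs. length bs = l} \<inter> {bs. satisfiable n (F @ hash_cnf Ss bs)}"
    have len: "length Ss = l" "\<And>S. S \<in> set Ss \<Longrightarrow> finite S" using Ss fin by (auto simp: set_replicate_pmf)
    have "?I \<subseteq> hash Ss ` solutions n F"
      using satisfiable_append_hash[of Ss _ n F] len by auto
    hence "card ?I \<le> card (hash Ss ` solutions n F)"
      by (rule card_mono[OF finite_imageI[OF finite_solutions(1)]])
    also have "\<dots> \<le> card (solutions n F)" by (rule card_image_le[OF finite_solutions(1)])
    finally have "2 * card ?I \<le> 2 ^ l" using s by simp
    hence "real (2 * card ?I) \<le> real (2 ^ l)" by (simp only: of_nat_le_iff)
    moreover have "measure_pmf.prob ?U {bs. satisfiable n (F @ hash_cnf Ss bs)} = real (card ?I) / 2 ^ l"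
      using measure_pmf_of_set[OF ne finite_lists_bool(1)] by (simp add: finite_lists_bool(2))
    ultimately have "measure_pmf.prob ?U {bs. satisfiable n (F @ hash_cnf Ss bs)} \<le> 1 / 2"
      by (simp only:) (subst pos_divide_le_eq, auto)
    moreover have "measure_pmf.prob ?U {bs. \<not> satisfiable n (F @ hash_cnf Ss bs)} =
        1 - measure_pmf.prob ?U {bs. satisfiable n (F @ hash_cnf Ss bs)}"
      using measure_pmf.prob_compl[of "{bs. satisfiable n (F @ hash_cnf Ss bs)}" ?U]
      by (simp add: Compl_eq_Diff_UNIV[symmetric] Collect_neg_eq)
    ultimately show ?thesis unfolding prob_E[symmetric] by linarith
  qed
  have "(1 - real l * \<pi>) / 2 \<le> (1 - \<pi>) ^ l / 2"
    using Bernoulli_inequality[of "- \<pi>" l] big(2) by simp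
  also have "(1 - \<pi>) ^ l \<le> measure_pmf.prob D {S. \<not> card S > k} ^ l"
  proof (rule power_mono)
    show "1 - \<pi> \<le> measure_pmf.prob D {S. \<not> card S > k}"
      using measure_pmf.prob_compl[of "{S. card S > k}" D] big(1)
      by (simp add: Compl_eq_Diff_UNIV[symmetric] Collect_neg_eq[symmetric])
  qed (use big in simp)
  also have "measure_pmf.prob D {S. \<not> card S > k} ^ l / 2 =
      E (replicate_pmf l D) (\<lambda>Ss. of_bool (\<forall>S\<in>set Ss. \<not> card S > k) / 2)"
  proof -
    have "measure_pmf.prob D {S. \<not> card S > k} ^ l = E (replicate_pmf l D) (\<lambda>Ss. of_bool (\<forall>S\<in>set Ss. \<not> card S > k))"
      unfolding prob_E[symmetric] measure_replicate_all ..
    thus ?thesis by simp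
  qed
  also have "\<dots> \<le> E (replicate_pmf l D) (\<lambda>Ss. E (bind_pmf ?U (\<lambda>bs. return_pmf
         (if \<exists>S\<in>set Ss. card S > k then False else \<not> satisfiable n (F @ hash_cnf Ss bs)))) (\<lambda>b. of_bool b))"
  proof (rule E_mono)
    fix Ss assume Ss: "Ss \<in> set_pmf (replicate_pmf l D)"
    show "of_bool (\<forall>S\<in>set Ss. \<not> card S > k) / 2 \<le> E (bind_pmf ?U (\<lambda>bs. return_pmf
         (if \<exists>S\<in>set Ss. card S > k then False else \<not> satisfiable n (F @ hash_cnf Ss bs)))) (\<lambda>b. of_bool b)"
    proof (cases "\<exists>S\<in>set Ss. card S > k")
      case True
      thus ?thesis by (auto simp: E_nonneg)
    next
      case False
      thus ?thesis using unsat[OF Ss] by (subst E_bind[of _ 1]) auto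
    qed
  next
    show "\<bar>of_bool (\<forall>S\<in>set Ss. \<not> card S > k) / 2\<bar> \<le> (1 :: real)" for Ss :: "nat set list" by simp
    show "\<bar>E p (\<lambda>b. of_bool b)\<bar> \<le> 1" for p :: "bool pmf"
      using E_le[of "\<lambda>b. of_bool b" 1 p] E_nonneg[of "\<lambda>b. of_bool b" p] by (simp add: abs_of_nonneg)
  qed
  also have "\<dots> = pmf (acount_round D n k F l) True"
    unfolding pmf_True_E acount_round_def by (subst E_bind[of _ 1]) auto
  finally show ?thesis by simp
qed

subsection \<open>Independent inclusion\<close>

lemma random_subset_Suc:
  "random_subset (Suc n) p =
     bind_pmf (bernoulli_pmf p) (\<lambda>b. map_pmf (\<lambda>S. if b then insert n S else S) (random_subset n p))"
proof -
  have "map_pmf (\<lambda>f. {j. (f(n := b)) j}) (Pi_pmf {..<n} False (\<lambda>_. bernoulli_pmf p)) =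
      map_pmf (\<lambda>S. if b then insert n S else S) (random_subset n p)" for b
    unfolding random_subset_def pmf.map_comp
  proof (rule map_pmf_cong[OF refl])
    fix f assume "f \<in> set_pmf (Pi_pmf {..<n} False (\<lambda>_. bernoulli_pmf p))"
    hence "f n = False" by (auto simp: set_Pi_pmf PiE_dflt_def)
    thus "{j. (f(n := b)) j} = ((\<lambda>S. if b then insert n S else S) \<circ> (\<lambda>f. {j. f j})) f" by auto
  qed
  moreover have "random_subset (Suc n) p =
      bind_pmf (bernoulli_pmf p) (\<lambda>b. map_pmf (\<lambda>f. {j. (f(n := b)) j}) (Pi_pmf {..<n} False (\<lambda>_. bernoulli_pmf p)))"
    unfolding random_subset_def lessThan_Suc
    by (subst Pi_pmf_insert) (simp_all add: pair_pmf_def map_bind_pmf map_pmf_def bind_assoc_pmf bind_return_pmf)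
  ultimately show ?thesis by simp
qed

lemma set_random_subset: "S \<in> set_pmf (random_subset n p) \<Longrightarrow> S \<subseteq> {..<n}"
  by (auto simp: random_subset_def set_Pi_pmf PiE_dflt_def)

lemma finite_random_subset: "S \<in> set_pmf (random_subset n p) \<Longrightarrow> finite S"
  by (rule finite_subset[OF set_random_subset finite_lessThan])

lemma E_random_subset_Suc:
  assumes "0 \<le> p" "p \<le> 1" "\<And>S. 0 \<le> f S" "\<And>S. f S \<le> B"
  shows "E (random_subset (Suc n) p) f =
     p * E (random_subset n p) (\<lambda>S. f (insert n S)) + (1 - p) * E (random_subset n p) f"
  unfolding random_subset_Suc using assms by (subst E_bind[of _ B]) (auto simp: mult.commute)

lemma parity_insert: "finite S \<Longrightarrow> n \<notin> S \<Longrightarrow> parity (insert n S) x \<longleftrightarrow> (parity S x \<noteq> x ! n)"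
  unfolding parity_def by (subst sum.insert) (cases "x ! n"; simp)+

text \<open>Each coordinate where \<open>x\<close> and \<open>y\<close> differ multiplies the bias
  of the parity of their difference by 1 - 2 p; the other coordinates do not change it.\<close>

lemma collide_random_subset:
  assumes "0 \<le> p" "p \<le> 1"
  shows "2 * collide (random_subset n p) parity x y = 1 + (1 - 2 * p) ^ card {i. i < n \<and> x ! i \<noteq> y ! i}"
proof (induction n)
  case 0
  show ?case by (simp add: collide_def random_subset_def parity_def)
next
  case (Suc n)
  let ?D = "random_subset n p"
  let ?c = "collide ?D parity x y"
  have notin: "n \<notin> S" "finite S" if "S \<in> set_pmf ?D" for S
    using set_random_subset[OF that] finite_random_subset[OF that] by auto
  have c: "?c = E ?D (\<lambda>S. of_bool (parity S x = parity S y))"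
    by (simp only: collide_def prob_E)
  have 1: "E ?D (\<lambda>S. of_bool (parity (insert n S) x = parity (insert n S) y)) =
      (if x ! n = y ! n then ?c else 1 - ?c)"
  proof (cases "x ! n = y ! n")
    case True
    have "E ?D (\<lambda>S. of_bool (parity (insert n S) x = parity (insert n S) y)) =
        E ?D (\<lambda>S. of_bool (parity S x = parity S y))"
      by (rule integral_cong_AE) (use True notin in \<open>auto simp: AE_measure_pmf_iff parity_insert\<close>)
    thus ?thesis using True c by simp
  next
    case False
    have "E ?D (\<lambda>S. of_bool (parity (insert n S) x = parity (insert n S) y)) =
        E ?D (\<lambda>S. 1 - of_bool (parity S x = parity S y))"
      by (rule integral_cong_AE) (use False notin in \<open>auto simp: AE_measure_pmf_iff parity_insert\<close>)
    also have "\<dots> = 1 - E ?D (\<lambda>S. of_bool (parity S x = parity S y))"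
      by (subst Bochner_Integration.integral_diff) (auto intro!: integrable_bounded_pmf[of _ _ 1])
    finally show ?thesis using False c by simp
  qed
  have step: "collide (random_subset (Suc n) p) parity x y = p * (if x ! n = y ! n then ?c else 1 - ?c) + (1 - p) * ?c"
  proof -
    have "collide (random_subset (Suc n) p) parity x y = E (random_subset (Suc n) p) (\<lambda>S. of_bool (parity S x = parity S y))"
      by (simp only: collide_def prob_E)
    also have "\<dots> = p * E ?D (\<lambda>S. of_bool (parity (insert n S) x = parity (insert n S) y)) +
        (1 - p) * E ?D (\<lambda>S. of_bool (parity S x = parity S y))"
      by (rule E_random_subset_Suc[OF assms, of _ 1]) simp_all
    finally show ?thesis unfolding 1 c[symmetric] .
  qed
  have eq: "{i. i < Suc n \<and> x ! i \<noteq> y ! i} = (if x ! n = y ! n then {} else {n}) \<union> {i. i < n \<and> x ! i \<noteq> y ! i}"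
    by (auto simp: less_Suc_eq)
  show ?case
  proof (cases "x ! n = y ! n")
    case True
    hence "collide (random_subset (Suc n) p) parity x y = ?c" using step by (simp add: algebra_simps)
    thus ?thesis using Suc.IH True unfolding eq by simp
  next
    case False
    have "2 * collide (random_subset (Suc n) p) parity x y = 1 + (1 - 2 * p) * (2 * ?c - 1)"
      using step False by (simp add: algebra_simps)
    thus ?thesis using Suc.IH False unfolding eq by simp
  qed
qed

text \<open>The intersection with \<open>{..<n}\<close> is the identity on the support, but bounds
  the integrand on every set, as \<open>E_random_subset_Suc\<close> requires.\<close>

lemma E_two_power_card:
  assumes "0 \<le> p" "p \<le> 1" "m \<le> n"
  shows "E (random_subset m p) (\<lambda>S. 2 ^ card (S \<inter> {..<n})) = (1 + p) ^ m"
  using assms(3)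
proof (induction m)
  case 0
  show ?case by (simp add: random_subset_def)
next
  case (Suc m)
  let ?f = "\<lambda>S. 2 ^ card (S \<inter> {..<n}) :: real"
  have bounds: "0 \<le> ?f S" "?f S \<le> 2 ^ n" for S
    using card_mono[of "{..<n}" "S \<inter> {..<n}"] by simp_all
  have "?f (insert m S) = 2 * ?f S" if "S \<in> set_pmf (random_subset m p)" for S
  proof -
    have "m \<notin> S" using set_random_subset[OF that] by blast
    thus ?thesis using Suc.prems by (simp add: Int_insert_left)
  qed
  hence "E (random_subset m p) (\<lambda>S. ?f (insert m S)) = E (random_subset m p) (\<lambda>S. 2 * ?f S)"
    by (intro integral_cong_AE) (simp_all add: AE_measure_pmf_iff)
  also have "\<dots> = 2 * (1 + p) ^ m" using Suc by simp
  finally have 1: "E (random_subset m p) (\<lambda>S. ?f (insert m S)) = 2 * (1 + p) ^ m" .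
  have "E (random_subset (Suc m) p) ?f = p * E (random_subset m p) (\<lambda>S. ?f (insert m S)) + (1 - p) * E (random_subset m p) ?f"
    by (rule E_random_subset_Suc[OF assms(1,2) bounds])
  also have "\<dots> = p * (2 * (1 + p) ^ m) + (1 - p) * (1 + p) ^ m" unfolding 1 using Suc by simp
  also have "\<dots> = (1 + p) ^ Suc m" by (simp add: algebra_simps)
  finally show ?case .
qed

text \<open>Markov's inequality for 2^|S|, whose mean is (1 + p)^n <= exp (p n).\<close>

lemma prob_card_random_subset:
  assumes "0 \<le> p" "p \<le> 1"
  shows "measure_pmf.prob (random_subset n p) {S. card S > k} \<le> exp (p * real n) / 2 ^ (k + 1)"
proof -
  let ?f = "\<lambda>S. 2 ^ card (S \<inter> {..<n}) :: real"
  have pow: "(1 :: real) \<le> 2 ^ (k + 1)" by (rule one_le_power) simp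
  have div: "?f S / 2 ^ (k + 1) \<le> ?f S / 1" for S by (rule divide_left_mono[OF pow]) simp_all
  have f: "?f S \<le> 2 ^ n" for S using card_mono[of "{..<n}" "S \<inter> {..<n}"] by simp
  have "measure_pmf.prob (random_subset n p) {S. card S > k} = E (random_subset n p) (\<lambda>S. of_bool (card S > k))"
    by (rule prob_E)
  also have "\<dots> \<le> E (random_subset n p) (\<lambda>S. ?f S / 2 ^ (k + 1))"
  proof (rule E_mono[where B = "2 ^ n"])
    fix S assume "S \<in> set_pmf (random_subset n p)"
    hence S: "S \<inter> {..<n} = S" using set_random_subset[of S n p] by blast
    show "of_bool (card S > k) \<le> ?f S / 2 ^ (k + 1)"
    proof (cases "k < card S")
      case True
      have "(2 :: real) ^ (k + 1) \<le> 2 ^ card S" by (rule power_increasing) (use True in auto)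
      hence "1 \<le> (2 :: real) ^ card S / 2 ^ (k + 1)" by (subst pos_le_divide_eq) simp_all
      thus ?thesis using True S by (simp only: of_bool_eq)
    qed (simp only: of_bool_eq, simp)
  next
    show "\<bar>of_bool (card S > k)\<bar> \<le> (2 :: real) ^ n" for S :: "nat set" by simp
    show "\<bar>?f S / 2 ^ (k + 1)\<bar> \<le> 2 ^ n" for S
    proof -
      have "?f S / 2 ^ (k + 1) \<le> 2 ^ n" using order_trans[OF div[of S], of "2 ^ n"] f[of S] by simp
      moreover have "0 \<le> ?f S / 2 ^ (k + 1)" by simp
      ultimately show ?thesis by (simp only: abs_of_nonneg)
    qed
  qed
  also have "\<dots> = (1 + p) ^ n / 2 ^ (k + 1)" using E_two_power_card[OF assms order_refl] by simp
  also have "\<dots> \<le> exp p ^ n / 2 ^ (k + 1)"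
    using assms exp_ge_add_one_self[of p] by (intro divide_right_mono power_mono) simp_all
  also have "exp p ^ n = exp (p * real n)" using exp_of_nat_mult[of n p] by (simp only: mult.commute)
  finally show ?thesis .
qed

subsection \<open>Hamming balls\<close>

text \<open>Chernoff's method: t^(d - r) >= 1 for a distance d < r since t <= 1, and t^d sums to (1
  + t)^n over the cube.\<close>

lemma card_near_le:
  fixes t r :: real
  assumes t: "0 < t" "t \<le> 1" and x: "length x = n" and S: "S \<subseteq> {y. length y = n}"
  shows "real (card {y\<in>S. real (hdist x y) < r}) \<le> (1 + t) ^ n * t powr (- r)"
proof -
  let ?A = "{y :: bool list. length y = length x}"
  have fin: "finite ?A" by (rule finite_lists_bool)
  have sub: "{y\<in>S. real (hdist x y) < r} \<subseteq> {y\<in>?A. real (hdist x y) < r}" using S x by auto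
  have "real (card {y\<in>S. real (hdist x y) < r}) \<le> real (card {y\<in>?A. real (hdist x y) < r})"
    using card_mono[OF _ sub] fin by simp
  also have "\<dots> = (\<Sum>y\<in>?A. of_bool (real (hdist x y) < r))"
  proof -
    have "?A \<inter> {y. real (hdist x y) < r} = {y\<in>?A. real (hdist x y) < r}" by auto
    thus ?thesis using fin by simp
  qed
  also have "\<dots> \<le> (\<Sum>y\<in>?A. t ^ hdist x y * t powr (- r))"
  proof (rule sum_mono)
    fix y
    show "of_bool (real (hdist x y) < r) \<le> t ^ hdist x y * t powr (- r)"
    proof (cases "real (hdist x y) < r")
      case True
      have "1 \<le> t powr (real (hdist x y) - r)"
        using t True powr_mono'[of "real (hdist x y) - r" 0 t] by simp
      also have "\<dots> = t ^ hdist x y * t powr (- r)"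
        using t by (simp add: powr_diff powr_minus powr_realpow divide_inverse)
      finally show ?thesis using True by simp
    qed (use t in simp)
  qed
  also have "\<dots> = (\<Sum>y\<in>?A. t ^ hdist x y * 1 ^ (length x - hdist x y)) * t powr (- r)"
    by (simp add: sum_distrib_right)
  also have "\<dots> = (1 + t) ^ n * t powr (- r)"
    unfolding sum_hdist by (simp add: x add.commute)
  finally show ?thesis .
qed

lemma exp_le_1_plus_2: "0 \<le> x \<Longrightarrow> x \<le> 1 / 2 \<Longrightarrow> exp x \<le> 1 + 2 * (x :: real)"
proof -
  assume x: "0 \<le> x" "x \<le> 1 / 2"
  have "exp x \<le> 1 + x + x\<^sup>2" by (rule exp_bound) (use x in auto)
  also have "x\<^sup>2 \<le> 1 * x" unfolding power2_eq_square by (rule mult_right_mono) (use x in auto)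
  finally show ?thesis by simp
qed

text \<open>Follows from e < 2.72 and 2.72^20 <= 2^29. The form is chosen for the consequence 2 / ln
  2 <= 29 / 10.\<close>

lemma ln2_ge: "20 / 29 \<le> ln (2 :: real)"
proof -
  have "exp 1 ^ 20 \<le> (272 / 100 :: real) ^ 20"
    by (rule power_mono) (use e_less_272 in auto)
  also have "\<dots> \<le> 2 ^ 29" by (simp add: power_divide)
  finally have "exp 20 \<le> (2 :: real) ^ 29" by (simp flip: exp_of_nat_mult)
  hence "ln (exp 20) \<le> ln ((2 :: real) ^ 29)" by (subst ln_le_cancel_iff) auto
  also have "\<dots> = real 29 * ln 2" by (rule ln_realpow)
  finally show ?thesis by simp
qed

subsection \<open>The success probability of ACOUNT\<close>

text \<open>As p n = (k + 1) / 2, the tail bound is exp (1/2 - ln 2) to the power k + 1, and k + 1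
  >= 4 log w with w = 16 n turns it into w to the power 2 / ln 2 - 4 < - 11 / 10. One factor 1 / w
  compensates for the n + 1 sets; the remaining power -1/10 outweighs the logarithm in the first
  claim, which is the hypothesis of \<open>majority_ge_quarter\<close>.\<close>

lemma oversize_bound:
  fixes n k :: nat
  defines "p \<equiv> (real k + 1) / (2 * real n)"
  assumes n: "37 \<le> n" and k: "4 * log 2 (16 * real n) \<le> real k + 1" "k + 1 \<le> n"
  defines "\<pi> \<equiv> measure_pmf.prob (random_subset n p) {S. card S > k}"
  shows "((real n + 1) * \<pi>)\<^sup>2 * (log 2 (real n) + 1) \<le> 105 / 10000" "(real n + 1) * \<pi> \<le> 1"
proof -
  define w where "w = 16 * real n"
  have w: "w > 1" "w \<ge> 592" using n by (simp_all add: w_def)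
  have p: "0 \<le> p" "p \<le> 1" using k n by (simp_all add: p_def field_simps)
  have "\<pi> \<le> exp (p * real n) / 2 ^ (k + 1)"
    unfolding \<pi>_def by (rule prob_card_random_subset[OF p])
  also have "\<dots> = exp ((real k + 1) * (1 / 2 - ln 2))"
  proof -
    have "p * real n = (real k + 1) / 2" using n by (simp add: p_def)
    moreover have "(2 :: real) ^ (k + 1) = exp ((real k + 1) * ln 2)"
      by (subst powr_realpow[symmetric]) (simp_all add: powr_def add.commute)
    ultimately show ?thesis by (simp add: right_diff_distrib exp_diff)
  qed
  also have "\<dots> \<le> exp (4 * log 2 w * (1 / 2 - ln 2))"
  proof -
    have "1 / 2 - ln (2 :: real) \<le> 0" using ln2_ge by simp
    hence "(real k + 1) * (1 / 2 - ln 2) \<le> 4 * log 2 w * (1 / 2 - ln 2)"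
      using k(1) by (intro mult_right_mono_neg) (simp_all add: w_def)
    thus ?thesis by simp
  qed
  also have "4 * log 2 w * (1 / 2 - ln 2) = ln w * (2 / ln 2 - 4)"
    by (simp add: log_def field_simps)
  also have "exp \<dots> \<le> exp (ln w * (- 11 / 10))"
  proof -
    have "2 / ln (2 :: real) \<le> 29 / 10" using ln2_ge by (simp add: field_simps)
    hence "2 / ln (2 :: real) - 4 \<le> - 11 / 10" by simp
    hence "ln w * (2 / ln 2 - 4) \<le> ln w * (- 11 / 10)" using w by (intro mult_left_mono) auto
    thus ?thesis by (simp only: exp_le_cancel_iff)
  qed
  finally have \<pi>: "\<pi> \<le> exp (ln w * (- 11 / 10))" .
  define u where "u = exp (ln w * (- 1 / 10))"
  have u: "0 < u" "u \<le> 1" using w by (simp_all add: u_def)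
  have "exp (ln w * (- 11 / 10)) = u / w"
  proof -
    have "ln w * (- 11 / 10) = ln w * (- 1 / 10) - ln w" by simp
    hence "exp (ln w * (- 11 / 10)) = exp (ln w * (- 1 / 10)) / exp (ln w)" by (simp only: exp_diff)
    thus ?thesis using w by (simp add: u_def)
  qed
  with \<pi> have "(real n + 1) * \<pi> \<le> (real n + 1) * (u / w)" by (intro mult_left_mono) auto
  also have "\<dots> = (real n + 1) / w * u" by simp
  \<comment> \<open>On n >= 37 the quotient (n + 1) / (16 n) is largest at n = 37, where it is 38 /
    592.\<close>
  also have "\<dots> \<le> 6419 / 100000 * u + 0"
    using n u by (intro add_increasing2 mult_right_mono) (simp_all add: w_def field_simps)
  finally have A: "(real n + 1) * \<pi> \<le> 642 / 10000 * u" using u by simp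
  have A0: "0 \<le> (real n + 1) * \<pi>" by (simp add: \<pi>_def)
  show "(real n + 1) * \<pi> \<le> 1" using A u by simp
  define z where "z = log 2 (real n) + 1"
  have z: "z > 0" using n by (simp add: z_def add_nonneg_pos)
  have lw: "ln w = ln 2 * (z + 3)"
  proof -
    have "ln (16 :: real) = 4 * ln 2" using ln_realpow[of "2 :: real" 4] by simp
    hence "ln w = 4 * ln 2 + ln (real n)" using n by (simp add: w_def ln_mult)
    thus ?thesis by (simp add: z_def log_def field_simps)
  qed
  \<comment> \<open>Here u^2 is 1 / (2^(3/5) * 2^(z/5)); the first factor is at least 3/2 because
    (3/2)^5 <= 8, and 2 x <= exp x bounds the second from below by 4 z / 15.\<close>
  have "u\<^sup>2 * z \<le> 5 / 2"
  proof -
    have e2: "2 * x \<le> exp x" for x :: real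
    proof -
      have "1 + (x - ln 2) \<le> exp (x - ln 2)" by (rule exp_ge_add_one_self)
      also have "\<dots> = exp x / 2" by (simp add: exp_diff)
      finally show ?thesis using ln_2_less_1 by simp
    qed
    have "u\<^sup>2 = exp (- (ln w / 5))" unfolding u_def power2_eq_square by (simp flip: exp_add)
    also have "ln w / 5 = 3 * ln 2 / 5 + z * ln 2 / 5" unfolding lw by (simp add: algebra_simps)
    finally have u2: "u\<^sup>2 * (exp (3 * ln 2 / 5) * exp (z * ln 2 / 5)) = 1"
      by (simp flip: exp_add)
    have "3 / 2 \<le> exp (3 * ln 2 / 5 :: real)"
    proof -
      have "(3 / 2) ^ 5 \<le> exp (3 * ln 2 / 5 :: real) ^ 5"
      proof -
        have "exp (3 * ln 2 / 5 :: real) ^ 5 = exp (3 * ln 2)"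
          using exp_of_nat_mult[of 5 "3 * ln 2 / 5 :: real"] by simp
        also have "\<dots> = exp (ln 2) ^ 3" using exp_of_nat_mult[of 3 "ln 2 :: real"] by simp
        finally show ?thesis by (simp add: power_divide)
      qed
      thus ?thesis by (subst (asm) power_mono_iff) auto
    qed
    moreover have "4 / 15 * z \<le> exp (z * ln 2 / 5)"
    proof -
      have "4 / 15 * z \<le> 2 * (z * ln 2 / 5)" using ln2_ge z by (simp add: field_simps)
      also have "\<dots> \<le> exp (z * ln 2 / 5)" by (rule e2)
      finally show ?thesis .
    qed
    ultimately have "3 / 2 * (4 / 15 * z) \<le> exp (3 * ln 2 / 5) * exp (z * ln 2 / 5)"
      using z by (intro mult_mono) auto
    hence "u\<^sup>2 * (3 / 2 * (4 / 15 * z)) \<le> u\<^sup>2 * (exp (3 * ln 2 / 5) * exp (z * ln 2 / 5))"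
      by (rule mult_left_mono) simp
    thus ?thesis unfolding u2 by simp
  qed
  have "((real n + 1) * \<pi>)\<^sup>2 * z \<le> (642 / 10000 * u)\<^sup>2 * z"
    using A A0 z by (intro mult_right_mono power_mono) auto
  also have "\<dots> = (642 / 10000)\<^sup>2 * (u\<^sup>2 * z)" by (simp only: power_mult_distrib mult.assoc)
  also have "\<dots> \<le> (642 / 10000)\<^sup>2 * (5 / 2)" by (rule mult_left_mono[OF \<open>u\<^sup>2 * z \<le> 5 / 2\<close>]) simp
  also have "\<dots> \<le> 105 / 10000" by (simp add: power2_eq_square)
  finally show "((real n + 1) * \<pi>)\<^sup>2 * (log 2 (real n) + 1) \<le> 105 / 10000" by (simp add: z_def)
qed

text \<open>With a = 4 L >= 24 the tie has probability at most 1 / sqrt 73 < 0.118, the second-order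
  loss is at most 0.021 and the first-order loss at most 0.12; (1 - 0.118) / 2 - 0.021 - 0.12 is
  exactly 3/10. The surplus over 1/4 pays for wrong stops at earlier levels.\<close>

lemma majority_ge_quarter:
  assumes L: "6 \<le> L" and \<epsilon>: "0 \<le> \<epsilon>" "\<epsilon> \<le> 1" "\<epsilon>\<^sup>2 * real L \<le> 105 / 10000" and p: "(1 - \<epsilon>) / 2 \<le> pmf p True"
  shows "3 / 10 \<le> measure_pmf.prob (replicate_pmf (8 * L) p) {rs. 4 * L < count_list rs True}"
proof -
  define a where "a = 4 * L"
  define b where "b = real (2 * a choose a) / 4 ^ a"
  have b: "b\<^sup>2 * (3 * real a + 1) \<le> 1" "0 \<le> b" using central_binomial_le[of a] by (simp_all add: b_def)
  have a: "real a = 4 * real L" "24 \<le> real a" using L by (simp_all add: a_def)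
  have "b\<^sup>2 * 73 \<le> b\<^sup>2 * (3 * real a + 1)" using a by (intro mult_left_mono) auto
  hence "b\<^sup>2 \<le> 1 / 73" using b by simp
  hence "b\<^sup>2 \<le> (118 / 1000)\<^sup>2" by (simp add: power2_eq_square)
  hence b': "b \<le> 118 / 1000" by (rule power2_le_imp_le) simp
  have "\<epsilon>\<^sup>2 * real a \<le> 42 / 1000" using \<epsilon>(3) by (simp add: a)
  moreover have "(\<epsilon> * real a * b)\<^sup>2 = (\<epsilon>\<^sup>2 * real a) * (b\<^sup>2 * real a)" by (simp add: power2_eq_square)
  moreover have "b\<^sup>2 * real a \<le> 1 / 3"
  proof -
    have "b\<^sup>2 * (3 * real a) \<le> b\<^sup>2 * (3 * real a + 1)" by (intro mult_left_mono) auto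
    thus ?thesis using b(1) by simp
  qed
  ultimately have "(\<epsilon> * real a * b)\<^sup>2 \<le> 42 / 1000 * (1 / 3)"
    using \<epsilon> by (simp only:) (rule mult_mono, auto)
  hence "(\<epsilon> * real a * b)\<^sup>2 \<le> (12 / 100)\<^sup>2" by (simp add: power2_eq_square)
  hence x: "\<epsilon> * real a * b \<le> 12 / 100" by (rule power2_le_imp_le) simp
  have "(1 - b) / 2 - real a * \<epsilon>\<^sup>2 / 2 - \<epsilon> * real a * b \<le>
      measure_pmf.prob (replicate_pmf (2 * a) p) {rs. a < count_list rs True}"
    unfolding b_def by (rule majority_ge[OF p \<epsilon>(1,2)])
  moreover have "2 * a = 8 * L" by (simp add: a_def)
  ultimately have "(1 - b) / 2 - real a * \<epsilon>\<^sup>2 / 2 - \<epsilon> * real a * b \<le>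
      measure_pmf.prob (replicate_pmf (8 * L) p) {rs. 4 * L < count_list rs True}" by (simp only: a_def)
  moreover have "real a * \<epsilon>\<^sup>2 \<le> 42 / 1000" using \<epsilon>(3) by (simp add: a mult.commute)
  moreover have "(1 - b) / 2 - Y / 2 - Z \<le> P \<Longrightarrow> Y \<le> 42 / 1000 \<Longrightarrow> b \<le> 118 / 1000 \<Longrightarrow> Z \<le> 12 / 100 \<Longrightarrow> 3 / 10 \<le> P"
    for b Y Z P :: real by argo
  ultimately show ?thesis using b' x by blast
qed

text \<open>The distance \<rho> n separates near from far pairs, and each kind contributes at most
  1/32 beyond 1. The ball of radius \<rho> n has at most 2^(3 n / (4 \<kappa>)) points, whereas 2^j
  / s is at most 2^(- n / \<kappa>) / 2, so the near pairs leave a factor 2^(- n / (4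
  \<kappa>)).\<close>

lemma dispersion_random_subset:
  fixes n k j :: nat and \<kappa> :: real and F :: cnf
  defines "p \<equiv> (real k + 1) / (2 * real n)"
  defines "S \<equiv> solutions n F"
  assumes n: "37 \<le> n" and k: "k + 1 \<le> n" and S: "S \<noteq> {}"
    and \<kappa>: "1 < \<kappa>" "real k + 1 = \<kappa> * log 2 (512 * \<kappa>) * (4 * log 2 (16 * real n))"
    and j: "2 ^ j \<le> 2 powr (- real n / \<kappa>) * real (card S) / 2"
  shows "dispersion (random_subset n p) parity S j \<le> 1 + 1 / 16"
proof -
  define lam where "lam = log 2 (512 * \<kappa>)"
  define w where "w = 16 * real n"
  define y where "y = log 2 w"
  \<comment> \<open>Chosen such that 2 p r = \<rho> (k + 1) = 2 y for the radius r = \<rho> n. The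
    bias of far pairs is then at most exp (- 2 y) <= 1 / w^2, small even after multiplication by j
    <= n.\<close>
  define \<rho> where "\<rho> = 1 / (2 * \<kappa> * lam)"
  define r where "r = \<rho> * real n"
  define \<tau> where "\<tau> = exp (- 2 * y)"
  have w: "w \<ge> 592" using n by (simp add: w_def)
  have nine: "9 = log 2 (512 :: real)" using log_pow_cancel[of "2 :: real" 9] by simp
  have lam: "9 \<le> lam" unfolding nine lam_def using \<kappa> by (subst log_le_cancel_iff) auto
  have y: "9 \<le> y" unfolding nine y_def using w by (subst log_le_cancel_iff) auto
  have p: "0 \<le> p" "2 * p \<le> 1" "p \<le> 1" using k n by (simp_all add: p_def field_simps)
  have \<rho>: "0 < \<rho>" "\<rho> \<le> 1"
  proof -
    have "1 * 9 \<le> \<kappa> * lam" using \<kappa> lam by (intro mult_mono) auto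
    thus "0 < \<rho>" "\<rho> \<le> 1" by (simp_all add: \<rho>_def field_simps)
  qed
  have fin: "finite S" unfolding S_def by (rule finite_solutions)
  have len: "length x = n" if "x \<in> S" for x using that by (simp add: S_def solutions_def)
  have s: "0 < real (card S)" using S fin by (simp add: card_gt_0_iff)
  have disp: "dispersion (random_subset n p) parity S j \<le>
      (1 + \<tau>) ^ j + ((1 + \<rho>) ^ n * \<rho> powr (- r)) * 2 ^ j / real (card S)"
  proof (rule dispersion_le[OF fin S, where near = "\<lambda>x y. real (hdist x y) < r"])
    fix x z assume x: "x \<in> S" "z \<in> S" and far: "\<not> real (hdist x z) < r"
    have "2 * collide (random_subset n p) parity x z = 1 + (1 - 2 * p) ^ hdist x z"
      using collide_random_subset[OF p(1,3)] len[OF x(1)] by (simp add: hdist_def)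
    also have "(1 - 2 * p) ^ hdist x z \<le> exp (- (2 * p)) ^ hdist x z"
      using p exp_ge_add_one_self[of "- (2 * p)"] by (intro power_mono) auto
    also have "\<dots> = exp (real (hdist x z) * - (2 * p))" by (rule exp_of_nat_mult[symmetric])
    also have "\<dots> \<le> exp (r * - (2 * p))"
      using far p by (simp add: mult_right_mono)
    also have "r * - (2 * p) = - 2 * y"
    proof -
      have "r * (2 * p) = \<rho> * (real k + 1)" using n by (simp add: r_def p_def)
      also have "\<dots> = 2 * y" unfolding \<kappa>(2) \<rho>_def y_def w_def lam_def[symmetric] using \<kappa> lam by simp
      finally show ?thesis by simp
    qed
    finally show "2 * collide (random_subset n p) parity x z \<le> 1 + \<tau>" by (simp add: \<tau>_def)
  next
    fix x assume "x \<in> S"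
    show "real (card {z \<in> S. real (hdist x z) < r}) \<le> (1 + \<rho>) ^ n * \<rho> powr (- r)"
      by (rule card_near_le[OF \<rho> len[OF \<open>x \<in> S\<close>]]) (use len in auto)
  qed (simp add: \<tau>_def)
  have far: "(1 + \<tau>) ^ j \<le> 1 + 1 / 32"
  proof -
    have "(2 :: real) ^ j \<le> 1 * real (card S) / 1"
    proof -
      have "2 powr (- real n / \<kappa>) \<le> 1" using \<kappa> powr_mono[of "- real n / \<kappa>" 0 2] by (simp add: divide_nonpos_pos)
      hence "2 powr (- real n / \<kappa>) * real (card S) / 2 \<le> 1 * real (card S) / 1"
        by (intro frac_le mult_right_mono) auto
      with j show ?thesis by linarith
    qed
    also have "\<dots> \<le> 2 ^ n" using finite_solutions(2)[of n F] by (simp add: S_def)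
    finally have jn: "j \<le> n" by simp
    have "\<tau> \<le> 1 / w\<^sup>2"
    proof -
      have "ln w \<le> y" unfolding y_def log_def using w ln_2_less_1 by (simp add: field_simps)
      hence "\<tau> \<le> exp (- (2 * ln w))" by (simp add: \<tau>_def)
      also have "\<dots> = 1 / w\<^sup>2" using w by (simp add: exp_minus exp_double divide_inverse)
      finally show ?thesis .
    qed
    hence "real j * \<tau> \<le> real n * (1 / w\<^sup>2)" using jn by (intro mult_mono) (auto simp: \<tau>_def)
    also have "\<dots> = 1 / (256 * real n)" using n by (simp add: w_def power2_eq_square)
    also have "\<dots> \<le> 1 / 64" using n by (intro divide_left_mono) auto
    finally have jt: "real j * \<tau> \<le> 1 / 64" .
    have "(1 + \<tau>) ^ j \<le> exp \<tau> ^ j"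
      by (intro power_mono) (auto simp: \<tau>_def add.commute exp_ge_add_one_self intro: add_nonneg_nonneg)
    also have "\<dots> = exp (real j * \<tau>)" by (rule exp_of_nat_mult[symmetric])
    also have "\<dots> \<le> 1 + 2 * (real j * \<tau>)"
      by (rule exp_le_1_plus_2) (use jt in \<open>auto simp: \<tau>_def\<close>)
    finally show ?thesis using jt by simp
  qed
  have near: "((1 + \<rho>) ^ n * \<rho> powr (- r)) * 2 ^ j / real (card S) \<le> 1 / 32"
  proof -
    have "((1 + \<rho>) ^ n * \<rho> powr (- r)) * 2 ^ j / real (card S) \<le>
        (exp r * exp (r * ln (2 * \<kappa> * lam))) * (2 powr (- real n / \<kappa>) * real (card S) / 2) / real (card S)"
    proof (intro divide_right_mono mult_mono j)
      have "(1 + \<rho>) ^ n \<le> exp \<rho> ^ n"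
        using \<rho> by (intro power_mono) (auto simp: add.commute exp_ge_add_one_self)
      also have "\<dots> = exp r" by (simp add: r_def mult.commute flip: exp_of_nat_mult)
      finally show "(1 + \<rho>) ^ n \<le> exp r" .
      have "ln \<rho> = - ln (2 * \<kappa> * lam)" unfolding \<rho>_def using \<kappa> lam by (simp add: ln_div)
      thus "\<rho> powr (- r) \<le> exp (r * ln (2 * \<kappa> * lam))" using \<rho> by (simp add: powr_def)
    qed auto
    also have "\<dots> = exp (r * (1 + ln (2 * \<kappa> * lam)) - real n / \<kappa> * ln 2) / 2"
    proof -
      have "exp A * (exp (- B) * c / 2) / c = exp (A - B) / 2" if "0 < c" for A B c :: real
      proof -
        have "exp (A - B) = exp A * exp (- B)" by (simp flip: exp_add)
        thus ?thesis using that by simp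
      qed
      from this[OF s, of "r * (1 + ln (2 * \<kappa> * lam))" "real n / \<kappa> * ln 2"] show ?thesis
        by (simp add: powr_def distrib_left exp_add)
    qed
    also have "\<dots> \<le> exp (- (4 * ln 2)) / 2"
    proof -
      have "ln (2 * \<kappa> * lam) = ln (2 * \<kappa>) + ln lam" using \<kappa> lam by (simp add: ln_mult)
      \<comment> \<open>The constant 512 exceeds the 2 in 1 / \<rho> by a factor 2^8; the slack 8 ln
        2 absorbs the summand 1 that stems from (1 + \<rho>)^n.\<close>
      moreover have "ln (2 * \<kappa>) = lam * ln 2 - 8 * ln 2"
      proof -
        have "ln (256 :: real) = 8 * ln 2" using ln_realpow[of "2 :: real" 8] by simp
        moreover have "ln (512 * \<kappa>) = ln (256 * (2 * \<kappa>))" by simp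
        moreover have "\<dots> = ln 256 + ln (2 * \<kappa>)" using \<kappa> by (subst ln_mult) auto
        ultimately show ?thesis using \<kappa> by (simp add: lam_def log_def)
      qed
      moreover have "ln lam \<le> lam / 3"
      proof -
        have "ln (lam / 9) \<le> lam / 9 - 1" by (rule ln_le_minus_one) (use lam in simp)
        moreover have "ln (lam / 9) = ln lam - ln 9" using lam by (simp add: ln_div)
        moreover have "ln (9 :: real) \<le> 8 / 3"
        proof -
          have "(9 :: real) \<le> (1 + 1 / 3) ^ 8" by (simp add: power_divide)
          also have "\<dots> \<le> exp (1 / 3) ^ 8"
            using exp_ge_add_one_self[of "1 / 3"] by (intro power_mono) auto
          also have "\<dots> = exp (8 / 3)" by (simp flip: exp_of_nat_mult)
          finally have "ln 9 \<le> ln (exp (8 / 3 :: real))" by (subst ln_le_cancel_iff) auto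
          thus ?thesis by simp
        qed
        ultimately show ?thesis using lam by simp
      qed
      moreover have "lam * (2 / 3) \<le> lam * ln 2" using ln2_ge lam by (intro mult_left_mono) auto
      moreover have "1 \<le> 8 * ln (2 :: real)" using ln2_ge by simp
      ultimately have "1 + ln (2 * \<kappa> * lam) \<le> 3 / 2 * (lam * ln 2)" by linarith
      hence "r * (1 + ln (2 * \<kappa> * lam)) \<le> r * (3 / 2 * (lam * ln 2))"
        using \<rho> by (intro mult_left_mono) (auto simp: r_def)
      also have "\<dots> = 3 / 4 * (real n / \<kappa> * ln 2)" using \<kappa> lam by (simp add: r_def \<rho>_def)
      finally have 1: "r * (1 + ln (2 * \<kappa> * lam)) - real n / \<kappa> * ln 2 \<le> - (1 / 4 * (real n / \<kappa> * ln 2))" by simp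
      \<comment> \<open>The bound k + 1 <= n makes n / \<kappa> large, much more than the 16 needed
        for the factor 2^-4.\<close>
      have "9 * (4 * 9) \<le> lam * (4 * y)" using lam y by (intro mult_mono) auto
      also have "\<dots> = (real k + 1) / \<kappa>" unfolding \<kappa>(2) y_def w_def lam_def using \<kappa> by simp
      also have "\<dots> \<le> real n / \<kappa>" using k \<kappa> by (intro divide_right_mono) auto
      finally have "16 * ln 2 \<le> real n / \<kappa> * ln 2" by (intro mult_right_mono) auto
      with 1 have "r * (1 + ln (2 * \<kappa> * lam)) - real n / \<kappa> * ln 2 \<le> - (4 * ln 2)" by argo
      thus ?thesis by simp
    qed
    also have "exp (- (4 * ln 2)) / 2 = (1 / 32 :: real)"
    proof -
      have "exp (4 * ln 2 :: real) = exp (ln 2) ^ 4" using exp_of_nat_mult[of 4 "ln 2 :: real"] by simp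
      thus ?thesis by (simp add: exp_minus)
    qed
    finally show ?thesis .
  qed
  from disp far near show ?thesis by linarith
qed

text \<open>The condition says (16 n)^4 <= 2^n. Up to 36 this fails, and four intervals from a to b
  with 2^b < (16 a)^4 exhaust these numbers.\<close>

lemma log_bound_37:
  assumes "4 * log 2 (16 * real n) \<le> real n" "1 \<le> n"
  shows "37 \<le> n"
proof (rule ccontr)
  assume "\<not> 37 \<le> n"
  have step: "2 ^ n < (16 * n) ^ 4" if "a \<le> n" "n \<le> b" "(2 :: nat) ^ b < (16 * a) ^ 4" for a b
  proof -
    have "(2 :: nat) ^ n \<le> 2 ^ b" using that by (intro power_increasing) auto
    also note that(3)
    also have "(16 * a) ^ 4 \<le> (16 * n) ^ 4" using that by (intro power_mono) auto
    finally show ?thesis .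
  qed
  consider "1 \<le> n" "n \<le> 15" | "16 \<le> n" "n \<le> 31" | "32 \<le> n" "n \<le> 35" | "36 \<le> n" "n \<le> 36"
    using assms(2) \<open>\<not> 37 \<le> n\<close> by linarith
  hence "2 ^ n < (16 * n) ^ 4"
  proof cases
    case 1 thus ?thesis by (rule step) simp
  next
    case 2 thus ?thesis by (rule step) simp
  next
    case 3 thus ?thesis by (rule step) simp
  next
    case 4 thus ?thesis by (rule step) simp
  qed
  hence "real (2 ^ n) < real ((16 * n) ^ 4)" by (simp only: of_nat_less_iff)
  hence "log 2 (2 ^ n) < log 2 ((16 * real n) ^ 4)" by (subst log_less_cancel_iff) (use assms in auto)
  moreover have "log 2 ((16 * real n) ^ 4) = real 4 * log 2 (16 * real n)" by (rule log_nat_power) (use assms(2) in simp)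
  ultimately have "real n < 4 * log 2 (16 * real n)" by simp
  thus False using assms(1) by simp
qed

lemma upt_split:
  assumes "a \<le> l" "l < b"
  shows "[a..<b] = [a..<l] @ l # [Suc l..<b]"
proof -
  have "[a..<l + (b - l)] = [a..<l] @ [l..<l + (b - l)]" by (rule upt_add_eq_append[OF assms(1)])
  thus ?thesis using assms(2) by (simp add: upt_conv_Cons)
qed

text \<open>The algorithm is right if it stops at the first level \<open>l\<close> with \<open>2\<^sup>l \<ge> 2 s\<close>, or at an earlier
  level that is not too small.\<close>

lemma acount_loop_success:
  fixes n k :: nat and F :: cnf and \<gamma> :: real
  defines "s \<equiv> card (solutions n F)"
  defines "L \<equiv> nat \<lceil>log 2 (real n)\<rceil>"
  defines "G \<equiv> {r. 1 / 4 * \<gamma> * real s \<le> real r \<and> real r \<le> 4 * real s}"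
  assumes s: "0 < s" and n: "2 \<le> n" and \<gamma>: "\<gamma> \<le> 1"
    and maj: "\<And>l. 2 * s \<le> 2 ^ l \<Longrightarrow> l \<le> n + 1 \<Longrightarrow>
      \<beta> \<le> measure_pmf.prob (replicate_pmf (8 * L) (acount_round D n k F l)) {rs. 4 * L < count_list rs True}"
    and low: "\<And>j. 1 \<le> j \<Longrightarrow> 2 ^ j \<le> \<gamma> * real s / 2 \<Longrightarrow> pmf (acount_round D n k F j) True \<le> 1 / 16"
  shows "\<beta> - 1 / 2 ^ (7 * L) \<le> measure_pmf.prob (acount_loop D n k F [1..<n + 2]) G"
proof -
  define l where "l = (LEAST l. 2 * s \<le> 2 ^ l)"
  have sn: "2 * s \<le> 2 ^ (n + 1)" using finite_solutions(2)[of n F] by (simp add: s_def)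
  have l: "2 * s \<le> 2 ^ l" "l \<le> n + 1"
    unfolding l_def using sn by (rule LeastI, intro Least_le)
  have l1: "1 \<le> l"
  proof (rule ccontr)
    assume "\<not> 1 \<le> l"
    hence "l = 0" by simp
    thus False using l(1) s by simp
  qed
  have below: "2 ^ j < 2 * s" if "j < l" for j
    using not_less_Least[OF that[unfolded l_def]] by simp
  have up: "real (2 ^ (j - 1)) \<le> 4 * real s" if "j \<le> l" "1 \<le> j" for j
  proof -
    have "2 ^ (j - 1) < 2 * s" by (rule below) (use that in simp)
    hence "2 ^ (j - 1) \<le> 4 * s" by simp
    hence "real (2 ^ (j - 1)) \<le> real (4 * s)" by (simp only: of_nat_le_iff)
    thus ?thesis by simp
  qed
  have eq: "[1..<n + 2] = [1..<l] @ l # [Suc l..<n + 2]"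
    by (rule upt_split) (use l l1 in auto)
  have "\<beta> - real (length [1..<l]) * (1 / 2 ^ (8 * L)) \<le> measure_pmf.prob (acount_loop D n k F ([1..<l] @ l # [Suc l..<n + 2])) G"
    unfolding L_def
  proof (rule acount_loop_ge)
    have "2 * s \<le> 2 * 2 ^ (l - 1)" using l l1 by (cases l) auto
    hence "real s \<le> real (2 ^ (l - 1))" by (simp only: of_nat_le_iff)
    moreover have "1 / 4 * \<gamma> * real s \<le> 1 * real s" using \<gamma> by (intro mult_right_mono) auto
    ultimately have "1 / 4 * \<gamma> * real s \<le> real (2 ^ (l - 1))" by (simp only: mult_1)
    thus "2 ^ (l - 1) \<in> G" unfolding G_def using up[OF order_refl l1] by (simp only: mem_Collect_eq)
    show "\<beta> \<le> measure_pmf.prob (replicate_pmf (8 * nat \<lceil>log 2 (real n)\<rceil>) (acount_round D n k F l))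
        {rs. 4 * nat \<lceil>log 2 (real n)\<rceil> < count_list rs True}"
      using maj[OF l] by (simp only: L_def)
    fix j assume j: "j \<in> set [1..<l]"
    hence j1: "1 \<le> j" "j \<le> l" by auto
    show "2 ^ (j - 1) \<in> G \<or> measure_pmf.prob (replicate_pmf (8 * nat \<lceil>log 2 (real n)\<rceil>) (acount_round D n k F j))
        {rs. 4 * nat \<lceil>log 2 (real n)\<rceil> < count_list rs True} \<le> 1 / 2 ^ (8 * nat \<lceil>log 2 (real n)\<rceil>)"
    proof (cases "1 / 4 * \<gamma> * real s \<le> real (2 ^ (j - 1))")
      case True
      thus ?thesis using up[OF j1(2,1)] by (simp add: G_def)
    next
      \<comment> \<open>An output below \<gamma> s / 4 belongs to a level with 2^j <= \<gamma> s /
        2, where rounds rarely record unsatisfiability.\<close>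
      case False
      have "(2 :: real) ^ j = 2 * 2 ^ (j - 1)" using j1 by (cases j) auto
      hence "2 ^ j \<le> \<gamma> * real s / 2" using False by simp
      from majority_le[OF low[OF j1(1) this]] show ?thesis by blast
    qed
  qed simp
  moreover have "real (length [1..<l]) * (1 / 2 ^ (8 * L)) \<le> 1 / 2 ^ (7 * L)"
  proof -
    have "length [1..<l] \<le> n" using l by simp
    also have "n \<le> 2 ^ L"
      using log_ceiling_iff[of n L] n unfolding L_def by simp
    finally have "real (length [1..<l]) \<le> real (2 ^ L)" by (simp only: of_nat_le_iff)
    hence "real (length [1..<l]) \<le> 2 ^ L" by simp
    hence "real (length [1..<l]) * (1 / 2 ^ (8 * L)) \<le> 2 ^ L * (1 / 2 ^ (8 * L))"
      by (rule mult_right_mono) simp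
    also have "\<dots> = 1 / 2 ^ (7 * L)"
    proof -
      have "(2 :: real) ^ (8 * L) = 2 ^ L * 2 ^ (7 * L)" by (simp flip: power_add)
      thus ?thesis by simp
    qed
    finally show ?thesis .
  qed
  ultimately show ?thesis unfolding eq by linarith
qed

lemma acount_success:
  fixes n k :: nat and \<kappa> :: real and F :: cnf
  defines "s \<equiv> card (solutions n F)"
  assumes s: "0 < s" and k: "4 * log 2 (16 * real n) \<le> real k + 1" "k + 1 \<le> n"
    and \<kappa>: "0 < \<kappa>" "real k + 1 = \<kappa> * log 2 (512 * \<kappa>) * (4 * log 2 (16 * real n))"
  shows "1 / 4 \<le> measure_pmf.prob (acount n k F)
     {r. 1 / 4 * 2 powr (- real n / \<kappa>) * real s \<le> real r \<and> real r \<le> 4 * real s}"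
proof -
  have n: "37 \<le> n" by (rule log_bound_37) (use k in linarith)+
  define L where "L = nat \<lceil>log 2 (real n)\<rceil>"
  define p where "p = (real k + 1) / (2 * real n)"
  define \<pi> where "\<pi> = measure_pmf.prob (random_subset n p) {S. card S > k}"
  have L6: "6 \<le> L" using log_ceiling_iff[of n 5] n by (simp add: L_def)
  have L: "real L \<le> log 2 (real n) + 1" unfolding L_def using n by (simp add: of_nat_nat)
  note over = oversize_bound[OF n k, folded p_def, folded \<pi>_def]
  have \<pi>: "0 \<le> \<pi>" "\<pi> \<le> 1" by (simp_all add: \<pi>_def)
  have S: "solutions n F \<noteq> {}" using s by (auto simp: s_def)
  have "3 / 10 - 1 / 2 ^ (7 * L) \<le> measure_pmf.prob (acount_loop (random_subset n p) n k F [1..<n + 2])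
      {r. 1 / 4 * 2 powr (- real n / \<kappa>) * real (card (solutions n F)) \<le> real r \<and> real r \<le> 4 * real (card (solutions n F))}"
    unfolding L_def
  proof (rule acount_loop_success)
    show "0 < card (solutions n F)" using s by (simp add: s_def)
    show "2 \<le> n" using n by simp
    show "2 powr (- real n / \<kappa>) \<le> 1"
      using \<kappa> powr_mono[of "- real n / \<kappa>" 0 2] by (simp add: divide_nonpos_pos)
  next
    fix l assume l: "2 * card (solutions n F) \<le> 2 ^ l" "l \<le> n + 1"
    show "3 / 10 \<le> measure_pmf.prob (replicate_pmf (8 * nat \<lceil>log 2 (real n)\<rceil>) (acount_round (random_subset n p) n k F l))
        {rs. 4 * nat \<lceil>log 2 (real n)\<rceil> < count_list rs True}"
      unfolding L_def[symmetric]
    proof (rule majority_ge_quarter[OF L6])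
      show "0 \<le> (real n + 1) * \<pi>" "(real n + 1) * \<pi> \<le> 1" using over \<pi> by simp_all
      have "((real n + 1) * \<pi>)\<^sup>2 * real L \<le> ((real n + 1) * \<pi>)\<^sup>2 * (log 2 (real n) + 1)"
        by (rule mult_left_mono[OF L]) simp
      thus "((real n + 1) * \<pi>)\<^sup>2 * real L \<le> 105 / 10000" using over(1) by linarith
      have "real l * \<pi> \<le> (real n + 1) * \<pi>" using l \<pi> by (intro mult_right_mono) auto
      hence "(1 - (real n + 1) * \<pi>) / 2 \<le> (1 - real l * \<pi>) / 2" by simp
      also have "\<dots> \<le> pmf (acount_round (random_subset n p) n k F l) True"
        by (rule acount_round_ge[OF finite_random_subset _ _ l(1)]) (use \<pi> in \<open>simp_all add: \<pi>_def\<close>)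
      finally show "(1 - (real n + 1) * \<pi>) / 2 \<le> pmf (acount_round (random_subset n p) n k F l) True" .
    qed
  next
    fix j :: nat assume j: "1 \<le> j" "2 ^ j \<le> 2 powr (- real n / \<kappa>) * real (card (solutions n F)) / 2"
    show "pmf (acount_round (random_subset n p) n k F j) True \<le> 1 / 16"
    proof (cases "1 < \<kappa>")
      case True
      have "dispersion (random_subset n p) parity (solutions n F) j \<le> 1 + 1 / 16"
        unfolding p_def by (rule dispersion_random_subset[OF n k(2) S True \<kappa>(2) j(2)])
      moreover have "pmf (acount_round (random_subset n p) n k F j) True \<le>
          dispersion (random_subset n p) parity (solutions n F) j - 1"
        by (rule acount_round_le[OF finite_random_subset S])
      ultimately show ?thesis by linarith
    next
      \<comment> \<open>For \<kappa> <= 1 the number 2^(- n / \<kappa>) s is at most 1, so no level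
        is as low as assumed.\<close>
      case False
      have "real n \<le> real n / \<kappa>" using mult_left_le[of \<kappa> "real n"] False \<kappa>(1) by (simp add: pos_le_divide_eq mult.commute)
      hence "2 powr (- real n / \<kappa>) \<le> 2 powr (- real n)" by (intro powr_mono) auto
      hence "2 powr (- real n / \<kappa>) * real (card (solutions n F)) \<le> 2 powr (- real n) * 2 ^ n"
        using finite_solutions(2)[of n F] by (intro mult_mono) auto
      also have "\<dots> = 1" by (simp add: powr_minus powr_realpow)
      finally have "(2 :: real) ^ j \<le> 1 / 2" using j(2) by linarith
      moreover have "(1 :: real) \<le> 2 ^ j" by simp
      ultimately show ?thesis by linarith
    qed
  qed
  moreover have "1 / 2 ^ (7 * L) \<le> (1 / 20 :: real)"
  proof -
    have "(2 :: real) ^ 5 \<le> 2 ^ (7 * L)" using L6 by (intro power_increasing) auto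
    thus ?thesis by (simp add: field_simps)
  qed
  ultimately show ?thesis unfolding acount_def p_def s_def by linarith
qed

subsection \<open>Uniform k-subsets\<close>

text \<open>The \<open>k\<close>-th elementary symmetric polynomial. At signs it depends only on how
  many of them are -1, and is a Krawtchouk polynomial in that number.\<close>

definition esym :: "(nat \<Rightarrow> real) \<Rightarrow> nat set \<Rightarrow> nat \<Rightarrow> real" where
  "esym y A k = (\<Sum>S | S \<subseteq> A \<and> card S = k. \<Prod>j\<in>S. y j)"

text \<open>Double counting: a set with a marked element corresponds to the set without it and an
  element outside.\<close>

lemma sum_subset_element:
  fixes h :: "nat set \<Rightarrow> nat \<Rightarrow> real"
  assumes "finite A"
  shows "(\<Sum>T | T \<subseteq> A \<and> card T = Suc m. \<Sum>j\<in>T. h T j) =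
     (\<Sum>S | S \<subseteq> A \<and> card S = m. \<Sum>j\<in>A - S. h (insert j S) j)"
proof -
  have fin: "finite {S. S \<subseteq> A \<and> card S = m}" for m
    by (rule finite_subset[of _ "Pow A"]) (use assms in auto)
  have fT: "finite T" if "T \<subseteq> A" for T using that assms finite_subset by blast
  have "(\<Sum>T | T \<subseteq> A \<and> card T = Suc m. \<Sum>j\<in>T. h T j) =
      (\<Sum>(T, j)\<in>Sigma {T. T \<subseteq> A \<and> card T = Suc m} (\<lambda>T. T). h T j)"
    using fin fT by (subst sum.Sigma) auto
  also have "\<dots> = (\<Sum>(S, j)\<in>Sigma {S. S \<subseteq> A \<and> card S = m} (\<lambda>S. A - S). h (insert j S) j)"
    by (rule sum.reindex_bij_witness[of _ "\<lambda>(S, j). (insert j S, j)" "\<lambda>(T, j). (T - {j}, j)"])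
      (use fT in \<open>auto simp: insert_absorb\<close>)
  also have "\<dots> = (\<Sum>S | S \<subseteq> A \<and> card S = m. \<Sum>j\<in>A - S. h (insert j S) j)"
    using fin assms by (subst sum.Sigma) auto
  finally show ?thesis .
qed

text \<open>The recurrence of Krawtchouk polynomials. Multiply by the sum of all y_j: for j outside
  S a set of size m + 2 arises, in m + 2 ways; for j in S the square y_j^2 = 1 cancels and a set of
  size m remains, in |A| - m ways.\<close>

lemma esym_rec:
  assumes A: "finite A" and y: "\<And>j. j \<in> A \<Longrightarrow> y j * y j = 1"
  shows "real (Suc (Suc m)) * esym y A (Suc (Suc m)) =
     (\<Sum>j\<in>A. y j) * esym y A (Suc m) - (real (card A) - real m) * esym y A m"
proof -
  have fT: "finite T" if "T \<subseteq> A" for T using that A finite_subset by blast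
  have up: "real (Suc (Suc m)) * esym y A (Suc (Suc m)) =
      (\<Sum>S | S \<subseteq> A \<and> card S = Suc m. \<Sum>j\<in>A - S. y j * (\<Prod>i\<in>S. y i))"
  proof -
    have "real (Suc (Suc m)) * esym y A (Suc (Suc m)) =
        (\<Sum>T | T \<subseteq> A \<and> card T = Suc (Suc m). \<Sum>j\<in>T. (\<Prod>i\<in>T. y i))"
      unfolding esym_def sum_distrib_left by (intro sum.cong refl) simp
    also have "\<dots> = (\<Sum>S | S \<subseteq> A \<and> card S = Suc m. \<Sum>j\<in>A - S. (\<Prod>i\<in>insert j S. y i))"
      by (rule sum_subset_element[OF A])
    finally show ?thesis using fT by (auto intro!: sum.cong)
  qed
  have down: "(real (card A) - real m) * esym y A m =
      (\<Sum>T | T \<subseteq> A \<and> card T = Suc m. \<Sum>j\<in>T. y j * (\<Prod>i\<in>T. y i))"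
  proof -
    have "(\<Sum>T | T \<subseteq> A \<and> card T = Suc m. \<Sum>j\<in>T. y j * (\<Prod>i\<in>T. y i)) =
        (\<Sum>S | S \<subseteq> A \<and> card S = m. \<Sum>j\<in>A - S. y j * (\<Prod>i\<in>insert j S. y i))"
      by (rule sum_subset_element[OF A])
    also have "\<dots> = (\<Sum>S | S \<subseteq> A \<and> card S = m. \<Sum>j\<in>A - S. \<Prod>i\<in>S. y i)"
    proof (intro sum.cong refl)
      fix S j assume "S \<in> {S. S \<subseteq> A \<and> card S = m}" "j \<in> A - S"
      hence "y j * (\<Prod>i\<in>insert j S. y i) = (y j * y j) * (\<Prod>i\<in>S. y i)" using fT by simp
      moreover have "y j * y j = 1" using y \<open>j \<in> A - S\<close> by auto
      ultimately show "y j * (\<Prod>i\<in>insert j S. y i) = (\<Prod>i\<in>S. y i)" by simp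
    qed
    also have "\<dots> = (\<Sum>S | S \<subseteq> A \<and> card S = m. (real (card A) - real m) * (\<Prod>i\<in>S. y i))"
    proof (intro sum.cong refl)
      fix S assume "S \<in> {S. S \<subseteq> A \<and> card S = m}"
      hence S: "S \<subseteq> A" "card S = m" "card S \<le> card A" using A card_mono by auto
      hence "real (card (A - S)) = real (card A) - real m" using fT by (simp add: card_Diff_subset of_nat_diff)
      thus "(\<Sum>j\<in>A - S. \<Prod>i\<in>S. y i) = (real (card A) - real m) * (\<Prod>i\<in>S. y i)" by simp
    qed
    finally show ?thesis by (simp add: esym_def sum_distrib_left)
  qed
  have "(\<Sum>j\<in>A. y j) * esym y A (Suc m) =
      (\<Sum>S | S \<subseteq> A \<and> card S = Suc m. \<Sum>j\<in>A. y j * (\<Prod>i\<in>S. y i))"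
    unfolding esym_def by (subst sum_distrib_left) (simp only: sum_distrib_right)
  also have "\<dots> = (\<Sum>S | S \<subseteq> A \<and> card S = Suc m.
      (\<Sum>j\<in>A - S. y j * (\<Prod>i\<in>S. y i)) + (\<Sum>j\<in>S. y j * (\<Prod>i\<in>S. y i)))"
    by (intro sum.cong refl sum.subset_diff) (use A in auto)
  finally show ?thesis unfolding sum.distrib up[symmetric] down[symmetric] by simp
qed

text \<open>In the recurrence both summands are at most B^k, the second because |A| <= B^2; dividing
  by k >= 2 closes the induction.\<close>

lemma esym_bound:
  assumes A: "finite A" and y: "\<And>j. j \<in> A \<Longrightarrow> y j * y j = 1"
    and B: "\<bar>\<Sum>j\<in>A. y j\<bar> \<le> B" "real (card A) \<le> B\<^sup>2"
  shows "k \<le> card A \<Longrightarrow> \<bar>esym y A k\<bar> \<le> B ^ k"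
proof (induction k rule: less_induct)
  case (less k)
  have B0: "0 \<le> B" using B(1) by linarith
  consider "k = 0" | "k = 1" | m where "k = Suc (Suc m)" by (metis One_nat_def not0_implies_Suc)
  thus ?case
  proof cases
    case 1
    have "{S. S \<subseteq> A \<and> card S = 0} = {{}}" using A finite_subset by fastforce
    thus ?thesis using 1 by (simp add: esym_def)
  next
    case 2
    have "{S. S \<subseteq> A \<and> card S = 1} = (\<lambda>j. {j}) ` A" by (auto simp: card_1_singleton_iff)
    hence "esym y A 1 = (\<Sum>j\<in>A. y j)" unfolding esym_def by (simp add: sum.reindex inj_on_def)
    thus ?thesis using 2 B by simp
  next
    case (3 m)
    have 1: "\<bar>esym y A (Suc m)\<bar> \<le> B ^ Suc m" "\<bar>esym y A m\<bar> \<le> B ^ m"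
      using less.IH[of "Suc m"] less.IH[of m] less.prems 3 by simp_all
    have m: "0 \<le> real (card A) - real m" "real (card A) - real m \<le> B\<^sup>2" using less.prems 3 B by auto
    have r: "real (Suc (Suc m)) * esym y A (Suc (Suc m)) =
        (\<Sum>j\<in>A. y j) * esym y A (Suc m) - (real (card A) - real m) * esym y A m"
      by (rule esym_rec[OF A]) (rule y)
    have "\<bar>real (Suc (Suc m)) * esym y A (Suc (Suc m))\<bar> \<le>
        \<bar>(\<Sum>j\<in>A. y j) * esym y A (Suc m)\<bar> + \<bar>(real (card A) - real m) * esym y A m\<bar>"
      unfolding r by (rule abs_triangle_ineq4)
    also have "\<dots> \<le> B * B ^ Suc m + B\<^sup>2 * B ^ m"
      unfolding abs_mult using 1 m B B0 by (intro add_mono mult_mono) auto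
    also have "\<dots> = 2 * B ^ k" by (simp add: 3 power2_eq_square)
    also have "\<dots> \<le> real (Suc (Suc m)) * B ^ k" using B0 by (intro mult_right_mono) auto
    finally have "real (Suc (Suc m)) * \<bar>esym y A k\<bar> \<le> real (Suc (Suc m)) * B ^ k" by (simp add: abs_mult 3)
    thus ?thesis by (simp del: of_nat_Suc)
  qed
qed

section \<open>Collisions and unbalanced pairs for uniform k-subsets\<close>

lemma subsets_card_k:
  assumes "k \<le> n"
  shows "finite {S. S \<subseteq> {..<n} \<and> card S = k}" "{S. S \<subseteq> {..<n} \<and> card S = k} \<noteq> {}"
    "card {S. S \<subseteq> {..<n} \<and> card S = k} = n choose k"
proof -
  show 1: "finite {S. S \<subseteq> {..<n} \<and> card S = k}" by (rule finite_subset[of _ "Pow {..<n}"]) auto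
  show 2: "card {S. S \<subseteq> {..<n} \<and> card S = k} = n choose k"
    using n_subsets[of "{..<n}" k] by simp
  have "0 < n choose k" using assms by (rule zero_less_binomial)
  thus "{S. S \<subseteq> {..<n} \<and> card S = k} \<noteq> {}" using 2 by (metis card.empty less_irrefl)
qed

lemma set_random_k_subset: "k \<le> n \<Longrightarrow> S \<in> set_pmf (random_k_subset n k) \<Longrightarrow> finite S \<and> card S = k"
  unfolding random_k_subset_def using subsets_card_k[of k n] by (auto intro: finite_subset)

text \<open>With a sign -1 for every differing coordinate, the product of the signs over a set is 1
  if its parity does not separate the points and -1 otherwise.\<close>

lemma collide_random_k_subset:
  assumes k: "k \<le> n"
  shows "2 * collide (random_k_subset n k) parity x z =
    1 + esym (\<lambda>j. if x ! j \<noteq> z ! j then -1 else 1) {..<n} k / real (n choose k)"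
proof -
  let ?P = "{S. S \<subseteq> {..<n} \<and> card S = k}"
  note P = subsets_card_k[OF k]
  let ?y = "\<lambda>j. if x ! j \<noteq> z ! j then -1 else (1 :: real)"
  have sgn: "(\<Prod>j\<in>S. ?y j) = 2 * of_bool (parity S x = parity S z) - 1" if "finite S" for S
    using that
  proof (induction S)
    case empty
    show ?case by (simp add: parity_def)
  next
    case (insert j S)
    show ?case using insert by (cases "x ! j"; cases "z ! j") (auto simp: parity_insert)
  qed
  have "esym ?y {..<n} k = (\<Sum>S\<in>?P. 2 * of_bool (parity S x = parity S z) - 1)"
    unfolding esym_def by (intro sum.cong refl sgn) (auto intro: finite_subset)
  also have "\<dots> = 2 * (\<Sum>S\<in>?P. of_bool (parity S x = parity S z)) - real (card ?P)"
    by (simp add: sum_subtractf sum_distrib_left)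
  finally have e: "esym ?y {..<n} k = 2 * (\<Sum>S\<in>?P. of_bool (parity S x = parity S z)) - real (n choose k)"
    unfolding P(3) .
  have "collide (random_k_subset n k) parity x z = (\<Sum>S\<in>?P. of_bool (parity S x = parity S z)) / real (n choose k)"
    unfolding collide_def prob_E random_k_subset_def by (subst integral_pmf_of_set[OF P(2,1)]) (simp only: P(3))
  moreover have "real (n choose k) > 0" using zero_less_binomial[OF k] by simp
  ultimately show ?thesis unfolding e by (simp add: field_simps)
qed

text \<open>Chernoff bound for both tails of the sum of the signs, by (exp t + exp (- t)) / 2 <= exp
  (t^2). Both are needed: for sets of fixed even size, antipodal points collide as surely as equal
  ones. The value t = B / (2 n) minimises n t^2 - t B.\<close>

lemma card_unbalanced_le:
  fixes B :: real
  assumes x: "length x = n" and S: "S \<subseteq> {y. length y = n}" and B: "0 < B" "B \<le> 2 * real n"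
  shows "real (card {y\<in>S. B < \<bar>real n - 2 * real (hdist x y)\<bar>}) \<le> 2 * 2 ^ n * exp (- B\<^sup>2 / (4 * real n))"
proof -
  let ?A = "{y :: bool list. length y = length x}"
  let ?d = "\<lambda>y. real n - 2 * real (hdist x y)"
  define t where "t = B / (2 * real n)"
  have n: "0 < real n" using B by linarith
  have t: "0 < t" "t \<le> 1" using B n by (simp_all add: t_def field_simps)
  have fin: "finite ?A" by (rule finite_lists_bool)
  have sub: "{y\<in>S. B < \<bar>?d y\<bar>} \<subseteq> {y\<in>?A. B < \<bar>?d y\<bar>}" using S x by auto
  have cosh: "exp t + exp (- t) \<le> 2 * exp (t\<^sup>2)"
  proof -
    have "exp t \<le> 1 + t + t\<^sup>2" by (rule exp_bound) (use t in auto)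
    moreover have "exp (- t) \<le> 1 - t + t\<^sup>2"
    proof -
      have "1 \<le> (1 - t + t\<^sup>2) * (1 + t)" using t by (simp add: algebra_simps power2_eq_square)
      also have "\<dots> \<le> (1 - t + t\<^sup>2) * exp t"
        using t exp_ge_add_one_self[of t] by (intro mult_left_mono) auto
      finally have "1 * exp (- t) \<le> (1 - t + t\<^sup>2) * exp t * exp (- t)" by (intro mult_right_mono) auto
      thus ?thesis by (simp add: mult.assoc flip: exp_add)
    qed
    moreover have "1 + t\<^sup>2 \<le> exp (t\<^sup>2)" by (rule exp_ge_add_one_self)
    ultimately show ?thesis by linarith
  qed
  have pw: "exp t ^ hdist x y * exp (- t) ^ (length x - hdist x y) = exp (- t * ?d y)"
    "exp (- t) ^ hdist x y * exp t ^ (length x - hdist x y) = exp (t * ?d y)" if "y \<in> ?A" for y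
    using hdist_le[of x y] by (simp_all add: x of_nat_diff algebra_simps flip: exp_of_nat_mult exp_add)
  have "real (card {y\<in>S. B < \<bar>?d y\<bar>}) \<le> real (card {y\<in>?A. B < \<bar>?d y\<bar>})"
    using card_mono[OF _ sub] fin by simp
  also have "\<dots> = (\<Sum>y\<in>?A. of_bool (B < \<bar>?d y\<bar>))"
  proof -
    have "?A \<inter> {y. B < \<bar>?d y\<bar>} = {y\<in>?A. B < \<bar>?d y\<bar>}" by auto
    thus ?thesis using fin by simp
  qed
  also have "\<dots> \<le> (\<Sum>y\<in>?A. (exp (- t * ?d y) + exp (t * ?d y)) * exp (- t * B))"
  proof (rule sum_mono)
    fix y
    show "of_bool (B < \<bar>?d y\<bar>) \<le> (exp (- t * ?d y) + exp (t * ?d y)) * exp (- t * B)"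
    proof (cases "B < \<bar>?d y\<bar>")
      case True
      hence "t * B \<le> t * \<bar>?d y\<bar>" using t by (intro mult_left_mono) auto
      hence "1 \<le> exp (t * \<bar>?d y\<bar>) * exp (- t * B)" by (simp flip: exp_add)
      also have "\<dots> \<le> (exp (- t * ?d y) + exp (t * ?d y)) * exp (- t * B)"
      proof (intro mult_right_mono)
        show "exp (t * \<bar>?d y\<bar>) \<le> exp (- t * ?d y) + exp (t * ?d y)"
        proof (cases "0 \<le> ?d y")
          case False
          hence "\<bar>?d y\<bar> = - ?d y" by simp
          hence "t * \<bar>?d y\<bar> = - t * ?d y" by (simp only: mult_minus_left mult_minus_right)
          thus ?thesis by (simp only: le_add_same_cancel1 exp_ge_zero)
        qed simp
      qed simp
      finally show ?thesis using True by simp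
    qed simp
  qed
  also have "\<dots> = ((\<Sum>y\<in>?A. exp t ^ hdist x y * exp (- t) ^ (length x - hdist x y)) +
      (\<Sum>y\<in>?A. exp (- t) ^ hdist x y * exp t ^ (length x - hdist x y))) * exp (- t * B)"
    unfolding sum.distrib[symmetric] sum_distrib_right by (intro sum.cong refl) (simp only: pw)
  also have "\<dots> = 2 * (exp t + exp (- t)) ^ n * exp (- t * B)"
    unfolding sum_hdist by (simp add: x add.commute)
  also have "\<dots> \<le> 2 * (2 * exp (t\<^sup>2)) ^ n * exp (- t * B)"
    using cosh by (intro mult_right_mono mult_left_mono power_mono) (auto intro: add_nonneg_nonneg)
  also have "\<dots> = 2 * 2 ^ n * exp (real n * t\<^sup>2 - t * B)"
    by (simp add: power_mult_distrib exp_diff exp_minus divide_inverse flip: exp_of_nat_mult)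
  also have "real n * t\<^sup>2 - t * B = - B\<^sup>2 / (4 * real n)"
    using n by (simp add: t_def field_simps power2_eq_square)
  finally show ?thesis .
qed

text \<open>Balanced pairs, whose sum of signs is at most B = n^(1 - 2/k) log n in absolute value,
  have bias at most (k B / n)^k = (k log n)^k / n^2 <= 1 / (64 n). The unbalanced ones are fewer
  than 2^n by a factor of about exp (- n^(1 - 4/k) (log n)^2 / 4), which outweighs the gain (log n /
  k) n^(1 - 4/k) in the exponent of \<gamma>.\<close>

lemma acount_constant_low:
  fixes n k j :: nat and F :: cnf
  defines "S \<equiv> solutions n F"
  defines "\<gamma> \<equiv> 2 powr (- real n + log 2 (real n) / real k * (real n powr (1 - 4 / real k)))"
  assumes k: "5 \<le> k" "k \<le> n" and n: "149 \<le> n" "5 \<le> ln (real n)"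
    and nk: "(real k * log 2 (real n)) ^ k \<le> real n / 64"
    and S: "S \<noteq> {}"
  shows "\<gamma> \<le> 1"
    "2 ^ j \<le> \<gamma> * real (card S) / 2 \<Longrightarrow> dispersion (random_k_subset n k) parity S j \<le> 1 + 1 / 16"
proof -
  define c where "c = 1 - 4 / real k"
  define B where "B = real n powr (1 - 2 / real k) * log 2 (real n)"
  define \<tau> where "\<tau> = (real k * B / real n) ^ k"
  have n0: "0 < real n" "1 \<le> real n" using n by simp_all
  have lg: "1 \<le> log 2 (real n)" using n by simp
  have k0: "0 < real k" using k by simp
  have c: "0 \<le> c" using k by (simp add: c_def field_simps)
  have kl: "real k * log 2 (real n) \<le> real n powr (1 / real k)"
  proof -
    have "(real k * log 2 (real n)) ^ k \<le> (real n powr (1 / real k)) ^ k"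
    proof -
      have "(real n powr (1 / real k)) ^ k = real n"
        using n0 k0 by (simp add: powr_powr flip: powr_realpow)
      thus ?thesis using nk n0 by simp
    qed
    thus ?thesis using k by (subst (asm) power_mono_iff) (use lg in auto)
  qed
  have l1: "log 2 (real n) / real k \<le> real n powr (4 / real k)"
  proof -
    have "log 2 (real n) / real k \<le> real k * log 2 (real n)"
    proof -
      have "1 * 1 \<le> real k * real k" using k by (intro mult_mono) auto
      thus ?thesis using lg k0 by (simp add: field_simps)
    qed
    also note kl
    also have "real n powr (1 / real k) \<le> real n powr (4 / real k)"
      using n0 k0 by (intro powr_mono divide_right_mono) auto
    finally show ?thesis .
  qed
  have g: "log 2 (real n) / real k * (real n powr c) \<le> real n"
  proof -
    have "log 2 (real n) / real k * (real n powr c) \<le> real n powr (4 / real k) * real n powr c"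
      by (rule mult_right_mono[OF l1]) simp
    also have "\<dots> = real n" using n0 by (simp add: c_def flip: powr_add)
    finally show ?thesis .
  qed
  show \<gamma>1: "\<gamma> \<le> 1"
    unfolding \<gamma>_def c_def[symmetric] using g powr_mono[of "- real n + log 2 (real n) / real k * (real n powr c)" 0 2] by simp
  assume j: "2 ^ j \<le> \<gamma> * real (card S) / 2"
  have fin: "finite S" unfolding S_def by (rule finite_solutions)
  have len: "length x = n" if "x \<in> S" for x using that by (simp add: S_def solutions_def)
  have s: "0 < real (card S)" using S fin by (simp add: card_gt_0_iff)
  have B0: "0 < B" using n0 lg by (simp add: B_def)
  have Bn: "real k * B \<le> real n powr (1 / real k + (1 - 2 / real k))"
  proof -
    have "real k * B = (real k * log 2 (real n)) * real n powr (1 - 2 / real k)" by (simp add: B_def)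
    also have "\<dots> \<le> real n powr (1 / real k) * real n powr (1 - 2 / real k)" by (rule mult_right_mono[OF kl]) simp
    finally show ?thesis by (simp only: powr_add)
  qed
  have Bn': "B \<le> 2 * real n"
  proof -
    have "1 * B \<le> real k * B" using k B0 by (intro mult_right_mono) auto
    also note Bn
    also have "real n powr (1 / real k + (1 - 2 / real k)) \<le> real n powr 1"
      using n0 k0 by (intro powr_mono) (auto simp: field_simps)
    finally show ?thesis using n0 by simp
  qed
  \<comment> \<open>Needed in \<open>esym_bound\<close>; the exponent 1 - 2/k of \<open>B\<close> is
    at least 1/2 here.\<close>
  have Bsq: "real n \<le> B\<^sup>2"
  proof -
    have "real n powr (1 / 2) \<le> real n powr (1 - 2 / real k)"
      using n0 k by (intro powr_mono) (auto simp: field_simps)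
    also have "\<dots> \<le> B" unfolding B_def using lg by (simp add: mult_le_cancel_left1)
    finally have "(real n powr (1 / 2))\<^sup>2 \<le> B\<^sup>2" by (intro power_mono) auto
    moreover have "(real n powr (1 / 2))\<^sup>2 = real n" using n0 by (simp add: powr_powr flip: powr_realpow)
    ultimately show ?thesis by simp
  qed
  have disp: "dispersion (random_k_subset n k) parity S j \<le>
      (1 + \<tau>) ^ j + (2 * 2 ^ n * exp (- B\<^sup>2 / (4 * real n))) * 2 ^ j / real (card S)"
  proof (rule dispersion_le[OF fin S, where near = "\<lambda>x y. B < \<bar>real n - 2 * real (hdist x y)\<bar>"])
    fix x z assume x: "x \<in> S" "z \<in> S" and far: "\<not> B < \<bar>real n - 2 * real (hdist x z)\<bar>"
    let ?y = "\<lambda>j. if x ! j \<noteq> z ! j then -1 else (1 :: real)"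
    have "(\<Sum>j<n. ?y j) = (\<Sum>j<n. 1 - 2 * of_bool (x ! j \<noteq> z ! j))" by (intro sum.cong) auto
    also have "\<dots> = real n - 2 * real (card ({..<n} \<inter> {j. x ! j \<noteq> z ! j}))"
      by (simp add: sum_subtractf flip: sum_distrib_left)
    also have "card ({..<n} \<inter> {j. x ! j \<noteq> z ! j}) = hdist x z"
      unfolding hdist_def len[OF x(1)] by (rule arg_cong[where f = card]) auto
    finally have sum: "(\<Sum>j<n. ?y j) = real n - 2 * real (hdist x z)" .
    have "\<bar>esym ?y {..<n} k\<bar> \<le> B ^ k"
    proof (rule esym_bound)
      show "\<bar>\<Sum>j<n. ?y j\<bar> \<le> B" unfolding sum using far by simp
    qed (use Bsq k in auto)
    hence "esym ?y {..<n} k / real (n choose k) \<le> B ^ k / (real n / real k) ^ k"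
    proof (intro frac_le)
      show "(real n / real k) ^ k \<le> real (n choose k)" by (rule binomial_ge_n_over_k_pow_k[OF k(2)])
    qed (use n0 k0 B0 in auto)
    also have "\<dots> = \<tau>" by (simp add: \<tau>_def power_divide power_mult_distrib)
    finally show "2 * collide (random_k_subset n k) parity x z \<le> 1 + \<tau>"
      unfolding collide_random_k_subset[OF k(2)] by simp
  next
    fix x assume x: "x \<in> S"
    show "real (card {y \<in> S. B < \<bar>real n - 2 * real (hdist x y)\<bar>}) \<le> 2 * 2 ^ n * exp (- B\<^sup>2 / (4 * real n))"
      by (rule card_unbalanced_le[OF len[OF x] _ B0 Bn']) (use len in auto)
  qed (use B0 in \<open>simp add: \<tau>_def\<close>)
  have jn: "j \<le> n"
  proof -
    have "(2 :: real) ^ j \<le> 1 * real (card S)"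
    proof -
      have "\<gamma> * real (card S) \<le> 1 * real (card S)" using \<gamma>1 by (intro mult_right_mono) auto
      hence "2 * (2 :: real) ^ j \<le> real (card S)" using j by linarith
      moreover have "0 \<le> (2 :: real) ^ j" by simp
      ultimately show ?thesis by linarith
    qed
    also have "\<dots> \<le> 2 ^ n" using finite_solutions(2)[of n F] by (simp add: S_def)
    finally show ?thesis by simp
  qed
  have far: "(1 + \<tau>) ^ j \<le> 1 + 1 / 32"
  proof -
    have "B / real n = real n powr (- 2 / real k) * log 2 (real n)"
      using n0 by (simp add: B_def powr_diff powr_minus divide_inverse)
    hence "\<tau> = (real k * log 2 (real n)) ^ k * (real n powr (- 2 / real k)) ^ k"
      unfolding \<tau>_def by (simp add: mult.assoc flip: power_mult_distrib times_divide_eq_right) (simp add: mult_ac)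
    also have "(real n powr (- 2 / real k)) ^ k = 1 / (real n)\<^sup>2"
    proof -
      have "(real n powr (- 2 / real k)) ^ k = (real n powr (- 2 / real k)) powr real k"
        using n0 by (intro powr_realpow[symmetric]) simp
      also have "\<dots> = real n powr (- real 2)" using k0 by (simp add: powr_powr)
      also have "\<dots> = 1 / (real n)\<^sup>2" using n0 by (simp only: powr_minus_divide powr_realpow)
      finally show ?thesis .
    qed
    finally have \<tau>: "\<tau> = (real k * log 2 (real n)) ^ k / (real n)\<^sup>2" by simp
    have \<tau>0: "0 \<le> \<tau>" using B0 by (simp add: \<tau>_def)
    have "real j * \<tau> \<le> real n * ((real n / 64) / (real n)\<^sup>2)"
      unfolding \<tau> using jn nk n0 lg k0 by (intro mult_mono divide_right_mono) auto
    also have "\<dots> = 1 / 64" using n0 by (simp add: power2_eq_square)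
    finally have jt: "real j * \<tau> \<le> 1 / 64" .
    have "(1 + \<tau>) ^ j \<le> exp \<tau> ^ j"
      using \<tau>0 exp_ge_add_one_self[of \<tau>] by (intro power_mono) auto
    also have "\<dots> = exp (real j * \<tau>)" by (rule exp_of_nat_mult[symmetric])
    also have "\<dots> \<le> 1 + 2 * (real j * \<tau>)"
      by (rule exp_le_1_plus_2) (use jt \<tau>0 in auto)
    finally show ?thesis using jt by simp
  qed
  have near: "(2 * 2 ^ n * exp (- B\<^sup>2 / (4 * real n))) * 2 ^ j / real (card S) \<le> 1 / 32"
  proof -
    define N where "N = real n powr c"
    have N: "1 \<le> N" unfolding N_def using n0 c by (intro ge_one_powr_ge_zero) auto
    have ln0: "0 < ln (real n)" using n by linarith
    have Bv: "B\<^sup>2 / (4 * real n) = N * (log 2 (real n))\<^sup>2 / 4"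
    proof -
      have "(real n powr (1 - 2 / real k))\<^sup>2 = real n powr (2 * (1 - 2 / real k))"
        using n0 by (simp add: powr_powr mult.commute flip: powr_realpow)
      also have "2 * (1 - 2 / real k) = 1 + c" by (simp add: c_def)
      also have "real n powr (1 + c) = real n * N" using n0 by (simp add: powr_add N_def)
      finally show ?thesis using n0 by (simp add: B_def power_mult_distrib)
    qed
    have "(2 * 2 ^ n * exp (- B\<^sup>2 / (4 * real n))) * 2 ^ j / real (card S) \<le>
        (2 * 2 ^ n * exp (- B\<^sup>2 / (4 * real n))) * (\<gamma> * real (card S) / 2) / real (card S)"
      by (intro divide_right_mono mult_left_mono j) auto
    also have "\<dots> = 2 ^ n * \<gamma> * exp (- (N * (log 2 (real n))\<^sup>2 / 4))"
      using s by (simp flip: Bv)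
    also have "2 ^ n * \<gamma> = exp (ln 2 * (log 2 (real n) / real k * N))"
    proof -
      have "2 ^ n * \<gamma> = 2 powr real n * 2 powr (- real n + log 2 (real n) / real k * N)"
        by (simp add: \<gamma>_def c_def N_def powr_realpow)
      also have "\<dots> = 2 powr (log 2 (real n) / real k * N)" by (simp flip: powr_add)
      finally show ?thesis by (simp add: powr_def mult.commute)
    qed
    also have "ln 2 * (log 2 (real n) / real k * N) = ln (real n) / real k * N"
      by (simp add: log_def)
    also have "exp (ln (real n) / real k * N) * exp (- (N * (log 2 (real n))\<^sup>2 / 4)) =
        exp (ln (real n) / real k * N - N * (log 2 (real n))\<^sup>2 / 4)"
      by (simp flip: exp_add)
    also have "\<dots> \<le> exp (- ln (real n))"
    proof -
      \<comment> \<open>With x = ln n >= 5 the exponent per unit of \<open>N\<close> is at most x /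
        5 - x^2 / 4 <= x / 5 - 5 x / 4 <= - x.\<close>
      have a: "ln (real n) / real k \<le> ln (real n) / 5" using ln0 k by (intro divide_left_mono) auto
      have "ln (real n) * 1 \<le> log 2 (real n)" unfolding log_def using ln0 ln_2_less_1 by (simp add: field_simps)
      hence "(ln (real n))\<^sup>2 \<le> (log 2 (real n))\<^sup>2" using ln0 by (intro power_mono) auto
      moreover have "5 * ln (real n) \<le> (ln (real n))\<^sup>2"
        unfolding power2_eq_square using n(2) ln0 by (intro mult_right_mono) auto
      moreover have "X \<le> x / 5 \<Longrightarrow> x\<^sup>2 \<le> z \<Longrightarrow> 5 * x \<le> x\<^sup>2 \<Longrightarrow> 0 < x \<Longrightarrow> X - z / 4 \<le> - x" for X x z :: real by argo
      ultimately have "ln (real n) / real k - (log 2 (real n))\<^sup>2 / 4 \<le> - ln (real n)" using a ln0 by blast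
      hence "N * (ln (real n) / real k - (log 2 (real n))\<^sup>2 / 4) \<le> N * - ln (real n)"
        using N by (intro mult_left_mono) auto
      also have "\<dots> \<le> - ln (real n)" using mult_right_mono[OF N, of "ln (real n)"] ln0 by simp
      finally show ?thesis by (simp add: algebra_simps)
    qed
    also have "\<dots> = 1 / real n" using n0 by (simp add: exp_minus divide_inverse)
    also have "\<dots> \<le> 1 / 32" using n by (intro divide_left_mono) auto
    finally show ?thesis .
  qed
  from disp far near show "dispersion (random_k_subset n k) parity S j \<le> 1 + 1 / 16" by linarith
qed

lemma acount_constant_success:
  assumes k: "5 \<le> (k :: nat)"
  shows "\<exists>n\<^sub>0. \<forall>n\<ge>n\<^sub>0. \<forall>(F :: cnf) (s :: nat). cnf_over n F \<and> s = card (solutions n F) \<and> s > 0 \<longrightarrow>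
     measure (measure_pmf (acount_constant n k F))
          {r. 1 / 4 * 2 powr (- real n + log 2 (real n) / real k *
                                (real n powr (1 - 4 / real k))) * real s \<le> real r \<and>
              real r \<le> 4 * real s}
          \<ge> 1 / 4"
proof -
  have "((\<lambda>x :: real. x ^ k / exp x) \<longlongrightarrow> 0) at_top" by (rule tendsto_power_div_exp_0)
  hence "((\<lambda>n. ln (real n) ^ k / exp (ln (real n))) \<longlongrightarrow> 0) sequentially"
    by (rule filterlim_compose) (rule filterlim_compose[OF ln_at_top filterlim_real_sequentially])
  hence "\<forall>\<^sub>F n in sequentially. ln (real n) ^ k / exp (ln (real n)) < 1 / (64 * (real k / ln 2) ^ k)"
    by (rule order_tendstoD) (use k in simp)
  moreover have "\<forall>\<^sub>F n in sequentially. 5 \<le> ln (real n)"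
    using filterlim_compose[OF ln_at_top filterlim_real_sequentially] by (simp add: filterlim_at_top)
  moreover have "\<forall>\<^sub>F n in sequentially. 149 \<le> n \<and> k \<le> n"
    using eventually_ge_at_top[of "max 149 k"] by eventually_elim auto
  ultimately have "\<forall>\<^sub>F n in sequentially. 149 \<le> n \<and> k \<le> n \<and> 5 \<le> ln (real n) \<and> (real k * log 2 (real n)) ^ k \<le> real n / 64"
  proof eventually_elim
    case (elim n)
    hence n: "0 < real n" by simp
    have "(real k * log 2 (real n)) ^ k = (real k / ln 2) ^ k * ln (real n) ^ k"
      by (simp add: log_def power_divide power_mult_distrib)
    moreover have "ln (real n) ^ k \<le> real n / (64 * (real k / ln 2) ^ k)"
      using elim(1) n by (simp add: field_simps)
    moreover have "0 < (real k / ln 2) ^ k" using k by simp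
    ultimately have "(real k * log 2 (real n)) ^ k \<le> (real k / ln 2) ^ k * (real n / (64 * (real k / ln 2) ^ k))"
      by (simp only:) (rule mult_left_mono, auto)
    also have "\<dots> = real n / 64" using \<open>0 < (real k / ln 2) ^ k\<close> by simp
    finally have "(real k * log 2 (real n)) ^ k \<le> real n / 64" .
    thus ?case using elim by simp
  qed
  then obtain n0 where n0: "\<And>n. n0 \<le> n \<Longrightarrow> 149 \<le> n \<and> k \<le> n \<and> 5 \<le> ln (real n) \<and> (real k * log 2 (real n)) ^ k \<le> real n / 64"
    unfolding eventually_sequentially by blast
  show ?thesis
  proof (intro exI[of _ n0] allI impI)
    fix n :: nat and F :: cnf and s :: nat
    assume "n0 \<le> n" and *: "cnf_over n F \<and> s = card (solutions n F) \<and> s > 0"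
    note n = n0[OF \<open>n0 \<le> n\<close>]
    let ?\<gamma> = "2 powr (- real n + log 2 (real n) / real k * (real n powr (1 - 4 / real k)))"
    let ?D = "random_k_subset n k"
    have S: "solutions n F \<noteq> {}" using * by auto
    have fin: "finite S" if "S \<in> set_pmf ?D" for S using set_random_k_subset[of k n S] n that by simp
    \<comment> \<open>No set is oversized, so the vote at the decisive level is at least as good as
      a fair coin, and \<epsilon> = 0 below.\<close>
    have zero: "measure_pmf.prob ?D {S. card S > k} \<le> 0"
    proof -
      have "measure_pmf.prob ?D {S. card S > k} = 0"
        using set_random_k_subset[of k n] n by (auto simp: measure_pmf_zero_iff)
      thus ?thesis by simp
    qed
    define L where "L = nat \<lceil>log 2 (real n)\<rceil>"
    have L6: "6 \<le> L" using log_ceiling_iff[of n 5] n by (simp add: L_def)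
    have low: "dispersion ?D parity (solutions n F) j \<le> 1 + 1 / 16"
      if "2 ^ j \<le> ?\<gamma> * real (card (solutions n F)) / 2" for j
      by (rule acount_constant_low(2)) (use n k S that in auto)
    have \<gamma>1: "?\<gamma> \<le> 1"
      by (rule acount_constant_low(1)[OF _ _ _ _ _ S]) (use n k in auto)
    have "3 / 10 - 1 / 2 ^ (7 * L) \<le> measure_pmf.prob (acount_loop ?D n k F [1..<n + 2])
      {r. 1 / 4 * ?\<gamma> * real (card (solutions n F)) \<le> real r \<and> real r \<le> 4 * real (card (solutions n F))}"
      unfolding L_def
    proof (rule acount_loop_success)
      show "0 < card (solutions n F)" "2 \<le> n" "?\<gamma> \<le> 1" using * n \<gamma>1 by auto
    next
      fix l assume l: "2 * card (solutions n F) \<le> 2 ^ l" "l \<le> n + 1"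
      show "3 / 10 \<le> measure_pmf.prob (replicate_pmf (8 * nat \<lceil>log 2 (real n)\<rceil>) (acount_round ?D n k F l))
          {rs. 4 * nat \<lceil>log 2 (real n)\<rceil> < count_list rs True}"
        unfolding L_def[symmetric]
      proof (rule majority_ge_quarter[OF L6, of 0])
        show "(1 - 0) / 2 \<le> pmf (acount_round ?D n k F l) True"
          using acount_round_ge[OF fin zero _ l(1)] by simp
      qed simp_all
    next
      fix j :: nat assume j: "1 \<le> j" "2 ^ j \<le> ?\<gamma> * real (card (solutions n F)) / 2"
      have "pmf (acount_round ?D n k F j) True \<le> dispersion ?D parity (solutions n F) j - 1"
        by (rule acount_round_le[OF fin S])
      with low[OF j(2)] show "pmf (acount_round ?D n k F j) True \<le> 1 / 16" by linarith
    qed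
    moreover have "1 / 2 ^ (7 * L) \<le> (1 / 20 :: real)"
    proof -
      have "(2 :: real) ^ 5 \<le> 2 ^ (7 * L)" using L6 by (intro power_increasing) auto
      thus ?thesis by (simp add: field_simps)
    qed
    ultimately have "1 / 4 \<le> measure_pmf.prob (acount_loop ?D n k F [1..<n + 2])
      {r. 1 / 4 * ?\<gamma> * real (card (solutions n F)) \<le> real r \<and> real r \<le> 4 * real (card (solutions n F))}"
      by linarith
    moreover have "s = card (solutions n F)" using * by simp
    ultimately show "measure (measure_pmf (acount_constant n k F))
          {r. 1 / 4 * ?\<gamma> * real s \<le> real r \<and> real r \<le> 4 * real s} \<ge> 1 / 4"
      unfolding acount_constant_def by (simp only:)
  qed
qed

subsection \<open>Counting solutions with a randomized SAT algorithm\<close>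

definition vote_pmf :: "nat \<Rightarrow> (cnf \<Rightarrow> bool pmf) \<Rightarrow> cnf \<Rightarrow> bool pmf" where
  "vote_pmf R once \<Phi> = map_pmf (\<lambda>bs. count_list bs False < count_list bs True) (replicate_pmf R (once \<Phi>))"

text \<open>A partial assignment is represented by unit clauses, so that it is a formula over the
  same variables and can be passed to the SAT algorithm as it is.\<close>

definition expand :: "nat \<Rightarrow> cnf list \<Rightarrow> cnf list" where
  "expand i \<Psi>s = fold (\<lambda>\<Psi> L. ([(i, True)] # \<Psi>) # ([(i, False)] # \<Psi>) # L) \<Psi>s []"

definition filter_step :: "(cnf \<Rightarrow> bool pmf) \<Rightarrow> nat \<Rightarrow> cnf \<Rightarrow> cnf list \<Rightarrow> cnf list pmf" where
  "filter_step test cap \<Psi> L =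
     (if length L < cap then map_pmf (\<lambda>b. if b then \<Psi> # L else L) (test \<Psi>) else return_pmf L)"

text \<open>One stage of a breadth-first search through the tree of prefixes of solutions: it keeps
  prefixes judged extendable, at most \<open>cap\<close> of them.\<close>

definition count_step :: "(cnf \<Rightarrow> bool pmf) \<Rightarrow> nat \<Rightarrow> nat \<Rightarrow> cnf list \<Rightarrow> cnf list pmf" where
  "count_step test cap i \<Psi>s = mfold (filter_step test cap) (expand i \<Psi>s) []"

definition count_sols :: "(cnf \<Rightarrow> bool pmf) \<Rightarrow> nat \<Rightarrow> nat \<Rightarrow> cnf \<Rightarrow> nat pmf" where
  "count_sols test cap n \<Phi> = map_pmf length (mfold (count_step test cap) [0..<n] [\<Phi>])"

text \<open>Indices are drawn with replacement: independence gives the collision probability in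
  closed form (\<open>collide_index_list\<close>), and repeated indices cancel in
  \<open>lparity\<close>. The reversal reflects the order in which the program conses them.\<close>

definition index_list :: "nat \<Rightarrow> nat \<Rightarrow> nat list pmf" where
  "index_list n k = map_pmf rev (replicate_pmf k (pmf_of_set {..<n}))"

definition add_parities :: "(nat list \<times> bool) list \<Rightarrow> cnf \<Rightarrow> cnf" where
  "add_parities ps F = fold (\<lambda>p G. parity_clauses (fst p) (snd p) G) ps F"

definition trial :: "(cnf \<Rightarrow> bool pmf) \<Rightarrow> nat \<Rightarrow> nat \<Rightarrow> nat \<Rightarrow> cnf \<Rightarrow> nat \<Rightarrow> nat pmf" where
  "trial test cap n k F l =
     bind_pmf (hash_pmf (index_list n k) l) (\<lambda>ps. count_sols test cap n (add_parities ps F))"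

text \<open>The comparison with \<open>4 * M\<close> asks whether the mean of the \<open>M\<close>
  trials exceeds 4. A result (l, t) stands for the estimate t 2^l / M.\<close>

primrec levels :: "(nat \<Rightarrow> nat pmf) \<Rightarrow> nat \<Rightarrow> nat list \<Rightarrow> (nat \<times> nat) pmf" where
  "levels tr M [] = return_pmf (0, 0)"
| "levels tr M (l # ls) = bind_pmf (map_pmf sum_list (replicate_pmf M (tr l)))
     (\<lambda>t. if 4 * M < t then levels tr M ls else return_pmf (l, t))"

lemma expand_eq: "expand i \<Psi>s = concat (map (\<lambda>\<Psi>. [[(i, True)] # \<Psi>, [(i, False)] # \<Psi>]) (rev \<Psi>s))"
proof -
  have "fold (\<lambda>\<Psi> L. ([(i, True)] # \<Psi>) # ([(i, False)] # \<Psi>) # L) \<Psi>s M =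
      concat (map (\<lambda>\<Psi>. [[(i, True)] # \<Psi>, [(i, False)] # \<Psi>]) (rev \<Psi>s)) @ M" for M
    by (induction \<Psi>s arbitrary: M) simp_all
  thus ?thesis by (simp add: expand_def)
qed

lemma ball_expand:
  "(\<forall>\<Psi>\<in>set (expand i \<Psi>s). P \<Psi>) \<longleftrightarrow> (\<forall>\<Psi>\<in>set \<Psi>s. P ([(i, True)] # \<Psi>) \<and> P ([(i, False)] # \<Psi>))"
  by (simp add: expand_eq)

lemma length_expand: "length (expand i \<Psi>s) = 2 * length \<Psi>s"
  by (induction \<Psi>s) (simp_all add: expand_eq)

lemma filter_step_invariant:
  "L' \<in> set_pmf (filter_step test cap \<Psi> L) \<Longrightarrow> length L \<le> cap \<Longrightarrow> length L' \<le> cap \<and> set L' \<subseteq> insert \<Psi> (set L)"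
  by (auto simp: filter_step_def split: if_splits)

lemma count_step_invariant:
  assumes "L \<in> set_pmf (count_step test cap i \<Psi>s)"
  shows "length L \<le> cap \<and> set L \<subseteq> set (expand i \<Psi>s)"
proof -
  define I where "I = (\<lambda>zs L. length L \<le> cap \<and> set L \<subseteq> set (expand i \<Psi>s) \<and> set zs \<subseteq> set (expand i \<Psi>s))"
  have "I [] L"
  proof (rule mfold_invariant[where I = I, OF assms[unfolded count_step_def]])
    fix z zs a a' assume "I (z # zs) a" "a' \<in> set_pmf (filter_step test cap z a)"
    thus "I zs a'" using filter_step_invariant[of a' test cap z a] by (auto simp: I_def)
  qed (simp add: I_def)
  thus ?thesis by (simp add: I_def)
qed

section \<open>Machine programs for expanding, hashing and adding\<close>

definition enc_cnfs :: "cnf list \<Rightarrow> val" where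
  "enc_cnfs \<Psi>s = enc_list (map enc_clauses \<Psi>s)"

lemma enc_cnfs_simps [simp]:
  "enc_cnfs [] = Num 0" "enc_cnfs (\<Psi> # \<Psi>s) = Pair (enc_clauses \<Psi>) (enc_cnfs \<Psi>s)"
  by (simp_all add: enc_cnfs_def)

definition prog_expand :: com where
  "prog_expand = Seq (asn (EP r1 (EP (EN 0) e0)))
     (Seq (whl CPair e0 EV (asn (EP (ESnd e0) (EP
        (EP (EP (EP (EP r2 (EN 1)) (EN 0)) (EFst e0)) (EP (EP (EP (EP r2 (EN 0)) (EN 0)) (EFst e0)) e1)) r2))))
     (asn e1))"

lemma computes_expand:
  "computes orc prog_expand (Pair (Num i) (enc_cnfs \<Psi>s)) (return_pmf (enc_cnfs (expand i \<Psi>s)))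
     ((length \<Psi>s + 1) * 200)"
proof -
  have "computes orc (whl CPair e0 EV (asn (EP (ESnd e0) (EP
        (EP (EP (EP (EP r2 (EN 1)) (EN 0)) (EFst e0)) (EP (EP (EP (EP r2 (EN 0)) (EN 0)) (EFst e0)) e1)) r2))))
     (Pair (enc_cnfs \<Psi>s) (Pair (enc_cnfs []) (Num i)))
     (return_pmf (Pair (enc_cnfs []) (Pair (enc_cnfs (expand i \<Psi>s)) (Num i)))) ((length \<Psi>s + 1) * 100)"
    unfolding expand_def
    by (rule computes_for_asn[where zs = \<Psi>s and a = "[]" and
       \<phi> = "\<lambda>zs L. Pair (enc_cnfs zs) (Pair (enc_cnfs L) (Num i))"
       and g = "\<lambda>\<Psi> L. ([(i, True)] # \<Psi>) # ([(i, False)] # \<Psi>) # L"]) simp_all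
  note W = this[unfolded enc_cnfs_simps(1)]
  show ?thesis unfolding prog_expand_def
    apply (rule computes_mono)
     apply (rule computes_Seq_det[OF computes_asn])
     apply (simp only: ev.simps fst_val.simps snd_val.simps)
     apply (rule computes_Seq_det[OF W])
     apply (rule computes_asn_eq)
     apply simp
    apply simp
    done
qed

text \<open>The number \<open>k\<close> depends only on the required accuracy, so it is part of the
  program text and not of the input.\<close>

definition prog_indices :: "nat \<Rightarrow> com" where
  "prog_indices k = Seq (asn (EP (EN k) (EP (EN 0) EV)))
     (Seq (whl CLess (EN 0) e0 (Seq (rnd r2) (asn (EP (EDec e1) (EP (EP e0 e2) r3))))) (asn e1))"

lemma computes_indices:
  assumes "1 \<le> n"
  shows "computes orc (prog_indices k) (Num n) (map_pmf (\<lambda>js. enc_list (map Num js)) (index_list n k)) ((k + 1) * 100)"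
proof -
  define \<phi> where "\<phi> = (\<lambda>(zs :: unit list) js. Pair (Num (length zs)) (Pair (enc_list (map Num js)) (Num n)))"
  define W where "W = whl CLess (EN 0) e0 (Seq (rnd r2) (asn (EP (EDec e1) (EP (EP e0 e2) r3))))"
  have fold: "fold (#) ys js = rev ys @ js" for ys js :: "nat list"
    by (induction ys arbitrary: js) auto
  have body: "computes orc (Seq (rnd r2) (asn (EP (EDec e1) (EP (EP e0 e2) r3)))) (\<phi> (z # zs) js)
      (map_pmf (\<phi> zs) (map_pmf (\<lambda>y. y # js) (pmf_of_set {..<n}))) 40" for z zs js
    unfolding pmf.map_comp
    by (rule computes_mono, rule computes_then_asn, rule computes_rnd_num[of _ _ n]) (use assms in \<open>simp_all add: \<phi>_def\<close>)
  have "computes orc W (\<phi> (replicate k ()) [])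
     (map_pmf (\<phi> []) (mfold (\<lambda>_ js. map_pmf (\<lambda>y. y # js) (pmf_of_set {..<n})) (replicate k ()) []))
     ((length (replicate k ()) + 1) * 60)"
    unfolding W_def
    by (rule computes_for_le[where I = "\<lambda>_ _. True" and \<phi> = \<phi> and g = "\<lambda>_ js. map_pmf (\<lambda>y. y # js) (pmf_of_set {..<n})", OF _ _ body])
      (simp_all add: \<phi>_def)
  hence "computes orc W (ev (EP (EN k) (EP (EN 0) EV)) (Num n)) (map_pmf (\<phi> []) (index_list n k)) ((k + 1) * 60)"
    unfolding mfold_replicate by (simp add: fold index_list_def pmf.map_comp o_def \<phi>_def)
  note W = this
  show ?thesis unfolding prog_indices_def W_def[symmetric]
    apply (rule computes_mono)
     apply (rule computes_Seq_det[OF computes_asn])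
     apply (rule computes_then_asn[OF W])
     apply (simp add: \<phi>_def)
    apply simp
    done
qed

definition prog_hashed :: "nat \<Rightarrow> com" where
  "prog_hashed k = whl CLess (EN 0) e0
     (Seq (call (prog_indices k) r4) (Seq (rnd (EN 2))
     (Seq (call prog_parity (EP e1 (EP e0 e3))) (asn (EP (EDec e3) (EP e0 r5))))))"

lemma set_index_list: "1 \<le> n \<Longrightarrow> js \<in> set_pmf (index_list n k) \<Longrightarrow> length js = k \<and> set js \<subseteq> {..<n}"
  by (force simp: index_list_def set_replicate_pmf set_pmf_of_set lessThan_empty_iff)

lemma add_parities_size:
  assumes n: "1 \<le> n" and ps: "ps \<in> set_pmf (hash_pmf (index_list n k) l)" and F: "cnf_over n F"
  shows "cnf_over n (add_parities ps F) \<and> cnf_size n (add_parities ps F) \<le> cnf_size n F + l * (2 ^ k * (1 + k))"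
proof -
  have "fst p \<in> set_pmf (index_list n k)" if "p \<in> set ps" for p
    using ps that by (auto simp: hash_pmf_def set_replicate_pmf)
  hence "\<forall>p\<in>set ps. length (fst p) = k \<and> set (fst p) \<subseteq> {..<n}" using set_index_list[OF n] by blast
  moreover have "length ps = l" using ps by (auto simp: hash_pmf_def set_replicate_pmf)
  ultimately show ?thesis using F unfolding add_parities_def
  proof (induction ps arbitrary: F l)
    case (Cons p ps)
    have "\<exists>l'. l = Suc l'" using Cons.prems by (cases l) auto
    then obtain l' where l': "l = Suc l'" by blast
    have "cnf_over n (parity_clauses (fst p) (snd p) F)"
      "cnf_size n (parity_clauses (fst p) (snd p) F) \<le> cnf_size n F + 2 ^ k * (1 + k)"
      using cnf_over_parity_clauses[of "fst p" n F "snd p"] cnf_size_parity_clauses[of n "fst p" "snd p" F] Cons.prems by auto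
    thus ?case using Cons.IH[of l' "parity_clauses (fst p) (snd p) F"] Cons.prems l' by (simp add: algebra_simps)
  qed simp
qed

lemma computes_hashed:
  fixes n cap R :: nat
  assumes n: "1 \<le> n"
  defines "env \<equiv> Pair (Num cap) (Pair (Num R) (Num n))"
  shows "computes orc (prog_hashed k) (Pair (Num l) (Pair (enc_clauses F) env))
     (map_pmf (\<lambda>ps. Pair (Num 0) (Pair (enc_clauses (add_parities ps F)) env)) (hash_pmf (index_list n k) l))
     ((l + 1) * (2000 * ((k + 1) * 2 ^ k)))"
proof -
  define K where "K = (k + 1) * 2 ^ k"
  have "(k + 1) * 1 \<le> K" unfolding K_def by (rule mult_le_mono2) simp
  hence K: "k + 1 \<le> K" "1 \<le> K" by simp_all
  define \<phi> where "\<phi> = (\<lambda>(zs :: unit list) G. Pair (Num (length zs)) (Pair (enc_clauses G) env))"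
  let ?h = "\<lambda>p G. parity_clauses (fst p) (snd p) G"
  let ?P = "pair_pmf (index_list n k) coin"
  have body: "computes orc (Seq (call (prog_indices k) r4) (Seq (rnd (EN 2))
     (Seq (call prog_parity (EP e1 (EP e0 e3))) (asn (EP (EDec e3) (EP e0 r5))))))
     (\<phi> (z # zs) G) (map_pmf (\<phi> zs) (map_pmf (\<lambda>y. ?h y G) ?P)) (100 * K + 1000 * K + 100)" for z zs G
  proof -
    let ?v = "\<phi> (z # zs) G"
    have "computes orc (prog_indices k) (ev r4 ?v) (map_pmf (\<lambda>js. enc_list (map Num js)) (index_list n k)) (100 * K)"
      using computes_mono[OF computes_indices[OF n, of orc k], of "100 * K"] K by (simp add: \<phi>_def env_def)
    note 1 = computes_call_map[OF this]
    have 3: "computes orc (Seq (call prog_parity (EP e1 (EP e0 e3))) (asn (EP (EDec e3) (EP e0 r5))))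
       (Pair (enc_bool b) (Pair (enc_list (map Num js)) ?v)) (return_pmf (\<phi> zs (?h (js, b) G))) (70 + 1000 * K)"
      if "js \<in> set_pmf (index_list n k)" for js b
    proof -
      have "computes orc prog_parity (ev (EP e1 (EP e0 e3)) (Pair (enc_bool b) (Pair (enc_list (map Num js)) ?v)))
          (return_pmf (enc_clauses (parity_clauses js b G))) (1000 * K)"
        using computes_parity[of orc js b G] set_index_list[OF n that] by (simp add: \<phi>_def K_def)
      note c = computes_call_det[OF this]
      show ?thesis
        by (rule computes_mono, rule computes_Seq_det[OF c], rule computes_asn_eq) (simp_all add: \<phi>_def)
    qed
    show ?thesis
    proof (rule computes_cong)
      show "computes orc (Seq (call (prog_indices k) r4) (Seq (rnd (EN 2))
         (Seq (call prog_parity (EP e1 (EP e0 e3))) (asn (EP (EDec e3) (EP e0 r5)))))) ?v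
         (bind_pmf (index_list n k) (\<lambda>js. bind_pmf coin (\<lambda>b. return_pmf (\<phi> zs (?h (js, b) G)))))
         ((ecost r4 + 2 + 100 * K) + (3 + (70 + 1000 * K)))"
        by (rule computes_Seq_map[OF 1], rule computes_Seq_map[OF computes_rnd_coin], rule 3)
      show "bind_pmf (index_list n k) (\<lambda>js. bind_pmf coin (\<lambda>b. return_pmf (\<phi> zs (?h (js, b) G)))) =
         map_pmf (\<phi> zs) (map_pmf (\<lambda>y. ?h y G) ?P)"
        by (simp add: pair_pmf_def map_pmf_def bind_assoc_pmf bind_return_pmf)
    qed simp
  qed
  have "computes orc (prog_hashed k) (\<phi> (replicate l ()) F)
     (map_pmf (\<phi> []) (mfold (\<lambda>_ G. map_pmf (\<lambda>y. ?h y G) ?P) (replicate l ()) F))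
     ((length (replicate l ()) + 1) * (2000 * K))"
    unfolding prog_hashed_def
    by (rule computes_for_le[where I = "\<lambda>_ _. True" and \<phi> = \<phi> and g = "\<lambda>_ G. map_pmf (\<lambda>y. ?h y G) ?P", OF _ _ body])
      (use K(2) in \<open>simp_all add: \<phi>_def\<close>)
  thus ?thesis unfolding mfold_replicate
    by (simp add: \<phi>_def K_def pmf.map_comp o_def add_parities_def hash_pmf_def)
qed

text \<open>Moves the first summand over by unit steps. It is applied with the count of one trial in
  that place, so the cost is governed by \<open>cap\<close> and not by the running sum.\<close>

definition prog_add :: com where
  "prog_add = Seq (whl CLess (EN 0) e0 (asn (EP (EDec e0) (EInc r1)))) (asn r1)"

lemma computes_add: "computes orc prog_add (Pair (Num a) (Num b)) (return_pmf (Num (a + b))) ((a + 1) * 30)"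
proof -
  have fold: "fold (\<lambda>_ a. Suc a) zs b = length zs + b" for zs :: "unit list" and b :: nat
    by (induction zs arbitrary: b) auto
  have "computes orc (whl CLess (EN 0) e0 (asn (EP (EDec e0) (EInc r1))))
      (Pair (Num (length (replicate a ()))) (Num b))
      (return_pmf (Pair (Num (length ([] :: unit list))) (Num (fold (\<lambda>_ a. Suc a) (replicate a ()) b))))
      ((length (replicate a ()) + 1) * 20)"
    by (rule computes_for_asn[where \<phi> = "\<lambda>zs a. Pair (Num (length zs)) (Num a)"]) simp_all
  hence *: "computes orc (whl CLess (EN 0) e0 (asn (EP (EDec e0) (EInc r1))))
      (Pair (Num a) (Num b)) (return_pmf (Pair (Num 0) (Num (a + b)))) ((a + 1) * 20)"
    unfolding fold by simp
  show ?thesis unfolding prog_add_def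
    by (rule computes_mono, rule computes_Seq_det[OF *], rule computes_asn_eq) simp_all
qed

subsection \<open>Binary numbers\<close>

definition enc_bits :: "bool list \<Rightarrow> val" where
  "enc_bits bs = enc_list (map enc_bool bs)"

lemma enc_bits_simps [simp]: "enc_bits [] = Num 0" "enc_bits (b # bs) = Pair (enc_bool b) (enc_bits bs)"
  by (simp_all add: enc_bits_def)

text \<open>The form follows the program, which has no recursion: strip the leading ones while
  stacking zeros, set the next bit, put the zeros back.\<close>

definition binc :: "bool list \<Rightarrow> bool list" where
  "binc bs = replicate (length (takeWhile (\<lambda>b. b) bs)) False @ True # tl (dropWhile (\<lambda>b. b) bs)"

lemma binc_simps [simp]: "binc [] = [True]" "binc (False # bs) = True # bs" "binc (True # bs) = False # binc bs"
  by (simp_all add: binc_def)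

lemma bin_val_binc: "bin_val (enc_bits (binc bs)) = Suc (bin_val (enc_bits bs))"
proof (induction bs)
  case (Cons b bs)
  thus ?case by (cases b) simp_all
qed simp

lemma length_binc: "length (binc bs) \<le> Suc (length bs)"
proof (induction bs)
  case (Cons b bs)
  thus ?case by (cases b) simp_all
qed simp

definition prog_binc :: com where
  "prog_binc = Seq (asn (EP EV (EN 0)))
     (Seq (whl CEq (EFst e0) (EN 1) (asn (EP (ESnd e0) (EP (EN 0) r1))))
     (Seq (asn (EP (EP (EN 1) (ESnd e0)) r1))
     (Seq (whl CPair r1 EV (asn (EP (EP (EN 0) e0) (ESnd r1)))) (asn e0))))"

lemma eq_val_enc_bool_1 [simp]: "eq_val (enc_bool b) (Num (Suc 0)) \<longleftrightarrow> b"
  by (simp add: enc_bool_def)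

lemma computes_binc: "computes orc prog_binc (enc_bits bs) (return_pmf (enc_bits (binc bs))) ((length bs + 1) * 200)"
proof -
  let ?W1 = "whl CEq (EFst e0) (EN 1) (asn (EP (ESnd e0) (EP (EN 0) r1)))"
  let ?z = "\<lambda>j. enc_bits (replicate j False)"
  have 1: "computes orc ?W1 (Pair (enc_bits bs) (?z j))
      (return_pmf (Pair (enc_bits (dropWhile (\<lambda>b. b) bs)) (?z (length (takeWhile (\<lambda>b. b) bs) + j)))) ((length bs + 1) * 50)" for j
  proof (induction bs arbitrary: j)
    case Nil
    show ?case by (rule computes_cong[OF computes_whl_stop]) simp_all
  next
    case (Cons b bs)
    show ?case
    proof (cases b)
      case True
      have IH: "computes orc ?W1 (Pair (enc_bits bs) (?z (Suc j)))
          (return_pmf (Pair (enc_bits (dropWhile (\<lambda>b. b) bs)) (?z (length (takeWhile (\<lambda>b. b) bs) + Suc j)))) ((length bs + 1) * 50)"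
        by (rule Cons.IH)
      show ?thesis
        by (rule computes_cong[OF computes_whl_step_det[OF _ computes_asn_eq IH]]) (use True in simp_all)
    next
      case False
      show ?thesis by (rule computes_cong[OF computes_whl_stop]) (use False in simp_all)
    qed
  qed
  define t where "t = length (takeWhile (\<lambda>b. b) bs)"
  have t: "t \<le> length bs" by (simp add: t_def length_takeWhile_le)
  have fold: "fold (\<lambda>_ L. False # L) zs L = replicate (length zs) False @ L" for zs :: "unit list" and L
  proof (induction zs arbitrary: L)
    case (Cons z zs)
    show ?case by (simp add: Cons.IH) (simp add: replicate_append_same flip: append_Cons)
  qed simp
  have "computes orc (whl CPair r1 EV (asn (EP (EP (EN 0) e0) (ESnd r1))))
      (Pair (enc_bits (True # tl (dropWhile (\<lambda>b. b) bs))) (?z (length (replicate t ()))))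
      (return_pmf (Pair (enc_bits (fold (\<lambda>_ L. False # L) (replicate t ()) (True # tl (dropWhile (\<lambda>b. b) bs)))) (?z (length ([] :: unit list)))))
      ((length (replicate t ()) + 1) * 50)"
    by (rule computes_for_asn[where \<phi> = "\<lambda>zs L. Pair (enc_bits L) (?z (length zs))"]) simp_all
  hence 2: "computes orc (whl CPair r1 EV (asn (EP (EP (EN 0) e0) (ESnd r1))))
      (Pair (Pair (Num 1) (enc_bits (tl (dropWhile (\<lambda>b. b) bs)))) (?z t)) (return_pmf (Pair (enc_bits (binc bs)) (Num 0))) ((t + 1) * 50)"
    unfolding fold by (simp add: binc_def t_def)
  have tl: "snd_val (enc_bits L) = enc_bits (tl L)" for L by (cases L) simp_all
  have w1: "computes orc ?W1 (ev (EP EV (EN 0)) (enc_bits bs))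
      (return_pmf (Pair (enc_bits (dropWhile (\<lambda>b. b) bs)) (?z t))) ((length bs + 1) * 50)"
    using 1[of 0] by (simp add: t_def)
  have w2: "computes orc (whl CPair r1 EV (asn (EP (EP (EN 0) e0) (ESnd r1))))
      (ev (EP (EP (EN 1) (ESnd e0)) r1) (Pair (enc_bits (dropWhile (\<lambda>b. b) bs)) (?z t)))
      (return_pmf (Pair (enc_bits (binc bs)) (Num 0))) ((t + 1) * 50)"
    using 2 by (simp add: tl)
  have "computes orc prog_binc (enc_bits bs) (return_pmf (enc_bits (binc bs)))
     (10 + ((length bs + 1) * 50 + (20 + ((t + 1) * 50 + 10))))"
    unfolding prog_binc_def
    apply (rule computes_mono)
     apply (rule computes_Seq_det[OF computes_asn])
     apply (rule computes_Seq_det[OF w1])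
     apply (rule computes_Seq_det[OF computes_asn_eq[OF refl]])
     apply (rule computes_Seq_det[OF w2])
     apply (rule computes_asn_eq)
     apply simp
    apply simp
    done
  thus ?thesis by (rule computes_mono) (use t in simp)
qed

text \<open>Conversion from a machine number by counting up. With at most \<open>x\<close> bits per
  increment the time is quadratic in \<open>x\<close>; this decides the running time of the whole
  algorithm.\<close>

definition bits :: "nat \<Rightarrow> bool list" where
  "bits x = (binc ^^ x) []"

lemma bin_val_bits [simp]: "bin_val (enc_bits (bits x)) = x"
  by (induction x) (simp_all add: bits_def bin_val_binc)

definition prog_bits :: com where
  "prog_bits = Seq (asn (EP EV (EN 0)))
     (Seq (whl CLess (EN 0) e0 (Seq (call prog_binc r1) (asn (EP (EDec e1) e0)))) (asn r1))"

lemma computes_bits: "computes orc prog_bits (Num x) (return_pmf (enc_bits (bits x))) ((x + 1) * (300 * (x + 1)))"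
proof -
  define \<phi> where "\<phi> = (\<lambda>(zs :: unit list) bs. Pair (Num (length zs)) (enc_bits bs))"
  have fold: "fold (\<lambda>_. binc) zs bs = (binc ^^ length zs) bs" for zs :: "unit list" and bs
    by (induction zs arbitrary: bs) (auto simp: funpow_swap1)
  have body: "computes orc (Seq (call prog_binc r1) (asn (EP (EDec e1) e0))) (\<phi> (z # zs) bs)
      (return_pmf (\<phi> zs (binc bs))) (200 * (x + 1) + 50)" if "length bs + length (z # zs) \<le> x" for z zs bs
  proof -
    have "(length bs + 1) * 200 \<le> 200 * (x + 1)" using that by simp
    hence "computes orc prog_binc (ev r1 (\<phi> (z # zs) bs)) (return_pmf (enc_bits (binc bs))) (200 * (x + 1))"
      using computes_mono[OF computes_binc[of orc bs]] by (simp add: \<phi>_def)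
    note c = computes_call_det[OF this]
    show ?thesis
      by (rule computes_mono, rule computes_Seq_det[OF c], rule computes_asn_eq) (simp_all add: \<phi>_def)
  qed
  have "computes orc (whl CLess (EN 0) e0 (Seq (call prog_binc r1) (asn (EP (EDec e1) e0)))) (\<phi> (replicate x ()) [])
      (return_pmf (\<phi> [] (fold (\<lambda>_. binc) (replicate x ()) []))) ((length (replicate x ()) + 1) * (260 * (x + 1)))"
  proof (rule computes_for_det[where I = "\<lambda>zs bs. length bs + length zs \<le> x" and \<phi> = \<phi> and g = "\<lambda>_. binc", OF _ _ body])
    show "length (binc bs) + length zs \<le> x" if "length bs + length (z # zs) \<le> x" for z :: unit and zs bs
      using that length_binc[of bs] by simp
  qed (simp_all add: \<phi>_def)
  hence W: "computes orc (whl CLess (EN 0) e0 (Seq (call prog_binc r1) (asn (EP (EDec e1) e0)))) (ev (EP EV (EN 0)) (Num x))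
      (return_pmf (\<phi> [] (bits x))) ((x + 1) * (260 * (x + 1)))"
    unfolding fold bits_def by (simp add: \<phi>_def)
  show ?thesis unfolding prog_bits_def
    apply (rule computes_mono)
     apply (rule computes_Seq_det[OF computes_asn])
     apply (rule computes_Seq_det[OF W])
     apply (rule computes_asn_eq)
     apply (simp add: \<phi>_def)
    apply (simp add: algebra_simps)
    done
qed

subsection \<open>Trials\<close>

text \<open>The bound \<open>tA n m\<close> covers all formulas of size up to \<open>m\<close>, so
  that one bound serves all queries although their sizes vary.\<close>

locale sat_program =
  fixes A :: com and pA :: "nat \<Rightarrow> cnf \<Rightarrow> val pmf" and tA :: "nat \<Rightarrow> nat \<Rightarrow> nat"
  assumes A: "\<And>n m \<Phi>. cnf_over n \<Phi> \<Longrightarrow> cnf_size n \<Phi> \<le> m \<Longrightarrow> computes_init no_oracle A (enc_cnf n \<Phi>) (pA n \<Phi>) (tA n m)"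
begin

text \<open>For lists that are not formulas over \<open>n\<close> variables the answer is declared
  correct. The error bounds then hold for every argument, and the closeness lemmas need no side
  condition on formulas.\<close>

definition once :: "nat \<Rightarrow> cnf \<Rightarrow> bool pmf" where
  "once n \<Phi> = (if cnf_over n \<Phi> then map_pmf (\<lambda>v. eq_val v (Num 1)) (pA n \<Phi>) else return_pmf (satisfiable n \<Phi>))"

definition prog_vote :: com where
  "prog_vote = Seq (asn (EP e0 (EP (EN 0) (EP (EN 0) r1))))
     (Seq (whl CLess (EN 0) e0 (Seq (call A r3)
        (asn (EIf CEq e0 (EN 1) (EP (EDec e1) (EP (EInc e2) r3)) (EP (EDec e1) (EP e2 (EP (EInc e3) r4)))))))
     (asn (EIf CLess e2 e1 (EN 1) (EN 0))))"

definition t_vote :: "nat \<Rightarrow> nat \<Rightarrow> nat \<Rightarrow> nat" where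
  "t_vote n m R = (R + 1) * (100 + tA n m) + 50"

lemma computes_vote:
  assumes "cnf_over n \<Phi>" "cnf_size n \<Phi> \<le> m"
  shows "computes no_oracle prog_vote (Pair (Num R) (enc_cnf n \<Phi>)) (map_pmf enc_bool (vote_pmf R (once n) \<Phi>)) (t_vote n m R)"
proof -
  define \<phi> where "\<phi> = (\<lambda>(zs :: unit list) a. Pair (Num (length zs)) (Pair (Num (fst a)) (Pair (Num (snd a)) (enc_cnf n \<Phi>))))"
  let ?h = "\<lambda>b a. if b then (Suc (fst a), snd a) else (fst a, Suc (snd a))"
  have fold: "fold ?h bs a = (count_list bs True + fst a, count_list bs False + snd a)" for bs a
    by (induction bs arbitrary: a) auto
  define W where "W = whl CLess (EN 0) e0 (Seq (call A r3)
        (asn (EIf CEq e0 (EN 1) (EP (EDec e1) (EP (EInc e2) r3)) (EP (EDec e1) (EP e2 (EP (EInc e3) r4))))))"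
  have body: "computes no_oracle (Seq (call A r3)
        (asn (EIf CEq e0 (EN 1) (EP (EDec e1) (EP (EInc e2) r3)) (EP (EDec e1) (EP e2 (EP (EInc e3) r4))))))
      (\<phi> (z # zs) a) (map_pmf (\<phi> zs) (map_pmf (\<lambda>b. ?h b a) (once n \<Phi>))) (70 + tA n m)" for z zs a
  proof -
    have "computes_init no_oracle A (ev r3 (\<phi> (z # zs) a)) (pA n \<Phi>) (tA n m)"
      using A[OF assms] by (simp add: \<phi>_def)
    note c = computes_call_init[OF this]
    have once: "once n \<Phi> = map_pmf (\<lambda>v. eq_val v (Num 1)) (pA n \<Phi>)" using assms by (simp add: once_def)
    show ?thesis unfolding once pmf.map_comp
      by (rule computes_mono, rule computes_then_asn, rule c) (auto simp: \<phi>_def)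
  qed
  have "computes no_oracle W (\<phi> (replicate R ()) (0, 0))
     (map_pmf (\<phi> []) (mfold (\<lambda>_ a. map_pmf (\<lambda>b. ?h b a) (once n \<Phi>)) (replicate R ()) (0, 0)))
     ((length (replicate R ()) + 1) * (100 + tA n m))"
    unfolding W_def
    by (rule computes_for_le[where I = "\<lambda>_ _. True" and \<phi> = \<phi> and g = "\<lambda>_ a. map_pmf (\<lambda>b. ?h b a) (once n \<Phi>)", OF _ _ body])
      (simp_all add: \<phi>_def)
  hence W: "computes no_oracle W (ev (EP e0 (EP (EN 0) (EP (EN 0) r1))) (Pair (Num R) (enc_cnf n \<Phi>)))
     (map_pmf (\<lambda>bs. \<phi> [] (count_list bs True, count_list bs False)) (replicate_pmf R (once n \<Phi>)))
     ((R + 1) * (100 + tA n m))"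
    unfolding mfold_replicate fold by (simp add: pmf.map_comp o_def \<phi>_def)
  show ?thesis unfolding prog_vote_def W_def[symmetric] vote_pmf_def pmf.map_comp t_vote_def
    apply (rule computes_mono)
     apply (rule computes_Seq_det[OF computes_asn])
     apply (rule computes_then_asn[OF W])
     apply (simp add: \<phi>_def)
    apply simp
    done
qed

definition prog_filter :: com where
  "prog_filter = whl CPair e0 EV (ite CLess e2 e3
     (Seq (call prog_vote (EP e4 (EP r5 (EFst e0))))
        (asn (EIf CEq e0 (EN 1) (EP (ESnd e1) (EP (EP (EFst e1) e2) (EP (EInc e3) r4))) (EP (ESnd e1) r2))))
     (asn (EP (ESnd e0) r1)))"

lemma computes_filter:
  fixes n m R cap :: nat
  defines "env \<equiv> Pair (Num cap) (Pair (Num R) (Num n))"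
  assumes "\<And>\<Psi>. \<Psi> \<in> set zs \<Longrightarrow> cnf_over n \<Psi> \<and> cnf_size n \<Psi> \<le> m"
  shows "computes no_oracle prog_filter (Pair (enc_cnfs zs) (Pair (Num 0) (Pair (Num 0) env)))
     (map_pmf (\<lambda>L. Pair (Num 0) (Pair (enc_cnfs L) (Pair (Num (length L)) env)))
       (mfold (filter_step (vote_pmf R (once n)) cap) zs []))
     ((length zs + 1) * (200 + t_vote n m R))"
proof -
  define \<phi> where "\<phi> = (\<lambda>zs L. Pair (enc_cnfs zs) (Pair (enc_cnfs L) (Pair (Num (length L)) env)))"
  have body: "computes no_oracle (ite CLess e2 e3
     (Seq (call prog_vote (EP e4 (EP r5 (EFst e0))))
        (asn (EIf CEq e0 (EN 1) (EP (ESnd e1) (EP (EP (EFst e1) e2) (EP (EInc e3) r4))) (EP (ESnd e1) r2))))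
     (asn (EP (ESnd e0) r1))) (\<phi> (z # zs) L) (map_pmf (\<phi> zs) (filter_step (vote_pmf R (once n)) cap z L))
     (150 + t_vote n m R)" if z: "\<forall>\<Psi>\<in>set (z # zs). cnf_over n \<Psi> \<and> cnf_size n \<Psi> \<le> m" for z zs L
  proof (rule computes_mono, rule computes_ite[where T = "120 + t_vote n m R"], goal_cases)
    case 1
    hence len: "length L < cap" by (simp add: \<phi>_def env_def)
    have "computes no_oracle prog_vote (ev (EP e4 (EP r5 (EFst e0))) (\<phi> (z # zs) L))
        (map_pmf enc_bool (vote_pmf R (once n) z)) (t_vote n m R)"
      using computes_vote[of n z m R] z by (simp add: \<phi>_def env_def enc_cnf_eq)
    note c = computes_call_map[OF this]
    have "computes no_oracle (Seq (call prog_vote (EP e4 (EP r5 (EFst e0))))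
        (asn (EIf CEq e0 (EN 1) (EP (ESnd e1) (EP (EP (EFst e1) e2) (EP (EInc e3) r4))) (EP (ESnd e1) r2))))
      (\<phi> (z # zs) L) (map_pmf (\<lambda>b. \<phi> zs (if b then z # L else L)) (vote_pmf R (once n) z)) (120 + t_vote n m R)"
      by (rule computes_mono, rule computes_then_asn[OF c]) (auto simp: \<phi>_def env_def)
    thus ?case using len by (simp add: filter_step_def pmf.map_comp o_def)
  next
    case 2
    hence "\<not> length L < cap" by (simp add: \<phi>_def env_def)
    thus ?case by (intro computes_cong[OF computes_asn]) (simp_all add: \<phi>_def filter_step_def)
  qed simp
  have "computes no_oracle prog_filter (\<phi> zs [])
     (map_pmf (\<phi> []) (mfold (filter_step (vote_pmf R (once n)) cap) zs [])) ((length zs + 1) * (200 + t_vote n m R))"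
    unfolding prog_filter_def
    by (rule computes_for_le[where I = "\<lambda>zs _. \<forall>\<Psi>\<in>set zs. cnf_over n \<Psi> \<and> cnf_size n \<Psi> \<le> m" and \<phi> = \<phi>
        and g = "filter_step (vote_pmf R (once n)) cap", OF _ _ body])
      (use assms in \<open>simp_all add: \<phi>_def\<close>)
  thus ?thesis by (simp add: \<phi>_def)
qed

definition prog_count :: com where
  "prog_count = Seq (whl CLess (EN 0) e0 (Seq (call prog_expand (EP e1 e2))
     (Seq (call prog_filter (EP e0 (EP (EN 0) (EP (EN 0) r5))))
        (asn (EP (EDec e2) (EP (EInc e3) (ESnd e0))))))) (asn e3)"

definition t_count :: "nat \<Rightarrow> nat \<Rightarrow> nat \<Rightarrow> nat \<Rightarrow> nat" where
  "t_count n m R cap = (n + 1) * ((2 * cap + 1) * (200 + t_vote n m R) + (cap + 1) * 200 + 200) + 20"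

lemma computes_count:
  fixes n m R cap :: nat
  defines "env \<equiv> Pair (Num cap) (Pair (Num R) (Num n))"
  assumes \<Phi>: "cnf_over n \<Phi>" "cnf_size n \<Phi> + 2 * n \<le> m" and cap: "1 \<le> cap"
  shows "computes no_oracle prog_count (Pair (Num n) (Pair (Num 0) (Pair (Pair (enc_clauses \<Phi>) (Num 0)) (Pair (Num 1) env))))
     (map_pmf Num (count_sols (vote_pmf R (once n)) cap n \<Phi>)) (t_count n m R cap)"
    and "c \<in> set_pmf (count_sols (vote_pmf R (once n)) cap n \<Phi>) \<Longrightarrow> c \<le> cap"
proof -
  define \<phi> where "\<phi> = (\<lambda>(zs :: nat list) \<Psi>s. Pair (Num (length zs)) (Pair (Num (n - length zs))
      (Pair (enc_cnfs \<Psi>s) (Pair (Num (length \<Psi>s)) env))))"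
  \<comment> \<open>A unit clause adds 2 to \<open>cnf_size\<close>; the summand
    \<open>2 * length zs\<close> reserves this for every variable not yet fixed.\<close>
  define I where "I = (\<lambda>zs \<Psi>s. zs = [n - length zs..<n] \<and> length zs \<le> n \<and> length \<Psi>s \<le> cap \<and>
      (\<forall>\<Psi>\<in>set \<Psi>s. cnf_over n \<Psi> \<and> cnf_size n \<Psi> + 2 * length zs \<le> m))"
  let ?t = "vote_pmf R (once n)"
  define K where "K = (2 * cap + 1) * (200 + t_vote n m R)"
  have upt: "z = n - Suc (length zs) \<and> z < n" "zs = [n - length zs..<n]" "length zs \<le> n" if I: "I (z # zs) \<Psi>s" for z zs \<Psi>s
  proof -
    have zz: "z # zs = [n - Suc (length zs)..<n]" "Suc (length zs) \<le> n" using I unfolding I_def list.size add_0_right add_Suc_right by blast+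
    have a: "n - Suc (length zs) < n" using zz(2) by simp
    have b: "Suc (n - Suc (length zs)) = n - length zs" using zz(2) by simp
    have "z # zs = (n - Suc (length zs)) # [n - length zs..<n]"
      using zz(1) unfolding upt_conv_Cons[OF a] b .
    thus "z = n - Suc (length zs) \<and> z < n" "zs = [n - length zs..<n]" using a by (simp_all only: list.inject)
    show "length zs \<le> n" using zz(2) by simp
  qed
  have ex: "\<forall>\<Psi>\<in>set (expand z \<Psi>s). cnf_over n \<Psi> \<and> cnf_size n \<Psi> + 2 * length zs \<le> m" and z: "z = n - Suc (length zs)" "z < n"
    if I: "I (z # zs) \<Psi>s" for z zs \<Psi>s
  proof -
    show z: "z = n - Suc (length zs)" "z < n" using upt[OF I] by simp_all
    show "\<forall>\<Psi>\<in>set (expand z \<Psi>s). cnf_over n \<Psi> \<and> cnf_size n \<Psi> + 2 * length zs \<le> m"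
    proof -
      have "\<forall>\<Psi>\<in>set \<Psi>s. cnf_over n \<Psi> \<and> cnf_size n \<Psi> + 2 * Suc (length zs) \<le> m"
        using I unfolding I_def by simp
      thus ?thesis unfolding ball_expand using z(2) by (simp add: cnf_size_def)
    qed
  qed
  have step: "I zs L" if I: "I (z # zs) \<Psi>s" and L: "L \<in> set_pmf (count_step ?t cap z \<Psi>s)" for z zs \<Psi>s L
  proof -
    have "length L \<le> cap" "set L \<subseteq> set (expand z \<Psi>s)" using count_step_invariant[OF L] by simp_all
    thus ?thesis unfolding I_def using upt(2,3)[OF I] ex[OF I] by blast
  qed
  have body: "computes no_oracle (Seq (call prog_expand (EP e1 e2))
     (Seq (call prog_filter (EP e0 (EP (EN 0) (EP (EN 0) r5))))
        (asn (EP (EDec e2) (EP (EInc e3) (ESnd e0)))))) (\<phi> (z # zs) \<Psi>s)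
      (map_pmf (\<phi> zs) (count_step ?t cap z \<Psi>s)) (K + (cap + 1) * 200 + 100)" if I: "I (z # zs) \<Psi>s" for z zs \<Psi>s
  proof -
    let ?v = "\<phi> (z # zs) \<Psi>s"
    have len: "length \<Psi>s \<le> cap" using I by (simp add: I_def)
    have "computes no_oracle prog_expand (ev (EP e1 e2) ?v) (return_pmf (enc_cnfs (expand z \<Psi>s))) ((cap + 1) * 200)"
      using computes_mono[OF computes_expand[of no_oracle z \<Psi>s], of "(cap + 1) * 200"] len z[OF I] by (simp add: \<phi>_def)
    note c1 = computes_call_det[OF this]
    have "(length (expand z \<Psi>s) + 1) * (200 + t_vote n m R) \<le> K"
      unfolding K_def length_expand by (rule mult_le_mono1) (use len in simp)
    hence le: "(length (expand z \<Psi>s) + 1) * (200 + t_vote n m R) \<le> K" .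
    have zs: "\<And>\<Psi>. \<Psi> \<in> set (expand z \<Psi>s) \<Longrightarrow> cnf_over n \<Psi> \<and> cnf_size n \<Psi> \<le> m"
      using ex[OF I] by auto
    have "computes no_oracle prog_filter (ev (EP e0 (EP (EN 0) (EP (EN 0) r5))) (Pair (enc_cnfs (expand z \<Psi>s)) ?v))
      (map_pmf (\<lambda>L. Pair (Num 0) (Pair (enc_cnfs L) (Pair (Num (length L)) env))) (count_step ?t cap z \<Psi>s)) K"
      using computes_mono[OF computes_filter[OF zs, where cap = cap and R = R] le] by (simp add: \<phi>_def env_def count_step_def)
    note c2 = computes_call_map[OF this]
    have n: "Suc (length zs) \<le> n" using I by (simp add: I_def)
    show ?thesis
      by (rule computes_mono, rule computes_Seq_det[OF c1], rule computes_then_asn[OF c2])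
        (use n in \<open>simp_all add: \<phi>_def Suc_diff_Suc\<close>)
  qed
  have I0: "I [0..<n] [\<Phi>]" using \<Phi> cap by (simp add: I_def)
  have W: "computes no_oracle (whl CLess (EN 0) e0 (Seq (call prog_expand (EP e1 e2))
     (Seq (call prog_filter (EP e0 (EP (EN 0) (EP (EN 0) r5))))
        (asn (EP (EDec e2) (EP (EInc e3) (ESnd e0))))))) (\<phi> [0..<n] [\<Phi>])
     (map_pmf (\<phi> []) (mfold (count_step ?t cap) [0..<n] [\<Phi>])) ((length [0..<n] + 1) * (K + (cap + 1) * 200 + 200))"
    by (rule computes_for_le[where I = I and \<phi> = \<phi> and g = "count_step ?t cap", OF _ _ body step I0])
      (simp_all add: \<phi>_def)
  have e: "ev e3 (\<phi> [] \<Psi>s) = Num (length \<Psi>s)" for \<Psi>s by (simp add: \<phi>_def)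
  have init: "\<phi> [0..<n] [\<Phi>] = Pair (Num n) (Pair (Num 0) (Pair (Pair (enc_clauses \<Phi>) (Num 0)) (Pair (Num 1) env)))"
    by (simp add: \<phi>_def)
  show "computes no_oracle prog_count (Pair (Num n) (Pair (Num 0) (Pair (Pair (enc_clauses \<Phi>) (Num 0)) (Pair (Num 1) env))))
     (map_pmf Num (count_sols ?t cap n \<Phi>)) (t_count n m R cap)"
    unfolding prog_count_def count_sols_def pmf.map_comp t_count_def K_def[symmetric] init[symmetric] o_def
    by (rule computes_mono[OF computes_then_asn[OF W e]]) simp
  show "c \<le> cap" if c: "c \<in> set_pmf (count_sols ?t cap n \<Phi>)"
  proof -
    from c obtain L where L: "L \<in> set_pmf (mfold (count_step ?t cap) [0..<n] [\<Phi>])" "c = length L"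
      by (auto simp: count_sols_def)
    have "I [] L" by (rule mfold_invariant[where I = I, OF L(1) I0], rule step)
    thus ?thesis by (simp add: I_def L(2))
  qed
qed

end

subsection \<open>Concentration of sums\<close>

lemma exp_le_quadratic:
  fixes y :: real
  assumes "\<bar>y\<bar> \<le> 1"
  shows "exp y \<le> 1 + y + y\<^sup>2"
proof (cases "0 \<le> y")
  case True
  thus ?thesis using exp_bound[of y] assms by simp
next
  case False
  define t where "t = - y"
  have t: "0 < t" "t \<le> 1" using False assms by (simp_all add: t_def)
  have "1 \<le> (1 - t + t\<^sup>2) * (1 + t)" using t by (simp add: algebra_simps power2_eq_square)
  also have "\<dots> \<le> (1 - t + t\<^sup>2) * exp t"
    using t exp_ge_add_one_self[of t] by (intro mult_left_mono) auto
  finally have "1 * exp (- t) \<le> (1 - t + t\<^sup>2) * exp t * exp (- t)" by (intro mult_right_mono) auto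
  hence "exp (- t) \<le> 1 - t + t\<^sup>2" by (simp add: mult.assoc flip: exp_add)
  thus ?thesis by (simp add: t_def)
qed

lemma nn_integral_replicate_prod:
  fixes f :: "'a \<Rightarrow> ennreal"
  shows "(\<integral>\<^sup>+xs. (\<Prod>x\<leftarrow>xs. f x) \<partial>measure_pmf (replicate_pmf m p)) = (\<integral>\<^sup>+x. f x \<partial>measure_pmf p) ^ m"
  by (induction m) (simp_all add: nn_integral_cmult nn_integral_multc)

text \<open>Chernoff's method: exp y <= 1 + y + y^2 and mean zero give E exp (c g) <= exp (c^2 B^2),
  and c = \<epsilon> / (2 B^2) minimises c^2 B^2 - c \<epsilon>. The assumption \<epsilon> <= 2 B
  keeps |c g| <= 1, where the quadratic bound is valid.\<close>

lemma sum_list_tail: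
  fixes g :: "'a \<Rightarrow> real"
  assumes g: "\<And>x. x \<in> set_pmf p \<Longrightarrow> \<bar>g x\<bar> \<le> B" and mean: "E p g = 0" and B: "0 < B" and \<epsilon>: "0 \<le> \<epsilon>" "\<epsilon> \<le> 2 * B"
  shows "measure_pmf.prob (replicate_pmf m p) {xs. real m * \<epsilon> \<le> (\<Sum>x\<leftarrow>xs. g x)} \<le> exp (- (real m * \<epsilon>\<^sup>2 / (4 * B\<^sup>2)))"
proof -
  define c where "c = \<epsilon> / (2 * B\<^sup>2)"
  have c0: "0 \<le> c" using B \<epsilon> by (simp add: c_def)
  have cB: "c * B \<le> 1" using B \<epsilon> by (simp add: c_def power2_eq_square field_simps)
  have one: "(\<integral>\<^sup>+x. ennreal (exp (c * g x)) \<partial>measure_pmf p) \<le> ennreal (exp (c\<^sup>2 * B\<^sup>2))"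
  proof -
    have b: "\<bar>c * g x\<bar> \<le> 1" "(c * g x)\<^sup>2 \<le> c\<^sup>2 * B\<^sup>2" if "x \<in> set_pmf p" for x
    proof -
      have "\<bar>c * g x\<bar> = c * \<bar>g x\<bar>" using c0 by (simp add: abs_mult)
      also have "\<dots> \<le> c * B" using g[OF that] c0 by (rule mult_left_mono)
      finally have *: "\<bar>c * g x\<bar> \<le> c * B" .
      thus "\<bar>c * g x\<bar> \<le> 1" using cB by linarith
      have "\<bar>c * g x\<bar>\<^sup>2 \<le> (c * B)\<^sup>2" by (rule power_mono[OF *]) simp
      thus "(c * g x)\<^sup>2 \<le> c\<^sup>2 * B\<^sup>2" by (simp add: power_mult_distrib)
    qed
    have int: "integrable (measure_pmf p) (\<lambda>x. exp (c * g x))"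
    proof (rule integrable_bounded_pmf)
      fix x assume "x \<in> set_pmf p"
      hence "c * g x \<le> 1" using b(1)[of x] by linarith
      thus "\<bar>exp (c * g x)\<bar> \<le> exp 1" by simp
    qed
    have intg: "integrable (measure_pmf p) g" by (rule integrable_bounded_pmf) (rule g)
    have "E p (\<lambda>x. exp (c * g x)) \<le> E p (\<lambda>x. (1 + c\<^sup>2 * B\<^sup>2) + c * g x)"
    proof (rule integral_mono_AE[OF int])
      show "integrable (measure_pmf p) (\<lambda>x. (1 + c\<^sup>2 * B\<^sup>2) + c * g x)" using intg by simp
      show "AE x in measure_pmf p. exp (c * g x) \<le> (1 + c\<^sup>2 * B\<^sup>2) + c * g x"
        unfolding AE_measure_pmf_iff
      proof
        fix x assume x: "x \<in> set_pmf p"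
        have "exp (c * g x) \<le> 1 + c * g x + (c * g x)\<^sup>2" by (rule exp_le_quadratic[OF b(1)[OF x]])
        thus "exp (c * g x) \<le> (1 + c\<^sup>2 * B\<^sup>2) + c * g x" using b(2)[OF x] by linarith
      qed
    qed
    also have "\<dots> = 1 + c\<^sup>2 * B\<^sup>2"
      by (subst Bochner_Integration.integral_add) (use intg mean in simp_all)
    also have "\<dots> \<le> exp (c\<^sup>2 * B\<^sup>2)" by (rule exp_ge_add_one_self)
    finally have "E p (\<lambda>x. exp (c * g x)) \<le> exp (c\<^sup>2 * B\<^sup>2)" .
    thus ?thesis by (subst nn_integral_eq_integral[OF int]) (auto intro: ennreal_leI)
  qed
  let ?A = "{xs. real m * \<epsilon> \<le> (\<Sum>x\<leftarrow>xs. g x)}"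
  have "ennreal (measure_pmf.prob (replicate_pmf m p) ?A) = (\<integral>\<^sup>+xs. indicator ?A xs \<partial>measure_pmf (replicate_pmf m p))"
    by (simp add: measure_pmf.emeasure_eq_measure)
  also have "\<dots> \<le> (\<integral>\<^sup>+xs. ennreal (exp (- (c * (real m * \<epsilon>)))) * (\<Prod>x\<leftarrow>xs. ennreal (exp (c * g x))) \<partial>measure_pmf (replicate_pmf m p))"
  proof (rule nn_integral_mono)
    fix xs
    have prod: "(\<Prod>x\<leftarrow>xs. ennreal (exp (c * g x))) = ennreal (exp (c * (\<Sum>x\<leftarrow>xs. g x)))"
      by (induction xs) (simp_all add: distrib_left exp_add ennreal_mult')
    have eq: "ennreal (exp (- (c * (real m * \<epsilon>)))) * (\<Prod>x\<leftarrow>xs. ennreal (exp (c * g x))) =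
        ennreal (exp (c * ((\<Sum>x\<leftarrow>xs. g x) - real m * \<epsilon>)))"
    proof -
      have "exp (c * ((\<Sum>x\<leftarrow>xs. g x) - real m * \<epsilon>)) = exp (- (c * (real m * \<epsilon>))) * exp (c * (\<Sum>x\<leftarrow>xs. g x))"
        unfolding exp_add[symmetric] by (rule arg_cong[where f = exp]) (simp add: right_diff_distrib)
      thus ?thesis unfolding prod by (simp add: ennreal_mult')
    qed
    show "indicator ?A xs \<le> ennreal (exp (- (c * (real m * \<epsilon>)))) * (\<Prod>x\<leftarrow>xs. ennreal (exp (c * g x)))"
    proof (cases "xs \<in> ?A")
      case True
      hence "0 \<le> c * ((\<Sum>x\<leftarrow>xs. g x) - real m * \<epsilon>)" using c0 by simp
      hence "ennreal 1 \<le> ennreal (exp (c * ((\<Sum>x\<leftarrow>xs. g x) - real m * \<epsilon>)))" by (intro ennreal_leI) simp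
      thus ?thesis unfolding eq using True by simp
    qed simp
  qed
  also have "\<dots> = ennreal (exp (- (c * (real m * \<epsilon>)))) * (\<integral>\<^sup>+x. ennreal (exp (c * g x)) \<partial>measure_pmf p) ^ m"
    by (simp add: nn_integral_cmult nn_integral_replicate_prod)
  also have "\<dots> \<le> ennreal (exp (- (c * (real m * \<epsilon>)))) * ennreal (exp (c\<^sup>2 * B\<^sup>2)) ^ m"
    by (intro mult_left_mono power_mono one) auto
  also have "\<dots> = ennreal (exp (- (c * (real m * \<epsilon>))) * exp (c\<^sup>2 * B\<^sup>2) ^ m)"
    by (simp add: ennreal_power ennreal_mult')
  also have "exp (- (c * (real m * \<epsilon>))) * exp (c\<^sup>2 * B\<^sup>2) ^ m = exp (- (real m * \<epsilon>\<^sup>2 / (4 * B\<^sup>2)))"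
  proof -
    have "- (c * (real m * \<epsilon>)) + real m * (c\<^sup>2 * B\<^sup>2) = - (real m * \<epsilon>\<^sup>2 / (4 * B\<^sup>2))"
      using B by (simp add: c_def field_simps power2_eq_square)
    thus ?thesis by (simp only: exp_of_nat_mult[symmetric] exp_add[symmetric])
  qed
  finally show ?thesis by simp
qed

lemma mean_tail:
  fixes g :: "'a \<Rightarrow> real"
  assumes g: "\<And>x. 0 \<le> g x" "\<And>x. g x \<le> B" and B: "0 < B" and \<epsilon>: "0 \<le> \<epsilon>" "\<epsilon> \<le> 2 * B"
  shows "measure_pmf.prob (replicate_pmf m p) {xs. real m * \<epsilon> \<le> \<bar>(\<Sum>x\<leftarrow>xs. g x) - real m * E p g\<bar>} \<le>
     2 * exp (- (real m * \<epsilon>\<^sup>2 / (4 * B\<^sup>2)))"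
proof -
  let ?m = "E p g"
  have m: "0 \<le> ?m" "?m \<le> B" using E_nonneg[of g p] E_le[of g B p] g by auto
  have intg: "integrable (measure_pmf p) g"
    by (rule integrable_bounded_pmf[of _ _ B]) (use g in \<open>simp add: abs_of_nonneg\<close>)
  have abs: "\<bar>g x - ?m\<bar> \<le> B" "\<bar>?m - g x\<bar> \<le> B" for x
    using g(1)[of x] g(2)[of x] m by linarith+
  have sum: "(\<Sum>x\<leftarrow>xs. g x - ?m) = (\<Sum>x\<leftarrow>xs. g x) - real (length xs) * ?m"
    "(\<Sum>x\<leftarrow>xs. ?m - g x) = real (length xs) * ?m - (\<Sum>x\<leftarrow>xs. g x)" for xs
    by (induction xs) (simp_all add: algebra_simps)
  let ?R = "replicate_pmf m p"
  let ?U = "{xs. real m * \<epsilon> \<le> (\<Sum>x\<leftarrow>xs. g x - ?m)}" and ?V = "{xs. real m * \<epsilon> \<le> (\<Sum>x\<leftarrow>xs. ?m - g x)}"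
  have "measure_pmf.prob ?R {xs. real m * \<epsilon> \<le> \<bar>(\<Sum>x\<leftarrow>xs. g x) - real m * ?m\<bar>} \<le> measure_pmf.prob ?R (?U \<union> ?V)"
  proof (rule measure_pmf.finite_measure_mono_AE)
    show "AE xs in ?R. xs \<in> {xs. real m * \<epsilon> \<le> \<bar>(\<Sum>x\<leftarrow>xs. g x) - real m * ?m\<bar>} \<longrightarrow> xs \<in> ?U \<union> ?V"
      unfolding AE_measure_pmf_iff
    proof (intro ballI impI)
      fix xs assume "xs \<in> set_pmf ?R" and *: "xs \<in> {xs. real m * \<epsilon> \<le> \<bar>(\<Sum>x\<leftarrow>xs. g x) - real m * ?m\<bar>}"
      hence len: "length xs = m" by (simp add: set_replicate_pmf)
      show "xs \<in> ?U \<union> ?V" using * unfolding Un_iff mem_Collect_eq sum len by linarith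
    qed
  qed simp
  also have "\<dots> \<le> measure_pmf.prob ?R ?U + measure_pmf.prob ?R ?V"
    by (rule measure_Un_le) auto
  also have "measure_pmf.prob ?R ?U \<le> exp (- (real m * \<epsilon>\<^sup>2 / (4 * B\<^sup>2)))"
    by (rule sum_list_tail) (use abs intg B \<epsilon> in simp_all)
  also have "measure_pmf.prob ?R ?V \<le> exp (- (real m * \<epsilon>\<^sup>2 / (4 * B\<^sup>2)))"
    by (rule sum_list_tail) (use abs intg B \<epsilon> in simp_all)
  finally show ?thesis by simp
qed

subsection \<open>Capped counts\<close>

text \<open>Pointwise, min(cap, N) is at least \<theta> N - \<theta>^2 N^2 / (4 cap): the difference
  between cap and the right-hand side is a square, and \<theta> N <= N settles the rest. Hence the
  cut-off costs only a second moment. The parameter \<theta> keeps the bound useful for large \<mu>,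
  where the quadratic term would win at \<theta> = 1.\<close>

lemma capped_mean:
  fixes cap e l :: nat
  assumes fin: "finite S" and disp: "dispersion D g S l \<le> 2 ^ (e + 1)" and cap: "cap = 2 ^ (2 * e + 6)"
  defines "\<mu> \<equiv> real (card S) / 2 ^ l"
  defines "m \<equiv> E (hash_pmf D l) (\<lambda>ps. real (min cap (hits g S ps)))"
  shows "m \<le> \<mu>" "0 \<le> \<theta> \<Longrightarrow> \<theta> \<le> 1 \<Longrightarrow> \<theta> * \<mu> - (\<theta> * \<mu>)\<^sup>2 / 2 ^ (e + 7) \<le> m"
proof -
  let ?N = "\<lambda>ps. real (hits g S ps)"
  let ?s = "real (card S)"
  have N: "0 \<le> ?N ps" "?N ps \<le> ?s" for ps using hits_le[OF fin, of g ps] by simp_all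
  have N2: "(?N ps)\<^sup>2 \<le> ?s\<^sup>2" for ps by (rule power_mono) (use N in auto)
  have "m \<le> E (hash_pmf D l) ?N"
    unfolding m_def by (rule E_mono[of _ _ _ ?s]) (use N in \<open>auto simp: min_def intro: order_trans\<close>)
  thus "m \<le> \<mu>" by (simp add: E_hits[OF fin] \<mu>_def)
  assume lam: "0 \<le> \<theta>" "\<theta> \<le> 1"
  define a where "a = \<theta>\<^sup>2 / (4 * real cap)"
  have cap0: "0 < real cap" by (simp add: cap)
  have a0: "0 \<le> a" by (simp add: a_def)
  have pt: "\<theta> * ?N ps - a * (?N ps)\<^sup>2 \<le> real (min cap (hits g S ps))" for ps
  proof -
    have "\<theta> * ?N ps \<le> 1 * ?N ps" using lam by (intro mult_right_mono) auto
    moreover have "0 \<le> a * (?N ps)\<^sup>2" using a0 by simp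
    ultimately have 1: "\<theta> * ?N ps - a * (?N ps)\<^sup>2 \<le> ?N ps" by linarith
    have "0 \<le> (\<theta> * ?N ps - 2 * real cap)\<^sup>2 / (4 * real cap)" using cap0 by simp
    also have "\<dots> = a * (?N ps)\<^sup>2 - \<theta> * ?N ps + real cap"
      using cap0 by (simp add: a_def field_simps power2_eq_square)
    finally have "\<theta> * ?N ps - a * (?N ps)\<^sup>2 \<le> real cap" by linarith
    with 1 show ?thesis by (simp add: min_def)
  qed
  have int: "integrable (measure_pmf (hash_pmf D l)) (\<lambda>ps. \<theta> * ?N ps)" "integrable (measure_pmf (hash_pmf D l)) (\<lambda>ps. a * (?N ps)\<^sup>2)"
  proof -
    have "integrable (measure_pmf (hash_pmf D l)) ?N"
      by (rule integrable_bounded_pmf[of _ _ ?s]) (use N in simp)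
    thus "integrable (measure_pmf (hash_pmf D l)) (\<lambda>ps. \<theta> * ?N ps)" by simp
    have "integrable (measure_pmf (hash_pmf D l)) (\<lambda>ps. (?N ps)\<^sup>2)"
      by (rule integrable_bounded_pmf[of _ _ "?s\<^sup>2"]) (use N2 in simp)
    thus "integrable (measure_pmf (hash_pmf D l)) (\<lambda>ps. a * (?N ps)\<^sup>2)" by simp
  qed
  have "E (hash_pmf D l) (\<lambda>ps. \<theta> * ?N ps - a * (?N ps)\<^sup>2) \<le> m"
    unfolding m_def
  proof (rule integral_mono)
    show "integrable (measure_pmf (hash_pmf D l)) (\<lambda>ps. \<theta> * ?N ps - a * (?N ps)\<^sup>2)"
      by (rule Bochner_Integration.integrable_diff[OF int])
    show "integrable (measure_pmf (hash_pmf D l)) (\<lambda>ps. real (min cap (hits g S ps)))"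
      by (rule integrable_bounded_pmf[of _ _ "real cap"]) simp
  qed (rule pt)
  moreover have "E (hash_pmf D l) (\<lambda>ps. \<theta> * ?N ps - a * (?N ps)\<^sup>2) = \<theta> * \<mu> - a * (\<mu>\<^sup>2 * dispersion D g S l)"
    by (subst Bochner_Integration.integral_diff[OF int]) (simp add: E_hits[OF fin] E_hits_square[OF fin] \<mu>_def)
  moreover have "a * (\<mu>\<^sup>2 * dispersion D g S l) \<le> a * (\<mu>\<^sup>2 * 2 ^ (e + 1))"
    by (intro mult_left_mono disp a0) simp
  moreover have "a * (\<mu>\<^sup>2 * 2 ^ (e + 1)) = (\<theta> * \<mu>)\<^sup>2 / 2 ^ (e + 7)"
  proof -
    have "real cap = 2 ^ e * 2 ^ e * 64" by (simp add: cap power_add power_mult power2_eq_square flip: power_mult_distrib)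
    thus ?thesis by (simp add: a_def power_add power_mult_distrib mult_ac)
  qed
  ultimately show "\<theta> * \<mu> - (\<theta> * \<mu>)\<^sup>2 / 2 ^ (e + 7) \<le> m" by linarith
qed

definition accurate :: "nat \<Rightarrow> nat \<Rightarrow> nat \<Rightarrow> nat \<times> nat \<Rightarrow> bool" where
  "accurate e M s r \<longleftrightarrow> \<bar>real (snd r) * 2 ^ fst r / real M - real s\<bar> \<le> real s / 2 ^ e"

text \<open>The predicate \<open>ok\<close> says that the mean of the cut-off counts is within
  \<epsilon> = 2^-(e + 1) of its expectation. Then a mean of at most 4 certifies \<mu> < 8, where
  the cut-off costs at most \<epsilon>, and \<mu> <= 2 forces a mean of at most 4. As \<mu> >= 1,
  the total additive error 2 \<epsilon> is also a relative one.\<close>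

lemma level_error:
  fixes cap e l c :: nat
  assumes fin: "finite S" and disp: "dispersion D g S l \<le> 2 ^ (e + 1)" and cap: "cap = 2 ^ (2 * e + 6)"
    and s: "2 ^ l \<le> card S" and M: "M = 2 ^ (7 * e + c)"
  shows "\<exists>ok. measure_pmf.prob (map_pmf sum_list (replicate_pmf M (map_pmf (\<lambda>ps. min cap (hits g S ps)) (hash_pmf D l)))) {T. \<not> ok T}
       \<le> 2 * exp (- (2 ^ (e + c) / 2 ^ 16)) \<and>
     (\<forall>T. ok T \<longrightarrow> T \<le> 4 * M \<longrightarrow> accurate e M (card S) (l, T)) \<and>
     (card S \<le> 2 * 2 ^ l \<longrightarrow> (\<forall>T. ok T \<longrightarrow> T \<le> 4 * M))"
proof -
  define \<mu> where "\<mu> = real (card S) / 2 ^ l"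
  define m where "m = E (hash_pmf D l) (\<lambda>ps. real (min cap (hits g S ps)))"
  define \<epsilon> :: real where "\<epsilon> = 1 / 2 ^ (e + 1)"
  have \<epsilon>: "0 < \<epsilon>" "\<epsilon> \<le> 1 / 2" by (simp_all add: \<epsilon>_def)
  note cm = capped_mean[OF fin disp cap, folded \<mu>_def m_def]
  have M0: "0 < real M" by (simp add: M)
  have \<mu>1: "1 \<le> \<mu>"
  proof -
    have "real (2 ^ l) \<le> real (card S)" using s by (simp only: of_nat_le_iff)
    thus ?thesis by (simp add: \<mu>_def)
  qed
  define ok where "ok = (\<lambda>T :: nat. \<bar>real T - real M * m\<bar> < real M * \<epsilon>)"
  have ok: "real T < real M * (m + \<epsilon>)" "real M * (m - \<epsilon>) < real T" if "ok T" for T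
    using that unfolding ok_def abs_less_iff by (simp_all add: algebra_simps)
  have tail: "measure_pmf.prob (map_pmf sum_list (replicate_pmf M (map_pmf (\<lambda>ps. min cap (hits g S ps)) (hash_pmf D l)))) {T. \<not> ok T}
       \<le> 2 * exp (- (2 ^ (e + c) / 2 ^ 16))"
  proof -
    let ?X = "\<lambda>ps. min cap (hits g S ps)"
    have sum: "real (sum_list (map ?X xs)) = (\<Sum>ps\<leftarrow>xs. real (?X ps))" for xs
      by (induction xs) simp_all
    have "measure_pmf.prob (map_pmf sum_list (replicate_pmf M (map_pmf ?X (hash_pmf D l)))) {T. \<not> ok T} =
        measure_pmf.prob (replicate_pmf M (hash_pmf D l)) {xs. real M * \<epsilon> \<le> \<bar>(\<Sum>ps\<leftarrow>xs. real (?X ps)) - real M * m\<bar>}"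
      unfolding replicate_pmf_map pmf.map_comp measure_map_pmf
      by (rule arg_cong[where f = "measure_pmf.prob _"]) (auto simp: ok_def sum not_less)
    also have "\<dots> \<le> 2 * exp (- (real M * \<epsilon>\<^sup>2 / (4 * (real cap)\<^sup>2)))"
      unfolding m_def
    proof (rule mean_tail)
      have "(1 :: real) \<le> real cap" by (simp add: cap)
      thus "0 < real cap" "\<epsilon> \<le> 2 * real cap" using \<epsilon> by linarith+
    qed (use \<epsilon> in simp_all)
    also have "real M * \<epsilon>\<^sup>2 / (4 * (real cap)\<^sup>2) = 2 ^ (e + c) / 2 ^ 16"
    proof -
      define z :: real where "z = 2 ^ e"
      have z: "0 < z" by (simp add: z_def)
      have eM: "real M = z ^ 7 * 2 ^ c" by (simp add: M z_def power_add power_mult mult.commute flip: power_mult)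
      have eC: "real cap = z ^ 2 * 64" by (simp add: cap z_def power_add mult.commute flip: power_mult)
      have eE: "\<epsilon> = 1 / (z * 2)" by (simp add: \<epsilon>_def z_def)
      have eP: "2 ^ (e + c) = z * 2 ^ c" by (simp add: z_def power_add)
      show ?thesis unfolding eM eC eE eP using z by (simp add: field_simps eval_nat_numeral)
    qed
    finally show ?thesis .
  qed
  have acc: "accurate e M (card S) (l, T)" if T: "ok T" "T \<le> 4 * M" for T
  proof -
    have "real T \<le> real (4 * M)" using T(2) by (simp only: of_nat_le_iff)
    hence "real M * (m - \<epsilon>) < real M * 4" using ok(2)[OF T(1)] by simp
    hence m4: "m - \<epsilon> < 4" using M0 by (simp only: mult_less_cancel_left_pos)
    have \<mu>8: "\<mu> < 8"
    proof (rule ccontr)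
      assume "\<not> \<mu> < 8"
      \<comment> \<open>With \<theta> = 8 / \<mu> the expectation is at least 8 - 64 / 2^(e + 7) >=
        7, too much for an observed mean of at most 4.\<close>
      hence 8: "8 \<le> \<mu>" by simp
      have "(8 / \<mu>) * \<mu> - ((8 / \<mu>) * \<mu>)\<^sup>2 / 2 ^ (e + 7) \<le> m" by (rule cm(2)) (use 8 in simp_all)
      moreover have eq8: "(8 / \<mu>) * \<mu> = 8" using 8 by simp
      ultimately have "8 - 8\<^sup>2 / 2 ^ (e + 7) \<le> m" unfolding eq8 by simp
      moreover have "(8 :: real)\<^sup>2 / 2 ^ (e + 7) \<le> 1"
      proof -
        have "(1 :: real) \<le> 2 ^ e" by simp
        hence "(1 :: real) \<le> 2 * 2 ^ e" by linarith
        thus ?thesis by (simp add: power_add)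
      qed
      ultimately show False using m4 \<epsilon>(2) by linarith
    qed
    have "\<mu> - \<mu>\<^sup>2 / 2 ^ (e + 7) \<le> m" using cm(2)[of 1] by simp
    moreover have "\<mu>\<^sup>2 / 2 ^ (e + 7) \<le> \<epsilon>"
    proof -
      have "\<mu>\<^sup>2 \<le> 8\<^sup>2" using \<mu>8 \<mu>1 by (intro power_mono) auto
      hence "\<mu>\<^sup>2 / 2 ^ (e + 7) \<le> 8\<^sup>2 / 2 ^ (e + 7)" by (rule divide_right_mono) simp
      also have "\<dots> = \<epsilon>" by (simp add: \<epsilon>_def power_add)
      finally show ?thesis .
    qed
    ultimately have lo: "\<mu> - \<epsilon> \<le> m" by linarith
    have "real T / real M < m + \<epsilon>" "m - \<epsilon> < real T / real M"
      using ok[OF T(1)] M0 by (simp_all add: field_simps)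
    hence "\<bar>real T / real M - \<mu>\<bar> \<le> 2 * \<epsilon>" using lo cm(1) by linarith
    also have "2 * \<epsilon> = 1 / 2 ^ e" by (simp add: \<epsilon>_def)
    also have "\<dots> \<le> \<mu> / 2 ^ e" using \<mu>1 by (intro divide_right_mono) auto
    finally have "2 ^ l * \<bar>real T / real M - \<mu>\<bar> \<le> 2 ^ l * (\<mu> / 2 ^ e)" by (rule mult_left_mono) simp
    also have "2 ^ l * (\<mu> / 2 ^ e) = real (card S) / 2 ^ e" by (simp add: \<mu>_def)
    also have "2 ^ l * \<bar>real T / real M - \<mu>\<bar> = \<bar>2 ^ l * (real T / real M - \<mu>)\<bar>" by (simp add: abs_mult)
    also have "2 ^ l * (real T / real M - \<mu>) = real T * 2 ^ l / real M - real (card S)"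
      by (simp add: \<mu>_def right_diff_distrib)
    finally show ?thesis by (simp add: accurate_def)
  qed
  have stop: "T \<le> 4 * M" if "card S \<le> 2 * 2 ^ l" "ok T" for T
  proof -
    have "real (card S) \<le> real (2 * 2 ^ l)" using that(1) by (simp only: of_nat_le_iff)
    hence "\<mu> \<le> 2" by (simp add: \<mu>_def field_simps)
    hence "m + \<epsilon> \<le> 4" using cm(1) \<epsilon> by linarith
    hence "real M * (m + \<epsilon>) \<le> real M * 4" by (rule mult_left_mono) simp
    hence "real T \<le> real (4 * M)" using ok(1)[OF that(2)] by simp
    thus ?thesis by (simp only: of_nat_le_iff)
  qed
  show ?thesis by (rule exI[of _ ok]) (use tail acc stop in auto)
qed

text \<open>Union bound over the levels up to \<open>l0\<close>, where the search ends unless that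
  level fails; a stop at a level that is \<open>ok\<close> gives a good result.\<close>

lemma levels_error:
  fixes \<beta> :: real
  assumes ok: "\<And>l. l \<in> set (ls1 @ [l0]) \<Longrightarrow> measure_pmf.prob (map_pmf sum_list (replicate_pmf M (tr l))) {T. \<not> ok l T} \<le> \<beta>"
    and acc: "\<And>l T. l \<in> set (ls1 @ [l0]) \<Longrightarrow> ok l T \<Longrightarrow> T \<le> 4 * M \<Longrightarrow> G (l, T)"
    and stop: "\<And>T. ok l0 T \<Longrightarrow> T \<le> 4 * M"
  shows "measure_pmf.prob (levels tr M (ls1 @ l0 # ls2)) {r. \<not> G r} \<le> (real (length ls1) + 1) * \<beta>"
  using ok acc
proof (induction ls1)
  case Nil
  let ?P = "map_pmf sum_list (replicate_pmf M (tr l0))"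
  have "measure_pmf.prob (levels tr M (l0 # ls2)) {r. \<not> G r} =
      E ?P (\<lambda>T. E (if 4 * M < T then levels tr M ls2 else return_pmf (l0, T)) (\<lambda>r. of_bool (\<not> G r)))"
    unfolding prob_E levels.simps by (subst E_bind[of _ 1]) simp_all
  also have "\<dots> \<le> E ?P (\<lambda>T. of_bool (\<not> ok l0 T))"
  proof (rule E_mono[of _ _ _ 1])
    fix T
    show "E (if 4 * M < T then levels tr M ls2 else return_pmf (l0, T)) (\<lambda>r. of_bool (\<not> G r)) \<le> of_bool (\<not> ok l0 T)"
    proof (cases "ok l0 T")
      case True
      hence "\<not> 4 * M < T" "G (l0, T)" using stop[OF True] Nil(2)[of l0 T] by auto
      thus ?thesis by simp
    next
      case False
      thus ?thesis by (auto intro: E_le)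
    qed
    have "\<bar>E p (\<lambda>r. of_bool (\<not> G r))\<bar> \<le> 1" for p
      using E_le[of "\<lambda>r. of_bool (\<not> G r)" 1 p] E_nonneg[of "\<lambda>r. of_bool (\<not> G r)" p] by (simp add: abs_of_nonneg)
    thus "\<bar>E (if 4 * M < T then levels tr M ls2 else return_pmf (l0, T)) (\<lambda>r. of_bool (\<not> G r))\<bar> \<le> 1" .
  qed simp
  also have "\<dots> \<le> \<beta>" using Nil(1)[of l0] unfolding prob_E by simp
  finally show ?case by simp
next
  case (Cons l ls1)
  let ?P = "map_pmf sum_list (replicate_pmf M (tr l))"
  let ?L = "levels tr M (ls1 @ l0 # ls2)"
  let ?b = "(real (length ls1) + 1) * \<beta>"
  have IH: "E ?L (\<lambda>r. of_bool (\<not> G r)) \<le> ?b"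
    unfolding prob_E[symmetric] by (rule Cons.IH) (use Cons.prems in auto)
  have b1: "\<bar>E p (\<lambda>r. of_bool (\<not> G r))\<bar> \<le> 1" for p
    using E_le[of "\<lambda>r. of_bool (\<not> G r)" 1 p] E_nonneg[of "\<lambda>r. of_bool (\<not> G r)" p] by (simp add: abs_of_nonneg)
  have b0: "0 \<le> ?b" using order_trans[OF E_nonneg IH] by simp
  have "measure_pmf.prob (levels tr M ((l # ls1) @ l0 # ls2)) {r. \<not> G r} =
      E ?P (\<lambda>T. E (if 4 * M < T then ?L else return_pmf (l, T)) (\<lambda>r. of_bool (\<not> G r)))"
    unfolding prob_E append_Cons levels.simps by (subst E_bind[of _ 1]) simp_all
  also have "\<dots> \<le> E ?P (\<lambda>T. of_bool (\<not> ok l T) + ?b)"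
  proof (rule E_mono[of _ _ _ "1 + \<bar>?b\<bar>"])
    fix T
    show "E (if 4 * M < T then ?L else return_pmf (l, T)) (\<lambda>r. of_bool (\<not> G r)) \<le> of_bool (\<not> ok l T) + ?b"
    proof (cases "4 * M < T")
      case True
      have "E ?L (\<lambda>r. of_bool (\<not> G r)) \<le> of_bool (\<not> ok l T) + ?b"
        by (rule order_trans[OF IH]) simp
      thus ?thesis using True by simp
    next
      case False
      have "of_bool (\<not> G (l, T)) \<le> of_bool (\<not> ok l T) + ?b"
        using Cons.prems(2)[of l T] False b0 by (cases "ok l T") auto
      thus ?thesis using False by simp
    qed
    show "\<bar>E (if 4 * M < T then ?L else return_pmf (l, T)) (\<lambda>r. of_bool (\<not> G r))\<bar> \<le> 1 + \<bar>?b\<bar>"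
      by (rule order_trans[OF b1]) simp
    show "\<bar>of_bool (\<not> ok l T) + ?b\<bar> \<le> 1 + \<bar>?b\<bar>"
      by (rule order_trans[OF abs_triangle_ineq]) simp
  qed
  also have "\<dots> = E ?P (\<lambda>T. of_bool (\<not> ok l T)) + ?b"
    by (subst Bochner_Integration.integral_add) (auto intro!: integrable_bounded_pmf[of _ _ 1])
  also have "\<dots> \<le> \<beta> + ?b" using Cons.prems(1)[of l] unfolding prob_E by simp
  finally show ?case by (simp add: algebra_simps)
qed

subsection \<open>Sparse parities\<close>

lemma lparity_rev: "lparity (rev js) x = lparity js x"
  by (simp add: lparity_def sum_list_rev flip: rev_map)

text \<open>Each independent index hits a differing coordinate with probability d / n, which
  multiplies the bias by 1 - 2 d / n.\<close>

lemma collide_index_list: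
  assumes n: "1 \<le> n" and x: "length x = n"
  shows "2 * collide (index_list n k) lparity x y = 1 + (1 - 2 * (real (hdist x y) / real n)) ^ k"
proof -
  let ?U = "pmf_of_set {..<n}"
  let ?c = "\<lambda>k. E (replicate_pmf k ?U) (\<lambda>js. of_bool (lparity js x = lparity js y))"
  have n0: "0 < real n" using n by simp
  have ne: "{..<n} \<noteq> {}" using n by (simp add: lessThan_empty_iff)
  have step: "2 * ?c (Suc k) - 1 = (2 * ?c k - 1) * (1 - 2 * (real (hdist x y) / real n))" for k
  proof -
    have flip: "E (replicate_pmf k ?U) (\<lambda>js. of_bool (lparity (j # js) x = lparity (j # js) y)) =
        ?c k + of_bool (x ! j \<noteq> y ! j) * (1 - 2 * ?c k)" for j
    proof (cases "x ! j = y ! j")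
      case True
      have "(\<lambda>js. of_bool (lparity (j # js) x = lparity (j # js) y) :: real) = (\<lambda>js. of_bool (lparity js x = lparity js y))"
        using True by auto
      thus ?thesis using True by simp
    next
      case False
      have eq: "(\<lambda>js. of_bool (lparity (j # js) x = lparity (j # js) y) :: real) = (\<lambda>js. 1 - of_bool (lparity js x = lparity js y))"
        using False by auto
      have "E (replicate_pmf k ?U) (\<lambda>js. 1 - of_bool (lparity js x = lparity js y)) = 1 - ?c k"
        by (subst Bochner_Integration.integral_diff) (auto intro!: integrable_bounded_pmf[of _ _ 1])
      thus ?thesis unfolding eq using False by simp
    qed
    have "?c (Suc k) = E ?U (\<lambda>j. E (replicate_pmf k ?U) (\<lambda>js. of_bool (lparity (j # js) x = lparity (j # js) y)))"
      unfolding replicate_pmf.simps by (subst E_bind[of _ 1], simp, simp)+ (simp del: lparity_simps)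
    also have "\<dots> = (\<Sum>j<n. ?c k + of_bool (x ! j \<noteq> y ! j) * (1 - 2 * ?c k)) / real n"
      unfolding flip by (subst integral_pmf_of_set[OF ne]) simp_all
    also have "(\<Sum>j<n. ?c k + of_bool (x ! j \<noteq> y ! j) * (1 - 2 * ?c k)) = real n * ?c k + real (hdist x y) * (1 - 2 * ?c k)"
    proof -
      have "{..<n} \<inter> {j. x ! j \<noteq> y ! j} = {i. i < length x \<and> x ! i \<noteq> y ! i}" using x by auto
      hence "(\<Sum>j<n. of_bool (x ! j \<noteq> y ! j) :: real) = real (hdist x y)" by (simp add: hdist_def)
      thus ?thesis by (simp add: sum.distrib flip: sum_distrib_right)
    qed
    finally have "?c (Suc k) = ?c k + real (hdist x y) / real n * (1 - 2 * ?c k)"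
      using n0 by (simp add: add_divide_distrib)
    moreover have "C' = C + h * (1 - 2 * C) \<Longrightarrow> 2 * C' - 1 = (2 * C - 1) * (1 - 2 * h)" for C C' h :: real
      by (simp add: algebra_simps)
    ultimately show ?thesis by blast
  qed
  have "2 * ?c k - 1 = (1 - 2 * (real (hdist x y) / real n)) ^ k"
  proof (induction k)
    case (Suc k)
    show ?case unfolding step Suc.IH by simp
  qed simp
  moreover have "collide (index_list n k) lparity x y = ?c k"
    by (simp only: collide_def prob_E index_list_def integral_map_pmf lparity_rev)
  ultimately show ?thesis by simp
qed

text \<open>First t and \<rho> make Hamming balls of radius \<rho> n as small as exp (\<epsilon> n),
  the two factors taking half of the exponent each; then k makes the bias of pairs at distance
  \<rho> n at most \<epsilon>. An odd k makes the bias decreasing in the distance, negative for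
  almost antipodal pairs, so larger distances cause no harm.\<close>

lemma sparse_parameters:
  assumes \<epsilon>: "0 < (\<epsilon> :: real)"
  shows "\<exists>k t \<rho>. 0 < t \<and> t \<le> 1 \<and> (1 + t) * t powr (- \<rho>) \<le> exp \<epsilon> \<and> odd (k :: nat) \<and> (1 - 2 * \<rho>) ^ k \<le> \<epsilon>"
proof -
  define t where "t = min (1 / 2) (\<epsilon> / 2)"
  have t: "0 < t" "t \<le> 1 / 2" "t \<le> \<epsilon> / 2" using \<epsilon> by (simp_all add: t_def)
  define w where "w = - ln t"
  have "ln t < ln 1" using t by (subst ln_less_cancel_iff) auto
  hence w: "0 < w" by (simp add: w_def)
  define \<rho> where "\<rho> = min (1 / 2) (\<epsilon> / 2 / w)"
  have \<rho>: "0 < \<rho>" "\<rho> \<le> 1 / 2" "\<rho> \<le> \<epsilon> / 2 / w" using \<epsilon> w by (simp_all add: \<rho>_def)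
  have "\<rho> * w \<le> \<epsilon> / 2" using \<rho>(3) w by (simp add: pos_le_divide_eq)
  moreover have "t powr (- \<rho>) = exp (\<rho> * w)" using t by (simp add: powr_def w_def)
  ultimately have 1: "t powr (- \<rho>) \<le> exp (\<epsilon> / 2)" by simp
  have "1 + t \<le> exp t" by (rule exp_ge_add_one_self)
  also have "\<dots> \<le> exp (\<epsilon> / 2)" using t by simp
  finally have "(1 + t) * t powr (- \<rho>) \<le> exp (\<epsilon> / 2) * exp (\<epsilon> / 2)"
    using 1 t by (intro mult_mono) auto
  hence 2: "(1 + t) * t powr (- \<rho>) \<le> exp \<epsilon>" by (simp flip: exp_add)
  have "1 - 2 * \<rho> < 1" using \<rho> by simp
  then obtain k0 where k0: "(1 - 2 * \<rho>) ^ k0 < \<epsilon>" using real_arch_pow_inv[OF \<epsilon>] by blast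
  have "(1 - 2 * \<rho>) ^ (2 * k0 + 1) \<le> (1 - 2 * \<rho>) ^ k0" by (rule power_decreasing) (use \<rho> in auto)
  hence 3: "(1 - 2 * \<rho>) ^ (2 * k0 + 1) \<le> \<epsilon>" using k0 by simp
  have 4: "odd (2 * k0 + 1)" by simp
  have 5: "t \<le> 1" using t by simp
  show ?thesis using t(1) 5 2 4 3 by blast
qed

text \<open>Only an exponential bound is required, so parities of constant size suffice: near pairs
  contribute at most the ball size V since 2^l <= |S|, far pairs at most (1 + ln 2 / q)^l, and both
  are at most exp (n ln 2 / q) <= 2^e.\<close>

lemma dispersion_index_list:
  fixes n k l e q :: nat
  assumes n: "1 \<le> n" and S: "S \<subseteq> {x. length x = n}" "S \<noteq> {}" and l: "2 ^ l \<le> card S"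
    and q: "1 \<le> q" "n \<le> q * e"
    and par: "0 < t" "t \<le> 1" "(1 + t) * t powr (- \<rho>) \<le> exp (ln 2 / real q)" "odd k" "(1 - 2 * \<rho>) ^ k \<le> ln 2 / real q"
  shows "dispersion (index_list n k) lparity S l \<le> 2 ^ (e + 1)"
proof -
  define \<tau> where "\<tau> = ln 2 / real q"
  have \<tau>0: "0 \<le> \<tau>" by (simp add: \<tau>_def)
  have n0: "0 < real n" using n by simp
  have fin: "finite S" by (rule finite_subset[OF S(1) finite_lists_bool(1)])
  have len: "length x = n" if "x \<in> S" for x using that S by auto
  have cS: "card S \<le> 2 ^ n" using card_mono[OF finite_lists_bool(1) S(1)] by (simp add: finite_lists_bool(2))
  have ln: "l \<le> n"
  proof -
    have "(2 :: nat) ^ l \<le> 2 ^ n" using l cS by (rule order_trans)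
    thus ?thesis by (simp only: power_increasing_iff[of "2 :: nat"] one_less_numeral_iff semiring_norm)
  qed
  have exp: "exp \<tau> ^ n \<le> 2 ^ e"
  proof -
    have "real n \<le> real (q * e)" using q(2) by (simp only: of_nat_le_iff)
    hence "real n * \<tau> \<le> real (q * e) * \<tau>" by (rule mult_right_mono[OF _ \<tau>0])
    also have "\<dots> = real e * ln 2" using q by (simp add: \<tau>_def)
    finally have "exp (real n * \<tau>) \<le> exp (real e * ln 2)" by simp
    thus ?thesis by (simp only: exp_of_nat_mult) simp
  qed
  define V where "V = (1 + t) ^ n * t powr (- (\<rho> * real n))"
  have disp: "dispersion (index_list n k) lparity S l \<le> (1 + \<tau>) ^ l + V * 2 ^ l / real (card S)"
  proof (rule dispersion_le[OF fin S(2), where near = "\<lambda>x y. real (hdist x y) < \<rho> * real n"])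
    fix x y assume x: "x \<in> S" "y \<in> S" and far: "\<not> real (hdist x y) < \<rho> * real n"
    have "\<rho> \<le> real (hdist x y) / real n" using far n0 by (simp add: pos_le_divide_eq)
    hence "1 - 2 * (real (hdist x y) / real n) \<le> 1 - 2 * \<rho>" by simp
    hence "(1 - 2 * (real (hdist x y) / real n)) ^ k \<le> (1 - 2 * \<rho>) ^ k" by (rule power_mono_odd[OF par(4)])
    also have "\<dots> \<le> \<tau>" unfolding \<tau>_def by (rule par(5))
    finally show "2 * collide (index_list n k) lparity x y \<le> 1 + \<tau>"
      unfolding collide_index_list[OF n len[OF x(1)]] by simp
  next
    fix x assume x: "x \<in> S"
    show "real (card {y \<in> S. real (hdist x y) < \<rho> * real n}) \<le> V"
      unfolding V_def by (rule card_near_le[OF par(1,2) len[OF x] S(1)])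
  qed (rule \<tau>0)
  have "(1 + \<tau>) ^ l \<le> exp \<tau> ^ l" using \<tau>0 exp_ge_add_one_self[of \<tau>] by (intro power_mono) auto
  also have "\<dots> \<le> exp \<tau> ^ n" using ln \<tau>0 by (intro power_increasing) auto
  finally have 1: "(1 + \<tau>) ^ l \<le> 2 ^ e" using exp by linarith
  have "V = ((1 + t) * t powr (- \<rho>)) ^ n"
  proof -
    have "t powr (- (\<rho> * real n)) = (t powr (- \<rho>)) powr real n" by (simp add: powr_powr)
    also have "\<dots> = (t powr (- \<rho>)) ^ n" using par by (intro powr_realpow) simp
    finally show ?thesis by (simp add: V_def power_mult_distrib)
  qed
  also have "\<dots> \<le> exp \<tau> ^ n" unfolding \<tau>_def using par by (intro power_mono) auto
  finally have V: "V \<le> 2 ^ e" using exp by linarith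
  have "real (2 ^ l) \<le> real (card S)" using l by (simp only: of_nat_le_iff)
  moreover have "0 < real (card S)" using S(2) fin by (simp add: card_gt_0_iff)
  ultimately have "2 ^ l / real (card S) \<le> 1" by (simp add: pos_divide_le_eq)
  hence "V * (2 ^ l / real (card S)) \<le> V * 1" using par by (intro mult_left_mono) (auto simp: V_def)
  hence "V * 2 ^ l / real (card S) \<le> 2 ^ e" using V by simp
  with disp 1 show ?thesis by simp
qed

subsection \<open>Independence of errors of the oracle\<close>

text \<open>Total variation distance at most \<epsilon>; it is symmetric, since f can be replaced by
  1 - f. Test functions are used instead of events because the conditional expectation of a test
  function is again one, which yields composition along \<open>bind_pmf\<close>.\<close>

definition close :: "real \<Rightarrow> 'a pmf \<Rightarrow> 'a pmf \<Rightarrow> bool" where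
  "close \<epsilon> p q \<longleftrightarrow> (\<forall>f. (\<forall>x. 0 \<le> f x \<and> f x \<le> 1) \<longrightarrow> E p f \<le> E q f + \<epsilon>)"

lemma close_refl: "close 0 p p"
  by (simp add: close_def)

lemma close_mono: "close \<epsilon> p q \<Longrightarrow> \<epsilon> \<le> \<epsilon>' \<Longrightarrow> close \<epsilon>' p q"
  unfolding close_def by (meson add_left_mono order_trans)

lemma close_bind:
  assumes p: "close \<epsilon> p q" and f: "\<And>x. x \<in> set_pmf p \<Longrightarrow> close \<epsilon>' (f x) (g x)"
  shows "close (\<epsilon> + \<epsilon>') (bind_pmf p f) (bind_pmf q g)"
  unfolding close_def
proof (intro allI impI)
  fix h :: "'b \<Rightarrow> real" assume h: "\<forall>x. 0 \<le> h x \<and> h x \<le> 1"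
  have h0: "0 \<le> E r h" "E r h \<le> 1" for r using E_nonneg[of h r] E_le[of h 1 r] h by auto
  have "E (bind_pmf p f) h = E p (\<lambda>x. E (f x) h)" by (rule E_bind[of _ 1]) (use h in auto)
  also have "\<dots> \<le> E p (\<lambda>x. E (g x) h + \<epsilon>')"
  proof (rule E_mono[of _ _ _ "1 + \<bar>\<epsilon>'\<bar>"])
    show "E (f x) h \<le> E (g x) h + \<epsilon>'" if "x \<in> set_pmf p" for x
      using f[OF that] h unfolding close_def by (elim allE[of _ h] impE)
    show "\<bar>E (f x) h\<bar> \<le> 1 + \<bar>\<epsilon>'\<bar>" "\<bar>E (g x) h + \<epsilon>'\<bar> \<le> 1 + \<bar>\<epsilon>'\<bar>" for x
      using h0[of "f x"] h0[of "g x"] by linarith+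
  qed
  also have "\<dots> = E p (\<lambda>x. E (g x) h) + \<epsilon>'"
  proof -
    have "integrable (measure_pmf p) (\<lambda>x. E (g x) h)"
      by (rule integrable_bounded_pmf[of _ _ 1]) (use h0 in \<open>simp add: abs_of_nonneg\<close>)
    thus ?thesis by (subst Bochner_Integration.integral_add) simp_all
  qed
  also have "E p (\<lambda>x. E (g x) h) \<le> E q (\<lambda>x. E (g x) h) + \<epsilon>"
  proof -
    have "\<forall>x. 0 \<le> E (g x) h \<and> E (g x) h \<le> 1" using h0 by simp
    with p show ?thesis unfolding close_def by (elim allE[of _ "\<lambda>x. E (g x) h"] impE)
  qed
  also have "E q (\<lambda>x. E (g x) h) = E (bind_pmf q g) h" by (rule E_bind[symmetric, of _ 1]) (use h in auto)
  finally show "E (bind_pmf p f) h \<le> E (bind_pmf q g) h + (\<epsilon> + \<epsilon>')" by simp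
qed

lemma close_bind_same: "(\<And>x. x \<in> set_pmf p \<Longrightarrow> close \<epsilon> (f x) (g x)) \<Longrightarrow> close \<epsilon> (bind_pmf p f) (bind_pmf p g)"
  using close_bind[OF close_refl, of p \<epsilon> f g] by simp

lemma close_bind_left: "close \<epsilon> p q \<Longrightarrow> close \<epsilon> (bind_pmf p f) (bind_pmf q f)"
  using close_bind[of \<epsilon> p q 0 f f] by (simp add: close_refl)

lemma close_map: "close \<epsilon> p q \<Longrightarrow> close \<epsilon> (map_pmf f p) (map_pmf f q)"
  unfolding map_pmf_def by (rule close_bind_left)

lemma close_mfold:
  assumes step: "\<And>x a. I a \<Longrightarrow> close \<epsilon> (g x a) (g' x a)"
    and inv: "\<And>x a a'. I a \<Longrightarrow> a' \<in> set_pmf (g x a) \<Longrightarrow> I a'"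
  shows "I a \<Longrightarrow> close (real (length xs) * \<epsilon>) (mfold g xs a) (mfold g' xs a)"
proof (induction xs arbitrary: a)
  case Nil
  show ?case by (simp add: close_refl)
next
  case (Cons x xs)
  have "close (\<epsilon> + real (length xs) * \<epsilon>) (mfold g (x # xs) a) (mfold g' (x # xs) a)"
    unfolding mfold.simps by (rule close_bind[OF step[OF Cons.prems] Cons.IH]) (rule inv[OF Cons.prems])
  thus ?case by (simp add: algebra_simps)
qed

lemma close_replicate: "close \<epsilon> p q \<Longrightarrow> close (real m * \<epsilon>) (replicate_pmf m p) (replicate_pmf m q)"
proof (induction m)
  case 0
  show ?case by (simp add: close_refl)
next
  case (Suc m)
  have "close (\<epsilon> + real m * \<epsilon>) (replicate_pmf (Suc m) p) (replicate_pmf (Suc m) q)"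
    unfolding replicate_pmf.simps
    by (rule close_bind[OF Suc.prems]) (rule close_bind_left[OF Suc.IH[OF Suc.prems]])
  thus ?case by (simp add: algebra_simps)
qed

lemma close_levels:
  assumes "\<And>l. close \<epsilon> (tr l) (tr' l)" "0 \<le> \<epsilon>"
  shows "close (real (length ls) * (real M * \<epsilon>)) (levels tr M ls) (levels tr' M ls)"
proof (induction ls)
  case Nil
  show ?case by (simp add: close_refl)
next
  case (Cons l ls)
  have "close (real M * \<epsilon> + real (length ls) * (real M * \<epsilon>)) (levels tr M (l # ls)) (levels tr' M (l # ls))"
    unfolding levels.simps
  proof (rule close_bind[OF close_map[OF close_replicate[OF assms(1)]]])
    fix t
    show "close (real (length ls) * (real M * \<epsilon>)) (if 4 * M < t then levels tr M ls else return_pmf (l, t))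
        (if 4 * M < t then levels tr' M ls else return_pmf (l, t))"
      using Cons assms(2) by (simp add: close_mono[OF close_refl])
  qed
  thus ?case by (simp add: algebra_simps)
qed

text \<open>Each of the \<open>n\<close> stages makes at most \<open>2 * cap\<close> queries. Errors
  add up although later queries depend on earlier answers.\<close>

lemma close_count_sols:
  assumes test: "\<And>\<Psi>. close \<epsilon> (test \<Psi>) (test' \<Psi>)" and \<epsilon>: "0 \<le> \<epsilon>" and cap: "1 \<le> cap"
  shows "close (real n * (real (2 * cap) * \<epsilon>)) (count_sols test cap n \<Phi>) (count_sols test' cap n \<Phi>)"
proof -
  have filter: "close \<epsilon> (filter_step test cap \<Psi> L) (filter_step test' cap \<Psi> L)" for \<Psi> L
    unfolding filter_step_def using close_map[OF test, of "\<lambda>b. if b then \<Psi> # L else L" \<Psi>]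
    by (simp add: close_mono[OF close_refl \<epsilon>])
  have step: "close (real (2 * cap) * \<epsilon>) (count_step test cap i \<Psi>s) (count_step test' cap i \<Psi>s)" if "length \<Psi>s \<le> cap" for i \<Psi>s
  proof (rule close_mono)
    show "close (real (length (expand i \<Psi>s)) * \<epsilon>) (count_step test cap i \<Psi>s) (count_step test' cap i \<Psi>s)"
      unfolding count_step_def by (rule close_mfold[where I = "\<lambda>_. True"]) (simp_all add: filter)
    show "real (length (expand i \<Psi>s)) * \<epsilon> \<le> real (2 * cap) * \<epsilon>"
      unfolding length_expand by (rule mult_right_mono[OF _ \<epsilon>]) (use that in simp)
  qed
  have "close (real (length [0..<n]) * (real (2 * cap) * \<epsilon>)) (mfold (count_step test cap) [0..<n] [\<Phi>]) (mfold (count_step test' cap) [0..<n] [\<Phi>])"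
    by (rule close_mfold[where I = "\<lambda>\<Psi>s. length \<Psi>s \<le> cap"]) (use step count_step_invariant cap in auto)
  thus ?thesis unfolding count_sols_def by (intro close_map) simp
qed

lemma close_return:
  fixes p :: "'a pmf"
  assumes "measure_pmf.prob p {x. x \<noteq> b} \<le> \<epsilon>"
  shows "close \<epsilon> p (return_pmf b)"
  unfolding close_def
proof (intro allI impI)
  fix f :: "'a \<Rightarrow> real" assume f: "\<forall>x. 0 \<le> f x \<and> f x \<le> 1"
  have "E p f \<le> E p (\<lambda>x. f b + of_bool (x \<noteq> b))"
  proof (rule E_mono[of _ _ _ 2])
    show "f x \<le> f b + of_bool (x \<noteq> b)" for x using f by (cases "x = b") (auto intro: order_trans[of _ 1])
    show "\<bar>f x\<bar> \<le> 2" "\<bar>f b + of_bool (x \<noteq> b)\<bar> \<le> 2" for x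
    proof -
      have "0 \<le> f x" "f x \<le> 1" "0 \<le> f b" "f b \<le> 1" using f by auto
      thus "\<bar>f x\<bar> \<le> 2" "\<bar>f b + of_bool (x \<noteq> b)\<bar> \<le> 2" by (auto simp: of_bool_def)
    qed
  qed
  also have "\<dots> = f b + E p (\<lambda>x. of_bool (x \<noteq> b))"
    by (subst Bochner_Integration.integral_add) (auto intro!: integrable_bounded_pmf[of _ _ 1])
  finally show "E p f \<le> E (return_pmf b) f + \<epsilon>" using assms unfolding prob_E by simp
qed

subsection \<open>Exact counts\<close>

definition num_sols :: "nat \<Rightarrow> cnf list \<Rightarrow> nat" where
  "num_sols n \<Psi>s = (\<Sum>\<Psi>\<leftarrow>\<Psi>s. card (solutions n \<Psi>))"

lemma satisfiable_card: "satisfiable n \<Psi> \<longleftrightarrow> 0 < card (solutions n \<Psi>)"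
  using finite_solutions(1)[of n \<Psi>] by (simp add: satisfiable_def card_gt_0_iff)

lemma length_le_num_sols: "(\<forall>\<Psi>\<in>set L. satisfiable n \<Psi>) \<Longrightarrow> length L \<le> num_sols n L"
  by (induction L) (auto simp: num_sols_def satisfiable_card)

lemma solutions_unit: "solutions n ([(i, b)] # \<Psi>) = {x\<in>solutions n \<Psi>. x ! i = b}"
  by (auto simp: solutions_def satisfies_def)

lemma card_solutions_split:
  "card (solutions n ([(i, True)] # \<Psi>)) + card (solutions n ([(i, False)] # \<Psi>)) = card (solutions n \<Psi>)"
proof -
  have eq: "solutions n \<Psi> = solutions n ([(i, True)] # \<Psi>) \<union> solutions n ([(i, False)] # \<Psi>)"
    unfolding solutions_unit by auto
  have "solutions n ([(i, True)] # \<Psi>) \<inter> solutions n ([(i, False)] # \<Psi>) = {}"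
    unfolding solutions_unit by auto
  from card_Un_disjoint[OF finite_solutions(1) finite_solutions(1) this] show ?thesis by (simp flip: eq)
qed

lemma num_sols_expand: "num_sols n (expand i \<Psi>s) = num_sols n \<Psi>s"
proof -
  have "num_sols n (expand i \<Psi>s) = num_sols n (rev \<Psi>s)"
    unfolding expand_eq by (induction \<Psi>s) (simp_all add: num_sols_def card_solutions_split add.assoc[symmetric])
  thus ?thesis by (simp add: num_sols_def sum_list_rev flip: rev_map)
qed

text \<open>A satisfiable formula is rejected only when the list is full. Each entry has a solution,
  so the capped total is \<open>cap\<close> already and does not notice the loss.\<close>

lemma filter_exact:
  fixes cap n :: nat
  defines "step \<equiv> \<lambda>\<Psi> L. if length L < cap then if satisfiable n \<Psi> then \<Psi> # L else L else L"
  assumes "length L \<le> cap" "\<forall>\<Psi>\<in>set L. satisfiable n \<Psi>"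
  shows "length (fold step zs L) \<le> cap \<and> (\<forall>\<Psi>\<in>set (fold step zs L). satisfiable n \<Psi>) \<and>
    set (fold step zs L) \<subseteq> set L \<union> set zs \<and> min cap (num_sols n (fold step zs L)) = min cap (num_sols n L + num_sols n zs)"
  using assms(2,3)
proof (induction zs arbitrary: L)
  case Nil
  thus ?case by (simp add: num_sols_def)
next
  case (Cons z zs)
  have ns: "num_sols n (z # L) = card (solutions n z) + num_sols n L" for L by (simp add: num_sols_def)
  have inv: "length (step z L) \<le> cap" "\<forall>\<Psi>\<in>set (step z L). satisfiable n \<Psi>" "set (step z L) \<subseteq> insert z (set L)"
    using Cons.prems by (auto simp: step_def)
  have "min cap (num_sols n (step z L) + num_sols n zs) = min cap (num_sols n L + num_sols n (z # zs))"
  proof (cases "length L < cap")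
    case True
    thus ?thesis by (auto simp: step_def ns satisfiable_card)
  next
    case False
    hence "cap \<le> num_sols n L" using length_le_num_sols[OF Cons.prems(2)] by simp
    thus ?thesis using False by (simp add: step_def min_def)
  qed
  with Cons.IH[OF inv(1,2)] inv(3) show ?case by auto
qed

text \<open>Expansion and filtering preserve the capped total number of solutions
  (\<open>J\<close>). After \<open>n\<close> stages all variables are fixed and every kept formula
  is satisfiable, hence has exactly one solution, and the total is the length of the list.\<close>

lemma count_sols_exact:
  assumes n: "1 \<le> n" and cap: "1 \<le> cap"
  shows "count_sols (\<lambda>\<Psi>. return_pmf (satisfiable n \<Psi>)) cap n \<Phi> = return_pmf (min cap (card (solutions n \<Phi>)))"
proof -
  define step where "step = (\<lambda>\<Psi> L. if length L < cap then if satisfiable n \<Psi> then \<Psi> # L else L else L)"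
  define cs where "cs = (\<lambda>i \<Psi>s. fold step (expand i \<Psi>s) [])"
  have fs: "filter_step (\<lambda>\<Psi>. return_pmf (satisfiable n \<Psi>)) cap = (\<lambda>\<Psi> L. return_pmf (step \<Psi> L))"
    by (intro ext) (simp add: filter_step_def step_def)
  have cstep: "count_step (\<lambda>\<Psi>. return_pmf (satisfiable n \<Psi>)) cap = (\<lambda>i \<Psi>s. return_pmf (cs i \<Psi>s))"
    by (intro ext) (simp add: count_step_def fs mfold_return cs_def)
  define J where "J = (\<lambda>i \<Psi>s. min cap (num_sols n \<Psi>s) = min cap (card (solutions n \<Phi>)) \<and>
      (\<forall>\<Psi>\<in>set \<Psi>s. \<forall>x\<in>solutions n \<Psi>. \<forall>y\<in>solutions n \<Psi>. \<forall>j<i. x ! j = y ! j))"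
  define K where "K = (\<lambda>\<Psi>s. length \<Psi>s \<le> cap \<and> (\<forall>\<Psi>\<in>set \<Psi>s. satisfiable n \<Psi>))"
  have one: "J (Suc i) (cs i \<Psi>s) \<and> K (cs i \<Psi>s)" if "J i \<Psi>s" for i \<Psi>s
  proof -
    have fe: "length (cs i \<Psi>s) \<le> cap \<and> (\<forall>\<Psi>\<in>set (cs i \<Psi>s). satisfiable n \<Psi>) \<and>
        set (cs i \<Psi>s) \<subseteq> set (expand i \<Psi>s) \<and> min cap (num_sols n (cs i \<Psi>s)) = min cap (num_sols n [] + num_sols n (expand i \<Psi>s))"
      using filter_exact[of "[]" cap n "expand i \<Psi>s"] by (simp add: cs_def step_def)
    have K: "K (cs i \<Psi>s)" using fe by (simp add: K_def)
    have sub: "set (cs i \<Psi>s) \<subseteq> set (expand i \<Psi>s)" using fe by simp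
    have "min cap (num_sols n (cs i \<Psi>s)) = min cap (num_sols n \<Psi>s)"
      using fe by (simp only: num_sols_expand) (simp add: num_sols_def)
    moreover have m2: "\<forall>\<Psi>\<in>set (expand i \<Psi>s). \<forall>x\<in>solutions n \<Psi>. \<forall>y\<in>solutions n \<Psi>. \<forall>j<Suc i. x ! j = y ! j"
      unfolding ball_expand
    proof (intro ballI conjI)
      fix \<Psi> assume "\<Psi> \<in> set \<Psi>s"
      hence agree: "x ! j = y ! j" if "x \<in> solutions n \<Psi>" "y \<in> solutions n \<Psi>" "j < i" for x y j
        using \<open>J i \<Psi>s\<close> that unfolding J_def by blast
      have agree': "x ! j = y ! j" if "x \<in> solutions n ([(i, b)] # \<Psi>)" "y \<in> solutions n ([(i, b)] # \<Psi>)" "j < Suc i" for x y j b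
        using that agree[of x y j] unfolding solutions_unit by (cases "j = i") simp_all
      show "\<forall>j<Suc i. x ! j = y ! j" if "x \<in> solutions n ([(i, True)] # \<Psi>)" "y \<in> solutions n ([(i, True)] # \<Psi>)" for x y
        using that agree' by blast
      show "\<forall>j<Suc i. x ! j = y ! j" if "x \<in> solutions n ([(i, False)] # \<Psi>)" "y \<in> solutions n ([(i, False)] # \<Psi>)" for x y
        using that agree' by blast
    qed
    ultimately have "min cap (num_sols n (cs i \<Psi>s)) = min cap (card (solutions n \<Phi>))" using that unfolding J_def by simp
    moreover have "\<forall>x\<in>solutions n \<Psi>. \<forall>y\<in>solutions n \<Psi>. \<forall>j<Suc i. x ! j = y ! j" if "\<Psi> \<in> set (cs i \<Psi>s)" for \<Psi>
      by (rule bspec[OF m2 subsetD[OF sub that]])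
    ultimately have "J (Suc i) (cs i \<Psi>s)" unfolding J_def by blast
    with K show ?thesis by simp
  qed
  \<comment> \<open>The initial formula may be unsatisfiable, so \<open>K\<close> holds only after
    the first stage; this is where \<open>1 \<le> n\<close> enters.\<close>
  have all: "J i (fold cs [0..<i] [\<Phi>]) \<and> (0 < i \<longrightarrow> K (fold cs [0..<i] [\<Phi>]))" for i
  proof (induction i)
    case 0
    show ?case by (simp add: J_def num_sols_def)
  next
    case (Suc i)
    thus ?case using one[of i "fold cs [0..<i] [\<Phi>]"] by simp
  qed
  let ?L = "fold cs [0..<n] [\<Phi>]"
  have J: "J n ?L" and K: "K ?L" using all[of n] n by auto
  have "card (solutions n \<Psi>) = 1" if "\<Psi> \<in> set ?L" for \<Psi>
  proof -
    have "satisfiable n \<Psi>" using K that by (simp add: K_def)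
    then obtain x where x: "x \<in> solutions n \<Psi>" unfolding satisfiable_def by blast
    have "y = x" if y: "y \<in> solutions n \<Psi>" for y
    proof (rule nth_equalityI)
      show "length y = length x" using x y by (simp add: solutions_def)
      show "y ! j = x ! j" if "j < length y" for j
      proof -
        have "j < n" using that y by (simp add: solutions_def)
        have all: "\<forall>x\<in>solutions n \<Psi>. \<forall>y\<in>solutions n \<Psi>. \<forall>j<n. x ! j = y ! j"
          using J \<open>\<Psi> \<in> set ?L\<close> unfolding J_def by (elim conjE bspec)
        from bspec[OF bspec[OF all y] x] \<open>j < n\<close> show ?thesis by blast
      qed
    qed
    hence "solutions n \<Psi> = {x}" using x by blast
    thus ?thesis by simp
  qed
  moreover have "num_sols n L = length L" if "\<And>\<Psi>. \<Psi> \<in> set L \<Longrightarrow> card (solutions n \<Psi>) = 1" for L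
    using that by (induction L) (simp_all add: num_sols_def)
  ultimately have "num_sols n ?L = length ?L" by blast
  hence "min cap (length ?L) = min cap (card (solutions n \<Phi>))" using J by (simp add: J_def)
  moreover have "length ?L \<le> cap" using K by (simp add: K_def)
  ultimately have "length ?L = min cap (card (solutions n \<Phi>))" by simp
  thus ?thesis by (simp add: count_sols_def cstep mfold_return)
qed

lemma solutions_add_parities:
  "solutions n (add_parities ps F) = {x\<in>solutions n F. agree lparity ps x}"
proof -
  have "satisfies x (fold (\<lambda>p G. parity_clauses (fst p) (snd p) G) ps F) \<longleftrightarrow> satisfies x F \<and> agree lparity ps x" for x
    by (induction ps arbitrary: F) (auto simp: satisfies_parity_clauses agree_def)
  thus ?thesis by (auto simp: solutions_def add_parities_def)
qed

lemma trial_exact: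
  assumes "1 \<le> n" "1 \<le> cap"
  shows "trial (\<lambda>\<Psi>. return_pmf (satisfiable n \<Psi>)) cap n k F l =
    map_pmf (\<lambda>ps. min cap (hits lparity (solutions n F) ps)) (hash_pmf (index_list n k) l)"
  unfolding trial_def count_sols_exact[OF assms] solutions_add_parities hits_def map_pmf_def ..

context sat_program begin

definition prog_trial :: "nat \<Rightarrow> com" where
  "prog_trial k = Seq (prog_hashed k)
     (Seq (asn (EP r4 (EP (EN 0) (EP (EP e1 (EN 0)) (EP (EN 1) r2))))) prog_count)"

definition t_trial :: "nat \<Rightarrow> nat \<Rightarrow> nat \<Rightarrow> nat \<Rightarrow> nat \<Rightarrow> nat \<Rightarrow> nat" where
  "t_trial k l n m R cap = (l + 1) * (2000 * ((k + 1) * 2 ^ k)) + (100 + t_count n m R cap)"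

lemma computes_trial:
  fixes n m R cap k l :: nat
  defines "env \<equiv> Pair (Num cap) (Pair (Num R) (Num n))"
  assumes n: "1 \<le> n" and F: "cnf_over n F" "cnf_size n F + l * (2 ^ k * (1 + k)) + 2 * n \<le> m" and cap: "1 \<le> cap"
  shows "computes no_oracle (prog_trial k) (Pair (Num l) (Pair (enc_clauses F) env))
     (map_pmf Num (trial (vote_pmf R (once n)) cap n k F l)) (t_trial k l n m R cap)"
    and "c \<in> set_pmf (trial (vote_pmf R (once n)) cap n k F l) \<Longrightarrow> c \<le> cap"
proof -
  let ?H = "hash_pmf (index_list n k) l"
  have size: "cnf_over n (add_parities ps F)" "cnf_size n (add_parities ps F) + 2 * n \<le> m" if "ps \<in> set_pmf ?H" for ps
    using add_parities_size[OF n that F(1)] F(2) by simp_all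
  have H: "computes no_oracle (prog_hashed k) (Pair (Num l) (Pair (enc_clauses F) env))
     (map_pmf (\<lambda>ps. Pair (Num 0) (Pair (enc_clauses (add_parities ps F)) env)) ?H) ((l + 1) * (2000 * ((k + 1) * 2 ^ k)))"
    unfolding env_def by (rule computes_hashed[OF n])
  have rest: "computes no_oracle (Seq (asn (EP r4 (EP (EN 0) (EP (EP e1 (EN 0)) (EP (EN 1) r2))))) prog_count)
      (Pair (Num 0) (Pair (enc_clauses (add_parities ps F)) env))
      (map_pmf Num (count_sols (vote_pmf R (once n)) cap n (add_parities ps F))) (100 + t_count n m R cap)"
    if ps: "ps \<in> set_pmf ?H" for ps
  proof -
    note C = computes_count(1)[OF size[OF ps] cap, of R, folded env_def]
    show ?thesis
      by (rule computes_mono, rule computes_Seq_det[OF computes_asn_eq C]) (simp_all add: env_def)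
  qed
  have eq: "map_pmf Num (trial (vote_pmf R (once n)) cap n k F l) =
      bind_pmf ?H (\<lambda>ps. map_pmf Num (count_sols (vote_pmf R (once n)) cap n (add_parities ps F)))"
    by (simp add: trial_def map_bind_pmf)
  show "computes no_oracle (prog_trial k) (Pair (Num l) (Pair (enc_clauses F) env))
     (map_pmf Num (trial (vote_pmf R (once n)) cap n k F l)) (t_trial k l n m R cap)"
    unfolding prog_trial_def t_trial_def eq by (rule computes_Seq_map[OF H rest])
  show "c \<le> cap" if "c \<in> set_pmf (trial (vote_pmf R (once n)) cap n k F l)"
    using that computes_count(2)[OF size cap] unfolding trial_def by (auto simp: set_bind_pmf)
qed

definition prog_total :: "nat \<Rightarrow> com" where
  "prog_total k = whl CLess (EN 0) e0
     (Seq (call (prog_trial k) r2) (Seq (call prog_add (EP e0 e2)) (asn (EP (EDec e2) (EP e0 r4)))))"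

definition t_total :: "nat \<Rightarrow> nat \<Rightarrow> nat \<Rightarrow> nat \<Rightarrow> nat \<Rightarrow> nat \<Rightarrow> nat \<Rightarrow> nat" where
  "t_total M k l n m R cap = (M + 1) * (t_trial k l n m R cap + (cap + 1) * 30 + 200)"

lemma computes_total:
  fixes n m R cap k l M :: nat
  defines "env \<equiv> Pair (Num cap) (Pair (Num R) (Num n))"
  assumes n: "1 \<le> n" and F: "cnf_over n F" "cnf_size n F + l * (2 ^ k * (1 + k)) + 2 * n \<le> m" and cap: "1 \<le> cap"
  shows "computes no_oracle (prog_total k) (Pair (Num M) (Pair (Num 0) (Pair (Num l) (Pair (enc_clauses F) env))))
     (map_pmf (\<lambda>t. Pair (Num 0) (Pair (Num t) (Pair (Num l) (Pair (enc_clauses F) env))))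
       (map_pmf sum_list (replicate_pmf M (trial (vote_pmf R (once n)) cap n k F l)))) (t_total M k l n m R cap)"
proof -
  let ?w = "Pair (Num l) (Pair (enc_clauses F) env)"
  let ?tr = "trial (vote_pmf R (once n)) cap n k F l"
  define \<phi> where "\<phi> = (\<lambda>(zs :: unit list) t. Pair (Num (length zs)) (Pair (Num t) ?w))"
  define T where "T = t_trial k l n m R cap"
  note tr = computes_trial[OF n F cap, where R = R, folded env_def T_def]
  have fold: "fold (\<lambda>x a. x + a) xs b = sum_list xs + b" for xs :: "nat list" and b
    by (induction xs arbitrary: b) auto
  have body: "computes no_oracle (Seq (call (prog_trial k) r2) (Seq (call prog_add (EP e0 e2)) (asn (EP (EDec e2) (EP e0 r4)))))
      (\<phi> (z # zs) t) (map_pmf (\<phi> zs) (map_pmf (\<lambda>x. x + t) ?tr)) (T + (cap + 1) * 30 + 100)" for z zs t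
  proof -
    let ?v = "\<phi> (z # zs) t"
    have "computes no_oracle (prog_trial k) (ev r2 ?v) (map_pmf Num ?tr) T" using tr(1) by (simp add: \<phi>_def)
    note c1 = computes_call_map[OF this]
    have rest: "computes no_oracle (Seq (call prog_add (EP e0 e2)) (asn (EP (EDec e2) (EP e0 r4)))) (Pair (Num x) ?v)
        (return_pmf (\<phi> zs (x + t))) ((cap + 1) * 30 + 80)" if x: "x \<in> set_pmf ?tr" for x
    proof -
      have "(x + 1) * 30 \<le> (cap + 1) * 30" using tr(2)[OF x] by simp
      hence "computes no_oracle prog_add (ev (EP e0 e2) (Pair (Num x) ?v)) (return_pmf (Num (x + t))) ((cap + 1) * 30)"
        using computes_mono[OF computes_add[of no_oracle x t]] by (simp add: \<phi>_def)
      note c2 = computes_call_det[OF this]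
      show ?thesis
        by (rule computes_mono, rule computes_Seq_det[OF c2], rule computes_asn_eq) (simp_all add: \<phi>_def)
    qed
    have eq: "map_pmf (\<phi> zs) (map_pmf (\<lambda>x. x + t) ?tr) = bind_pmf ?tr (\<lambda>x. return_pmf (\<phi> zs (x + t)))"
      by (simp add: pmf.map_comp o_def) (simp add: map_pmf_def)
    show ?thesis unfolding eq
      by (rule computes_mono, rule computes_Seq_map[OF c1 rest]) simp_all
  qed
  have "computes no_oracle (prog_total k) (\<phi> (replicate M ()) 0)
     (map_pmf (\<phi> []) (mfold (\<lambda>_ t. map_pmf (\<lambda>x. x + t) ?tr) (replicate M ()) 0))
     ((length (replicate M ()) + 1) * (T + (cap + 1) * 30 + 200))"
    unfolding prog_total_def
    by (rule computes_for_le[where I = "\<lambda>_ _. True" and \<phi> = \<phi> and g = "\<lambda>_ t. map_pmf (\<lambda>x. x + t) ?tr", OF _ _ body])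
      (simp_all add: \<phi>_def)
  thus ?thesis unfolding mfold_replicate fold t_total_def T_def[symmetric]
    by (simp add: \<phi>_def pmf.map_comp o_def)
qed

definition prog_search :: "nat \<Rightarrow> com" where
  "prog_search k = whl CLess (EN 0) e0
     (Seq (call (prog_total k) (EP e1 (EP (EN 0) r3)))
       (asn (EIf CLess e3 (EFst (ESnd e0))
         (EIf CLess (EN 1) e1 (EP (EDec e1) (EP e2 (EP e3 (EP (EInc e4) r5)))) (EP (EN 0) (EP (EN 0) (EN 0))))
         (EP (EN 0) (EP e4 (EFst (ESnd e0)))))))"

text \<open>When the levels are exhausted the program has already replaced its state by the default
  result; the case distinction in \<open>st\<close> reflects this.\<close>

lemma computes_search:
  fixes n m R cap k M N :: nat
  defines "env \<equiv> Pair (Num cap) (Pair (Num R) (Num n))"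
  assumes n: "1 \<le> n" and F: "cnf_over n F" "cnf_size n F + N * (2 ^ k * (1 + k)) + 2 * n \<le> m" and cap: "1 \<le> cap"
  defines "st \<equiv> \<lambda>j l. if j = 0 then Pair (Num 0) (Pair (Num 0) (Num 0))
     else Pair (Num j) (Pair (Num M) (Pair (Num (4 * M)) (Pair (Num l) (Pair (enc_clauses F) env))))"
  shows "l + j \<le> N \<Longrightarrow> computes no_oracle (prog_search k) (st j l)
     (map_pmf (\<lambda>r. Pair (Num 0) (Pair (Num (fst r)) (Num (snd r))))
       (levels (trial (vote_pmf R (once n)) cap n k F) M [l..<l + j])) ((j + 1) * (t_total M k N n m R cap + 200))"
proof (induction j arbitrary: l)
  case 0
  show ?case unfolding prog_search_def
    by (rule computes_cong[OF computes_whl_stop]) (simp_all add: st_def)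
next
  case (Suc j)
  let ?tr = "trial (vote_pmf R (once n)) cap n k F"
  let ?out = "\<lambda>r. Pair (Num 0) (Pair (Num (fst r)) (Num (snd r)))"
  let ?P = "map_pmf sum_list (replicate_pmf M (?tr l))"
  let ?T = "t_total M k N n m R cap"
  define \<psi> where "\<psi> = (\<lambda>t. if 4 * M < t then st j (Suc l) else Pair (Num 0) (Pair (Num l) (Num t)))"
  have l: "l \<le> N" "Suc l + j \<le> N" using Suc.prems by simp_all
  have size: "cnf_size n F + l * (2 ^ k * (1 + k)) + 2 * n \<le> m"
  proof -
    have "l * (2 ^ k * (1 + k)) \<le> N * (2 ^ k * (1 + k))" by (rule mult_le_mono1[OF l(1)])
    thus ?thesis using F(2) by linarith
  qed
  have tt: "t_total M k l n m R cap \<le> ?T"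
    unfolding t_total_def t_trial_def using l(1) by (intro mult_le_mono add_le_mono) simp_all
  have "computes no_oracle (prog_total k) (ev (EP e1 (EP (EN 0) r3)) (st (Suc j) l))
      (map_pmf (\<lambda>t. Pair (Num 0) (Pair (Num t) (Pair (Num l) (Pair (enc_clauses F) env)))) ?P) ?T"
    using computes_mono[OF computes_total[OF n F(1) size cap, of M R] tt] by (simp add: st_def env_def)
  note c = computes_call_map[OF this]
  have body: "computes no_oracle (Seq (call (prog_total k) (EP e1 (EP (EN 0) r3)))
       (asn (EIf CLess e3 (EFst (ESnd e0))
         (EIf CLess (EN 1) e1 (EP (EDec e1) (EP e2 (EP e3 (EP (EInc e4) r5)))) (EP (EN 0) (EP (EN 0) (EN 0))))
         (EP (EN 0) (EP e4 (EFst (ESnd e0))))))) (st (Suc j) l) (map_pmf \<psi> ?P) (?T + 150)"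
    by (rule computes_mono, rule computes_then_asn[OF c]) (auto simp: st_def \<psi>_def)
  have rest: "computes no_oracle (prog_search k) (\<psi> t)
      (map_pmf ?out (if 4 * M < t then levels ?tr M [Suc l..<Suc l + j] else return_pmf (l, t))) ((j + 1) * (?T + 200))" for t
  proof (cases "4 * M < t")
    case True
    thus ?thesis using Suc.IH[OF l(2)] by (simp add: \<psi>_def)
  next
    case False
    show ?thesis unfolding prog_search_def
      by (rule computes_cong[OF computes_whl_stop]) (use False in \<open>simp_all add: \<psi>_def\<close>)
  qed
  have upt: "[l..<l + Suc j] = l # [Suc l..<Suc l + j]" by (simp add: upt_conv_Cons del: upt_Suc)
  have eq: "map_pmf ?out (levels ?tr M [l..<l + Suc j]) =
      bind_pmf ?P (\<lambda>t. map_pmf ?out (if 4 * M < t then levels ?tr M [Suc l..<Suc l + j] else return_pmf (l, t)))"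
    unfolding upt levels.simps map_bind_pmf ..
  show ?case unfolding eq
    by (rule computes_mono, unfold prog_search_def, rule computes_whl_step_map[OF _ body], simp add: st_def,
      rule rest[unfolded prog_search_def]) simp
qed

end

subsection \<open>Parameters and output\<close>

definition prog_pow :: com where
  "prog_pow = Seq (asn (EP EV (EN 1)))
     (Seq (whl CLess (EN 0) e0 (Seq (call prog_double r1) (asn (EP (EDec e1) e0)))) (asn r1))"

lemma computes_pow: "computes orc prog_pow (Num x) (return_pmf (Num (2 ^ x))) ((x + 2) * (200 * 2 ^ x))"
proof -
  define \<phi> where "\<phi> = (\<lambda>(zs :: unit list) y. Pair (Num (length zs)) (Num y))"
  have fold: "fold (\<lambda>_ a. 2 * a) zs b = 2 ^ length zs * b" for zs :: "unit list" and b :: nat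
    by (induction zs arbitrary: b) auto
  have body: "computes orc (Seq (call prog_double r1) (asn (EP (EDec e1) e0))) (\<phi> (z # zs) y)
      (return_pmf (\<phi> zs (2 * y))) (80 * 2 ^ x + 50)" if "y * 2 ^ length (z # zs) \<le> 2 ^ x" for z zs y
  proof -
    have "y * 1 \<le> y * 2 ^ length (z # zs)" by (rule mult_le_mono2) simp
    hence "y \<le> 2 ^ x" using that by linarith
    moreover have "(1 :: nat) \<le> 2 ^ x" by simp
    moreover have "y \<le> z \<Longrightarrow> 1 \<le> z \<Longrightarrow> (y + 1) * 40 \<le> 80 * z" for z :: nat by simp
    ultimately have "(y + 1) * 40 \<le> 80 * 2 ^ x" by blast
    hence "computes orc prog_double (ev r1 (\<phi> (z # zs) y)) (return_pmf (Num (2 * y))) (80 * 2 ^ x)"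
      using computes_mono[OF computes_double[of orc y]] by (simp add: \<phi>_def)
    note c = computes_call_det[OF this]
    show ?thesis
      by (rule computes_mono, rule computes_Seq_det[OF c], rule computes_asn_eq) (simp_all add: \<phi>_def)
  qed
  have "computes orc (whl CLess (EN 0) e0 (Seq (call prog_double r1) (asn (EP (EDec e1) e0)))) (\<phi> (replicate x ()) 1)
      (return_pmf (\<phi> [] (fold (\<lambda>_ a. 2 * a) (replicate x ()) 1))) ((length (replicate x ()) + 1) * (80 * 2 ^ x + 80))"
    by (rule computes_for_det[where I = "\<lambda>zs y. y * 2 ^ length zs \<le> 2 ^ x" and \<phi> = \<phi> and g = "\<lambda>_ a. 2 * a", OF _ _ body])
      (simp_all add: \<phi>_def)
  hence W: "computes orc (whl CLess (EN 0) e0 (Seq (call prog_double r1) (asn (EP (EDec e1) e0)))) (ev (EP EV (EN 1)) (Num x))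
      (return_pmf (\<phi> [] (2 ^ x))) ((x + 1) * (80 * 2 ^ x + 80))"
    unfolding fold by (simp add: \<phi>_def)
  have le: "20 + ((x + 1) * (80 * 2 ^ x + 80) + 20) \<le> (x + 2) * (200 * 2 ^ x)"
  proof -
    have 1: "(1 :: nat) \<le> 2 ^ x" by simp
    hence "(x + 1) * (80 * 2 ^ x + 80) \<le> (x + 1) * (200 * 2 ^ x)" by (intro mult_le_mono2) linarith
    moreover have "(x + 2) * (200 * 2 ^ x) = (x + 1) * (200 * 2 ^ x) + 200 * 2 ^ x" by (simp add: algebra_simps)
    ultimately show ?thesis using 1 by linarith
  qed
  have "computes orc prog_pow (Num x) (return_pmf (Num (2 ^ x))) (20 + ((x + 1) * (80 * 2 ^ x + 80) + 20))"
    unfolding prog_pow_def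
    apply (rule computes_mono)
     apply (rule computes_Seq_det[OF computes_asn])
     apply (rule computes_Seq_det[OF W])
     apply (rule computes_asn_eq)
     apply (simp add: \<phi>_def)
    apply simp
    done
  thus ?thesis by (rule computes_mono[OF _ le])
qed

text \<open>The machine cannot divide or multiply. It counts up to \<open>n\<close> with a counter
  modulo \<open>q\<close> and carries the three parameters along; the initial entries
  \<open>7 + c\<close> and 8 are 7 e + c and 2 e + 6 at e = 1.\<close>

definition prog_params :: "nat \<Rightarrow> nat \<Rightarrow> nat \<Rightarrow> nat \<Rightarrow> com" where
  "prog_params q c R w = Seq (asn (EP EV (EP (EN 0) (EP (EN (7 + c)) (EP (EN 8) (EN R))))))
     (Seq (whl CLess (EN 0) e0 (asn (EIf CLess (EInc e1) (EN q)
        (EP (EDec e0) (EP (EInc e1) (EP e2 (EP e3 ((EInc ^^ w) r4)))))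
        (EP (EDec e0) (EP (EN 0) (EP ((EInc ^^ 7) e2) (EP (EInc (EInc e3)) ((EInc ^^ w) r4))))))))
     (asn r2))"

lemma computes_params:
  assumes q: "1 \<le> q"
  defines "e \<equiv> \<lambda>n. n div q + 1"
  shows "computes orc (prog_params q c R w) (Num n)
     (return_pmf (Pair (Num (7 * e n + c)) (Pair (Num (2 * e n + 6)) (Num (R + w * n))))) ((n + 2) * (300 + 2 * w))"
proof -
  define \<phi> where "\<phi> = (\<lambda>(zs :: unit list) i. Pair (Num (length zs)) (Pair (Num (i mod q)) (Pair (Num (7 * e i + c))
      (Pair (Num (2 * e i + 6)) (Num (R + w * i))))))"
  have fold: "fold (\<lambda>_ i. Suc i) zs b = length zs + b" for zs :: "unit list" and b
    by (induction zs arbitrary: b) auto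
  have step: "Suc (i mod q) < q \<and> Suc i mod q = Suc (i mod q) \<and> e (Suc i) = e i \<or>
      \<not> Suc (i mod q) < q \<and> Suc i mod q = 0 \<and> e (Suc i) = Suc (e i)" for i
  proof -
    have "i mod q < q" using q by simp
    thus ?thesis by (auto simp: e_def div_Suc mod_Suc)
  qed
  have "computes orc (whl CLess (EN 0) e0 (asn (EIf CLess (EInc e1) (EN q)
        (EP (EDec e0) (EP (EInc e1) (EP e2 (EP e3 ((EInc ^^ w) r4)))))
        (EP (EDec e0) (EP (EN 0) (EP ((EInc ^^ 7) e2) (EP (EInc (EInc e3)) ((EInc ^^ w) r4)))))))) (\<phi> (replicate n ()) 0)
      (return_pmf (\<phi> [] (fold (\<lambda>_ i. Suc i) (replicate n ()) 0))) ((length (replicate n ()) + 1) * (200 + 2 * w))"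
  proof (rule computes_for_asn[where \<phi> = \<phi> and g = "\<lambda>_ i. Suc i"])
    fix z :: unit and zs i
    show "ev (EIf CLess (EInc e1) (EN q)
        (EP (EDec e0) (EP (EInc e1) (EP e2 (EP e3 ((EInc ^^ w) r4)))))
        (EP (EDec e0) (EP (EN 0) (EP ((EInc ^^ 7) e2) (EP (EInc (EInc e3)) ((EInc ^^ w) r4)))))) (\<phi> (z # zs) i) = \<phi> zs (Suc i)"
      using step[of i] by (elim disjE conjE) (simp_all add: \<phi>_def)
  qed (simp_all add: \<phi>_def)
  hence W: "computes orc (whl CLess (EN 0) e0 (asn (EIf CLess (EInc e1) (EN q)
        (EP (EDec e0) (EP (EInc e1) (EP e2 (EP e3 ((EInc ^^ w) r4)))))
        (EP (EDec e0) (EP (EN 0) (EP ((EInc ^^ 7) e2) (EP (EInc (EInc e3)) ((EInc ^^ w) r4))))))))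
      (ev (EP EV (EP (EN 0) (EP (EN (7 + c)) (EP (EN 8) (EN R))))) (Num n))
      (return_pmf (\<phi> [] n)) ((n + 1) * (200 + 2 * w))"
    unfolding fold by (simp add: \<phi>_def e_def)
  show ?thesis unfolding prog_params_def
    apply (rule computes_mono)
     apply (rule computes_Seq_det[OF computes_asn])
     apply (rule computes_Seq_det[OF W])
     apply (rule computes_asn_eq)
     apply (simp add: \<phi>_def)
    apply (simp add: algebra_simps)
    done
qed

text \<open>The factor 2^l may be as large as 2^n and must not be computed in unary; in binary it is
  \<open>l\<close> zeros before the bits of \<open>t\<close>. The denominator is \<open>M\<close>,
  so no division is performed.\<close>

definition prog_out :: com where
  "prog_out = Seq (call prog_bits e1) (Seq (call prog_bits r3) (Seq (asn (EP e2 (EP e1 e0)))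
     (Seq (whl CLess (EN 0) e0 (asn (EP (EDec e0) (EP (EP (EN 0) e1) r2)))) (asn r1))))"

lemma computes_out:
  "computes orc prog_out (Pair (Num l) (Pair (Num t) (Num M)))
     (return_pmf (Pair (enc_bits (replicate l False @ bits t)) (enc_bits (bits M))))
     ((t + 1) * (300 * (t + 1)) + (M + 1) * (300 * (M + 1)) + (l + 2) * 100)"
proof -
  have fold: "fold (\<lambda>_ b. False # b) zs b = replicate (length zs) False @ b" for zs :: "unit list" and b
  proof (induction zs arbitrary: b)
    case (Cons z zs)
    show ?case by (simp add: Cons.IH) (simp add: replicate_append_same flip: append_Cons)
  qed simp
  have "computes orc (whl CLess (EN 0) e0 (asn (EP (EDec e0) (EP (EP (EN 0) e1) r2))))
      (Pair (Num (length (replicate l ()))) (Pair (enc_bits (bits t)) (enc_bits (bits M))))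
      (return_pmf (Pair (Num (length ([] :: unit list))) (Pair (enc_bits (fold (\<lambda>_ b. False # b) (replicate l ()) (bits t))) (enc_bits (bits M)))))
      ((length (replicate l ()) + 1) * 50)"
    by (rule computes_for_asn[where \<phi> = "\<lambda>zs b. Pair (Num (length zs)) (Pair (enc_bits b) (enc_bits (bits M)))"]) (simp_all add: enc_bool_def)
  hence W: "computes orc (whl CLess (EN 0) e0 (asn (EP (EDec e0) (EP (EP (EN 0) e1) r2))))
      (ev (EP e2 (EP e1 e0)) (Pair (enc_bits (bits M)) (Pair (enc_bits (bits t)) (Pair (Num l) (Pair (Num t) (Num M))))))
      (return_pmf (Pair (Num 0) (Pair (enc_bits (replicate l False @ bits t)) (enc_bits (bits M))))) ((l + 1) * 50)"
    unfolding fold by simp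
  have "computes orc prog_bits (ev e1 (Pair (Num l) (Pair (Num t) (Num M)))) (return_pmf (enc_bits (bits t))) ((t + 1) * (300 * (t + 1)))"
    using computes_bits[of orc t] by simp
  note c1 = computes_call_det[OF this]
  have "computes orc prog_bits (ev r3 (Pair (enc_bits (bits t)) (Pair (Num l) (Pair (Num t) (Num M)))))
      (return_pmf (enc_bits (bits M))) ((M + 1) * (300 * (M + 1)))"
    using computes_bits[of orc M] by simp
  note c2 = computes_call_det[OF this]
  show ?thesis unfolding prog_out_def
    apply (rule computes_mono)
     apply (rule computes_Seq_det[OF c1])
     apply (rule computes_Seq_det[OF c2])
     apply (rule computes_Seq_det[OF computes_asn])
     apply (rule computes_Seq_det[OF W])
     apply (rule computes_asn_eq)
     apply simp
    apply simp
    done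
qed

lemma bin_val_zeros: "bin_val (enc_bits (replicate l False @ bs)) = 2 ^ l * bin_val (enc_bits bs)"
  by (induction l) (simp_all add: enc_bool_def)

context sat_program begin

definition prog_main :: "nat \<Rightarrow> nat \<Rightarrow> nat \<Rightarrow> nat \<Rightarrow> nat \<Rightarrow> com" where
  "prog_main q c R w k = Seq (call (prog_params q c R w) e0)
     (Seq (call prog_pow (EFst e0))
     (Seq (call prog_pow (EFst (ESnd e1)))
     (Seq (call prog_pow (EInc (EInc (EFst e2))))
     (Seq (asn (EP (EP (EInc e4) (EP e2 (EP e0 (EP (EN 0) (EP r5 (EP e1 (EP (ESnd (ESnd e3)) e4))))))) e2))
     (Seq (call (prog_search k) e0)
     (Seq (asn (EP (EFst (ESnd e0)) (EP (ESnd (ESnd e0)) r2))) prog_out))))))"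

lemma levels_cong: "(\<And>l. l \<in> set ls \<Longrightarrow> tr l = tr' l) \<Longrightarrow> levels tr M ls = levels tr' M ls"
  by (induction ls) (simp_all cong: if_cong)

lemma levels_total_le:
  assumes tr: "\<And>l x. x \<in> set_pmf (tr l) \<Longrightarrow> x \<le> cap"
  shows "r \<in> set_pmf (levels tr M ls) \<Longrightarrow> snd r \<le> M * cap \<and> fst r \<in> insert 0 (set ls)"
proof (induction ls)
  case Nil
  thus ?case by simp
next
  case (Cons l ls)
  have sum: "sum_list xs \<le> length xs * cap" if "\<forall>x\<in>set xs. x \<le> cap" for xs :: "nat list"
    using that by (induction xs) auto
  have tot: "sum_list xs \<le> M * cap" if xs: "xs \<in> set_pmf (replicate_pmf M (tr l))" for xs
    using sum[of xs] xs tr by (auto simp: set_replicate_pmf)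
  from Cons.prems obtain xs where xs: "xs \<in> set_pmf (replicate_pmf M (tr l))"
    and r: "r \<in> set_pmf (if 4 * M < sum_list xs then levels tr M ls else return_pmf (l, sum_list xs))"
    by auto
  show ?case
  proof (cases "4 * M < sum_list xs")
    case True
    thus ?thesis using r Cons.IH by auto
  next
    case False
    thus ?thesis using r tot[OF xs] by auto
  qed
qed

lemma computes_main:
  fixes n m q c R w k :: nat
  assumes q: "1 \<le> q" and n: "1 \<le> n" and F: "cnf_over n F" "cnf_size n F + (n + 1) * (2 ^ k * (1 + k)) + 2 * n \<le> m"
  defines "e \<equiv> n div q + 1"
  defines "M \<equiv> 2 ^ (7 * e + c)"
  defines "cap \<equiv> 2 ^ (2 * e + 6)"
  defines "R' \<equiv> R + w * n"
  shows "computes no_oracle (prog_main q c R w k) (enc_cnf n F)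
     (map_pmf (\<lambda>r. Pair (enc_bits (replicate (fst r) False @ bits (snd r))) (enc_bits (bits M)))
       (levels (trial (vote_pmf R' (once n)) cap n k F) M [0..<n + 1]))
     ((n + 2) * (300 + 2 * w) + 3 * ((7 * e + c + 4) * (800 * (M * cap))) +
      (n + 2) * (t_total M k (n + 1) n m R' cap + 200) + 2 * ((M * cap + 1) * (300 * (M * cap + 1))) + (n + 3) * 100 + 500)"
proof -
  let ?env = "Pair (Num cap) (Pair (Num R') (Num n))"
  let ?tr = "trial (vote_pmf R' (once n)) cap n k F"
  let ?P = "Pair (Num (7 * e + c)) (Pair (Num (2 * e + 6)) (Num R'))"
  let ?v0 = "Pair (Num n) (enc_clauses F)"
  have cap1: "1 \<le> cap" and M1: "1 \<le> M" by (simp_all add: cap_def M_def)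
  define B where "B = M * cap"
  have MB: "M \<le> B" "cap \<le> B" using cap1 M1 by (simp_all add: B_def)
  define S where "S = Pair (Num (n + 1)) (Pair (Num M) (Pair (Num (4 * M)) (Pair (Num 0) (Pair (enc_clauses F) ?env))))"
  have "computes no_oracle (prog_params q c R w) (ev e0 ?v0) (return_pmf ?P) ((n + 2) * (300 + 2 * w))"
    using computes_params[OF q, of no_oracle c R w n] by (simp add: e_def R'_def)
  note c1 = computes_call_det[OF this]
  have pow: "computes no_oracle prog_pow (Num x) (return_pmf (Num (2 ^ x))) ((7 * e + c + 4) * (800 * B))"
    if "x \<le> 7 * e + c + 2" "2 ^ x \<le> 4 * B" for x
  proof (rule computes_mono[OF computes_pow])
    have "200 * 2 ^ x \<le> 800 * B" using that(2) by linarith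
    moreover have "x + 2 \<le> 7 * e + c + 4" using that(1) by simp
    ultimately show "(x + 2) * (200 * 2 ^ x) \<le> (7 * e + c + 4) * (800 * B)" by (rule mult_le_mono[rotated])
  qed
  have "computes no_oracle prog_pow (ev (EFst e0) (Pair ?P ?v0)) (return_pmf (Num M)) ((7 * e + c + 4) * (800 * B))"
    using pow[of "7 * e + c"] MB by (simp add: M_def)
  note c2 = computes_call_det[OF this]
  have "computes no_oracle prog_pow (ev (EFst (ESnd e1)) (Pair (Num M) (Pair ?P ?v0))) (return_pmf (Num cap)) ((7 * e + c + 4) * (800 * B))"
  proof -
    have "2 * e + 6 \<le> 7 * e + c + 2" by (simp add: e_def)
    thus ?thesis using pow[of "2 * e + 6"] MB by (simp add: cap_def)
  qed
  note c3 = computes_call_det[OF this]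
  have "computes no_oracle prog_pow (ev (EInc (EInc (EFst e2))) (Pair (Num cap) (Pair (Num M) (Pair ?P ?v0)))) (return_pmf (Num (4 * M))) ((7 * e + c + 4) * (800 * B))"
    using pow[of "7 * e + c + 2"] MB by (simp add: M_def)
  note c4 = computes_call_det[OF this]
  have asn1: "ev (EP (EP (EInc e4) (EP e2 (EP e0 (EP (EN 0) (EP r5 (EP e1 (EP (ESnd (ESnd e3)) e4))))))) e2)
      (Pair (Num (4 * M)) (Pair (Num cap) (Pair (Num M) (Pair ?P ?v0)))) = Pair S (Num M)"
    by (simp add: S_def)
  have "computes no_oracle (prog_search k) (ev e0 (Pair S (Num M)))
      (map_pmf (\<lambda>r. Pair (Num 0) (Pair (Num (fst r)) (Num (snd r)))) (levels ?tr M [0..<n + 1]))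
      ((n + 2) * (t_total M k (n + 1) n m R' cap + 200))"
    using computes_search[OF n F cap1, of 0 "n + 1" M R'] by (simp add: S_def del: upt_Suc)
  note c6 = computes_call_map[OF this]
  have out: "computes no_oracle (Seq (asn (EP (EFst (ESnd e0)) (EP (ESnd (ESnd e0)) r2))) prog_out)
      (Pair (Pair (Num 0) (Pair (Num (fst r)) (Num (snd r)))) (Pair S (Num M)))
      (return_pmf (Pair (enc_bits (replicate (fst r) False @ bits (snd r))) (enc_bits (bits M))))
      (50 + (2 * ((B + 1) * (300 * (B + 1))) + (n + 3) * 100))"
    if r: "r \<in> set_pmf (levels ?tr M [0..<n + 1])" for r
  proof -
    have "x \<le> cap" if "x \<in> set_pmf (?tr l)" "l \<le> n + 1" for x l
    proof -
      have "l * (2 ^ k * (1 + k)) \<le> (n + 1) * (2 ^ k * (1 + k))" by (rule mult_le_mono1[OF that(2)])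
      hence "cnf_size n F + l * (2 ^ k * (1 + k)) + 2 * n \<le> m" using F(2) by linarith
      from computes_trial(2)[OF n F(1) this cap1 that(1)] show ?thesis .
    qed
    \<comment> \<open>\<open>levels_total_le\<close> asks for the bound at every level. Beyond
      \<open>n + 1\<close> the size bound does not reach, so those trials are replaced by a
      constant.\<close>
    hence trc: "x \<le> cap" if "x \<in> set_pmf (if l \<le> n + 1 then ?tr l else return_pmf 0)" for x l
      using that by (auto split: if_splits)
    have "levels ?tr M ls = levels (\<lambda>l. if l \<le> n + 1 then ?tr l else return_pmf 0) M ls" if "\<forall>l\<in>set ls. l \<le> n + 1" for ls
      by (rule levels_cong) (use that in auto)
    from this[of "[0..<n + 1]"] r have "r \<in> set_pmf (levels (\<lambda>l. if l \<le> n + 1 then ?tr l else return_pmf 0) M [0..<n + 1])"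
      by simp
    hence "snd r \<le> M * cap \<and> fst r \<in> insert 0 (set [0..<n + 1])"
      by (rule levels_total_le[rotated]) (rule trc)
    hence r': "snd r \<le> B" "fst r \<le> n + 1" by (auto simp: B_def)
    have t: "(snd r + 1) * (300 * (snd r + 1)) + (M + 1) * (300 * (M + 1)) + (fst r + 2) * 100 \<le>
        2 * ((B + 1) * (300 * (B + 1))) + (n + 3) * 100"
    proof -
      have "(snd r + 1) * (300 * (snd r + 1)) \<le> (B + 1) * (300 * (B + 1))" using r'(1) by (intro mult_le_mono) simp_all
      moreover have "(M + 1) * (300 * (M + 1)) \<le> (B + 1) * (300 * (B + 1))" using MB(1) by (intro mult_le_mono) simp_all
      moreover have "a \<le> c \<Longrightarrow> b \<le> c \<Longrightarrow> f \<le> n + 1 \<Longrightarrow> a + b + (f + 2) * 100 \<le> 2 * c + (n + 3) * 100" for a b c f :: nat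
        by simp
      ultimately show ?thesis using r'(2) by blast
    qed
    note O = computes_mono[OF computes_out[of no_oracle "fst r" "snd r" M] t]
    show ?thesis
      by (rule computes_mono, rule computes_Seq_det[OF computes_asn_eq O]) simp_all
  qed
  note tail = computes_Seq_map[OF c6 out]
  have eq: "map_pmf (\<lambda>r. Pair (enc_bits (replicate (fst r) False @ bits (snd r))) (enc_bits (bits M))) (levels ?tr M [0..<n + 1]) =
     bind_pmf (levels ?tr M [0..<n + 1]) (\<lambda>r. return_pmf (Pair (enc_bits (replicate (fst r) False @ bits (snd r))) (enc_bits (bits M))))"
    by (simp only: map_pmf_def)
  have time: "c1 + P + (c2 + Q + (c3 + Q + (c4 + Q + (c5 + (c6 + S + (50 + (U + V))))))) \<le> P + 3 * Q + S + U + V + 500"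
    if "c1 + c2 + c3 + c4 + c5 + c6 \<le> 400" for c1 c2 c3 c4 c5 c6 P Q S U V :: nat
    using that by linarith
  show ?thesis unfolding prog_main_def enc_cnf_eq eq B_def[symmetric]
    apply (rule computes_mono)
     apply (rule computes_Seq_det[OF c1])
     apply (rule computes_Seq_det[OF c2])
     apply (rule computes_Seq_det[OF c3])
     apply (rule computes_Seq_det[OF c4])
     apply (rule computes_Seq_det[OF computes_asn_eq[OF asn1]])
     apply (rule tail, assumption)
    apply (rule time)
    apply simp
    done
qed

end

subsection \<open>Events of runs\<close>

lemma measure_run_ge:
  assumes c: "computes orc c v p T" and Q: "\<And>t. t \<le> T \<Longrightarrow> Q t"
  shows "measure_pmf.prob p {w. G w} \<le> measure (measure_spmf (run orc c v)) {(w, t). Q t \<and> G w}"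
proof -
  have "measure_pmf.prob p {w. G w} = measure (measure_spmf (map_spmf fst (run orc c v))) {w. G w}"
    unfolding computes_run(1)[OF c] by simp
  also have "\<dots> = measure (measure_spmf (run orc c v)) (fst -` {w. G w})"
    by (rule measure_map_spmf)
  also have "\<dots> \<le> measure (measure_spmf (run orc c v)) {(w, t). Q t \<and> G w}"
  proof (rule measure_spmf.finite_measure_mono_AE)
    show "AE x in measure_spmf (run orc c v). x \<in> fst -` {w. G w} \<longrightarrow> x \<in> {(w, t). Q t \<and> G w}"
      unfolding AE_measure_spmf_iff
    proof (intro ballI impI)
      fix x assume x: "x \<in> set_spmf (run orc c v)" "x \<in> fst -` {w. G w}"
      have "snd x \<le> T" using computes_run(2)[OF c] x(1) by (auto simp: split_beta)
      thus "x \<in> {(w, t). Q t \<and> G w}" using x(2) Q by (auto simp: split_beta)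
    qed
  qed simp
  finally show ?thesis .
qed

text \<open>The dominant term is n levels times 8 log n rounds times the cost \<open>T\<close> of a
  round, in which the encoding of the n sets costs of order n 2^k k and drawing them n^2.\<close>

lemma acount_time:
  fixes n k size :: nat
  defines "L \<equiv> nat \<lceil>log 2 (real n)\<rceil>"
  defines "B \<equiv> 2 ^ k * (k + 1)"
  defines "T \<equiv> (n + 2) * (500 * (n + 1) + 1000 * B) + (4 * (size + (n + 1) * B) + 100)"
  assumes n: "2 \<le> n" and k: "1 \<le> k"
  shows "real ((n + 1) * (300 + (8 * L + 1) * (100 + T)) + (L + 2) * (200 * (n + 1))) \<le>
    200000 * (real n * log 2 (real n) * ((real n)\<^sup>2 + 2 ^ k * real k * real n + real size))"
proof -
  define Y where "Y = 2 ^ k * k * n"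
  define Z where "Z = n\<^sup>2 + Y + size"
  define lg where "lg = log 2 (real n)"
  have lg: "1 \<le> lg" unfolding lg_def using n by simp
  have L: "real L \<le> 2 * lg"
  proof -
    have "real L \<le> lg + 1" unfolding L_def lg_def using n by (simp add: of_nat_nat)
    thus ?thesis using lg by linarith
  qed
  have B: "B \<le> 2 * (2 ^ k * k)" unfolding B_def using k by simp
  have n2: "n \<le> n\<^sup>2" "1 \<le> n\<^sup>2" using n by (simp_all add: power2_eq_square)
  have nB: "(n + 1) * B \<le> 4 * Y" "(n + 2) * B \<le> 4 * Y"
  proof -
    have "(n + 2) * B \<le> (2 * n) * (2 * (2 ^ k * k))" by (rule mult_le_mono) (use n B in simp_all)
    thus "(n + 2) * B \<le> 4 * Y" by (simp add: Y_def mult_ac)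
    moreover have "(n + 1) * B \<le> (n + 2) * B" by simp
    ultimately show "(n + 1) * B \<le> 4 * Y" by (rule order_trans[rotated])
  qed
  have nn: "(n + 2) * (n + 1) \<le> 4 * n\<^sup>2"
  proof -
    have "(n + 2) * (n + 1) \<le> (2 * n) * (2 * n)" by (rule mult_le_mono) (use n in simp_all)
    thus ?thesis by (simp add: power2_eq_square)
  qed
  have "T = 500 * ((n + 2) * (n + 1)) + 1000 * ((n + 2) * B) + 4 * size + 4 * ((n + 1) * B) + 100"
    unfolding T_def by (simp add: algebra_simps)
  moreover have "T = 500 * a + 1000 * b + 4 * size + 4 * c + 100 \<Longrightarrow> c \<le> 4 * Y \<Longrightarrow> b \<le> 4 * Y \<Longrightarrow> a \<le> 4 * v \<Longrightarrow> 1 \<le> v \<Longrightarrow>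
      100 + T \<le> 5000 * (v + Y + size)" for a b c v T Y size :: nat
  proof -
    assume T: "T = 500 * a + 1000 * b + 4 * size + 4 * c + 100" and le: "c \<le> 4 * Y" "b \<le> 4 * Y" "a \<le> 4 * v" "1 \<le> v"
    have "100 + T = 500 * a + 1000 * b + 4 * size + 4 * c + 200 * 1" unfolding T by simp
    also have "\<dots> \<le> 500 * (4 * v) + 1000 * (4 * Y) + 4 * size + 4 * (4 * Y) + 200 * v"
      using le by (intro add_le_mono mult_le_mono2 order_refl)
    also have "\<dots> = 2200 * v + 4016 * Y + 4 * size" by simp
    also have "\<dots> \<le> 5000 * v + 5000 * Y + 5000 * size" by (intro add_le_mono mult_le_mono1) simp_all
    finally show ?thesis by (simp only: distrib_left)
  qed
  ultimately have "100 + T \<le> 5000 * Z" unfolding Z_def using nB nn n2(2) by blast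
  hence T: "100 + real T \<le> 5000 * real Z" by linarith
  have "1 \<le> Z" unfolding Z_def using n2(2) by linarith
  hence Z: "1 \<le> real Z" by simp
  have lZ: "1 * 1 \<le> lg * real Z" using lg Z by (intro mult_mono) auto
  have lZ': "lg * 1 \<le> lg * real Z" using lg Z by (intro mult_left_mono) auto
  have "(8 * real L + 1) * (100 + real T) \<le> (17 * lg) * (5000 * real Z)"
    using L lg T by (intro mult_mono) auto
  hence 1: "300 + (8 * real L + 1) * (100 + real T) \<le> 85300 * (lg * real Z)" using lZ by linarith
  have "(real n + 1) * (300 + (8 * real L + 1) * (100 + real T)) \<le> (2 * real n) * (85300 * (lg * real Z))"
    using 1 n by (intro mult_mono) auto
  moreover have "(real L + 2) * (200 * (real n + 1)) \<le> (4 * (lg * real Z)) * (200 * (2 * real n))"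
  proof (rule mult_mono)
    show "real L + 2 \<le> 4 * (lg * real Z)" using L lg lZ' by linarith
    show "0 \<le> 4 * (lg * real Z)" using lZ by linarith
  qed (use n in simp_all)
  ultimately have "real ((n + 1) * (300 + (8 * L + 1) * (100 + T)) + (L + 2) * (200 * (n + 1))) \<le> 172200 * (real n * (lg * real Z))"
    by (simp add: algebra_simps)
  also have "\<dots> \<le> 200000 * (real n * (lg * real Z))" using lg by (intro mult_right_mono) auto
  also have "real n * (lg * real Z) = real n * lg * ((real n)\<^sup>2 + 2 ^ k * real k * real n + real size)"
    by (simp add: Z_def Y_def)
  finally show ?thesis by (simp only: lg_def)
qed

lemma acount_program_success:
  fixes n k :: nat and \<kappa> :: real and F :: cnf
  assumes F: "cnf_over n F" and s: "s = card (solutions n F)" "0 < s"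
    and k: "4 * log 2 (16 * real n) \<le> real k + 1" "k + 1 \<le> n"
    and \<kappa>: "0 < \<kappa>" "real k + 1 = \<kappa> * log 2 (512 * \<kappa>) * (4 * log 2 (16 * real n))"
  shows "1 / 4 \<le> measure (measure_spmf (run sat_oracle prog_acount (acount_input n k F)))
             {(v, t).
                real t \<le> 200000 * (real n * log 2 (real n) *
                               ((real n)\<^sup>2 + 2 ^ k * real k * real n + real (cnf_size n F))) \<and>
                1 / 4 * 2 powr (- real n / \<kappa>) * real s \<le> real (bin_val v) \<and>
                real (bin_val v) \<le> 4 * real s}"
proof -
  have n: "37 \<le> n" by (rule log_bound_37) (use k in linarith)+
  have k1: "1 \<le> k"
  proof -
    have "log 2 16 \<le> log 2 (16 * real n)" using n by (subst log_le_cancel_iff) auto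
    moreover have "log 2 (16 :: real) = 4" using log_pow_cancel[of "2 :: real" 4] by simp
    ultimately have "2 \<le> real k + 1" using k(1) by linarith
    thus ?thesis by simp
  qed
  let ?p = "acount_vals (random_subset n ((real k + 1) / (2 * real n))) n k F [1..<n + 2]"
  let ?G = "\<lambda>r. 1 / 4 * 2 powr (- real n / \<kappa>) * real s \<le> real r \<and> real r \<le> 4 * real s"
  note c = computes_acount[OF F, of k]
  have "1 / 4 \<le> measure_pmf.prob (acount n k F) {r. ?G r}"
    unfolding s(1) by (rule acount_success[OF _ k \<kappa>]) (use s in simp)
  also have "\<dots> = measure_pmf.prob (map_pmf bin_val ?p) {r. ?G r}"
    by (simp only: map_acount_vals acount_def)
  also have "\<dots> = measure_pmf.prob ?p {v. ?G (bin_val v)}"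
    by (simp add: vimage_def)
  also have "\<dots> \<le> measure (measure_spmf (run sat_oracle prog_acount (acount_input n k F)))
      {(v, t). real t \<le> 200000 * (real n * log 2 (real n) *
                               ((real n)\<^sup>2 + 2 ^ k * real k * real n + real (cnf_size n F))) \<and> ?G (bin_val v)}"
  proof (rule measure_run_ge[OF c])
    fix t :: nat
    assume t: "t \<le> (n + 1) * (300 + (8 * nat \<lceil>log 2 (real n)\<rceil> + 1) * (100 + ((n + 2) * (500 * (n + 1) + 1000 * (2 ^ k * (k + 1))) +
        (4 * (cnf_size n F + (n + 1) * (2 ^ k * (k + 1))) + 100)))) + (nat \<lceil>log 2 (real n)\<rceil> + 2) * (200 * (n + 1))"
    show "real t \<le> 200000 * (real n * log 2 (real n) *
                               ((real n)\<^sup>2 + 2 ^ k * real k * real n + real (cnf_size n F)))"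
    proof (rule order_trans[OF _ acount_time])
      show "2 \<le> n" using n by simp
      show "1 \<le> k" by (rule k1)
    qed (use t in \<open>simp only: of_nat_le_iff\<close>)
  qed (use n k in simp_all)
  finally show ?thesis .
qed

subsection \<open>The accuracy of approximate counting\<close>

locale correct_sat_program = sat_program +
  assumes correct: "\<And>n \<Phi>. cnf_over n \<Phi> \<Longrightarrow> 2 / 3 \<le> measure_pmf.prob (pA n \<Phi>) {v. v = enc_bool (satisfiable n \<Phi>)}"
begin

lemma once_error: "measure_pmf.prob (once n \<Phi>) {b. b \<noteq> satisfiable n \<Phi>} \<le> 1 / 3"
proof (cases "cnf_over n \<Phi>")
  case True
  have "2 / 3 \<le> measure_pmf.prob (pA n \<Phi>) {v. v = enc_bool (satisfiable n \<Phi>)}" by (rule correct[OF True])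
  also have "\<dots> \<le> measure_pmf.prob (pA n \<Phi>) {v. eq_val v (Num 1) = satisfiable n \<Phi>}"
    by (rule measure_pmf.finite_measure_mono) (auto simp: enc_bool_def)
  also have "\<dots> = measure_pmf.prob (once n \<Phi>) {b. b = satisfiable n \<Phi>}"
    using True by (simp add: once_def vimage_def)
  finally have "2 / 3 \<le> measure_pmf.prob (once n \<Phi>) {b. b = satisfiable n \<Phi>}" .
  moreover have "measure_pmf.prob (once n \<Phi>) {b. b \<noteq> satisfiable n \<Phi>} =
      1 - measure_pmf.prob (once n \<Phi>) {b. b = satisfiable n \<Phi>}"
  proof -
    have "{b. b \<noteq> satisfiable n \<Phi>} = space (measure_pmf (once n \<Phi>)) - {b. b = satisfiable n \<Phi>}" by auto
    thus ?thesis by (simp only: measure_pmf.prob_compl sets_measure_pmf UNIV_I)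
  qed
  ultimately show ?thesis by linarith
next
  case False
  thus ?thesis by (simp add: once_def)
qed

text \<open>A wrong majority needs at least R / 2 errors where at most R / 3 are expected. The
  excess R / 6 has probability at most exp (- R / (4 * 36)), hence the factor 144.\<close>

lemma vote_close:
  assumes R: "R = 144 * r"
  shows "close (exp (- real r)) (vote_pmf R (once n) \<Phi>) (return_pmf (satisfiable n \<Phi>))"
proof (rule close_return)
  let ?b = "satisfiable n \<Phi>"
  let ?p = "measure_pmf.prob (once n \<Phi>) {b. b \<noteq> ?b}"
  let ?g = "\<lambda>b. of_bool (b \<noteq> ?b) - ?p"
  have p: "0 \<le> ?p" "?p \<le> 1 / 3" using once_error by simp_all
  have sum: "(\<Sum>b\<leftarrow>bs. ?g b) = real (count_list bs (\<not> ?b)) - real (length bs) * ?p" for bs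
    by (induction bs) (auto simp: algebra_simps)
  have count: "count_list bs True + count_list bs False = length bs" for bs
    by (induction bs) auto
  have "measure_pmf.prob (vote_pmf R (once n) \<Phi>) {x. x \<noteq> ?b} =
      measure_pmf.prob (replicate_pmf R (once n \<Phi>)) {bs. (count_list bs False < count_list bs True) \<noteq> ?b}"
    by (simp add: vote_pmf_def vimage_def)
  also have "\<dots> \<le> measure_pmf.prob (replicate_pmf R (once n \<Phi>)) {bs. real R * (1 / 6) \<le> (\<Sum>b\<leftarrow>bs. ?g b)}"
  proof (rule measure_pmf.finite_measure_mono_AE)
    show "AE bs in replicate_pmf R (once n \<Phi>). bs \<in> {bs. (count_list bs False < count_list bs True) \<noteq> ?b} \<longrightarrow>
        bs \<in> {bs. real R * (1 / 6) \<le> (\<Sum>b\<leftarrow>bs. ?g b)}"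
      unfolding AE_measure_pmf_iff
    proof (intro ballI impI)
      fix bs assume "bs \<in> set_pmf (replicate_pmf R (once n \<Phi>))" and w: "bs \<in> {bs. (count_list bs False < count_list bs True) \<noteq> ?b}"
      hence len: "length bs = R" by (simp add: set_replicate_pmf)
      have "length bs \<le> 2 * count_list bs (\<not> ?b)" using w count[of bs] by (cases ?b) auto
      hence "real R \<le> real (2 * count_list bs (\<not> ?b))" unfolding len by (simp only: of_nat_le_iff)
      moreover have "real R * ?p \<le> real R * (1 / 3)" using p by (intro mult_left_mono) auto
      ultimately show "bs \<in> {bs. real R * (1 / 6) \<le> (\<Sum>b\<leftarrow>bs. ?g b)}" unfolding mem_Collect_eq sum len by simp
    qed
  qed simp
  also have "\<dots> \<le> exp (- (real R * (1 / 6)\<^sup>2 / (4 * 1\<^sup>2)))"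
  proof (rule sum_list_tail)
    show "E (once n \<Phi>) ?g = 0"
      by (subst Bochner_Integration.integral_diff) (auto simp: prob_E[symmetric] intro!: integrable_bounded_pmf[of _ _ 1])
    show "\<bar>?g b\<bar> \<le> 1" for b
    proof -
      have "0 \<le> (of_bool (b \<noteq> ?b) :: real)" "(of_bool (b \<noteq> ?b) :: real) \<le> 1" by simp_all
      thus ?thesis using p by linarith
    qed
  qed simp_all
  also have "real R * (1 / 6)\<^sup>2 / (4 * 1\<^sup>2) = real r" by (simp add: R power2_eq_square)
  finally show "measure_pmf.prob (vote_pmf R (once n) \<Phi>) {x. x \<noteq> ?b} \<le> exp (- real r)" .
qed

text \<open>Sampling errors with a perfect oracle and the deviation caused by the real one are
  bounded separately, each by 2^-(n + 1).\<close>

lemma approximate_count: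
  fixes n q k :: nat and F :: cnf and t \<rho> :: real
  defines "e \<equiv> n div q + 1"
  defines "c \<equiv> 2 * q + 19"
  defines "M \<equiv> 2 ^ (7 * e + c)"
  defines "cap \<equiv> 2 ^ (2 * e + 6)"
  defines "R \<equiv> 144 * (2 * q + 36) + 1728 * n"
  defines "s \<equiv> card (solutions n F)"
  assumes n: "1 \<le> n" and q: "1 \<le> q"
    and par: "0 < t" "t \<le> 1" "(1 + t) * t powr (- \<rho>) \<le> exp (ln 2 / real q)" "odd k" "(1 - 2 * \<rho>) ^ k \<le> ln 2 / real q"
  shows "1 - 1 / 2 ^ n \<le> measure_pmf.prob (levels (trial (vote_pmf R (once n)) cap n k F) M [0..<n + 1]) {r. accurate e M s r}"
proof -
  let ?S = "solutions n F"
  \<comment> \<open>The number of queries times 2^(n + 1) is at most 2^(3 n + 9 e + c + 8), and e <=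
    n + 1 with c = 2 q + 19 gives this exponent.\<close>
  define r where "r = 12 * n + 2 * q + 36"
  have R: "R = 144 * r" by (simp add: R_def r_def)
  have cap1: "1 \<le> cap" by (simp add: cap_def)
  have qe: "n \<le> q * e"
  proof -
    have "n = q * (n div q) + n mod q" by simp
    moreover have "n mod q < q" using q by simp
    ultimately have "n \<le> q * (n div q) + q" by linarith
    thus ?thesis by (simp add: e_def)
  qed
  have en: "e \<le> n + 1" unfolding e_def by simp
  let ?T = "trial (\<lambda>\<Psi>. return_pmf (satisfiable n \<Psi>)) cap n k F"
  define \<beta> :: real where "\<beta> = 2 * exp (- (2 ^ (e + c) / 2 ^ 16))"
  have exact: "measure_pmf.prob (levels ?T M [0..<n + 1]) {r. \<not> accurate e M s r} \<le> (real n + 1) * \<beta>"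
  proof (cases "s = 0")
    \<comment> \<open>The dispersion is useful only for a nonempty set. Without solutions every
      trial is 0, and level 0 stops with the exact answer.\<close>
    case True
    hence S: "?S = {}" using finite_solutions(1)[of n F] by (simp add: s_def)
    have zero: "sum_list (map (\<lambda>_. 0) xs) = (0 :: nat)" for xs :: "(nat list \<times> bool) list list" by (induction xs) auto
    have split: "[0..<n + 1] = [] @ 0 # [Suc 0..<n + 1]" by (simp add: upt_conv_Cons del: upt_Suc)
    have "measure_pmf.prob (levels ?T M ([] @ 0 # [Suc 0..<n + 1])) {r. \<not> accurate e M s r} \<le> (real (length ([] :: nat list)) + 1) * 0"
    proof (rule levels_error[where ok = "\<lambda>_ T. T = 0"])
      fix l
      have "?T l = map_pmf (\<lambda>_. 0) (hash_pmf (index_list n k) l)"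
        unfolding trial_exact[OF n cap1] S by (simp add: hits_def)
      hence "?T l = return_pmf 0" by simp
      hence "map_pmf sum_list (replicate_pmf M (?T l)) = return_pmf 0"
      proof -
        have "xs \<in> set_pmf (replicate_pmf M (return_pmf 0)) \<Longrightarrow> sum_list xs = 0" for xs :: "nat list"
          by (auto simp: set_replicate_pmf)
        hence "map_pmf sum_list (replicate_pmf M (return_pmf (0 :: nat))) = map_pmf (\<lambda>_. 0) (replicate_pmf M (return_pmf (0 :: nat)))"
          by (intro map_pmf_cong refl) simp
        thus ?thesis using \<open>?T l = return_pmf 0\<close> by simp
      qed
      thus "measure_pmf.prob (map_pmf sum_list (replicate_pmf M (?T l))) {T. T \<noteq> 0} \<le> 0" by simp
    qed (simp_all add: accurate_def True)
    hence "measure_pmf.prob (levels ?T M [0..<n + 1]) {r. \<not> accurate e M s r} \<le> 0" unfolding split by simp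
    moreover have "0 \<le> (real n + 1) * \<beta>" by (simp add: \<beta>_def)
    ultimately show ?thesis by linarith
  next
    case False
    hence s1: "1 \<le> s" by simp
    hence S: "?S \<noteq> {}" by (auto simp: s_def)
    have sn: "s \<le> 2 ^ n" unfolding s_def by (rule finite_solutions)
    define l0 where "l0 = (LEAST l. s \<le> 2 * 2 ^ l)"
    have ex: "s \<le> 2 * 2 ^ n" using sn by simp
    have l0: "s \<le> 2 * 2 ^ l0" "l0 \<le> n" unfolding l0_def using ex by (rule LeastI, intro Least_le)
    have low: "2 ^ l \<le> s" if "l \<le> l0" for l
    proof (cases l0)
      case 0
      thus ?thesis using that s1 by simp
    next
      case (Suc l')
      have "\<not> s \<le> 2 * 2 ^ l'" using not_less_Least[of l' "\<lambda>l. s \<le> 2 * 2 ^ l"] Suc by (simp add: l0_def)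
      hence "2 ^ l0 \<le> s" by (simp add: Suc)
      moreover have "(2 :: nat) ^ l \<le> 2 ^ l0" using that by (intro power_increasing) auto
      ultimately show ?thesis by linarith
    qed
    have sub: "?S \<subseteq> {x. length x = n}" by (auto simp: solutions_def)
    have "\<exists>ok. measure_pmf.prob (map_pmf sum_list (replicate_pmf M (?T l))) {T. \<not> ok T} \<le> \<beta> \<and>
        (\<forall>T. ok T \<longrightarrow> T \<le> 4 * M \<longrightarrow> accurate e M s (l, T)) \<and> (s \<le> 2 * 2 ^ l \<longrightarrow> (\<forall>T. ok T \<longrightarrow> T \<le> 4 * M))"
      if l: "l \<le> l0" for l
    proof -
      have l2: "2 ^ l \<le> card ?S" using low[OF l] by (simp add: s_def)
      have "dispersion (index_list n k) lparity ?S l \<le> 2 ^ (e + 1)"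
        by (rule dispersion_index_list[OF n sub S l2 q qe par])
      from level_error[OF finite_solutions(1) this meta_eq_to_obj_eq[OF cap_def] l2 meta_eq_to_obj_eq[OF M_def]]
      show ?thesis unfolding trial_exact[OF n cap1] \<beta>_def s_def .
    qed
    hence "\<forall>l\<in>{..l0}. \<exists>ok. measure_pmf.prob (map_pmf sum_list (replicate_pmf M (?T l))) {T. \<not> ok T} \<le> \<beta> \<and>
        (\<forall>T. ok T \<longrightarrow> T \<le> 4 * M \<longrightarrow> accurate e M s (l, T)) \<and> (s \<le> 2 * 2 ^ l \<longrightarrow> (\<forall>T. ok T \<longrightarrow> T \<le> 4 * M))" by simp
    from bchoice[OF this] obtain ok where ok: "\<And>l. l \<le> l0 \<Longrightarrow> measure_pmf.prob (map_pmf sum_list (replicate_pmf M (?T l))) {T. \<not> ok l T} \<le> \<beta>"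
      "\<And>l T. l \<le> l0 \<Longrightarrow> ok l T \<Longrightarrow> T \<le> 4 * M \<Longrightarrow> accurate e M s (l, T)"
      "\<And>l T. l \<le> l0 \<Longrightarrow> s \<le> 2 * 2 ^ l \<Longrightarrow> ok l T \<Longrightarrow> T \<le> 4 * M" by auto
    have split: "[0..<n + 1] = [0..<l0] @ l0 # [Suc l0..<n + 1]"
      by (rule upt_split) (use l0 in auto)
    have "measure_pmf.prob (levels ?T M ([0..<l0] @ l0 # [Suc l0..<n + 1])) {r. \<not> accurate e M s r} \<le> (real (length [0..<l0]) + 1) * \<beta>"
    proof (rule levels_error[where ok = ok])
      have le: "l \<le> l0" if "l \<in> set ([0..<l0] @ [l0])" for l using that by auto
      show "measure_pmf.prob (map_pmf sum_list (replicate_pmf M (?T l))) {T. \<not> ok l T} \<le> \<beta>" if "l \<in> set ([0..<l0] @ [l0])" for l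
        by (rule ok(1)[OF le[OF that]])
      show "accurate e M s (l, T)" if "l \<in> set ([0..<l0] @ [l0])" "ok l T" "T \<le> 4 * M" for l T
        by (rule ok(2)[OF le[OF that(1)] that(2,3)])
      show "T \<le> 4 * M" if "ok l0 T" for T by (rule ok(3)[OF order_refl l0(1) that])
    qed
    also have "\<dots> \<le> (real n + 1) * \<beta>" using l0(2) by (intro mult_right_mono) (auto simp: \<beta>_def)
    finally show ?thesis unfolding split .
  qed
  define \<epsilon> where "\<epsilon> = exp (- real r)"
  have \<epsilon>0: "0 \<le> \<epsilon>" by (simp add: \<epsilon>_def)
  have "close (real n * (real (2 * cap) * \<epsilon>)) (trial (vote_pmf R (once n)) cap n k F l) (?T l)" for l
    unfolding trial_def by (rule close_bind_same, rule close_count_sols) (use vote_close[OF R] cap1 in \<open>simp_all add: \<epsilon>_def\<close>)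
  from close_levels[OF this, of "[0..<n + 1]" M]
  have "close ((real n + 1) * (real M * (real n * (real (2 * cap) * \<epsilon>))))
      (levels (trial (vote_pmf R (once n)) cap n k F) M [0..<n + 1]) (levels ?T M [0..<n + 1])"
    using \<epsilon>0 by (simp add: add.commute del: upt_Suc)
  hence "E (levels (trial (vote_pmf R (once n)) cap n k F) M [0..<n + 1]) (\<lambda>r. of_bool (\<not> accurate e M s r)) \<le>
      E (levels ?T M [0..<n + 1]) (\<lambda>r. of_bool (\<not> accurate e M s r)) + (real n + 1) * (real M * (real n * (real (2 * cap) * \<epsilon>)))"
    unfolding close_def by (elim allE[of _ "\<lambda>r. of_bool (\<not> accurate e M s r)"] impE) simp_all
  hence bad: "measure_pmf.prob (levels (trial (vote_pmf R (once n)) cap n k F) M [0..<n + 1]) {r. \<not> accurate e M s r} \<le>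
      (real n + 1) * \<beta> + (real n + 1) * (real M * (real n * (real (2 * cap) * \<epsilon>)))"
    using exact unfolding prob_E by linarith
  have exp2: "(2 :: real) ^ x \<le> exp (real x)" for x
  proof -
    have "(2 :: real) ^ x \<le> exp 1 ^ x" using exp_ge_add_one_self[of 1] by (intro power_mono) auto
    thus ?thesis by (simp flip: exp_of_nat_mult)
  qed
  \<comment> \<open>By the choice of \<open>c\<close> the exponent in \<open>\<beta>\<close> is 2^(e
    + 2 q + 3), which is at least 2 n + 3 because n <= q e.\<close>
  have b1: "(real n + 1) * \<beta> \<le> 1 / 2 ^ (n + 1)"
  proof -
    have "2 * q + 3 \<le> 2 ^ (2 * q + 3)" using less_exp[of "2 * q + 3"] by simp
    moreover have "e \<le> 2 ^ e" "(1 :: nat) \<le> 2 ^ e" using less_exp[of e] by simp_all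
    ultimately have "2 * (q * e) + 3 \<le> 2 ^ (2 * q + 3) * 2 ^ e"
    proof -
      assume a: "2 * q + 3 \<le> 2 ^ (2 * q + 3)" "e \<le> 2 ^ e" "(1 :: nat) \<le> 2 ^ e"
      have "2 * (q * e) + 3 * 1 \<le> 2 * (q * 2 ^ e) + 3 * 2 ^ e"
        using a by (intro add_le_mono mult_le_mono) simp_all
      also have "\<dots> = (2 * q + 3) * 2 ^ e" by (simp add: distrib_right)
      also have "\<dots> \<le> 2 ^ (2 * q + 3) * 2 ^ e" by (rule mult_le_mono1[OF a(1)])
      finally show ?thesis by simp
    qed
    hence "2 * n + 3 \<le> 2 ^ (2 * q + 3) * 2 ^ e" using qe by linarith
    hence "real (2 * n + 3) \<le> real (2 ^ (2 * q + 3) * 2 ^ e)" by (simp only: of_nat_le_iff)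
    also have "\<dots> = 2 ^ (e + c) / 2 ^ 16" by (simp add: c_def power_add)
    finally have "exp (- (2 ^ (e + c) / 2 ^ 16)) \<le> exp (- real (2 * n + 3))" by simp
    hence "(real n + 1) * \<beta> \<le> (real n + 1) * (2 * exp (- real (2 * n + 3)))"
      unfolding \<beta>_def by (intro mult_left_mono) auto
    also have "\<dots> \<le> exp (real n) * (exp 1 * exp (- real (2 * n + 3)))"
      using exp_ge_add_one_self[of "real n"] exp_ge_add_one_self[of 1] by (intro mult_mono) (auto simp: add.commute)
    also have "\<dots> = exp (- real (n + 2))" by (simp flip: exp_add)
    also have "\<dots> \<le> exp (- real (n + 1))" by simp
    also have "\<dots> \<le> 1 / 2 ^ (n + 1)"
      using exp2[of "n + 1"] unfolding exp_minus inverse_eq_divide by (intro divide_left_mono) simp_all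
    finally show ?thesis .
  qed
  have b2: "(real n + 1) * (real M * (real n * (real (2 * cap) * \<epsilon>))) \<le> 1 / 2 ^ (n + 1)"
  proof -
    have "n < 2 ^ n" by (rule less_exp)
    hence n1: "n + 1 \<le> 2 ^ n" "n \<le> 2 ^ n" by linarith+
    have "(n + 1) * (M * (n * (2 * cap))) * 2 ^ (n + 1) \<le> 2 ^ n * (M * (2 ^ n * (2 * cap))) * 2 ^ (n + 1)"
      using n1 by (intro mult_le_mono) simp_all
    also have "\<dots> = 2 ^ (n + (7 * e + c + (n + (1 + (2 * e + 6)))) + (n + 1))"
      by (simp only: M_def cap_def power_add power_one_right)
    also have "\<dots> \<le> 2 ^ r" by (intro power_increasing) (use en in \<open>simp_all add: r_def c_def\<close>)
    finally have le: "real ((n + 1) * (M * (n * (2 * cap))) * 2 ^ (n + 1)) \<le> real (2 ^ r)" by (simp only: of_nat_le_iff)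
    have "real ((n + 1) * (M * (n * (2 * cap))) * 2 ^ (n + 1)) = (real n + 1) * (real M * (real n * real (2 * cap))) * 2 ^ (n + 1)"
      by (simp only: of_nat_mult of_nat_add of_nat_1 of_nat_power of_nat_numeral)
    moreover have "real (2 ^ r) \<le> exp (real r)" using exp2[of r] by simp
    ultimately have "(real n + 1) * (real M * (real n * real (2 * cap))) * 2 ^ (n + 1) \<le> exp (real r)"
      using le by linarith
    hence "(real n + 1) * (real M * (real n * real (2 * cap))) * 2 ^ (n + 1) * \<epsilon> \<le> exp (real r) * \<epsilon>"
      by (rule mult_right_mono[OF _ \<epsilon>0])
    also have "exp (real r) * \<epsilon> = 1" by (simp add: \<epsilon>_def flip: exp_add)
    finally show ?thesis by (simp add: pos_le_divide_eq mult_ac)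
  qed
  have "(1 :: real) / 2 ^ (n + 1) + 1 / 2 ^ (n + 1) = 1 / 2 ^ n" by simp
  hence "measure_pmf.prob (levels (trial (vote_pmf R (once n)) cap n k F) M [0..<n + 1]) {r. \<not> accurate e M s r} \<le> 1 / 2 ^ n"
    using bad b1 b2 by linarith
  thus ?thesis
    using measure_pmf.prob_compl[of "{r. \<not> accurate e M s r}" "levels (trial (vote_pmf R (once n)) cap n k F) M [0..<n + 1]"]
    by (simp add: Compl_eq_Diff_UNIV[symmetric] Collect_neg_eq[symmetric])
qed

end

subsection \<open>Running times\<close>

text \<open>Bookkeeping for bounds of the form polynomial times 2^(j e) times 2^(u c n), with
  \<open>W\<close> the input size, \<open>X\<close> = 2^e and \<open>Y\<close> = 2^(c n). Only the
  exponents of \<open>X\<close> and \<open>Y\<close> are tracked; constants and the degree in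
  \<open>W\<close> stay hidden in the existential quantifier.\<close>

locale growth =
  fixes W X Y :: "'z \<Rightarrow> real"
  assumes ge1: "1 \<le> W z" "1 \<le> X z" "1 \<le> Y z"
begin

definition grows :: "nat \<Rightarrow> nat \<Rightarrow> ('z \<Rightarrow> nat) \<Rightarrow> bool" where
  "grows j u f \<longleftrightarrow> (\<exists>C d. 0 \<le> C \<and> (\<forall>z. real (f z) \<le> C * W z ^ d * X z ^ j * Y z ^ u))"

lemma growsI: "0 \<le> C \<Longrightarrow> (\<And>z. real (f z) \<le> C * W z ^ d * X z ^ j * Y z ^ u) \<Longrightarrow> grows j u f"
  unfolding grows_def by blast

lemma pos: "0 \<le> W z" "0 \<le> X z" "0 \<le> Y z"
  using ge1[of z] by linarith+

lemma grows_const: "grows 0 0 (\<lambda>_. a)"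
  by (rule growsI[of "real a" _ 0]) simp_all

lemma mono_term:
  assumes "d \<le> d'" "j \<le> j'" "u \<le> u'" "0 \<le> C" "C \<le> C'"
  shows "C * W z ^ d * X z ^ j * Y z ^ u \<le> C' * W z ^ d' * X z ^ j' * Y z ^ u'"
  using assms ge1[of z] pos[of z] by (intro mult_mono power_increasing mult_nonneg_nonneg zero_le_power) auto

lemma grows_mono: "grows j u f \<Longrightarrow> j \<le> j' \<Longrightarrow> u \<le> u' \<Longrightarrow> grows j' u' f"
  unfolding grows_def by (meson mono_term order_refl order_trans)

lemma grows_add:
  assumes "grows j u f" "grows j' u' g"
  shows "grows (max j j') (max u u') (\<lambda>z. f z + g z)"
proof -
  from assms obtain C d C' d' where f: "0 \<le> C" "\<And>z. real (f z) \<le> C * W z ^ d * X z ^ j * Y z ^ u"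
    and g: "0 \<le> C'" "\<And>z. real (g z) \<le> C' * W z ^ d' * X z ^ j' * Y z ^ u'" unfolding grows_def by blast
  let ?t = "\<lambda>C z. C * W z ^ max d d' * X z ^ max j j' * Y z ^ max u u'"
  show ?thesis
  proof (rule growsI[of "C + C'" _ "max d d'"])
    fix z
    have "real (f z) \<le> ?t C z" by (rule order_trans[OF f(2) mono_term]) (use f in auto)
    moreover have "real (g z) \<le> ?t C' z" by (rule order_trans[OF g(2) mono_term]) (use g in auto)
    ultimately show "real (f z + g z) \<le> ?t (C + C') z" by (simp add: distrib_right)
  qed (use f g in simp)
qed

lemma grows_mult:
  assumes "grows j u f" "grows j' u' g"
  shows "grows (j + j') (u + u') (\<lambda>z. f z * g z)"
proof -
  from assms obtain C d C' d' where f: "0 \<le> C" "\<And>z. real (f z) \<le> C * W z ^ d * X z ^ j * Y z ^ u"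
    and g: "0 \<le> C'" "\<And>z. real (g z) \<le> C' * W z ^ d' * X z ^ j' * Y z ^ u'" unfolding grows_def by blast
  show ?thesis
  proof (rule growsI[of "C * C'" _ "d + d'"])
    fix z
    have "real (f z) * real (g z) \<le> (C * W z ^ d * X z ^ j * Y z ^ u) * (C' * W z ^ d' * X z ^ j' * Y z ^ u')"
      by (intro mult_mono f(2) g(2)) (use f(1) pos[of z] in auto)
    also have "\<dots> = C * C' * W z ^ (d + d') * X z ^ (j + j') * Y z ^ (u + u')" by (simp add: power_add mult_ac)
    finally show "real (f z * g z) \<le> C * C' * W z ^ (d + d') * X z ^ (j + j') * Y z ^ (u + u')" by simp
  qed (use f g in simp)
qed

lemma grows_power: "grows 0 0 f \<Longrightarrow> grows 0 0 (\<lambda>z. f z ^ d)"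
proof (induction d)
  case 0
  show ?case using grows_const[of 1] by simp
next
  case (Suc d)
  thus ?case using grows_mult[of 0 0 f 0 0 "\<lambda>z. f z ^ d"] by simp
qed

lemmas grows_rules = grows_const grows_add grows_mult

end

subsection \<open>The counting algorithm\<close>

lemma sat_program_exists:
  assumes "sat_algorithm A c"
  obtains pA K d where "0 \<le> K" "correct_sat_program A pA (\<lambda>n m. nat \<lfloor>K * (1 + real m) ^ d * 2 powr (c * real n)\<rfloor>)"
proof -
  from assms obtain K d where A: "\<And>n F. cnf_over n F \<Longrightarrow> lossless_spmf (run no_oracle A (enc_cnf n F))"
    "\<And>n F v t. cnf_over n F \<Longrightarrow> (v, t) \<in> set_spmf (run no_oracle A (enc_cnf n F)) \<Longrightarrow> real t \<le> exp_time K d c n (cnf_size n F)"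
    "\<And>n F. cnf_over n F \<Longrightarrow> measure (measure_spmf (run no_oracle A (enc_cnf n F))) {(v, t). v = enc_bool (satisfiable n F)} \<ge> 2 / 3"
    unfolding sat_algorithm_def Let_def by fast
  have "\<exists>p. cnf_over n F \<longrightarrow> map_spmf fst (run no_oracle A (enc_cnf n F)) = spmf_of_pmf p" for n F
  proof (cases "cnf_over n F")
    case True
    hence "lossless_spmf (map_spmf fst (run no_oracle A (enc_cnf n F)))" using A(1) by simp
    thus ?thesis unfolding lossless_spmf_conv_spmf_of_pmf by blast
  qed simp
  then obtain pA where pA: "\<And>n F. cnf_over n F \<Longrightarrow> map_spmf fst (run no_oracle A (enc_cnf n F)) = spmf_of_pmf (pA n F)"
    by metis
  \<comment> \<open>The constant from \<open>sat_algorithm\<close> carries no sign condition; its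
    absolute value makes the bound monotone in the size.\<close>
  have "correct_sat_program A pA (\<lambda>n m. nat \<lfloor>\<bar>K\<bar> * (1 + real m) ^ d * 2 powr (c * real n)\<rfloor>)"
  proof unfold_locales
    fix n m \<Phi> assume \<Phi>: "cnf_over n \<Phi>" "cnf_size n \<Phi> \<le> m"
    show "computes_init no_oracle A (enc_cnf n \<Phi>) (pA n \<Phi>) (nat \<lfloor>\<bar>K\<bar> * (1 + real m) ^ d * 2 powr (c * real n)\<rfloor>)"
    proof (rule computes_init_run[OF pA[OF \<Phi>(1)]], clarify)
      fix v t assume "(v, t) \<in> set_spmf (run no_oracle A (enc_cnf n \<Phi>))"
      from A(2)[OF \<Phi>(1) this] have "real t \<le> K * (1 + real (cnf_size n \<Phi>)) ^ d * 2 powr (c * real n)"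
        by (simp only: exp_time_def)
      also have "\<dots> \<le> \<bar>K\<bar> * (1 + real m) ^ d * 2 powr (c * real n)"
        by (intro mult_right_mono mult_mono power_mono) (use \<Phi>(2) in auto)
      finally show "t \<le> nat \<lfloor>\<bar>K\<bar> * (1 + real m) ^ d * 2 powr (c * real n)\<rfloor>" by (rule le_nat_floor)
    qed
  next
    fix n \<Phi> assume \<Phi>: "cnf_over n \<Phi>"
    let ?R = "run no_oracle A (enc_cnf n \<Phi>)"
    have "2 / 3 \<le> measure (measure_spmf ?R) {(v, t). v = enc_bool (satisfiable n \<Phi>)}" by (rule A(3)[OF \<Phi>])
    also have "{(v, t). v = enc_bool (satisfiable n \<Phi>)} = fst -` {v. v = enc_bool (satisfiable n \<Phi>)}" by auto
    also have "measure (measure_spmf ?R) \<dots> = measure (measure_spmf (map_spmf fst ?R)) {v. v = enc_bool (satisfiable n \<Phi>)}"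
      by (rule measure_map_spmf[symmetric])
    also have "\<dots> = measure_pmf.prob (pA n \<Phi>) {v. v = enc_bool (satisfiable n \<Phi>)}" unfolding pA[OF \<Phi>] by simp
    finally show "2 / 3 \<le> measure_pmf.prob (pA n \<Phi>) {v. v = enc_bool (satisfiable n \<Phi>)}" .
  qed
  thus thesis using that[of "\<bar>K\<bar>" pA d] by simp
qed

text \<open>The time is polynomial times 2^(c n) times 2^(18 e) with e = n div q + 1, and 18 <=
  \<delta> q turns the last factor into 2^(\<delta> n) up to a constant. The accuracy 2^-e is at
  least as good as 2^(- n / q).\<close>

lemma counting_algorithm_exists:
  assumes A: "sat_algorithm A c" and c: "0 \<le> c" and q: "1 \<le> q" "18 \<le> \<delta> * real q"
  shows "\<exists>B. counting_algorithm B (c + \<delta>) (1 / real q)"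
proof -
  obtain pA K d where K: "0 \<le> K" and loc: "correct_sat_program A pA (\<lambda>n m. nat \<lfloor>K * (1 + real m) ^ d * 2 powr (c * real n)\<rfloor>)"
    using sat_program_exists[OF A] .
  interpret correct_sat_program A pA "\<lambda>n m. nat \<lfloor>K * (1 + real m) ^ d * 2 powr (c * real n)\<rfloor>" by (rule loc)
  have "0 < ln 2 / real q" using q by simp
  from sparse_parameters[OF this] obtain k t \<rho>
    where par: "0 < t" "t \<le> 1" "(1 + t) * t powr (- \<rho>) \<le> exp (ln 2 / real q)" "odd k" "(1 - 2 * \<rho>) ^ k \<le> ln 2 / real q"
    by blast
  define R0 where "R0 = 144 * (2 * q + 36)"
  define w :: nat where "w = 1728"
  define cc where "cc = 2 * q + 19"
  define B where "B = prog_main q cc R0 w k"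
  define e where "e = (\<lambda>z :: nat \<times> cnf. fst z div q + 1)"
  define M :: "nat \<times> cnf \<Rightarrow> nat" where "M = (\<lambda>z. 2 ^ (7 * e z + cc))"
  define cap :: "nat \<times> cnf \<Rightarrow> nat" where "cap = (\<lambda>z. 2 ^ (2 * e z + 6))"
  define R where "R = (\<lambda>z :: nat \<times> cnf. R0 + w * fst z)"
  define size where "size = (\<lambda>z :: nat \<times> cnf. cnf_size (fst z) (snd z))"
  define m where "m = (\<lambda>z. size z + (fst z + 1) * (2 ^ k * (1 + k)) + 2 * fst z)"
  define T where "T = (\<lambda>z. (fst z + 2) * (300 + 2 * w) + 3 * ((7 * e z + cc + 4) * (800 * (M z * cap z))) +
      (fst z + 2) * (t_total (M z) k (fst z + 1) (fst z) (m z) (R z) (cap z) + 200) +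
      2 * ((M z * cap z + 1) * (300 * (M z * cap z + 1))) + (fst z + 3) * 100 + 500)"
  define W where "W = (\<lambda>z. 1 + real (size z))"
  define X :: "nat \<times> cnf \<Rightarrow> real" where "X = (\<lambda>z. 2 ^ e z)"
  define Y where "Y = (\<lambda>z :: nat \<times> cnf. 2 powr (c * real (fst z)))"
  interpret G: growth W X Y
    by unfold_locales (use c in \<open>simp_all add: W_def X_def Y_def ge_one_powr_ge_zero\<close>)
  have g_size: "G.grows 0 0 size" by (rule G.growsI[of 1 _ 1]) (simp_all add: W_def)
  have g_n: "G.grows 0 0 fst"
    by (rule G.growsI[of 1 _ 1]) (simp_all add: W_def size_def cnf_size_def)
  have g_e: "G.grows 0 0 e"
  proof (rule G.growsI[of 1 _ 1])
    fix z :: "nat \<times> cnf"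
    have "e z \<le> 1 + size z" unfolding e_def size_def cnf_size_def by (simp add: trans_le_add1)
    hence "real (e z) \<le> real (1 + size z)" by (simp only: of_nat_le_iff)
    thus "real (e z) \<le> 1 * W z ^ 1 * X z ^ 0 * Y z ^ 0" by (simp add: W_def)
  qed simp
  have g_M: "G.grows 7 0 M"
    by (rule G.growsI[of "2 ^ cc" _ 0]) (simp_all add: M_def X_def power_add power_mult mult.commute flip: power_mult)
  have g_cap: "G.grows 2 0 cap"
    by (rule G.growsI[of "2 ^ 6" _ 0]) (simp_all add: cap_def X_def power_add mult.commute flip: power_mult)
  have g_m: "G.grows 0 0 m"
    unfolding m_def by (rule G.grows_mono, (rule G.grows_rules g_size g_n)+) simp_all
  have g_A: "G.grows 0 1 (\<lambda>z. nat \<lfloor>K * (1 + real (m z)) ^ d * 2 powr (c * real (fst z))\<rfloor>)"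
  proof -
    have "G.grows 0 0 (\<lambda>z. 1 + m z)" by (rule G.grows_mono, (rule G.grows_rules g_m)+) simp_all
    from G.grows_power[OF this, of d] obtain C d' where C: "0 \<le> C" "\<And>z. real ((1 + m z) ^ d) \<le> C * W z ^ d' * X z ^ 0 * Y z ^ 0"
      unfolding G.grows_def by blast
    show ?thesis
    proof (rule G.growsI[of "K * C" _ d'])
      fix z
      have "real (nat \<lfloor>K * (1 + real (m z)) ^ d * 2 powr (c * real (fst z))\<rfloor>) \<le> K * (1 + real (m z)) ^ d * 2 powr (c * real (fst z))"
        using K by (simp add: of_nat_nat)
      also have "\<dots> \<le> K * (C * W z ^ d') * 2 powr (c * real (fst z))"
        using C(2)[of z] K by (intro mult_right_mono mult_left_mono) auto
      finally show "real (nat \<lfloor>K * (1 + real (m z)) ^ d * 2 powr (c * real (fst z))\<rfloor>) \<le> K * C * W z ^ d' * X z ^ 0 * Y z ^ 1"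
        by (simp add: Y_def mult.assoc)
    qed (use K C in simp)
  qed
  have g_vote: "G.grows 0 1 (\<lambda>z. t_vote (fst z) (m z) (R z))"
    unfolding t_vote_def R_def by (rule G.grows_mono, (rule G.grows_rules g_n g_A)+) simp_all
  have g_count: "G.grows 2 1 (\<lambda>z. t_count (fst z) (m z) (R z) (cap z))"
    unfolding t_count_def by (rule G.grows_mono, (rule G.grows_rules g_n g_cap g_vote)+) simp_all
  have g_trial: "G.grows 2 1 (\<lambda>z. t_trial k (fst z + 1) (fst z) (m z) (R z) (cap z))"
    unfolding t_trial_def by (rule G.grows_mono, (rule G.grows_rules g_n g_count)+) simp_all
  have g_total: "G.grows 9 1 (\<lambda>z. t_total (M z) k (fst z + 1) (fst z) (m z) (R z) (cap z))"
    unfolding t_total_def by (rule G.grows_mono, (rule G.grows_rules g_n g_M g_cap g_trial)+) simp_all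
  \<comment> \<open>The search contributes \<open>X\<close> only to the power 9, from M and cap; the
    conversion of the result to binary squares their product. The power 1 of \<open>Y\<close> stems
    from the calls of the SAT algorithm.\<close>
  have "G.grows 18 1 T"
    unfolding T_def by (rule G.grows_mono, (rule G.grows_rules g_n g_M g_cap g_e g_total)+) simp_all
  then obtain C d' where C: "0 \<le> C" "\<And>z. real (T z) \<le> C * W z ^ d' * X z ^ 18 * Y z ^ 1"
    unfolding G.grows_def by blast
  have time: "real (T (n, F)) \<le> exp_time (C * 2 ^ 18) d' (c + \<delta>) n (cnf_size n F)" for n F
  proof -
    have "X (n, F) ^ 18 \<le> 2 ^ 18 * 2 powr (\<delta> * real n)"
    proof -
      have "X (n, F) ^ 18 = 2 ^ 18 * 2 powr (18 * real (n div q))"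
      proof -
        have exponent: "18 + 18 * (n div q) = (n div q + 1) * 18" by simp
        have "X (n, F) ^ 18 = 2 ^ (18 + 18 * (n div q))"
          unfolding exponent by (simp only: X_def e_def fst_conv power_mult)
        also have "\<dots> = 2 ^ 18 * 2 powr real (18 * (n div q))" by (simp only: power_add powr_realpow[of "2 :: real"] zero_less_numeral)
        finally show ?thesis by simp
      qed
      also have "18 * real (n div q) \<le> \<delta> * real n"
      proof -
        have "18 * real (n div q) \<le> (\<delta> * real q) * real (n div q)" by (rule mult_right_mono[OF q(2)]) simp
        also have "\<dots> = \<delta> * real (q * (n div q))" by simp
        also have "\<dots> \<le> \<delta> * real n"
        proof (rule mult_left_mono)
          show "real (q * (n div q)) \<le> real n" by (simp only: of_nat_le_iff) simp
          show "0 \<le> \<delta>" using q by (simp add: zero_le_mult_iff) (smt (verit) mult_nonneg_nonpos2 of_nat_0_le_iff)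
        qed
        finally show ?thesis .
      qed
      hence "2 powr (18 * real (n div q)) \<le> (2 :: real) powr (\<delta> * real n)" by (intro powr_mono) auto
      finally show ?thesis by simp
    qed
    hence "C * W (n, F) ^ d' * X (n, F) ^ 18 * Y (n, F) \<le> C * W (n, F) ^ d' * (2 ^ 18 * 2 powr (\<delta> * real n)) * Y (n, F)"
      using C(1) G.pos[of "(n, F)"] by (intro mult_right_mono mult_left_mono) auto
    also have "\<dots> = exp_time (C * 2 ^ 18) d' (c + \<delta>) n (cnf_size n F)"
      by (simp add: exp_time_def W_def size_def Y_def distrib_right powr_add)
    finally show ?thesis using C(2)[of "(n, F)"] by simp
  qed
  have "counting_algorithm B (c + \<delta>) (1 / real q)"
    unfolding counting_algorithm_def
  proof (rule exI[of _ "C * 2 ^ 18"], rule exI[of _ d'], intro allI impI)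
    fix n :: nat and F :: cnf assume F: "cnf_over n F"
    let ?s = "card (solutions n F)"
    let ?\<gamma> = "2 powr (- (1 / real q) * real n)"
    let ?G = "\<lambda>v. (1 - ?\<gamma>) * real ?s \<le> rat_val v \<and> rat_val v \<le> (1 + ?\<gamma>) * real ?s"
    show "1 - 1 / 2 ^ n \<le> measure (measure_spmf (run no_oracle B (enc_cnf n F)))
       {(v, t). real t \<le> exp_time (C * 2 ^ 18) d' (c + \<delta>) n (cnf_size n F) \<and> ?G v}"
    proof (cases "n = 0")
      \<comment> \<open>The required probability is 0.\<close>
      case True
      thus ?thesis by simp
    next
      case False
      hence n: "1 \<le> n" by simp
      let ?z = "(n, F)"
      let ?L = "levels (trial (vote_pmf (R ?z) (once n)) (cap ?z) n k F) (M ?z) [0..<n + 1]"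
      let ?out = "\<lambda>r. Pair (enc_bits (replicate (fst r) False @ bits (snd r))) (enc_bits (bits (M ?z)))"
      have size: "cnf_size n F + (n + 1) * (2 ^ k * (1 + k)) + 2 * n \<le> m ?z" by (simp add: m_def size_def)
      have comp: "computes no_oracle B (enc_cnf n F) (map_pmf ?out ?L) (T ?z)"
        using computes_main[OF q(1) n F size, of cc R0 w]
        unfolding B_def T_def M_def cap_def R_def e_def fst_conv snd_conv .
      have good: "?G (?out r)" if r: "accurate (e ?z) (M ?z) ?s r" for r
      proof -
        have "rat_val (?out r) = real (snd r) * 2 ^ fst r / real (M ?z)"
          by (simp add: rat_val_def bin_val_zeros mult.commute)
        hence "\<bar>rat_val (?out r) - real ?s\<bar> \<le> real ?s / 2 ^ e ?z" using r by (simp add: accurate_def)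
        also have "\<dots> \<le> ?\<gamma> * real ?s"
        proof -
          have "real n / real q \<le> real (e ?z)"
          proof -
            have "n = q * (n div q) + n mod q" by simp
            moreover have "n mod q < q" using q by simp
            ultimately have "n \<le> q * (n div q) + q" by linarith
            hence "n \<le> q * e ?z" by (simp add: e_def)
            hence "real n \<le> real (q * e ?z)" by (simp only: of_nat_le_iff)
            thus ?thesis using q by (simp add: pos_divide_le_eq mult.commute)
          qed
          hence "2 powr (- real (e ?z)) \<le> (2 :: real) powr (- (real n / real q))" by (intro powr_mono) auto
          moreover have "2 powr (- real (e ?z)) = (1 :: real) / 2 ^ e ?z" by (simp add: powr_minus_divide powr_realpow)
          ultimately have "1 / 2 ^ e ?z \<le> ?\<gamma>" by simp
          from mult_right_mono[OF this, of "real ?s"] show ?thesis by simp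
        qed
        finally show ?thesis unfolding abs_le_iff by (simp add: algebra_simps)
      qed
      have "1 - 1 / 2 ^ n \<le> measure_pmf.prob ?L {r. accurate (e ?z) (M ?z) ?s r}"
        using approximate_count[OF n q(1) par, of F]
        unfolding M_def cap_def R_def e_def R0_def w_def cc_def fst_conv .
      also have "\<dots> \<le> measure_pmf.prob ?L {r. ?G (?out r)}"
        by (rule measure_pmf.finite_measure_mono) (use good in auto)
      also have "\<dots> = measure_pmf.prob (map_pmf ?out ?L) {v. ?G v}" by (simp add: vimage_def del: upt_Suc)
      also have "\<dots> \<le> measure (measure_spmf (run no_oracle B (enc_cnf n F)))
          {(v, t). real t \<le> exp_time (C * 2 ^ 18) d' (c + \<delta>) n (cnf_size n F) \<and> ?G v}"
      proof (rule measure_run_ge[OF comp])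
        fix t assume "t \<le> T ?z"
        hence "real t \<le> real (T ?z)" by (simp only: of_nat_le_iff)
        also note time
        finally show "real t \<le> exp_time (C * 2 ^ 18) d' (c + \<delta>) n (cnf_size n F)" .
      qed
      finally show ?thesis .
    qed
  qed
  thus ?thesis by blast
qed

text \<open>For \<delta> < 1/2 the left function is at least \<delta> / 19, and log (1 / \<delta>)
  >= 1 bounds the right one by \<delta>^2 and thus by \<delta>.\<close>

lemma bigomega_inverse_ceiling:
  "(\<lambda>\<delta>. 1 / real (nat \<lceil>18 / \<delta>\<rceil>)) \<in> \<Omega>[at_right 0](\<lambda>\<delta>. \<delta>\<^sup>2 / log 2 (1 / \<delta>))"
proof -
  have "(\<lambda>\<delta>. \<delta>\<^sup>2 / log 2 (1 / \<delta>)) \<in> O[at_right 0](\<lambda>\<delta>. 1 / real (nat \<lceil>18 / \<delta>\<rceil>))"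
  proof (rule bigoI[where c = 19])
    show "\<forall>\<^sub>F \<delta> in at_right 0. norm (\<delta>\<^sup>2 / log 2 (1 / \<delta>)) \<le> 19 * norm (1 / real (nat \<lceil>18 / \<delta>\<rceil>))"
    proof (rule eventually_at_rightI[of 0 "1 / 2"])
      fix \<delta> :: real assume "\<delta> \<in> {0<..<1 / 2}"
      hence \<delta>: "0 < \<delta>" "\<delta> < 1 / 2" by auto
      define Q where "Q = real (nat \<lceil>18 / \<delta>\<rceil>)"
      have pos: "0 < 18 / \<delta>" using \<delta> by simp
      have Q: "18 / \<delta> \<le> Q" "Q \<le> 18 / \<delta> + 1" unfolding Q_def using pos by linarith+
      have Q0: "0 < Q" using Q(1) pos by linarith
      have "18 / \<delta> + 1 \<le> 19 / \<delta>" using \<delta> by (simp add: field_simps)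
      hence "Q \<le> 19 / \<delta>" using Q(2) by linarith
      hence "\<delta> \<le> 19 / Q" using \<delta> Q0 by (simp add: field_simps)
      moreover have "\<delta>\<^sup>2 / log 2 (1 / \<delta>) \<le> \<delta>" "0 \<le> \<delta>\<^sup>2 / log 2 (1 / \<delta>)"
      proof -
        have "log 2 2 \<le> log 2 (1 / \<delta>)" using \<delta> by (subst log_le_cancel_iff) (auto simp: field_simps)
        hence l: "1 \<le> log 2 (1 / \<delta>)" by simp
        have "\<delta>\<^sup>2 / log 2 (1 / \<delta>) \<le> \<delta>\<^sup>2 / 1" by (rule divide_left_mono) (use l in auto)
        also have "\<dots> \<le> \<delta>" using \<delta> by (simp add: power2_eq_square mult_le_cancel_left1)
        finally show "\<delta>\<^sup>2 / log 2 (1 / \<delta>) \<le> \<delta>" .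
        show "0 \<le> \<delta>\<^sup>2 / log 2 (1 / \<delta>)" using l by simp
      qed
      ultimately show "norm (\<delta>\<^sup>2 / log 2 (1 / \<delta>)) \<le> 19 * norm (1 / real (nat \<lceil>18 / \<delta>\<rceil>))"
        unfolding Q_def[symmetric] using Q0 by simp
    qed simp
  qed
  thus ?thesis by (simp only: bigomega_iff_bigo)
qed

theorem theorem1:
  shows
    "(\<exists>\<alpha> :: real \<Rightarrow> real.
        \<alpha> \<in> \<Omega>[at_right 0](\<lambda>\<delta>. \<delta>\<^sup>2 / log 2 (1 / \<delta>)) \<and>
        (\<forall>\<delta>>0. \<alpha> \<delta> > 0) \<and>
        (\<forall>c>0. (\<exists>A. sat_algorithm A c) \<longrightarrow>
           (\<forall>\<delta>>0. \<exists>B. counting_algorithm B (c + \<delta>) (\<alpha> \<delta>))))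
     \<and>
     (\<exists>Q (K :: real). implements_acount Q \<and>
        (\<forall>(n :: nat) (k :: nat) (\<kappa> :: real) (F :: cnf) (s :: nat).
           cnf_over n F \<and> s = card (solutions n F) \<and> s > 0 \<and>
           4 * log 2 (16 * real n) \<le> real k + 1 \<and> k + 1 \<le> n \<and>
           \<kappa> > 0 \<and> real k + 1 = \<kappa> * log 2 (512 * \<kappa>) * (4 * log 2 (16 * real n)) \<longrightarrow>
           measure (measure_spmf (run sat_oracle Q (acount_input n k F)))
             {(v, t).
                real t \<le> K * (real n * log 2 (real n) *
                               ((real n)\<^sup>2 + 2 ^ k * real k * real n + real (cnf_size n F))) \<and>
                1 / 4 * 2 powr (- real n / \<kappa>) * real s \<le> real (bin_val v) \<and>
                real (bin_val v) \<le> 4 * real s}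
             \<ge> 1 / 4))
     \<and>
     (\<forall>k\<ge>5. \<exists>n\<^sub>0. \<forall>n\<ge>n\<^sub>0. \<forall>(F :: cnf) (s :: nat).
        cnf_over n F \<and> s = card (solutions n F) \<and> s > 0 \<longrightarrow>
        measure (measure_pmf (acount_constant n k F))
          {r. 1 / 4 * 2 powr (- real n + log 2 (real n) / real k *
                                (real n powr (1 - 4 / real k))) * real s \<le> real r \<and>
              real r \<le> 4 * real s}
          \<ge> 1 / 4)"
proof (intro conjI)
  have q: "1 \<le> nat \<lceil>18 / \<delta>\<rceil> \<and> 18 \<le> \<delta> * real (nat \<lceil>18 / \<delta>\<rceil>)" if "0 < \<delta>" for \<delta> :: real
  proof -
    have pos: "0 < 18 / \<delta>" using that by simp
    hence "18 / \<delta> \<le> real (nat \<lceil>18 / \<delta>\<rceil>)" by linarith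
    hence "\<delta> * (18 / \<delta>) \<le> \<delta> * real (nat \<lceil>18 / \<delta>\<rceil>)" by (rule mult_left_mono) (use that in simp)
    moreover have "\<delta> * (18 / \<delta>) = 18" using that by simp
    ultimately have "18 \<le> \<delta> * real (nat \<lceil>18 / \<delta>\<rceil>)" by linarith
    moreover have "1 \<le> nat \<lceil>18 / \<delta>\<rceil>" using pos by linarith
    ultimately show ?thesis by simp
  qed
  show "\<exists>\<alpha> :: real \<Rightarrow> real.
        \<alpha> \<in> \<Omega>[at_right 0](\<lambda>\<delta>. \<delta>\<^sup>2 / log 2 (1 / \<delta>)) \<and>
        (\<forall>\<delta>>0. \<alpha> \<delta> > 0) \<and>
        (\<forall>c>0. (\<exists>A. sat_algorithm A c) \<longrightarrow>
           (\<forall>\<delta>>0. \<exists>B. counting_algorithm B (c + \<delta>) (\<alpha> \<delta>)))"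
  proof (intro exI[of _ "\<lambda>\<delta>. 1 / real (nat \<lceil>18 / \<delta>\<rceil>)"] conjI allI impI)
    show "0 < 1 / real (nat \<lceil>18 / \<delta>\<rceil>)" if "0 < \<delta>" for \<delta> :: real using q[OF that] that by simp
    show "\<exists>B. counting_algorithm B (c + \<delta>) (1 / real (nat \<lceil>18 / \<delta>\<rceil>))"
      if "0 < c" "\<exists>A. sat_algorithm A c" "0 < \<delta>" for c \<delta> :: real
    proof -
      from that(2) obtain A where "sat_algorithm A c" by blast
      thus ?thesis by (rule counting_algorithm_exists) (use that q[OF that(3)] in auto)
    qed
  qed (rule bigomega_inverse_ceiling)
  show "\<exists>Q (K :: real). implements_acount Q \<and>
        (\<forall>(n :: nat) (k :: nat) (\<kappa> :: real) (F :: cnf) (s :: nat).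
           cnf_over n F \<and> s = card (solutions n F) \<and> s > 0 \<and>
           4 * log 2 (16 * real n) \<le> real k + 1 \<and> k + 1 \<le> n \<and>
           \<kappa> > 0 \<and> real k + 1 = \<kappa> * log 2 (512 * \<kappa>) * (4 * log 2 (16 * real n)) \<longrightarrow>
           measure (measure_spmf (run sat_oracle Q (acount_input n k F)))
             {(v, t).
                real t \<le> K * (real n * log 2 (real n) *
                               ((real n)\<^sup>2 + 2 ^ k * real k * real n + real (cnf_size n F))) \<and>
                1 / 4 * 2 powr (- real n / \<kappa>) * real s \<le> real (bin_val v) \<and>
                real (bin_val v) \<le> 4 * real s}
             \<ge> 1 / 4)"
    by (rule exI[of _ prog_acount], rule exI[of _ 200000], rule conjI[OF implements_acount_prog],
        intro allI impI, elim conjE, rule acount_program_success)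
  show "\<forall>k\<ge>5. \<exists>n\<^sub>0. \<forall>n\<ge>n\<^sub>0. \<forall>(F :: cnf) (s :: nat).
        cnf_over n F \<and> s = card (solutions n F) \<and> s > 0 \<longrightarrow>
        measure (measure_pmf (acount_constant n k F))
          {r. 1 / 4 * 2 powr (- real n + log 2 (real n) / real k *
                                (real n powr (1 - 4 / real k))) * real s \<le> real r \<and>
              real r \<le> 4 * real s}
          \<ge> 1 / 4"
    by (intro allI impI acount_constant_success)
qed

end
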